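(* (i) Let $\Omega\subset\mathbb{R}^{2}$ be (the interior of) any triangle, rectangle, rhombus or regular polygon, and let $\mathbf{x}_0$ be its barycenter. Then, with the Horgan–Payne angle $\omega(\Omega)$ taken with respect to $\mathbf{x}_0$, the Horgan–Payne inequality $$\beta(\Omega)\ \ge\ \sin\frac{\omega(\Omega)}{2}$$ holds. (ii) There exist bounded domains $\Omega\subset\mathbb{R}^{2}$, star-shaped with respect to a ball with center $\mathbf{x}_0$, such that the Horgan–Payne inequality is not satisfied, i.e. $\beta(\Omega)<\sin\frac{\omega(\Omega)}{2}$, where $\omega(\Omega)$ is the Horgan–Payne angle with respect to $\mathbf{x}_0$.
   Context: A domain is a nonempty connected open set. $L^2_\circ(\Omega)$ is the space of $q\in L^2(\Omega)$ with mean value zero, $\|\cdot\|_{0,\Omega}$ the $L^2(\Omega)$ norm, $\langle\cdot,\cdot\rangle_\Omega$ the $L^2(\Omega)$ scalar product, $H^1_0(\Omega)$ the closure of $C_0^\infty(\Omega)$ in $H^1(\Omega)$, and $|\mathbf{v}|_{1,\Omega}=\big(\sum_{k,j}\|\partial_{x_j}v_k\|_{0,\Omega}^2\big)^{1/2}$ for vector functions $\mathbf{v}\in H^1_0(\Omega)^2$. The inf-sup constant of $\Omega$ is $$\beta(\Omega)=\inf_{q\in L^2_\circ(\Omega)\setminus\{0\}}\ \sup_{\mathbf{v}\in H^1_0(\Omega)^2\setminus\{0\}}\ \frac{\langle\operatorname{div}\mathbf{v},q\rangle_\Omega}{|\mathbf{v}|_{1,\Omega}\,\|q\|_{0,\Omega}}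 .$$ $\Omega$ is star-shaped with respect to an open ball $B\subset\Omega$ if every segment with one end in $B$ and the other in $\Omega$ is contained in $\Omega$. If $\Omega\subset\mathbb{R}^2$ is bounded and star-shaped with respect to a ball with center $\mathbf{x}_0$, then its boundary is Lipschitz and has a tangent at almost every point. At such a point $\mathbf{x}\in\partial\Omega$, let $\omega(\mathbf{x})\in(0,\frac{\pi}{2}]$ be the (non-oriented) angle between the ray from $\mathbf{x}_0$ through $\mathbf{x}$ and the tangent line to $\partial\Omega$ at $\mathbf{x}$. The Horgan–Payne angle of $\Omega$ with respect to $\mathbf{x}_0$ is $\omega(\Omega)=\inf_{\mathbf{x}\in\partial\Omega}\omega(\mathbf{x})$, the infimum being taken over the boundary points where the tangent exists. It depends on $\mathbf{x}_0$ as well as on $\Omega$. *)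

theory Defs
  imports "HOL-Analysis.Analysis"
begin

text \<open>Elements of Lebesgue and Sobolev spaces on \<open>\<Omega>\<close> are represented by functions on the whole
  plane: values outside \<open>\<Omega>\<close> are ignored, and equality is equality almost everywhere in \<open>\<Omega>\<close>.\<close>

definition is_domain :: "(real^2) set \<Rightarrow> bool" where
  "is_domain \<Omega> \<longleftrightarrow> \<Omega> \<noteq> {} \<and> connected \<Omega> \<and> open \<Omega>"

definition L2 :: "(real^2) set \<Rightarrow> (real^2 \<Rightarrow> real) set" where
  "L2 \<Omega> = {u \<in> borel_measurable (lebesgue_on \<Omega>). integrable (lebesgue_on \<Omega>) (\<lambda>x. (u x)\<^sup>2)}"

definition L2_inner :: "(real^2) set \<Rightarrow> (real^2 \<Rightarrow> real) \<Rightarrow> (real^2 \<Rightarrow> real) \<Rightarrow> real" where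
  "L2_inner \<Omega> u w = (LINT x|lebesgue_on \<Omega>. u x * w x)"

definition L2_norm :: "(real^2) set \<Rightarrow> (real^2 \<Rightarrow> real) \<Rightarrow> real" where
  "L2_norm \<Omega> u = sqrt (L2_inner \<Omega> u u)"

text \<open>The vanishing integral expresses mean value zero when \<open>\<Omega>\<close> has finite measure
  (then \<open>L2 \<Omega>\<close> consists of integrable functions).\<close>

definition L2_mean_zero :: "(real^2) set \<Rightarrow> (real^2 \<Rightarrow> real) set" where
  "L2_mean_zero \<Omega> = {q \<in> L2 \<Omega>. (LINT x|lebesgue_on \<Omega>. q x) = 0}"

definition pderiv_at :: "2 \<Rightarrow> (real^2 \<Rightarrow> real) \<Rightarrow> real^2 \<Rightarrow> real" where
  "pderiv_at j f x = frechet_derivative f (at x) (axis j 1)"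

fun Ck :: "nat \<Rightarrow> (real^2 \<Rightarrow> real) \<Rightarrow> bool" where
  "Ck 0 f \<longleftrightarrow> continuous_on UNIV f"
| "Ck (Suc k) f \<longleftrightarrow> (\<forall>x. f differentiable (at x)) \<and> (\<forall>j. Ck k (pderiv_at j f))"

definition test_functions :: "(real^2) set \<Rightarrow> (real^2 \<Rightarrow> real) set" where
  "test_functions \<Omega> =
     {\<phi>. (\<forall>k. Ck k \<phi>) \<and> compact (closure {x. \<phi> x \<noteq> 0}) \<and> closure {x. \<phi> x \<noteq> 0} \<subseteq> \<Omega>}"

definition has_weak_pderiv ::
  "(real^2) set \<Rightarrow> 2 \<Rightarrow> (real^2 \<Rightarrow> real) \<Rightarrow> (real^2 \<Rightarrow> real) \<Rightarrow> bool" where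
  "has_weak_pderiv \<Omega> j u g \<longleftrightarrow>
     (\<forall>\<phi>\<in>test_functions \<Omega>. L2_inner \<Omega> u (pderiv_at j \<phi>) = - L2_inner \<Omega> g \<phi>)"

definition H1 :: "(real^2) set \<Rightarrow> (real^2 \<Rightarrow> real) set" where
  "H1 \<Omega> = {u \<in> L2 \<Omega>. \<forall>j. \<exists>g\<in>L2 \<Omega>. has_weak_pderiv \<Omega> j u g}"

text \<open>For \<open>u \<in> H1 \<Omega>\<close> with \<open>\<Omega>\<close> open, the weak derivative is unique up to null sets, so the choice
  only selects a representative.\<close>

definition weak_pderiv :: "(real^2) set \<Rightarrow> 2 \<Rightarrow> (real^2 \<Rightarrow> real) \<Rightarrow> real^2 \<Rightarrow> real" where
  "weak_pderiv \<Omega> j u = (SOME g. g \<in> L2 \<Omega> \<and> has_weak_pderiv \<Omega> j u g)"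

definition H1_norm :: "(real^2) set \<Rightarrow> (real^2 \<Rightarrow> real) \<Rightarrow> real" where
  "H1_norm \<Omega> u = sqrt ((L2_norm \<Omega> u)\<^sup>2 + (\<Sum>j\<in>UNIV. (L2_norm \<Omega> (weak_pderiv \<Omega> j u))\<^sup>2))"

definition H10 :: "(real^2) set \<Rightarrow> (real^2 \<Rightarrow> real) set" where
  "H10 \<Omega> = {u \<in> H1 \<Omega>. \<forall>\<epsilon>>0. \<exists>\<phi>\<in>test_functions \<Omega>. H1_norm \<Omega> (\<lambda>x. u x - \<phi> x) < \<epsilon>}"

definition H10_vec :: "(real^2) set \<Rightarrow> (real^2 \<Rightarrow> real^2) set" where
  "H10_vec \<Omega> = {v. \<forall>k. (\<lambda>x. v x $ k) \<in> H10 \<Omega>}"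

definition weak_div :: "(real^2) set \<Rightarrow> (real^2 \<Rightarrow> real^2) \<Rightarrow> real^2 \<Rightarrow> real" where
  "weak_div \<Omega> v x = (\<Sum>k\<in>UNIV. weak_pderiv \<Omega> k (\<lambda>y. v y $ k) x)"

definition H1_seminorm :: "(real^2) set \<Rightarrow> (real^2 \<Rightarrow> real^2) \<Rightarrow> real" where
  "H1_seminorm \<Omega> v =
     sqrt (\<Sum>k\<in>UNIV. \<Sum>j\<in>UNIV. (L2_norm \<Omega> (weak_pderiv \<Omega> j (\<lambda>x. v x $ k)))\<^sup>2)"

definition infsup_const :: "(real^2) set \<Rightarrow> ereal" where
  "infsup_const \<Omega> =
     (INF q \<in> {q \<in> L2_mean_zero \<Omega>. \<not> (AE x in lebesgue_on \<Omega>. q x = 0)}.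
        SUP v \<in> {v \<in> H10_vec \<Omega>. \<not> (AE x in lebesgue_on \<Omega>. v x = 0)}.
          ereal (L2_inner \<Omega> (weak_div \<Omega> v) q / (H1_seminorm \<Omega> v * L2_norm \<Omega> q)))"

definition star_shaped_wrt_ball :: "(real^2) set \<Rightarrow> real^2 \<Rightarrow> real \<Rightarrow> bool" where
  "star_shaped_wrt_ball \<Omega> x0 r \<longleftrightarrow>
     0 < r \<and> ball x0 r \<subseteq> \<Omega> \<and> (\<forall>b\<in>ball x0 r. \<forall>x\<in>\<Omega>. closed_segment b x \<subseteq> \<Omega>)"

text \<open>The line through \<open>x\<close> with direction \<open>\<tau>\<close> is tangent to \<open>S\<close> at \<open>x\<close>: points of \<open>S\<close> near \<open>x\<close>,
  on all sides, have distance \<open>o(dist y x)\<close> from the line. Where \<open>S\<close> is locally the graph of a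
  Lipschitz function, this is differentiability of that function; in particular there is no
  tangent at a corner.\<close>

definition tangent_direction :: "(real^2) set \<Rightarrow> real^2 \<Rightarrow> real^2 \<Rightarrow> bool" where
  "tangent_direction S x \<tau> \<longleftrightarrow>
     x \<in> S \<and> x islimpt S \<and> \<tau> \<noteq> 0 \<and>
     ((\<lambda>y. infdist y {x + t *\<^sub>R \<tau> | t. True} / dist y x) \<longlongrightarrow> 0) (at x within S)"

text \<open>The absolute value makes the angle independent of the orientation of \<open>\<tau>\<close> and gives a value
  between \<open>0\<close> and \<open>pi / 2\<close>.\<close>

definition ray_line_angle :: "real^2 \<Rightarrow> real^2 \<Rightarrow> real" where
  "ray_line_angle e \<tau> = arccos (\<bar>e \<bullet> \<tau>\<bar> / (norm e * norm \<tau>))"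

definition horgan_payne_angle :: "(real^2) set \<Rightarrow> real^2 \<Rightarrow> real" where
  "horgan_payne_angle \<Omega> x0 =
     Inf {ray_line_angle (x - x0) \<tau> | x \<tau>. tangent_direction (frontier \<Omega>) x \<tau>}"

definition barycenter :: "(real^2) set \<Rightarrow> real^2" where
  "barycenter \<Omega> = (1 / measure lebesgue \<Omega>) *\<^sub>R (LINT x|lebesgue_on \<Omega>. x)"

definition open_triangle :: "(real^2) set \<Rightarrow> bool" where
  "open_triangle \<Omega> \<longleftrightarrow>
     (\<exists>a b c. \<not> collinear {a, b, c} \<and> \<Omega> = interior (convex hull {a, b, c}))"

definition open_rectangle :: "(real^2) set \<Rightarrow> bool" where
  "open_rectangle \<Omega> \<longleftrightarrow>
     (\<exists>a u v. u \<noteq> 0 \<and> v \<noteq> 0 \<and> u \<bullet> v = 0 \<and>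
        \<Omega> = interior (convex hull {a, a + u, a + u + v, a + v}))"

definition open_rhombus :: "(real^2) set \<Rightarrow> bool" where
  "open_rhombus \<Omega> \<longleftrightarrow>
     (\<exists>a u v. \<not> collinear {0, u, v} \<and> norm u = norm v \<and>
        \<Omega> = interior (convex hull {a, a + u, a + u + v, a + v}))"

definition open_regular_polygon :: "(real^2) set \<Rightarrow> bool" where
  "open_regular_polygon \<Omega> \<longleftrightarrow>
     (\<exists>(n::nat) c R \<theta>. 3 \<le> n \<and> 0 < R \<and>
        \<Omega> = interior (convex hull
          ((\<lambda>k. c + R *\<^sub>R vector [cos (\<theta> + 2 * pi * real k / real n),
                                 sin (\<theta> + 2 * pi * real k / real n)]) ` {..<n})))"

end

theory Submission
  imports Defs "HOL-Complex_Analysis.Complex_Analysis"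
begin

text \<open>For a convex polygon, solving \<open>\<Delta> u = \<nabla> q\<close> with \<open>u = 0\<close> on the boundary turns the inf-sup
  condition into Friedrichs' inequality \<open>\<parallel>h\<parallel>\<^sup>2 \<le> \<Gamma> \<parallel>g\<parallel>\<^sup>2\<close> for conjugate harmonic functions \<open>h\<close> and
  \<open>g\<close>, where \<open>h\<close> has mean value zero. Following Horgan and Payne, this inequality follows by integrating
  the divergence of a field built from \<open>((h + i g)\<^sup>2 - const) / (z - c)\<close> and vanishing on the boundary
  through the factor \<open>1 - N\<^sup>2\<close>, with \<open>N\<close> the gauge of the polygon with respect to \<open>c\<close>. It
  yields the optimal estimate when a nearest side contains a farthest vertex, and in triangles,
  parallelograms and regular polygons a longest side is a nearest side and has this property.

  For the failure in general, testing with the harmonic coordinate functions bounds the inf-sup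
  constant above by the second moments of \<open>\<Omega>\<close>. An ellipse with half axes \<open>2\<close> and \<open>1\<close> gives equality
  of this bound with the sine of half the Horgan--Payne angle, and cutting off caps at both ends
  of the short axis makes the inequality strict.\<close>

text \<open>Let \<omega> be the angle at a farthest vertex lying on a nearest side, \<delta> the
  distance of that side and R the distance of that vertex from c. Then sin \<omega> = \<delta> / R,
  and with C = cos \<omega> the Friedrichs constant (1 + C) / (1 - C) is the square of cot (\<omega>
  / 2), so that 1 / sqrt (1 + \<Gamma>) becomes sin (\<omega> / 2). The obstacle is regularity: a
  conjugate pair is only square integrable and has no boundary values, while the boundary-vanishing
  field has to be Lipschitz on a closed polygon. The estimate is therefore made for mollified pairs
  on shrunken copies of the polygon. It normalises h by its value at c instead of its mean; pairing
  with test functions of integral zero hides this constant, and the limit is taken in inner products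
  only. The divergence of a compactly supported Lipschitz field has integral zero by translation
  invariance, so no boundary integral occurs. For the ellipse, 3/5 = (4 - 1) / (4 + 1) is the
  largest cosine of the angle, and half of 1 - 3/5 is 1/5, the same fraction as that of the smaller
  second moment.\<close>

no_notation fps_nth (infixl "$" 75)

section \<open>The space of square integrable functions\<close>

lemma L2_measurable: "u \<in> L2 \<Omega> \<Longrightarrow> u \<in> borel_measurable (lebesgue_on \<Omega>)"
  and L2_square_integrable: "u \<in> L2 \<Omega> \<Longrightarrow> integrable (lebesgue_on \<Omega>) (\<lambda>x. (u x)\<^sup>2)"
  by (auto simp: L2_def)

lemma L2_mult_integrable:
  assumes "u \<in> L2 \<Omega>" "w \<in> L2 \<Omega>"
  shows "integrable (lebesgue_on \<Omega>) (\<lambda>x. u x * w x)"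
proof (rule Bochner_Integration.integrable_bound)
  show "integrable (lebesgue_on \<Omega>) (\<lambda>x. (u x)\<^sup>2 + (w x)\<^sup>2)"
    using assms by (auto simp: L2_def)
  show "(\<lambda>x. u x * w x) \<in> borel_measurable (lebesgue_on \<Omega>)"
    using assms by (auto simp: L2_def)
  have "\<bar>a * b\<bar> \<le> a\<^sup>2 + b\<^sup>2" for a b :: real
  proof -
    have "2 * (\<bar>a\<bar> * \<bar>b\<bar>) \<le> a\<^sup>2 + b\<^sup>2"
      using sum_squares_bound[of "\<bar>a\<bar>" "\<bar>b\<bar>"] by (simp add: mult.assoc)
    moreover have "0 \<le> \<bar>a\<bar> * \<bar>b\<bar>" by simp
    ultimately show ?thesis unfolding abs_mult by linarith
  qed
  then show "AE x in lebesgue_on \<Omega>. norm (u x * w x) \<le> norm ((u x)\<^sup>2 + (w x)\<^sup>2)"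
    by (simp add: abs_of_nonneg)
qed

lemma L2_scale: "u \<in> L2 \<Omega> \<Longrightarrow> (\<lambda>x. c * u x) \<in> L2 \<Omega>"
  by (auto simp: L2_def power_mult_distrib)

lemma L2_add:
  assumes "u \<in> L2 \<Omega>" "w \<in> L2 \<Omega>"
  shows "(\<lambda>x. u x + w x) \<in> L2 \<Omega>"
proof -
  have "integrable (lebesgue_on \<Omega>) (\<lambda>x. (u x)\<^sup>2 + (w x)\<^sup>2 + 2 * (u x * w x))"
    using L2_mult_integrable[OF assms] assms by (auto simp: L2_def)
  then have "integrable (lebesgue_on \<Omega>) (\<lambda>x. (u x + w x)\<^sup>2)"
    by (simp add: power2_sum mult.assoc)
  then show ?thesis using assms by (auto simp: L2_def)
qed

lemma L2_uminus: "u \<in> L2 \<Omega> \<Longrightarrow> (\<lambda>x. - u x) \<in> L2 \<Omega>"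
  using L2_scale[of u \<Omega> "-1"] by simp

lemma L2_diff: "u \<in> L2 \<Omega> \<Longrightarrow> w \<in> L2 \<Omega> \<Longrightarrow> (\<lambda>x. u x - w x) \<in> L2 \<Omega>"
  using L2_add[OF _ L2_uminus, of u \<Omega> w] by simp

lemma L2_zero: "(\<lambda>x. 0) \<in> L2 \<Omega>"
  by (simp add: L2_def)

lemma L2_sum: "(\<And>i. i \<in> I \<Longrightarrow> u i \<in> L2 \<Omega>) \<Longrightarrow> (\<lambda>x. \<Sum>i\<in>I. u i x) \<in> L2 \<Omega>"
  by (induction I rule: infinite_finite_induct) (auto intro: L2_add L2_zero)

lemmas L2_intros = L2_add L2_diff L2_scale L2_uminus L2_zero L2_sum

lemma L2_inner_commute: "L2_inner \<Omega> u w = L2_inner \<Omega> w u"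
  by (simp add: L2_inner_def mult.commute)

lemma L2_inner_add_left:
  "u \<in> L2 \<Omega> \<Longrightarrow> u' \<in> L2 \<Omega> \<Longrightarrow> w \<in> L2 \<Omega> \<Longrightarrow>
   L2_inner \<Omega> (\<lambda>x. u x + u' x) w = L2_inner \<Omega> u w + L2_inner \<Omega> u' w"
  by (simp add: L2_inner_def distrib_right L2_mult_integrable)

lemma L2_inner_diff_left:
  "u \<in> L2 \<Omega> \<Longrightarrow> u' \<in> L2 \<Omega> \<Longrightarrow> w \<in> L2 \<Omega> \<Longrightarrow>
   L2_inner \<Omega> (\<lambda>x. u x - u' x) w = L2_inner \<Omega> u w - L2_inner \<Omega> u' w"
  by (simp add: L2_inner_def left_diff_distrib L2_mult_integrable)

lemma L2_inner_scale_left: "L2_inner \<Omega> (\<lambda>x. c * u x) w = c * L2_inner \<Omega> u w"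
  by (simp add: L2_inner_def mult.assoc)

lemma L2_inner_uminus_left: "L2_inner \<Omega> (\<lambda>x. - u x) w = - L2_inner \<Omega> u w"
  by (simp add: L2_inner_def)

lemma L2_inner_add_right:
  "u \<in> L2 \<Omega> \<Longrightarrow> u' \<in> L2 \<Omega> \<Longrightarrow> w \<in> L2 \<Omega> \<Longrightarrow>
   L2_inner \<Omega> w (\<lambda>x. u x + u' x) = L2_inner \<Omega> w u + L2_inner \<Omega> w u'"
  by (subst (1 2 3) L2_inner_commute) (rule L2_inner_add_left)

lemma L2_inner_diff_right:
  "u \<in> L2 \<Omega> \<Longrightarrow> u' \<in> L2 \<Omega> \<Longrightarrow> w \<in> L2 \<Omega> \<Longrightarrow>
   L2_inner \<Omega> w (\<lambda>x. u x - u' x) = L2_inner \<Omega> w u - L2_inner \<Omega> w u'"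
  by (subst (1 2 3) L2_inner_commute) (rule L2_inner_diff_left)

lemma L2_inner_scale_right: "L2_inner \<Omega> w (\<lambda>x. c * u x) = c * L2_inner \<Omega> w u"
  by (subst (1 2) L2_inner_commute) (rule L2_inner_scale_left)

lemma L2_inner_uminus_right: "L2_inner \<Omega> w (\<lambda>x. - u x) = - L2_inner \<Omega> w u"
  by (simp add: L2_inner_def)

lemmas L2_inner_simps = L2_inner_add_left L2_inner_diff_left L2_inner_scale_left
  L2_inner_uminus_left L2_inner_add_right L2_inner_diff_right L2_inner_scale_right
  L2_inner_uminus_right

lemma L2_inner_self_nonneg: "0 \<le> L2_inner \<Omega> u u"
  by (simp add: L2_inner_def)

lemma L2_norm_nonneg: "0 \<le> L2_norm \<Omega> u"
  by (simp add: L2_norm_def L2_inner_self_nonneg)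

lemma L2_norm_square: "(L2_norm \<Omega> u)\<^sup>2 = L2_inner \<Omega> u u"
  by (simp add: L2_norm_def L2_inner_self_nonneg)

lemma L2_norm_eq_integral: "(L2_norm \<Omega> u)\<^sup>2 = (LINT x|lebesgue_on \<Omega>. (u x)\<^sup>2)"
  unfolding L2_norm_square by (simp add: L2_inner_def power2_eq_square)

lemma L2_inner_cong_AE:
  assumes "u \<in> L2 \<Omega>" "u' \<in> L2 \<Omega>" "w \<in> L2 \<Omega>" "w' \<in> L2 \<Omega>"
    and "AE x in lebesgue_on \<Omega>. u x = u' x" "AE x in lebesgue_on \<Omega>. w x = w' x"
  shows "L2_inner \<Omega> u w = L2_inner \<Omega> u' w'"
  unfolding L2_inner_def
  by (rule integral_cong_AE)
     (use assms in \<open>auto simp: L2_def intro!: borel_measurable_times\<close>)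

lemma L2_norm_cong_AE:
  assumes "u \<in> L2 \<Omega>" "u' \<in> L2 \<Omega>" "AE x in lebesgue_on \<Omega>. u x = u' x"
  shows "L2_norm \<Omega> u = L2_norm \<Omega> u'"
  unfolding L2_norm_def using L2_inner_cong_AE[OF assms(1,2) assms(1,2) assms(3,3)] by simp

lemma L2_norm_eq_0_iff:
  assumes "u \<in> L2 \<Omega>"
  shows "L2_norm \<Omega> u = 0 \<longleftrightarrow> (AE x in lebesgue_on \<Omega>. u x = 0)"
proof -
  have "L2_norm \<Omega> u = 0 \<longleftrightarrow> (LINT x|lebesgue_on \<Omega>. (u x)\<^sup>2) = 0"
    by (metis L2_norm_eq_integral power_eq_0_iff zero_neq_numeral zero_power2)
  also have "\<dots> \<longleftrightarrow> (AE x in lebesgue_on \<Omega>. (u x)\<^sup>2 = 0)"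
    by (rule integral_nonneg_eq_0_iff_AE) (use L2_square_integrable[OF assms] in auto)
  finally show ?thesis by simp
qed

lemma quadratic_nonneg_discriminant:
  fixes a b c :: real
  assumes "\<And>t. 0 \<le> a * t\<^sup>2 - 2 * b * t + c" "0 \<le> a"
  shows "b\<^sup>2 \<le> a * c"
proof (cases "a = 0")
  case True
  have "b = 0"
  proof (rule ccontr)
    assume "b \<noteq> 0"
    \<comment> \<open>With \<open>a = 0\<close> the expression is affine in \<open>t\<close>, and at
      this point its value is -1.\<close>
    then show False using assms(1)[of "(c + 1) / (2 * b)"] True by (simp add: field_simps)
  qed
  then show ?thesis using True by simp
next
  case False
  then have "0 < a" using assms(2) by simp
  then show ?thesis using assms(1)[of "b / a"] by (simp add: field_simps power2_eq_square)
qed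

lemma L2_Cauchy_Schwarz:
  assumes u: "u \<in> L2 \<Omega>" and w: "w \<in> L2 \<Omega>"
  shows "\<bar>L2_inner \<Omega> u w\<bar> \<le> L2_norm \<Omega> u * L2_norm \<Omega> w"
proof -
  have "0 \<le> L2_inner \<Omega> u u * t\<^sup>2 - 2 * L2_inner \<Omega> u w * t + L2_inner \<Omega> w w" for t
  proof -
    have "0 \<le> L2_inner \<Omega> (\<lambda>x. t * u x - w x) (\<lambda>x. t * u x - w x)"
      by (rule L2_inner_self_nonneg)
    also have "\<dots> = L2_inner \<Omega> u u * t\<^sup>2 - 2 * L2_inner \<Omega> u w * t + L2_inner \<Omega> w w"
      using u w by (simp add: L2_inner_simps L2_intros L2_inner_commute[of \<Omega> w u]
          power2_eq_square algebra_simps)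
    finally show ?thesis .
  qed
  then have "(L2_inner \<Omega> u w)\<^sup>2 \<le> L2_inner \<Omega> u u * L2_inner \<Omega> w w"
    by (rule quadratic_nonneg_discriminant) (rule L2_inner_self_nonneg)
  then have "\<bar>L2_inner \<Omega> u w\<bar>\<^sup>2 \<le> (L2_norm \<Omega> u * L2_norm \<Omega> w)\<^sup>2"
    by (simp add: power_mult_distrib L2_norm_square)
  then show ?thesis
    by (rule power2_le_imp_le) (simp add: L2_norm_nonneg)
qed

lemma L2_norm_triangle:
  assumes u: "u \<in> L2 \<Omega>" and w: "w \<in> L2 \<Omega>"
  shows "L2_norm \<Omega> (\<lambda>x. u x + w x) \<le> L2_norm \<Omega> u + L2_norm \<Omega> w"
proof (rule power2_le_imp_le)
  have "(L2_norm \<Omega> (\<lambda>x. u x + w x))\<^sup>2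
      = (L2_norm \<Omega> u)\<^sup>2 + 2 * L2_inner \<Omega> u w + (L2_norm \<Omega> w)\<^sup>2"
    using u w by (simp add: L2_norm_square L2_inner_simps L2_intros L2_inner_commute[of \<Omega> w u])
  then show "(L2_norm \<Omega> (\<lambda>x. u x + w x))\<^sup>2 \<le> (L2_norm \<Omega> u + L2_norm \<Omega> w)\<^sup>2"
    using L2_Cauchy_Schwarz[OF u w] by (simp add: power2_sum)
qed (simp add: L2_norm_nonneg)

lemma L2_norm_uminus: "L2_norm \<Omega> (\<lambda>x. - u x) = L2_norm \<Omega> u"
  by (simp add: L2_norm_def L2_inner_def)

lemma L2_norm_minus_commute: "L2_norm \<Omega> (\<lambda>x. u x - w x) = L2_norm \<Omega> (\<lambda>x. w x - u x)"
  using L2_norm_uminus[of \<Omega> "\<lambda>x. u x - w x"] by simp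

lemma L2_norm_triangle_diff:
  assumes u: "u \<in> L2 \<Omega>" and w: "w \<in> L2 \<Omega>"
  shows "\<bar>L2_norm \<Omega> u - L2_norm \<Omega> w\<bar> \<le> L2_norm \<Omega> (\<lambda>x. u x - w x)"
  using L2_norm_triangle[OF L2_diff[OF u w] w] L2_norm_triangle[OF L2_diff[OF w u] u]
    L2_norm_minus_commute[of \<Omega> u w] by (simp add: abs_le_iff)

lemma L2_norm_tendsto:
  assumes "\<And>n. f n \<in> L2 \<Omega>" "g \<in> L2 \<Omega>" "(\<lambda>n. L2_norm \<Omega> (\<lambda>x. f n x - g x)) \<longlonglongrightarrow> 0"
  shows "(\<lambda>n. L2_norm \<Omega> (f n)) \<longlonglongrightarrow> L2_norm \<Omega> g"
proof -
  have "(\<lambda>n. L2_norm \<Omega> (f n) - L2_norm \<Omega> g) \<longlonglongrightarrow> 0"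
    by (rule Lim_null_comparison[OF _ assms(3)])
       (use L2_norm_triangle_diff[OF assms(1,2)] in simp)
  then show ?thesis by (simp add: LIM_zero_iff)
qed

lemma L2_inner_tendsto_left:
  assumes "\<And>n. f n \<in> L2 \<Omega>" "g \<in> L2 \<Omega>" "w \<in> L2 \<Omega>"
    "(\<lambda>n. L2_norm \<Omega> (\<lambda>x. f n x - g x)) \<longlonglongrightarrow> 0"
  shows "(\<lambda>n. L2_inner \<Omega> (f n) w) \<longlonglongrightarrow> L2_inner \<Omega> g w"
proof -
  have "(\<lambda>n. L2_inner \<Omega> (f n) w - L2_inner \<Omega> g w) \<longlonglongrightarrow> 0"
  proof (rule Lim_null_comparison)
    show "(\<lambda>n. L2_norm \<Omega> (\<lambda>x. f n x - g x) * L2_norm \<Omega> w) \<longlonglongrightarrow> 0"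
      using tendsto_mult_right[OF assms(4), of "L2_norm \<Omega> w"] by simp
    show "\<forall>\<^sub>F n in sequentially. norm (L2_inner \<Omega> (f n) w - L2_inner \<Omega> g w)
        \<le> L2_norm \<Omega> (\<lambda>x. f n x - g x) * L2_norm \<Omega> w"
      using L2_Cauchy_Schwarz[OF L2_diff[OF assms(1,2)] assms(3)] assms(1-3)
      by (simp add: L2_inner_simps)
  qed
  then show ?thesis by (simp add: LIM_zero_iff)
qed

lemma L2_inner_tendsto:
  assumes "\<And>n. f n \<in> L2 \<Omega>" "g \<in> L2 \<Omega>" "\<And>n. f' n \<in> L2 \<Omega>" "g' \<in> L2 \<Omega>"
    "(\<lambda>n. L2_norm \<Omega> (\<lambda>x. f n x - g x)) \<longlonglongrightarrow> 0"
    "(\<lambda>n. L2_norm \<Omega> (\<lambda>x. f' n x - g' x)) \<longlonglongrightarrow> 0"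
  shows "(\<lambda>n. L2_inner \<Omega> (f n) (f' n)) \<longlonglongrightarrow> L2_inner \<Omega> g g'"
proof -
  have "(\<lambda>n. L2_inner \<Omega> (f n) (\<lambda>x. f' n x - g' x)) \<longlonglongrightarrow> 0"
  proof (rule Lim_null_comparison)
    show "(\<lambda>n. L2_norm \<Omega> (f n) * L2_norm \<Omega> (\<lambda>x. f' n x - g' x)) \<longlonglongrightarrow> 0"
      using tendsto_mult[OF L2_norm_tendsto[OF assms(1,2,5)] assms(6)] by simp
    show "\<forall>\<^sub>F n in sequentially. norm (L2_inner \<Omega> (f n) (\<lambda>x. f' n x - g' x))
        \<le> L2_norm \<Omega> (f n) * L2_norm \<Omega> (\<lambda>x. f' n x - g' x)"
      using L2_Cauchy_Schwarz[OF assms(1) L2_diff[OF assms(3,4)]] by simp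
  qed
  from tendsto_add[OF this L2_inner_tendsto_left[OF assms(1,2,4,5)]]
  show ?thesis using assms(1-4) by (simp add: L2_inner_simps)
qed

lemma finite_measure_lebesgue_on:
  fixes \<Omega> :: "(real^2) set"
  assumes "open \<Omega>" "bounded \<Omega>"
  shows "finite_measure (lebesgue_on \<Omega>)"
proof
  have "emeasure lebesgue \<Omega> < \<infinity>"
    using bounded_set_imp_lmeasurable[OF assms(2)] assms(1)
    by (auto simp: fmeasurable_def)
  then show "emeasure (lebesgue_on \<Omega>) (space (lebesgue_on \<Omega>)) \<noteq> \<infinity>"
    using assms by (simp add: emeasure_restrict_space)
qed

lemma L2_bounded:
  fixes u :: "real^2 \<Rightarrow> real"
  assumes "open \<Omega>" "bounded \<Omega>" "u \<in> borel_measurable (lebesgue_on \<Omega>)"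
    "\<And>x. x \<in> \<Omega> \<Longrightarrow> \<bar>u x\<bar> \<le> B"
  shows "u \<in> L2 \<Omega>"
proof -
  interpret finite_measure "lebesgue_on \<Omega>" by (rule finite_measure_lebesgue_on) fact+
  have "AE x in lebesgue_on \<Omega>. norm ((u x)\<^sup>2) \<le> B\<^sup>2"
    using assms(4) by (intro AE_I2) (fastforce simp: abs_le_square_iff[symmetric] intro: order_trans[OF _ abs_ge_self])
  then have "integrable (lebesgue_on \<Omega>) (\<lambda>x. (u x)\<^sup>2)"
    using assms(3) by (intro integrable_const_bound) auto
  then show ?thesis using assms(3) by (simp add: L2_def)
qed

lemma L2_const: "open \<Omega> \<Longrightarrow> bounded \<Omega> \<Longrightarrow> (\<lambda>x. c) \<in> L2 \<Omega>"
  by (rule L2_bounded) auto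

lemma L2_integrable:
  assumes "open \<Omega>" "bounded \<Omega>" "u \<in> L2 \<Omega>"
  shows "integrable (lebesgue_on \<Omega>) u"
  using L2_mult_integrable[OF assms(3) L2_const[OF assms(1,2), of 1]] by simp

text \<open>Riesz-Fischer. On a set of finite measure a Cauchy sequence in \<open>L2\<close> is also
  Cauchy in the mean, so a subsequence converges almost everywhere. Fatou's lemma along this
  subsequence, with the other index fixed, gives convergence in norm.\<close>

lemma L2_complete:
  assumes \<Omega>: "open \<Omega>" "bounded \<Omega>" and f: "\<And>n. f n \<in> L2 \<Omega>"
    and Cauchy: "\<And>e. 0 < e \<Longrightarrow> \<exists>N. \<forall>i\<ge>N. \<forall>j\<ge>N. L2_norm \<Omega> (\<lambda>x. f i x - f j x) < e"
  obtains g where "g \<in> L2 \<Omega>" "(\<lambda>n. L2_norm \<Omega> (\<lambda>x. f n x - g x)) \<longlonglongrightarrow> 0"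
proof -
  let ?M = "lebesgue_on \<Omega>"
  have one: "(\<lambda>x. 1) \<in> L2 \<Omega>" by (rule L2_const[OF \<Omega>])
  have L1: "(LINT x|?M. norm (f i x - f j x)) \<le> L2_norm \<Omega> (\<lambda>x. f i x - f j x) * L2_norm \<Omega> (\<lambda>x. 1)"
    for i j
  proof -
    have a: "(\<lambda>x. \<bar>f i x - f j x\<bar>) \<in> L2 \<Omega>"
      using L2_diff[OF f f, of i j] by (auto simp: L2_def)
    have "(LINT x|?M. norm (f i x - f j x)) = L2_inner \<Omega> (\<lambda>x. \<bar>f i x - f j x\<bar>) (\<lambda>x. 1)"
      by (simp add: L2_inner_def)
    also have "\<dots> \<le> L2_norm \<Omega> (\<lambda>x. \<bar>f i x - f j x\<bar>) * L2_norm \<Omega> (\<lambda>x. 1)"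
      using L2_Cauchy_Schwarz[OF a one] by simp
    also have "L2_norm \<Omega> (\<lambda>x. \<bar>f i x - f j x\<bar>) = L2_norm \<Omega> (\<lambda>x. f i x - f j x)"
      by (simp add: L2_norm_def L2_inner_def)
    finally show ?thesis .
  qed
  have L1_Cauchy: "\<exists>N. \<forall>i\<ge>N. \<forall>j\<ge>N. (LINT x|?M. norm (f i x - f j x)) < e" if "0 < e" for e
  proof -
    \<comment> \<open>The added 1 keeps the denominator positive for empty \<Omega>, where the
      constant 1 has norm 0.\<close>
    have "0 < e / (L2_norm \<Omega> (\<lambda>x. 1) + 1)"
      using that L2_norm_nonneg[of \<Omega> "\<lambda>x. 1"] by (simp add: add_nonneg_pos)
    then obtain N where N: "L2_norm \<Omega> (\<lambda>x. f i x - f j x) < e / (L2_norm \<Omega> (\<lambda>x. 1) + 1)"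
      if "i \<ge> N" "j \<ge> N" for i j using Cauchy by blast
    have "(LINT x|?M. norm (f i x - f j x)) < e" if "i \<ge> N" "j \<ge> N" for i j
    proof -
      have "(LINT x|?M. norm (f i x - f j x)) \<le> L2_norm \<Omega> (\<lambda>x. f i x - f j x) * (L2_norm \<Omega> (\<lambda>x. 1) + 1)"
        using L1[of i j] L2_norm_nonneg[of \<Omega> "\<lambda>x. f i x - f j x"] by (simp add: distrib_left)
      also have "\<dots> < e"
        using N[OF that] L2_norm_nonneg[of \<Omega> "\<lambda>x. 1"] by (simp add: field_simps)
      finally show ?thesis .
    qed
    then show ?thesis by blast
  qed
  obtain r where r: "strict_mono r" "AE x in ?M. Cauchy (\<lambda>i. f (r i) x)"
    by (rule cauchy_L1_AE_cauchy_subseq[OF L2_integrable[OF \<Omega> f] L1_Cauchy])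
  define g where "g x = lim (\<lambda>i. f (r i) x)" for x
  have [measurable]: "f n \<in> borel_measurable ?M" for n by (rule L2_measurable[OF f])
  have g_meas [measurable]: "g \<in> borel_measurable ?M"
    unfolding g_def by measurable
  have conv: "AE x in ?M. (\<lambda>i. f (r i) x) \<longlonglongrightarrow> g x"
    using r(2) by eventually_elim (simp add: g_def Cauchy_convergent_iff convergent_LIMSEQ_iff)
  have sq: "(\<integral>\<^sup>+x. ennreal ((f i x - f j x)\<^sup>2) \<partial>?M) = ennreal ((L2_norm \<Omega> (\<lambda>x. f i x - f j x))\<^sup>2)" for i j
    unfolding L2_norm_eq_integral
    by (rule nn_integral_eq_integral) (use L2_square_integrable[OF L2_diff[OF f f]] in auto)
  have fatou: "(\<integral>\<^sup>+x. ennreal ((f n x - g x)\<^sup>2) \<partial>?M) \<le> ennreal (e\<^sup>2)"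
    if N: "\<And>i j. i \<ge> N \<Longrightarrow> j \<ge> N \<Longrightarrow> L2_norm \<Omega> (\<lambda>x. f i x - f j x) < e" and n: "n \<ge> N" for n N e
  proof -
    have "(\<integral>\<^sup>+x. ennreal ((f n x - g x)\<^sup>2) \<partial>?M)
        = (\<integral>\<^sup>+x. liminf (\<lambda>i. ennreal ((f n x - f (r i) x)\<^sup>2)) \<partial>?M)"
    proof (rule nn_integral_cong_AE)
      show "AE x in ?M. ennreal ((f n x - g x)\<^sup>2) = liminf (\<lambda>i. ennreal ((f n x - f (r i) x)\<^sup>2))"
        using conv
      proof eventually_elim
        case (elim x)
        have "(\<lambda>i. ennreal ((f n x - f (r i) x)\<^sup>2)) \<longlonglongrightarrow> ennreal ((f n x - g x)\<^sup>2)"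
          by (intro tendsto_intros elim)
        then show ?case using lim_imp_Liminf[OF sequentially_bot] by metis
      qed
    qed
    also have "\<dots> \<le> liminf (\<lambda>i. \<integral>\<^sup>+x. ennreal ((f n x - f (r i) x)\<^sup>2) \<partial>?M)"
      by (rule nn_integral_liminf) measurable
    also have "\<dots> \<le> ennreal (e\<^sup>2)"
    proof (rule Liminf_le)
      show "\<forall>\<^sub>F i in sequentially. (\<integral>\<^sup>+x. ennreal ((f n x - f (r i) x)\<^sup>2) \<partial>?M) \<le> ennreal (e\<^sup>2)"
        using eventually_ge_at_top[of N]
      proof eventually_elim
        case (elim i)
        then have "r i \<ge> N" using seq_suble[OF r(1), of i] by simp
        then show ?case unfolding sq
          by (intro ennreal_leI power_mono less_imp_le[OF N[OF n]] L2_norm_nonneg)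
      qed
    qed simp
    finally show ?thesis .
  qed
  have diff_L2: "(\<lambda>x. f n x - g x) \<in> L2 \<Omega> \<and> L2_norm \<Omega> (\<lambda>x. f n x - g x) \<le> e"
    if N: "\<And>i j. i \<ge> N \<Longrightarrow> j \<ge> N \<Longrightarrow> L2_norm \<Omega> (\<lambda>x. f i x - f j x) < e" and n: "n \<ge> N" for n N e
  proof -
    have e: "0 \<le> e" using N[of N N] L2_norm_nonneg[of \<Omega> "\<lambda>x. f N x - f N x"] by simp
    have int: "integrable ?M (\<lambda>x. (f n x - g x)\<^sup>2)"
      using fatou[OF that] by (intro integrableI_bounded) (auto intro: le_less_trans)
    then have "(\<lambda>x. f n x - g x) \<in> L2 \<Omega>" by (simp add: L2_def)
    moreover have "(L2_norm \<Omega> (\<lambda>x. f n x - g x))\<^sup>2 \<le> e\<^sup>2"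
      unfolding L2_norm_eq_integral
      using fatou[OF that] nn_integral_eq_integral[OF int] by simp
    then have "L2_norm \<Omega> (\<lambda>x. f n x - g x) \<le> e" by (rule power2_le_imp_le[OF _ e])
    ultimately show ?thesis ..
  qed
  obtain N1 where N1: "\<And>i j. i \<ge> N1 \<Longrightarrow> j \<ge> N1 \<Longrightarrow> L2_norm \<Omega> (\<lambda>x. f i x - f j x) < 1"
    using Cauchy[of 1] by auto
  have "(\<lambda>x. f N1 x - (f N1 x - g x)) \<in> L2 \<Omega>"
    by (rule L2_diff[OF f diff_L2[THEN conjunct1, OF N1 order_refl]])
  then have g: "g \<in> L2 \<Omega>" by simp
  have "(\<lambda>n. L2_norm \<Omega> (\<lambda>x. f n x - g x)) \<longlonglongrightarrow> 0"
  proof (rule LIMSEQ_I)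
    fix e :: real assume "0 < e"
    then obtain N where N: "\<And>i j. i \<ge> N \<Longrightarrow> j \<ge> N \<Longrightarrow> L2_norm \<Omega> (\<lambda>x. f i x - f j x) < e/2"
      using Cauchy[of "e/2"] by auto
    have "norm (L2_norm \<Omega> (\<lambda>x. f n x - g x) - 0) < e" if "n \<ge> N" for n
      using diff_L2[OF N that] \<open>0 < e\<close> L2_norm_nonneg[of \<Omega> "\<lambda>x. f n x - g x"] by simp
    then show "\<exists>no. \<forall>n\<ge>no. norm (L2_norm \<Omega> (\<lambda>x. f n x - g x) - 0) < e" by blast
  qed
  with g show ?thesis by (rule that)
qed

text \<open>A quadratic functional \<open>J\<close> satisfying the parallelogram identity has maximising sequences
  that are Cauchy. This gives the Riesz representation and the density of test functions.\<close>

lemma maximising_sequence: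
  fixes J :: "'a \<Rightarrow> real"
  assumes ne: "v0 \<in> S" and bdd: "\<And>v. v \<in> S \<Longrightarrow> J v \<le> B"
    and mid: "\<And>v w. v \<in> S \<Longrightarrow> w \<in> S \<Longrightarrow> \<exists>z\<in>S. J z = (J v + J w) / 2 + d v w / 4"
  obtains v m where "\<And>n. v n \<in> S" "\<And>w. w \<in> S \<Longrightarrow> J w \<le> m"
    "\<And>n. m - 1 / real (Suc n) \<le> J (v n)"
    "\<And>e. 0 < e \<Longrightarrow> \<exists>N. \<forall>i\<ge>N. \<forall>j\<ge>N. d (v i) (v j) < e"
proof -
  define m where "m = Sup (J ` S)"
  have bdd': "bdd_above (J ` S)" using bdd by (auto intro!: bdd_aboveI)
  have le: "J w \<le> m" if "w \<in> S" for w
    unfolding m_def by (rule cSUP_upper[OF that bdd'])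
  have "\<exists>w\<in>S. m - 1 / real (Suc n) \<le> J w" for n
  proof -
    have "m - 1 / real (Suc n) < Sup (J ` S)" by (simp add: m_def)
    then show ?thesis using less_cSUP_iff[of S J] ne bdd' by (metis empty_iff less_imp_le)
  qed
  then obtain v where v: "\<And>n. v n \<in> S" "\<And>n. m - 1 / real (Suc n) \<le> J (v n)" by metis
  \<comment> \<open>Both values exceed \<open>m - e/4\<close>, while the point \<open>z\<close>
    between them has value at most \<open>m\<close>; so the excess \<open>d / 4\<close> stays below
    \<open>e / 4\<close>.\<close>
  have "\<exists>N. \<forall>i\<ge>N. \<forall>j\<ge>N. d (v i) (v j) < e" if "0 < e" for e
  proof -
    have "0 < e / 4" using that by simp
    then obtain N where N: "1 / real (Suc N) < e / 4" by (rule nat_approx_posE)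
    have "d (v i) (v j) < e" if "i \<ge> N" "j \<ge> N" for i j
    proof -
      obtain z where z: "z \<in> S" "J z = (J (v i) + J (v j)) / 2 + d (v i) (v j) / 4"
        using mid v(1) by blast
      have "m - e / 4 < J (v k)" if "k \<ge> N" for k
      proof -
        have "1 / real (Suc k) \<le> 1 / real (Suc N)" using that by (auto simp: field_simps)
        then have "1 / real (Suc k) < e / 4" using N by (rule le_less_trans)
        then show ?thesis using v(2)[of k] by argo
      qed
      from this[OF that(1)] this[OF that(2)] show ?thesis using le[OF z(1)] z(2) by argo
    qed
    then show ?thesis by blast
  qed
  with v le show ?thesis using that by blast
qed

section \<open>Integrals of derivatives of compactly supported functions\<close>

lemma lborel_integral_translation:
  fixes f :: "'a::euclidean_space \<Rightarrow> real"
  assumes [measurable]: "f \<in> borel_measurable borel"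
  shows "(LINT x|lborel. f (x + c)) = (LINT x|lborel. f x)"
proof -
  have "(LINT x|lborel. f x) = (LINT x|distr lborel borel ((+) c). f x)"
    by (simp add: lborel_distr_plus)
  also have "\<dots> = (LINT x|lborel. f (c + x))"
    by (rule integral_distr) auto
  finally show ?thesis by (simp add: add.commute)
qed

lemma lborel_integrable_translation:
  fixes f :: "'a::euclidean_space \<Rightarrow> real"
  assumes "integrable lborel f"
  shows "integrable lborel (\<lambda>x. f (x + c))"
proof -
  have "integrable (distr lborel borel ((+) c)) f"
    by (simp add: lborel_distr_plus assms)
  then have "integrable lborel (\<lambda>x. f (c + x))"
    by (rule integrable_distr[rotated]) auto
  then show ?thesis by (simp add: add.commute)
qed

lemma continuous_imp_borel_measurable_lebesgue:
  fixes f :: "'a::euclidean_space \<Rightarrow> 'b::{metric_space}"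
  shows "continuous_on UNIV f \<Longrightarrow> f \<in> borel_measurable lebesgue"
  by (intro measurable_completion) (auto intro: borel_measurable_continuous_onI)

lemma integrable_indicator_cball:
  "integrable lebesgue (\<lambda>x. c * indicat_real (cball (z::'a::euclidean_space) r) x)"
proof -
  have "emeasure lborel (cball z r) < \<infinity>"
    using emeasure_bounded_finite[of "cball z r"] by simp
  then have "integrable lborel (indicat_real (cball z r))"
    by (intro integrable_real_indicator) auto
  then have "integrable lebesgue (indicat_real (cball z r))"
    by (subst integrable_completion) auto
  then show ?thesis by simp
qed

text \<open>The difference quotients have integral zero by translation invariance and are dominated.\<close>

lemma integral_directional_derivative_eq_0:
  fixes f :: "'a::euclidean_space \<Rightarrow> real"
  assumes lip: "\<And>x y. \<bar>f x - f y\<bar> \<le> L * norm (x - y)"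
    and supp: "\<And>x. R < norm x \<Longrightarrow> f x = 0"
    and d: "d \<in> borel_measurable lebesgue"
    and deriv: "AE x in lebesgue. ((\<lambda>t. (f (x + t *\<^sub>R e) - f x) / t) \<longlongrightarrow> d x) (at_right 0)"
  shows "integrable lebesgue d" "(LINT x|lebesgue. d x) = 0"
proof -
  define t where "t n = 1 / real (Suc n)" for n
  have t: "0 < t n" "t n \<le> 1" for n by (auto simp: t_def)
  have t0: "t \<longlonglongrightarrow> 0" unfolding t_def by (rule LIMSEQ_Suc[OF lim_1_over_n])
  have t_right: "filterlim t (at_right 0) sequentially"
    using t(1) t0 by (intro filterlim_at_withinI) auto
  define s where "s n x = (f (x + t n *\<^sub>R e) - f x) / t n" for n x
  \<comment> \<open>Steps \<open>t n \<le> 1\<close> move the support by at most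
    \<open>norm e\<close>, so one enlarged ball carries all difference quotients.\<close>
  define w where "w x = \<bar>L\<bar> * norm e * indicat_real (cball (0::'a) (\<bar>R\<bar> + norm e)) x" for x
  have lip': "\<bar>f x - f y\<bar> \<le> \<bar>L\<bar> * norm (x - y)" for x y
    using lip[of x y] by (meson abs_ge_self mult_right_mono norm_ge_zero order_trans)
  then have "\<bar>L\<bar>-lipschitz_on UNIV f" by (intro lipschitz_onI) (auto simp: dist_norm)
  then have cont: "continuous_on UNIV f" by (rule lipschitz_on_continuous_on)
  have f_borel [measurable]: "f \<in> borel_measurable borel"
    by (rule borel_measurable_continuous_onI[OF cont])
  have s_borel [measurable]: "s n \<in> borel_measurable borel" for n
    unfolding s_def by measurable
  have f_int: "integrable lborel f"
  proof -
    have "(\<lambda>x. indicat_real (cball 0 \<bar>R\<bar>) x *\<^sub>R f x) = f"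
      using supp by (auto simp: indicator_def fun_eq_iff)
    moreover have "integrable lborel (\<lambda>x. indicat_real (cball 0 \<bar>R\<bar>) x *\<^sub>R f x)"
      using borel_integrable_compact[of "cball (0::'a) \<bar>R\<bar>" f] continuous_on_subset[OF cont]
      by (simp add: set_integrable_def)
    ultimately show ?thesis by simp
  qed
  have s_int: "(LINT x|lebesgue. s n x) = 0" for n
  proof -
    have "(LINT x|lebesgue. s n x) = (LINT x|lborel. s n x)"
      by (rule integral_completion) simp
    also have "\<dots> = ((LINT x|lborel. f (x + t n *\<^sub>R e)) - (LINT x|lborel. f x)) / t n"
      unfolding s_def using f_int lborel_integrable_translation[OF f_int, of "t n *\<^sub>R e"] by simp
    also have "\<dots> = 0"
      by (simp add: lborel_integral_translation)
    finally show ?thesis .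
  qed
  have s_bound: "\<bar>s n x\<bar> \<le> w x" for n x
  proof (cases "norm x \<le> \<bar>R\<bar> + norm e")
    case True
    have "\<bar>f (x + t n *\<^sub>R e) - f x\<bar> \<le> \<bar>L\<bar> * (t n * norm e)"
      using lip'[of "x + t n *\<^sub>R e" x] t(1)[of n] by simp
    then show ?thesis using True t(1)[of n] by (simp add: s_def w_def field_simps abs_divide)
  next
    case False
    have "norm (t n *\<^sub>R e) \<le> norm e" using t[of n] by (simp add: mult_left_le_one_le)
    then have "R < norm (x + t n *\<^sub>R e)"
      using False norm_triangle_ineq2[of x "- (t n *\<^sub>R e)"] by simp
    moreover have "R < norm x" using False norm_ge_zero[of e] by linarith
    ultimately show ?thesis by (simp add: s_def w_def supp)
  qed
  have lim: "AE x in lebesgue. (\<lambda>n. s n x) \<longlonglongrightarrow> d x"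
    using deriv by eventually_elim (auto simp: s_def intro: filterlim_compose[OF _ t_right])
  have w: "integrable lebesgue w" unfolding w_def by (rule integrable_indicator_cball)
  have s_meas: "s n \<in> borel_measurable lebesgue" for n by (rule measurable_completion) simp
  have bd: "AE x in lebesgue. norm (s n x) \<le> w x" for n using s_bound by simp
  show "integrable lebesgue d"
    by (rule integrable_dominated_convergence[OF d s_meas w lim bd])
  have "(\<lambda>n. LINT x|lebesgue. s n x) \<longlonglongrightarrow> (LINT x|lebesgue. d x)"
    by (rule integral_dominated_convergence[OF d s_meas w lim bd])
  then show "(LINT x|lebesgue. d x) = 0" by (simp add: s_int LIMSEQ_const_iff)
qed

lemma has_derivative_imp_quotient_tendsto:
  assumes "(f has_derivative f') (at x)"
  shows "((\<lambda>t. (f (x + t *\<^sub>R e) - f x) / t) \<longlongrightarrow> (f' e :: real)) (at 0)"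
proof -
  have "((\<lambda>t::real. x + t *\<^sub>R e) has_derivative (\<lambda>t. t *\<^sub>R e)) (at 0)"
    by (auto intro!: derivative_eq_intros)
  then have "((\<lambda>t. f (x + t *\<^sub>R e)) has_derivative (\<lambda>t. f' (t *\<^sub>R e))) (at 0)"
    using assms diff_chain_at[of "\<lambda>t. x + t *\<^sub>R e" "\<lambda>t. t *\<^sub>R e" 0 f f'] by (simp add: o_def)
  moreover have "f' (t *\<^sub>R e) = f' e * t" for t
    using linear_scale[OF has_derivative_linear[OF assms], of t e] by simp
  ultimately have "((\<lambda>t. f (x + t *\<^sub>R e)) has_real_derivative f' e) (at 0)"
    by (simp add: has_field_derivative_def)
  then show ?thesis by (simp add: has_field_derivative_iff)
qed

section \<open>Smooth functions and test functions\<close>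

lemma vec2_eq: "(v :: real^2) = v$1 *\<^sub>R axis 1 1 + v$2 *\<^sub>R axis 2 1"
  by (simp add: vec_eq_iff forall_2 axis_def)

lemma norm_vec2: "norm (v :: real^2) = sqrt ((v$1)\<^sup>2 + (v$2)\<^sup>2)"
  by (simp add: norm_vec_def L2_set_def sum_2)

lemma inner_vec2: "(v :: real^2) \<bullet> w = v$1 * w$1 + v$2 * w$2"
  by (simp add: inner_vec_def sum_2)

lemma has_derivative_pderiv:
  assumes "f differentiable (at x)"
  shows "(f has_derivative (\<lambda>v. v$1 * pderiv_at 1 f x + v$2 * pderiv_at 2 f x)) (at x)"
proof -
  let ?F = "frechet_derivative f (at x)"
  have F: "(f has_derivative ?F) (at x)" using assms by (simp add: frechet_derivative_works)
  have "?F v = v$1 * pderiv_at 1 f x + v$2 * pderiv_at 2 f x" for v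
  proof -
    have "?F v = ?F (v$1 *\<^sub>R axis 1 1 + v$2 *\<^sub>R axis 2 1)" using vec2_eq[of v] by simp
    also have "\<dots> = v$1 * ?F (axis 1 1) + v$2 * ?F (axis 2 1)"
      using has_derivative_linear[OF F] by (simp add: linear_add linear_scale)
    finally show ?thesis by (simp add: pderiv_at_def)
  qed
  then have "?F = (\<lambda>v. v$1 * pderiv_at 1 f x + v$2 * pderiv_at 2 f x)" by blast
  with F show ?thesis by simp
qed

lemma pderiv_at_eqI: "(f has_derivative f') (at x) \<Longrightarrow> pderiv_at j f x = f' (axis j 1)"
  by (metis frechet_derivative_at pderiv_at_def)

lemma Ck_continuous: "Ck k f \<Longrightarrow> continuous_on UNIV f"
  using differentiable_imp_continuous_on[of f UNIV] by (cases k) (auto simp: differentiable_on_def)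

lemma Ck_Suc_imp: "Ck (Suc k) f \<Longrightarrow> Ck k f"
proof (induction k arbitrary: f)
  case 0
  then show ?case using Ck_continuous[of "Suc 0" f] by simp
qed simp

lemma Ck_const: "Ck k (\<lambda>x. c)"
proof (induction k arbitrary: c)
  case (Suc k)
  have "pderiv_at j (\<lambda>x. c) = (\<lambda>x. 0)" for j
    by (rule ext, rule pderiv_at_eqI[THEN trans]) (auto intro!: derivative_eq_intros)
  then show ?case using Suc by simp
qed simp

lemma pderiv_at_add:
  "f differentiable (at x) \<Longrightarrow> g differentiable (at x) \<Longrightarrow>
   pderiv_at j (\<lambda>x. f x + g x) x = pderiv_at j f x + pderiv_at j g x"
  by (rule pderiv_at_eqI[THEN trans], rule has_derivative_add)
     (auto simp: frechet_derivative_works pderiv_at_def)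

lemma pderiv_at_mult:
  "f differentiable (at x) \<Longrightarrow> g differentiable (at x) \<Longrightarrow>
   pderiv_at j (\<lambda>x. f x * g x) x = f x * pderiv_at j g x + pderiv_at j f x * g x"
  by (rule pderiv_at_eqI[THEN trans], rule has_derivative_mult)
     (auto simp: frechet_derivative_works pderiv_at_def)

lemma Ck_add: "Ck k f \<Longrightarrow> Ck k g \<Longrightarrow> Ck k (\<lambda>x. f x + g x)"
proof (induction k arbitrary: f g)
  case (Suc k)
  have "pderiv_at j (\<lambda>x. f x + g x) = (\<lambda>x. pderiv_at j f x + pderiv_at j g x)" for j
    using Suc.prems by (auto simp: pderiv_at_add)
  then show ?case using Suc by auto
qed (auto intro: continuous_intros)

lemma Ck_mult: "Ck k f \<Longrightarrow> Ck k g \<Longrightarrow> Ck k (\<lambda>x. f x * g x)"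
proof (induction k arbitrary: f g)
  case (Suc k)
  have "pderiv_at j (\<lambda>x. f x * g x) = (\<lambda>x. f x * pderiv_at j g x + pderiv_at j f x * g x)" for j
    using Suc.prems by (auto simp: pderiv_at_mult)
  moreover have "Ck k (\<lambda>x. f x * pderiv_at j g x + pderiv_at j f x * g x)" for j
    using Suc.prems Ck_Suc_imp[OF Suc.prems(1)] Ck_Suc_imp[OF Suc.prems(2)]
    by (intro Ck_add Suc.IH) auto
  ultimately show ?case using Suc.prems by auto
qed (auto intro: continuous_intros)

lemma has_derivative_component: "((\<lambda>x::real^2. x$i) has_derivative (\<lambda>v. v$i)) (at x)"
  by (rule bounded_linear_imp_has_derivative[OF bounded_linear_vec_nth])

lemma pderiv_at_component: "pderiv_at j (\<lambda>x. x$i) = (\<lambda>x. if i = j then 1 else 0)"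
  by (rule ext, rule pderiv_at_eqI[OF has_derivative_component, THEN trans]) (simp add: axis_def)

lemma Ck_component: "Ck k (\<lambda>x. x$i)"
proof (cases k)
  case (Suc m)
  then show ?thesis
    using has_derivative_component Ck_const by (auto simp: pderiv_at_component differentiable_def)
qed (auto intro: continuous_intros)

text \<open>Mollification evaluates a function against the kernel \<rho>(x - y) as a function of y.
  The reflection rules make this kernel a test function and account for the sign of its
  derivatives.\<close>

lemma pderiv_at_reflect:
  assumes "f differentiable (at (a - x))"
  shows "pderiv_at j (\<lambda>x. f (a - x)) x = - pderiv_at j f (a - x)"
proof -
  have "((\<lambda>x. a - x) has_derivative (\<lambda>v. - v)) (at x)" by (auto intro!: derivative_eq_intros)
  from diff_chain_at[OF this has_derivative_pderiv[OF assms]]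
  have "((\<lambda>x. f (a - x)) has_derivative
      (\<lambda>v. (- v)$1 * pderiv_at 1 f (a - x) + (- v)$2 * pderiv_at 2 f (a - x))) (at x)"
    by (simp add: o_def)
  then show ?thesis
    by (rule pderiv_at_eqI[THEN trans]) (use exhaust_2[of j] in \<open>auto simp: axis_def\<close>)
qed

lemma differentiable_reflect:
  assumes "f differentiable (at (a - x))"
  shows "(\<lambda>x. f (a - x)) differentiable (at (x::real^2))"
proof -
  have "((\<lambda>x. a - x) has_derivative (\<lambda>v. - v)) (at x)" by (auto intro!: derivative_eq_intros)
  then show ?thesis using assms differentiable_chain_at[of "\<lambda>x. a - x" x f]
    by (auto simp: o_def differentiable_def)
qed

lemma Ck_reflect: "Ck k f \<Longrightarrow> Ck k (\<lambda>x. f (a - x))"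
proof (induction k arbitrary: f)
  case 0
  then show ?case by (auto intro!: continuous_on_compose2[of UNIV f] continuous_intros)
next
  case (Suc k)
  have "Ck k (\<lambda>x. - 1 * pderiv_at j f (a - x))" for j
    by (rule Ck_mult[OF Ck_const]) (use Suc in auto)
  moreover have "pderiv_at j (\<lambda>x. f (a - x)) = (\<lambda>x. - 1 * pderiv_at j f (a - x))" for j
    using Suc.prems by (auto simp: pderiv_at_reflect)
  moreover have "(\<lambda>x. f (a - x)) differentiable (at x)" for x
    using Suc.prems by (intro differentiable_reflect) auto
  ultimately show ?case by auto
qed

lemma pderiv_at_eq_0_outside:
  assumes "x \<notin> closure {x. f x \<noteq> 0}"
  shows "pderiv_at j f x = 0"
proof -
  have "((\<lambda>x. 0 :: real) has_derivative (\<lambda>v. 0)) (at x)" by simp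
  then have "(f has_derivative (\<lambda>v. 0)) (at x)"
  proof (rule has_derivative_transform_within_open[where s="- closure {x. f x \<noteq> 0}"])
    fix y assume "y \<in> - closure {x. f x \<noteq> 0}"
    then show "0 = f y" using closure_subset[of "{x. f x \<noteq> 0}"] by auto
  qed (use assms in auto)
  then show ?thesis by (rule pderiv_at_eqI)
qed

lemma continuous_compact_support_bounded:
  fixes f :: "real^2 \<Rightarrow> real"
  assumes "continuous_on UNIV f" "compact (closure {x. f x \<noteq> 0})"
  obtains B where "0 \<le> B" "\<forall>x. \<bar>f x\<bar> \<le> B"
proof -
  have "bounded (f ` closure {x. f x \<noteq> 0})"
    by (intro compact_imp_bounded compact_continuous_image continuous_on_subset[OF assms(1)] assms(2)) simp
  then obtain B where bd: "\<forall>y\<in>f ` closure {x. f x \<noteq> 0}. norm y \<le> B"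
    unfolding bounded_iff by blast
  have B: "\<bar>f x\<bar> \<le> B" if "x \<in> closure {x. f x \<noteq> 0}" for x
    using bspec[OF bd imageI[OF that]] by simp
  have "\<bar>f x\<bar> \<le> \<bar>B\<bar>" for x
  proof (cases "f x = 0")
    case False
    then have "x \<in> closure {x. f x \<noteq> 0}" by (intro closure_subset[THEN subsetD]) simp
    then show ?thesis using B[of x] abs_ge_self[of B] by (meson order_trans)
  qed simp
  then show ?thesis using that[of "\<bar>B\<bar>"] by simp
qed

lemma compact_support_pderiv:
  assumes "compact (closure {x. f x \<noteq> 0})"
  shows "compact (closure {x. pderiv_at j f x \<noteq> 0})"
    "closure {x. pderiv_at j f x \<noteq> 0} \<subseteq> closure {x. f x \<noteq> 0}"
proof -
  show *: "closure {x. pderiv_at j f x \<noteq> 0} \<subseteq> closure {x. f x \<noteq> 0}"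
    by (rule closure_minimal) (use pderiv_at_eq_0_outside in auto)
  show "compact (closure {x. pderiv_at j f x \<noteq> 0})"
    using assms * by (meson bounded_subset closed_closure compact_eq_bounded_closed)
qed

section \<open>Integration by parts for compact supports\<close>

lemma C1_compact_support_Lipschitz:
  assumes C1: "Ck (Suc 0) f" and supp: "compact (closure {x. f x \<noteq> 0})"
  obtains L where "0 \<le> L" "\<forall>x y. \<bar>f x - f y\<bar> \<le> L * norm (x - y)"
proof -
  have cont: "continuous_on UNIV (pderiv_at j f)" for j using C1 by simp
  obtain B1 where B1: "0 \<le> B1" "\<forall>x. \<bar>pderiv_at 1 f x\<bar> \<le> B1"
    using continuous_compact_support_bounded[OF cont[of 1] compact_support_pderiv(1)[OF supp]] by blast
  obtain B2 where B2: "0 \<le> B2" "\<forall>x. \<bar>pderiv_at 2 f x\<bar> \<le> B2"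
    using continuous_compact_support_bounded[OF cont[of 2] compact_support_pderiv(1)[OF supp]] by blast
  let ?f' = "\<lambda>x (v::real^2). v$1 * pderiv_at 1 f x + v$2 * pderiv_at 2 f x"
  have "norm (f x - f y) \<le> (B1 + B2) * norm (x - y)" for x y
  proof (rule differentiable_bound[where S=UNIV and f'="?f'"])
    show "(f has_derivative ?f' x) (at x within UNIV)" for x
      using C1 has_derivative_pderiv by auto
    show "onorm (?f' x) \<le> B1 + B2" for x
    proof (rule onorm_bound)
      fix v :: "real^2"
      have "\<bar>v$1 * pderiv_at 1 f x\<bar> \<le> norm v * B1" "\<bar>v$2 * pderiv_at 2 f x\<bar> \<le> norm v * B2"
        unfolding abs_mult by (intro mult_mono component_le_norm_cart B1(2)[rule_format] B2(2)[rule_format]; simp)+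
      then show "norm (?f' x v) \<le> (B1 + B2) * norm v"
        using abs_triangle_ineq[of "v$1 * pderiv_at 1 f x" "v$2 * pderiv_at 2 f x"]
        by (simp add: algebra_simps)
    qed (use B1 B2 in simp)
  qed auto
  then show ?thesis using that[of "B1 + B2"] B1 B2 by simp
qed

lemma compact_support_radius:
  assumes "compact (closure {x. f x \<noteq> (0::real)})"
  obtains R where "\<forall>x. R < norm x \<longrightarrow> f x = 0"
proof -
  obtain R where R: "\<forall>x\<in>closure {x. f x \<noteq> 0}. norm x \<le> R"
    using compact_imp_bounded[OF assms] unfolding bounded_iff by blast
  have "f x = 0" if "R < norm x" for x
  proof (rule ccontr)
    assume "f x \<noteq> 0"
    then have "x \<in> closure {x. f x \<noteq> 0}" by (intro closure_subset[THEN subsetD]) simp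
    then show False using R that by force
  qed
  then show ?thesis using that[of R] by blast
qed

lemma integral_pderiv_eq_0:
  assumes C1: "Ck (Suc 0) f" and supp: "compact (closure {x. f x \<noteq> 0})"
  shows "integrable lebesgue (pderiv_at j f)" "(LINT x|lebesgue. pderiv_at j f x) = 0"
proof -
  obtain L where "0 \<le> L" and L: "\<forall>x y. \<bar>f x - f y\<bar> \<le> L * norm (x - y)"
    using C1_compact_support_Lipschitz[OF assms] by blast
  obtain R where R: "\<forall>x. R < norm x \<longrightarrow> f x = 0" using compact_support_radius[OF supp] by blast
  have "((\<lambda>t. (f (x + t *\<^sub>R axis j 1) - f x) / t) \<longlongrightarrow> pderiv_at j f x) (at 0)" for x
    unfolding pderiv_at_def
    by (rule has_derivative_imp_quotient_tendsto[OF frechet_derivative_works[THEN iffD1]])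
       (use C1 in simp)
  then have AE: "AE x in lebesgue.
      ((\<lambda>t. (f (x + t *\<^sub>R axis j 1) - f x) / t) \<longlongrightarrow> pderiv_at j f x) (at_right 0)"
    by (intro AE_I2) (rule filterlim_mono[OF _ order_refl at_le], auto)
  have meas: "pderiv_at j f \<in> borel_measurable lebesgue"
    using C1 by (intro continuous_imp_borel_measurable_lebesgue) auto
  show "integrable lebesgue (pderiv_at j f)"
    by (rule integral_directional_derivative_eq_0(1)[OF L[rule_format] R[rule_format] meas AE])
  show "(LINT x|lebesgue. pderiv_at j f x) = 0"
    by (rule integral_directional_derivative_eq_0(2)[OF L[rule_format] R[rule_format] meas AE])
qed

lemma continuous_compact_support_integrable:
  fixes f :: "real^2 \<Rightarrow> real"
  assumes "continuous_on UNIV f" "compact (closure {x. f x \<noteq> 0})"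
  shows "integrable lebesgue f" "integrable lborel f"
proof -
  have "(\<lambda>x. indicat_real (closure {x. f x \<noteq> 0}) x *\<^sub>R f x) = f"
    using closure_subset[of "{x. f x \<noteq> 0}"] by (auto simp: indicator_def fun_eq_iff)
  moreover have "integrable lborel (\<lambda>x. indicat_real (closure {x. f x \<noteq> 0}) x *\<^sub>R f x)"
    using borel_integrable_compact[OF assms(2) continuous_on_subset[OF assms(1)]]
    by (simp add: set_integrable_def)
  ultimately show "integrable lborel f" by simp
  then show "integrable lebesgue f"
    by (subst integrable_completion) (auto intro: borel_measurable_continuous_onI assms)
qed

lemma closure_support_mult:
  fixes f g :: "real^2 \<Rightarrow> real"
  shows "closure {x. f x * g x \<noteq> 0} \<subseteq> closure {x. g x \<noteq> 0}"
  by (intro closure_mono) auto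

lemma integral_by_parts:
  assumes "Ck (Suc 0) f" "Ck (Suc 0) g" "compact (closure {x. g x \<noteq> 0})"
  shows "(LINT x|lebesgue. f x * pderiv_at j g x) = - (LINT x|lebesgue. pderiv_at j f x * g x)"
proof -
  have supp: "compact (closure {x. f x * g x \<noteq> 0})"
    using closure_support_mult[of f g] assms(3)
    by (meson bounded_subset closed_closure compact_eq_bounded_closed)
  have *: "pderiv_at j (\<lambda>x. f x * g x) = (\<lambda>x. f x * pderiv_at j g x + pderiv_at j f x * g x)"
    using assms by (auto simp: pderiv_at_mult)
  have sub1: "closure {x. f x * pderiv_at j g x \<noteq> 0} \<subseteq> closure {x. g x \<noteq> 0}"
    using closure_support_mult[of f "pderiv_at j g"] compact_support_pderiv(2)[OF assms(3), of j] by blast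
  have sub2: "closure {x. pderiv_at j f x * g x \<noteq> 0} \<subseteq> closure {x. g x \<noteq> 0}"
    by (rule closure_support_mult)
  have c: "compact (closure {x. f x * pderiv_at j g x \<noteq> 0})"
      "compact (closure {x. pderiv_at j f x * g x \<noteq> 0})"
    using sub1 sub2 assms(3) by (meson bounded_subset closed_closure compact_eq_bounded_closed)+
  have "integrable lebesgue (\<lambda>x. f x * pderiv_at j g x)" "integrable lebesgue (\<lambda>x. pderiv_at j f x * g x)"
    using assms Ck_continuous[OF assms(1)] Ck_continuous[OF assms(2)]
    by (auto intro!: continuous_compact_support_integrable c continuous_intros)
  then show ?thesis
    using integral_pderiv_eq_0(2)[OF Ck_mult[OF assms(1,2)] supp, of j] unfolding * by simp
qed

section \<open>Smooth functions supported in a box\<close>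

definition decay :: "real poly \<Rightarrow> real \<Rightarrow> real" where
  "decay p x = (if 0 < x then poly p (1 / x) * exp (- (1 / x)) else 0)"

text \<open>The free power \<open>y ^ k\<close> carries the induction over the coefficients, since
  each \<open>pCons\<close> step contributes one further factor \<open>y\<close>.\<close>

lemma power_poly_exp_tendsto_0: "((\<lambda>y::real. y ^ k * poly p y / exp y) \<longlongrightarrow> 0) at_top"
proof (induction p arbitrary: k)
  case (pCons a p)
  have "((\<lambda>y::real. a * (y ^ k / exp y) + y ^ Suc k * poly p y / exp y) \<longlongrightarrow> a * 0 + 0) at_top"
    by (intro tendsto_add tendsto_mult tendsto_const tendsto_power_div_exp_0 pCons.IH)
  moreover have "(\<lambda>y. y ^ k * poly (pCons a p) y / exp y)
      = (\<lambda>y. a * (y ^ k / exp y) + y ^ Suc k * poly p y / exp y)"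
    by (rule ext) (simp add: distrib_left add_divide_distrib mult_ac)
  ultimately show ?case by simp
qed simp

text \<open>The polynomial factor closes the family of functions p(1/x) exp(-1/x) under
  differentiation: in y = 1/x the chain rule gives the factor -y^2 and the product rule p' - p. At 0
  the right difference quotient is y p(y) exp(-y), which tends to 0.\<close>

lemma decay_has_real_derivative:
  "(decay p has_real_derivative decay (monom 1 2 * (p - pderiv p)) x) (at x)"
proof -
  consider "x < 0" | "x = 0" | "0 < x" by linarith
  then show ?thesis
  proof cases
    case 1
    have "((\<lambda>x. 0) has_real_derivative 0) (at x)" by simp
    then have "(decay p has_real_derivative 0) (at x)"
      by (rule has_field_derivative_transform_within_open[where S="{..<0}"])
         (use 1 in \<open>auto simp: decay_def\<close>)
    then show ?thesis using 1 by (simp add: decay_def)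
  next
    case 3
    have "((\<lambda>x. poly p (1 / x) * exp (- (1 / x))) has_real_derivative
        decay (monom 1 2 * (p - pderiv p)) x) (at x)"
      using 3 by (auto intro!: derivative_eq_intros DERIV_chain'[OF _ poly_DERIV]
          simp: decay_def poly_monom field_simps power2_eq_square)
    then show ?thesis
      by (rule has_field_derivative_transform_within_open[where S="{0<..}"])
         (use 3 in \<open>auto simp: decay_def\<close>)
  next
    case 2
    have "((\<lambda>h. decay p h / h) \<longlongrightarrow> 0) (at_left 0)"
      by (rule tendsto_eventually) (auto simp: decay_def eventually_at_left_field intro: exI[of _ "-1"])
    moreover have "((\<lambda>h. decay p h / h) \<longlongrightarrow> 0) (at_right 0)"
      unfolding filterlim_at_right_to_top
    proof (rule Lim_transform_eventually[OF power_poly_exp_tendsto_0[of 1 p]])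
      show "\<forall>\<^sub>F y in at_top. y ^ 1 * poly p y / exp y = decay p (inverse y) / inverse y"
        using eventually_gt_at_top[of 0]
        by eventually_elim (simp add: decay_def field_simps exp_minus)
    qed
    ultimately have "((\<lambda>h. decay p h / h) \<longlongrightarrow> 0) (at 0)" by (rule filterlim_split_at)
    then show ?thesis using 2 by (simp add: has_field_derivative_iff decay_def)
  qed
qed

lemma decay_component_has_derivative:
  "((\<lambda>x::real^2. r * decay p (c * x$i + d)) has_derivative
    (\<lambda>v. r * (decay (monom 1 2 * (p - pderiv p)) (c * x$i + d) * (c * v$i)))) (at x)"
proof -
  have 1: "((\<lambda>x::real^2. c * x$i + d) has_derivative (\<lambda>v. c * v$i)) (at x)"
    by (auto intro!: derivative_eq_intros has_derivative_component)
  have "(decay p has_derivative (\<lambda>h. decay (monom 1 2 * (p - pderiv p)) (c * x$i + d) * h))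
      (at (c * x$i + d))"
    using decay_has_real_derivative by (simp add: has_field_derivative_def)
  from has_derivative_mult_right[OF diff_chain_at[OF 1 this], of r]
  show ?thesis by (simp add: o_def)
qed

text \<open>The scalar \<open>r\<close> absorbs the inner derivative \<open>c\<close>, so partial
  derivatives remain in the same class and the induction on \<open>k\<close> closes.\<close>

lemma Ck_decay: "Ck k (\<lambda>x::real^2. r * decay p (c * x$i + d))"
proof (induction k arbitrary: r p)
  case 0
  have "\<forall>x\<in>UNIV. isCont (\<lambda>x::real^2. r * decay p (c * x$i + d)) x"
    using has_derivative_continuous[OF decay_component_has_derivative] by blast
  then show ?case by (simp add: continuous_at_imp_continuous_on)
next
  case (Suc k)
  have "pderiv_at j (\<lambda>x::real^2. r * decay p (c * x$i + d))
      = (\<lambda>x. (if i = j then r * c else 0) * decay (monom 1 2 * (p - pderiv p)) (c * x$i + d))" for j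
    by (rule ext, rule pderiv_at_eqI[OF decay_component_has_derivative, THEN trans])
       (simp add: axis_def)
  moreover have "(\<lambda>x::real^2. r * decay p (c * x$i + d)) differentiable (at x)" for x
    using decay_component_has_derivative differentiable_def by blast
  ultimately show ?case using Suc.IH by simp
qed

lemma decay_1_bounds: "0 \<le> decay 1 y" "decay 1 y \<le> 1" "decay 1 y \<noteq> 0 \<longleftrightarrow> 0 < y"
  by (auto simp: decay_def)

text \<open>A product of one-sided cut-offs exp(-1/t), one for each side of the box. Larger
  \<open>n\<close> steepens the flanks without changing the support, so the bumps tend to the
  indicator of the open box.\<close>

definition bump :: "nat \<Rightarrow> real^2 \<Rightarrow> real^2 \<Rightarrow> real^2 \<Rightarrow> real" where
  "bump n a b x = (decay 1 (real (Suc n) * (x$1 - a$1)) * decay 1 (real (Suc n) * (b$1 - x$1)))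
     * (decay 1 (real (Suc n) * (x$2 - a$2)) * decay 1 (real (Suc n) * (b$2 - x$2)))"

lemma bump_Ck: "Ck k (bump n a b)"
proof -
  have 1: "Ck k (\<lambda>x. decay 1 (real (Suc n) * (x$i - c)))" for i c
    using Ck_decay[of k 1 1 "real (Suc n)" i "- (real (Suc n) * c)"]
    by (simp add: algebra_simps)
  have 2: "Ck k (\<lambda>x. decay 1 (real (Suc n) * (c - x$i)))" for i c
    using Ck_decay[of k 1 1 "- real (Suc n)" i "real (Suc n) * c"]
    by (simp add: algebra_simps)
  show ?thesis unfolding bump_def[abs_def] by (intro Ck_mult 1 2)
qed

lemma bump_support: "{x. bump n a b x \<noteq> 0} = box a b"
  by (auto simp: bump_def decay_1_bounds(3) mem_box_cart forall_2 zero_less_mult_iff)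

lemma bump_nonneg: "0 \<le> bump n a b x"
  and bump_le_1: "bump n a b x \<le> 1"
proof -
  show "0 \<le> bump n a b x" by (simp add: bump_def decay_1_bounds)
  show "bump n a b x \<le> 1" unfolding bump_def
    by (intro mult_le_one mult_nonneg_nonneg decay_1_bounds(1,2))
qed

lemma bump_test_function:
  assumes "cbox a b \<subseteq> \<Omega>"
  shows "bump n a b \<in> test_functions \<Omega>"
proof -
  have "closure (box a b) \<subseteq> cbox a b" by (intro closure_minimal box_subset_cbox closed_cbox)
  then show ?thesis
    using assms bounded_subset[OF bounded_cbox, of "closure (box a b)" a b]
    by (auto simp: test_functions_def bump_Ck bump_support compact_eq_bounded_closed)
qed

lemma bump_tendsto: "(\<lambda>n. bump n a b x) \<longlonglongrightarrow> indicat_real (box a b) x"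
proof (cases "x \<in> box a b")
  case True
  have lim: "(\<lambda>n. decay 1 (real (Suc n) * y)) \<longlonglongrightarrow> 1" if "0 < y" for y
  proof -
    have "(\<lambda>n. exp (- (1 / real (Suc n) * (1 / y)))) \<longlonglongrightarrow> exp (- (0 * (1 / y)))"
      by (intro tendsto_intros LIMSEQ_Suc[OF lim_1_over_n])
    then show ?thesis using that by (simp add: decay_def zero_less_mult_iff)
  qed
  have "(\<lambda>n. bump n a b x) \<longlonglongrightarrow> (1 * 1) * (1 * 1)"
    unfolding bump_def using True
    by (intro tendsto_mult lim) (auto simp: mem_box_cart)
  then show ?thesis using True by simp
next
  case False
  then have "bump n a b x = 0" for n using bump_support by blast
  then show ?thesis using False by simp
qed

lemma bump_continuous: "continuous_on UNIV (bump n a b)"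
  using bump_Ck[of 0] by simp

section \<open>Calculus of test functions\<close>

lemma test_function_Ck: "\<phi> \<in> test_functions \<Omega> \<Longrightarrow> Ck k \<phi>"
  and test_function_compact: "\<phi> \<in> test_functions \<Omega> \<Longrightarrow> compact (closure {x. \<phi> x \<noteq> 0})"
  and test_function_support: "\<phi> \<in> test_functions \<Omega> \<Longrightarrow> closure {x. \<phi> x \<noteq> 0} \<subseteq> \<Omega>"
  by (auto simp: test_functions_def)

lemma test_function_outside: "\<phi> \<in> test_functions \<Omega> \<Longrightarrow> x \<notin> \<Omega> \<Longrightarrow> \<phi> x = 0"
  using test_function_support[of \<phi> \<Omega>] closure_subset[of "{x. \<phi> x \<noteq> 0}"] by blast

lemma test_function_continuous: "\<phi> \<in> test_functions \<Omega> \<Longrightarrow> continuous_on UNIV \<phi>"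
  using test_function_Ck[of \<phi> \<Omega> 0] by simp

lemma test_function_differentiable: "\<phi> \<in> test_functions \<Omega> \<Longrightarrow> \<phi> differentiable (at x)"
  using test_function_Ck[of \<phi> \<Omega> "Suc 0"] by simp

lemma test_function_pderiv:
  assumes "\<phi> \<in> test_functions \<Omega>"
  shows "pderiv_at j \<phi> \<in> test_functions \<Omega>"
proof -
  have "Ck k (pderiv_at j \<phi>)" for k using test_function_Ck[OF assms, of "Suc k"] by simp
  then show ?thesis
    using compact_support_pderiv[OF test_function_compact[OF assms], of j] test_function_support[OF assms]
    unfolding test_functions_def by blast
qed

lemma test_function_add:
  assumes "\<phi> \<in> test_functions \<Omega>" "\<psi> \<in> test_functions \<Omega>"
  shows "(\<lambda>x. \<phi> x + \<psi> x) \<in> test_functions \<Omega>"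
proof -
  have sub: "closure {x. \<phi> x + \<psi> x \<noteq> 0} \<subseteq> closure {x. \<phi> x \<noteq> 0} \<union> closure {x. \<psi> x \<noteq> 0}"
    unfolding closure_Un[symmetric] by (intro closure_mono) auto
  have "compact (closure {x. \<phi> x \<noteq> 0} \<union> closure {x. \<psi> x \<noteq> 0})"
    using assms by (intro compact_Un test_function_compact)
  then have "compact (closure {x. \<phi> x + \<psi> x \<noteq> 0})"
    using sub by (meson bounded_subset closed_closure compact_eq_bounded_closed)
  then show ?thesis
    using sub test_function_support[OF assms(1)] test_function_support[OF assms(2)]
      Ck_add[OF test_function_Ck[OF assms(1)] test_function_Ck[OF assms(2)]]
    unfolding test_functions_def by blast
qed

lemma test_function_scale:
  assumes "\<phi> \<in> test_functions \<Omega>"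
  shows "(\<lambda>x. c * \<phi> x) \<in> test_functions \<Omega>"
proof -
  have sub: "closure {x. c * \<phi> x \<noteq> 0} \<subseteq> closure {x. \<phi> x \<noteq> 0}"
    by (intro closure_mono) auto
  then have "compact (closure {x. c * \<phi> x \<noteq> 0})"
    using test_function_compact[OF assms] by (meson bounded_subset closed_closure compact_eq_bounded_closed)
  then show ?thesis
    using sub test_function_support[OF assms] Ck_mult[OF Ck_const test_function_Ck[OF assms]]
    unfolding test_functions_def by blast
qed

lemma test_function_zero: "(\<lambda>x. 0) \<in> test_functions \<Omega>"
  by (simp add: test_functions_def Ck_const)

lemma test_function_diff:
  assumes "\<phi> \<in> test_functions \<Omega>" "\<psi> \<in> test_functions \<Omega>"
  shows "(\<lambda>x. \<phi> x - \<psi> x) \<in> test_functions \<Omega>"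
  using test_function_add[OF assms(1) test_function_scale[OF assms(2), of "-1"]] by simp

lemma pderiv_at_add_test:
  assumes "\<phi> \<in> test_functions \<Omega>" "\<psi> \<in> test_functions \<Omega>"
  shows "pderiv_at j (\<lambda>x. \<phi> x + \<psi> x) = (\<lambda>x. pderiv_at j \<phi> x + pderiv_at j \<psi> x)"
  by (rule ext, rule pderiv_at_add)
     (rule test_function_differentiable[OF assms(1)], rule test_function_differentiable[OF assms(2)])

lemma pderiv_at_scale_test:
  assumes "\<phi> \<in> test_functions \<Omega>"
  shows "pderiv_at j (\<lambda>x. c * \<phi> x) = (\<lambda>x. c * pderiv_at j \<phi> x)"
proof
  fix x
  show "pderiv_at j (\<lambda>x. c * \<phi> x) x = c * pderiv_at j \<phi> x"
    using pderiv_at_mult[of "\<lambda>x. c" x \<phi> j] test_function_differentiable[OF assms]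
      pderiv_at_eqI[OF has_derivative_const, of j c x] by simp
qed

lemma test_function_bounded:
  assumes "\<phi> \<in> test_functions \<Omega>"
  obtains B where "0 \<le> B" "\<forall>x. \<bar>\<phi> x\<bar> \<le> B"
  using continuous_compact_support_bounded[OF test_function_continuous[OF assms] test_function_compact[OF assms]]
  by blast

lemma test_function_Lipschitz:
  assumes "\<phi> \<in> test_functions \<Omega>"
  obtains L where "0 \<le> L" "\<forall>x y. \<bar>\<phi> x - \<phi> y\<bar> \<le> L * norm (x - y)"
  using C1_compact_support_Lipschitz[OF test_function_Ck[OF assms] test_function_compact[OF assms]]
  by blast

lemma test_function_L2:
  assumes "open \<Omega>" "bounded \<Omega>" "\<phi> \<in> test_functions \<Omega>'"
  shows "\<phi> \<in> L2 \<Omega>"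
proof -
  obtain B where "0 \<le> B" "\<forall>x. \<bar>\<phi> x\<bar> \<le> B" using test_function_bounded[OF assms(3)] by blast
  moreover have "\<phi> \<in> borel_measurable (lebesgue_on \<Omega>)"
    by (intro measurable_restrict_space1 continuous_imp_borel_measurable_lebesgue
        test_function_continuous[OF assms(3)])
  ultimately show ?thesis by (intro L2_bounded[OF assms(1,2), of _ B]) auto
qed

lemma integral_lebesgue_on_eq:
  fixes f :: "real^2 \<Rightarrow> real"
  assumes "open \<Omega>" "\<And>x. x \<notin> \<Omega> \<Longrightarrow> f x = 0"
  shows "(LINT x|lebesgue_on \<Omega>. f x) = (LINT x|lebesgue. f x)"
proof -
  have "(LINT x|lebesgue_on \<Omega>. f x) = (LINT x|lebesgue. indicat_real \<Omega> x *\<^sub>R f x)"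
    by (rule integral_restrict_space) (use assms(1) in simp)
  also have "\<dots> = (LINT x|lebesgue. f x)"
    by (rule Bochner_Integration.integral_cong) (use assms(2) in \<open>auto simp: indicator_def\<close>)
  finally show ?thesis .
qed

lemma L2_inner_test:
  assumes "open \<Omega>" "\<phi> \<in> test_functions \<Omega>"
  shows "L2_inner \<Omega> u \<phi> = (LINT x|lebesgue. u x * \<phi> x)"
  unfolding L2_inner_def
  by (rule integral_lebesgue_on_eq[OF assms(1)]) (simp add: test_function_outside[OF assms(2)])

text \<open>The partial derivatives are again test functions and hence Lipschitz, which makes the
  Taylor remainder quadratic uniformly in \<open>x\<close>. This uniformity is what allows a
  convolution with \<phi> to be differentiated.\<close>

lemma test_function_second_order:
  assumes "\<phi> \<in> test_functions \<Omega>"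
  obtains K where "0 \<le> K" "\<forall>x v. \<bar>\<phi> (x + v) - \<phi> x - (v$1 * pderiv_at 1 \<phi> x + v$2 * pderiv_at 2 \<phi> x)\<bar>
     \<le> K * (norm v)\<^sup>2"
proof -
  obtain L1 where L1: "0 \<le> L1" "\<forall>x y. \<bar>pderiv_at 1 \<phi> x - pderiv_at 1 \<phi> y\<bar> \<le> L1 * norm (x - y)"
    using test_function_Lipschitz[OF test_function_pderiv[OF assms, of 1]] by blast
  obtain L2 where L2: "0 \<le> L2" "\<forall>x y. \<bar>pderiv_at 2 \<phi> x - pderiv_at 2 \<phi> y\<bar> \<le> L2 * norm (x - y)"
    using test_function_Lipschitz[OF test_function_pderiv[OF assms, of 2]] by blast
  let ?D = "\<lambda>x (v::real^2). v$1 * pderiv_at 1 \<phi> x + v$2 * pderiv_at 2 \<phi> x"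
  have "\<bar>\<phi> (x + v) - \<phi> x - ?D x v\<bar> \<le> (L1 + L2) * (norm v)\<^sup>2" for x v
  proof -
    have "norm (\<phi> (x + v) - \<phi> x - ?D x ((x + v) - x)) \<le> norm ((x + v) - x) * ((L1 + L2) * norm v)"
    proof (rule differentiable_bound_linearization[where S="cball x (norm v)" and f'="?D"])
      show "x + t *\<^sub>R (x + v - x) \<in> cball x (norm v)" if "t \<in> {0..1}" for t
      proof -
        have "norm (t *\<^sub>R v) \<le> norm v" using that by (simp add: mult_left_le_one_le)
        then show ?thesis by (simp add: dist_norm)
      qed
      show "(\<phi> has_derivative ?D y) (at y within cball x (norm v))" for y
        by (rule has_derivative_at_withinI[OF has_derivative_pderiv[OF test_function_differentiable[OF assms]]])
      show "onorm (?D y - ?D x) \<le> (L1 + L2) * norm v" if y: "y \<in> cball x (norm v)" for y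
      proof (rule onorm_bound)
        fix w :: "real^2"
        have ny: "norm (y - x) \<le> norm v" using y by (simp add: dist_norm norm_minus_commute)
        have b1: "\<bar>pderiv_at 1 \<phi> y - pderiv_at 1 \<phi> x\<bar> \<le> L1 * norm v"
          using L1(2)[rule_format, of y x] mult_left_mono[OF ny L1(1)] by linarith
        have b2: "\<bar>pderiv_at 2 \<phi> y - pderiv_at 2 \<phi> x\<bar> \<le> L2 * norm v"
          using L2(2)[rule_format, of y x] mult_left_mono[OF ny L2(1)] by linarith
        have "\<bar>w$1 * (pderiv_at 1 \<phi> y - pderiv_at 1 \<phi> x)\<bar> \<le> norm w * (L1 * norm v)"
          unfolding abs_mult by (rule mult_mono[OF component_le_norm_cart b1]) auto
        moreover have "\<bar>w$2 * (pderiv_at 2 \<phi> y - pderiv_at 2 \<phi> x)\<bar> \<le> norm w * (L2 * norm v)"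
          unfolding abs_mult by (rule mult_mono[OF component_le_norm_cart b2]) auto
        moreover have "(?D y - ?D x) w = w$1 * (pderiv_at 1 \<phi> y - pderiv_at 1 \<phi> x)
            + w$2 * (pderiv_at 2 \<phi> y - pderiv_at 2 \<phi> x)"
          by (simp add: algebra_simps)
        moreover have "norm w * (L1 * norm v) + norm w * (L2 * norm v) = (L1 + L2) * norm v * norm w"
          by (simp add: algebra_simps)
        ultimately show "norm ((?D y - ?D x) w) \<le> (L1 + L2) * norm v * norm w"
          unfolding real_norm_def by linarith
      qed (use L1 L2 in simp)
    qed auto
    then show ?thesis by (simp add: power2_eq_square mult_ac)
  qed
  then show ?thesis using that[of "L1 + L2"] L1(1) L2(1) by simp
qed

text \<open>Discretising one of the derivatives avoids the symmetry of second derivatives.\<close>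

lemma integral_pderiv_swap:
  assumes a: "a \<in> test_functions \<Omega>" and b: "b \<in> test_functions \<Omega>"
  shows "(LINT x|lebesgue. pderiv_at i a x * pderiv_at j b x)
       = (LINT x|lebesgue. pderiv_at j a x * pderiv_at i b x)"
proof -
  define t where "t n = 1 / real (Suc n)" for n
  have t: "0 < t n" for n by (auto simp: t_def)
  have t0: "t \<longlonglongrightarrow> 0" unfolding t_def by (rule LIMSEQ_Suc[OF lim_1_over_n])
  let ?e = "axis j (1::real) :: real^2"
  \<comment> \<open>Both signs occur: moving the difference quotient from one factor to the other
    reverses the direction of the step.\<close>
  have quot: "(\<lambda>n. LINT x|lebesgue. p x * ((c (x + (s * t n) *\<^sub>R ?e) - c x) / (s * t n)))
      \<longlonglongrightarrow> (LINT x|lebesgue. p x * pderiv_at j c x)"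
    if p: "p \<in> test_functions \<Omega>" and c: "c \<in> test_functions \<Omega>" and s: "s = 1 \<or> s = -1" for p c s
  proof -
    obtain L where L: "0 \<le> L" "\<forall>x y. \<bar>c x - c y\<bar> \<le> L * norm (x - y)"
      using test_function_Lipschitz[OF c] by blast
    have pc: "continuous_on UNIV p" and cc: "continuous_on UNIV c"
      using p c by (auto intro: test_function_continuous)
    have st: "filterlim (\<lambda>n. s * t n) (at 0) sequentially"
    proof (rule filterlim_atI)
      show "(\<lambda>n. s * t n) \<longlonglongrightarrow> 0" using tendsto_mult_right_zero[OF t0] by simp
      show "\<forall>\<^sub>F n in sequentially. s * t n \<noteq> 0" using s t by (auto simp: less_imp_neq[THEN not_sym])
    qed
    have lim: "(\<lambda>n. (c (x + (s * t n) *\<^sub>R ?e) - c x) / (s * t n)) \<longlonglongrightarrow> pderiv_at j c x" for x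
      unfolding pderiv_at_def
      by (rule filterlim_compose[OF has_derivative_imp_quotient_tendsto[OF
            frechet_derivative_works[THEN iffD1, OF test_function_differentiable[OF c]]] st])
    show ?thesis
    proof (rule integral_dominated_convergence[where w="\<lambda>x. \<bar>p x\<bar> * L"])
      show "(\<lambda>x. p x * pderiv_at j c x) \<in> borel_measurable lebesgue"
        by (intro continuous_imp_borel_measurable_lebesgue continuous_intros pc
            test_function_continuous[OF test_function_pderiv[OF c]])
      show "(\<lambda>x. p x * ((c (x + (s * t n) *\<^sub>R ?e) - c x) / (s * t n))) \<in> borel_measurable lebesgue" for n
        unfolding divide_inverse
        by (intro continuous_imp_borel_measurable_lebesgue continuous_intros pc
            continuous_on_compose2[OF cc]) auto
      show "integrable lebesgue (\<lambda>x. \<bar>p x\<bar> * L)"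
        using continuous_compact_support_integrable(1)[OF pc test_function_compact[OF p]] by simp
      show "AE x in lebesgue. (\<lambda>n. p x * ((c (x + (s * t n) *\<^sub>R ?e) - c x) / (s * t n)))
          \<longlonglongrightarrow> p x * pderiv_at j c x"
        by (intro AE_I2 tendsto_mult tendsto_const lim)
      show "AE x in lebesgue. norm (p x * ((c (x + (s * t n) *\<^sub>R ?e) - c x) / (s * t n))) \<le> \<bar>p x\<bar> * L" for n
      proof (intro AE_I2)
        fix x
        have st: "\<bar>s * t n\<bar> > 0" "\<bar>s * t n\<bar> = t n" using s t[of n] by (auto simp: abs_mult)
        have "\<bar>c (x + (s * t n) *\<^sub>R ?e) - c x\<bar> \<le> L * t n"
          using L(2)[rule_format, of "x + (s * t n) *\<^sub>R ?e" x] st by simp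
        then have "\<bar>(c (x + (s * t n) *\<^sub>R ?e) - c x) / (s * t n)\<bar> \<le> L"
          using st t[of n] unfolding abs_divide by (simp add: field_simps)
        then show "norm (p x * ((c (x + (s * t n) *\<^sub>R ?e) - c x) / (s * t n))) \<le> \<bar>p x\<bar> * L"
          unfolding real_norm_def abs_mult[of "p x"] by (intro mult_left_mono) auto
      qed
    qed
  qed
  \<comment> \<open>Summation by parts. Integrating by parts in direction \<open>i\<close> involves
    first derivatives only; a translation then moves the increment in direction \<open>j\<close>
    from \<open>b\<close> to \<open>a\<close>.\<close>
  have eq: "(LINT x|lebesgue. pderiv_at i a x * ((b (x + (1 * t n) *\<^sub>R ?e) - b x) / (1 * t n)))
      = (LINT x|lebesgue. pderiv_at i b x * ((a (x + (-1 * t n) *\<^sub>R ?e) - a x) / (-1 * t n)))" for n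
  proof -
    let ?v = "t n *\<^sub>R ?e"
    note ac = test_function_continuous[OF a] and bc = test_function_continuous[OF b]
    note pac = test_function_continuous[OF test_function_pderiv[OF a, of i]]
      and pbc = test_function_continuous[OF test_function_pderiv[OF b, of i]]
    have bv: "(\<lambda>x. b (x + ?v)) differentiable (at x)" for x
      using differentiable_chain_at[of "\<lambda>x. x + ?v" x b] test_function_differentiable[OF b]
      by (simp add: o_def)
    have pbv: "pderiv_at k (\<lambda>x. b (x + ?v)) = (\<lambda>x. pderiv_at k b (x + ?v))" for k
    proof
      fix x
      have "((\<lambda>x. x + ?v) has_derivative (\<lambda>h. h)) (at x)" by (auto intro!: derivative_eq_intros)
      from diff_chain_at[OF this frechet_derivative_works[THEN iffD1, OF test_function_differentiable[OF b]]]
      show "pderiv_at k (\<lambda>x. b (x + ?v)) x = pderiv_at k b (x + ?v)"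
        by (subst pderiv_at_eqI) (auto simp: o_def pderiv_at_def)
    qed
    have bv1: "Ck (Suc 0) (\<lambda>x. b (x + ?v))"
      using bv pbv by (auto intro!: continuous_on_compose2[OF test_function_continuous[OF test_function_pderiv[OF b]]] continuous_intros)
    have cmp: "compact (closure {x. a x \<noteq> 0})" by (rule test_function_compact[OF a])
    have ibp1: "(LINT x|lebesgue. b (x + ?v) * pderiv_at i a x) = - (LINT x|lebesgue. pderiv_at i b (x + ?v) * a x)"
      using integral_by_parts[OF bv1 test_function_Ck[OF a] cmp, of i] unfolding pbv .
    have ibp2: "(LINT x|lebesgue. b x * pderiv_at i a x) = - (LINT x|lebesgue. pderiv_at i b x * a x)"
      by (rule integral_by_parts[OF test_function_Ck[OF b] test_function_Ck[OF a] cmp])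
    have csub: "compact (closure {x. f x * g x \<noteq> 0})" if "compact (closure {x. g x \<noteq> 0})" for f g :: "real^2 \<Rightarrow> real"
      using closure_support_mult[of f g] that by (meson bounded_subset closed_closure compact_eq_bounded_closed)
    have cmp': "compact (closure {x. pderiv_at i a x \<noteq> 0})"
      by (rule test_function_compact[OF test_function_pderiv[OF a]])
    have bvc: "continuous_on UNIV (\<lambda>x. b (x + ?v))"
      by (intro continuous_on_compose2[OF bc] continuous_intros) auto
    have avc: "continuous_on UNIV (\<lambda>x. a (x - ?v))"
      by (intro continuous_on_compose2[OF ac] continuous_intros) auto
    have pbvc: "continuous_on UNIV (\<lambda>x. pderiv_at i b (x + ?v))"
      by (intro continuous_on_compose2[OF pbc] continuous_intros) auto
    have int1: "integrable lebesgue (\<lambda>x. b (x + ?v) * pderiv_at i a x)"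
      by (intro continuous_compact_support_integrable csub cmp' continuous_intros bvc pac)
    have int2: "integrable lebesgue (\<lambda>x. b x * pderiv_at i a x)"
      by (intro continuous_compact_support_integrable csub cmp' continuous_intros bc pac)
    have cmpb: "compact (closure {x. pderiv_at i b x \<noteq> 0})"
      by (rule test_function_compact[OF test_function_pderiv[OF b]])
    have int3: "integrable lebesgue (\<lambda>x. a (x - ?v) * pderiv_at i b x)"
      by (intro continuous_compact_support_integrable csub cmpb continuous_intros avc pbc)
    have int4: "integrable lebesgue (\<lambda>x. a x * pderiv_at i b x)"
      by (intro continuous_compact_support_integrable csub cmpb continuous_intros ac pbc)
    have shift: "(LINT x|lebesgue. pderiv_at i b (x + ?v) * a x) = (LINT x|lebesgue. a (x - ?v) * pderiv_at i b x)"
    proof -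
      have m: "(\<lambda>x. a (x - ?v) * pderiv_at i b x) \<in> borel_measurable borel"
        by (intro borel_measurable_continuous_onI continuous_intros avc pbc)
      have m': "(\<lambda>x. pderiv_at i b (x + ?v) * a x) \<in> borel_measurable borel"
        by (intro borel_measurable_continuous_onI continuous_intros ac pbvc)
      show ?thesis
        using lborel_integral_translation[OF m, of ?v] m m'
        by (simp add: integral_completion mult.commute)
    qed
    have "(LINT x|lebesgue. pderiv_at i a x * ((b (x + (1 * t n) *\<^sub>R ?e) - b x) / (1 * t n)))
        = (LINT x|lebesgue. (b (x + ?v) * pderiv_at i a x - b x * pderiv_at i a x) / t n)"
      by (intro Bochner_Integration.integral_cong) (auto simp: algebra_simps diff_divide_distrib)
    also have "\<dots> = ((LINT x|lebesgue. b (x + ?v) * pderiv_at i a x) - (LINT x|lebesgue. b x * pderiv_at i a x)) / t n"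
      using int1 int2 by simp
    also have "\<dots> = ((LINT x|lebesgue. a x * pderiv_at i b x) - (LINT x|lebesgue. a (x - ?v) * pderiv_at i b x)) / t n"
      unfolding ibp1 ibp2 shift by (simp add: mult.commute)
    also have "\<dots> = (LINT x|lebesgue. (a x * pderiv_at i b x - a (x - ?v) * pderiv_at i b x) / t n)"
      using int3 int4 by simp
    also have "\<dots> = (LINT x|lebesgue. pderiv_at i b x * ((a (x + (-1 * t n) *\<^sub>R ?e) - a x) / (-1 * t n)))"
      by (intro Bochner_Integration.integral_cong) (auto simp: algebra_simps diff_divide_distrib)
    finally show ?thesis .
  qed
  have "(\<lambda>n. LINT x|lebesgue. pderiv_at i a x * ((b (x + (1 * t n) *\<^sub>R ?e) - b x) / (1 * t n)))
      \<longlonglongrightarrow> (LINT x|lebesgue. pderiv_at i a x * pderiv_at j b x)"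
    by (rule quot[OF test_function_pderiv[OF a] b]) simp
  moreover have "(\<lambda>n. LINT x|lebesgue. pderiv_at i b x * ((a (x + (-1 * t n) *\<^sub>R ?e) - a x) / (-1 * t n)))
      \<longlonglongrightarrow> (LINT x|lebesgue. pderiv_at i b x * pderiv_at j a x)"
    by (rule quot[OF test_function_pderiv[OF b] a]) simp
  ultimately show ?thesis
    unfolding eq by (simp add: LIMSEQ_unique mult.commute)
qed

section \<open>The fundamental lemma and density of test functions\<close>

text \<open>The positive and the negative part are densities of two measures that are finite and
  equal on boxes. Boxes form an intersection-stable generator, so the measures coincide, and with
  them the densities almost everywhere.\<close>

lemma AE_eq_0_if_box_integrals_0:
  fixes w :: "'a::euclidean_space \<Rightarrow> real"
  assumes int: "integrable lborel w"
    and zero: "\<And>c d. (LINT x|lborel. indicat_real (box c d) x * w x) = 0"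
  shows "AE x in lborel. w x = 0"
proof -
  have [measurable]: "w \<in> borel_measurable borel" using int by auto
  let ?P = "\<lambda>x. max 0 (w x)" and ?N = "\<lambda>x. max 0 (- w x)"
  have emb: "emeasure (density lborel (\<lambda>x. ennreal (f x))) X = ennreal (LINT x|lborel. indicat_real X x * f x)"
    if f: "integrable lborel f" "\<And>x. 0 \<le> f x" and X: "X \<in> sets borel" for f X
  proof -
    have [measurable]: "f \<in> borel_measurable borel" using f(1) by auto
    have "emeasure (density lborel (\<lambda>x. ennreal (f x))) X = (\<integral>\<^sup>+x. ennreal (f x) * indicator X x \<partial>lborel)"
      using X by (subst emeasure_density) auto
    also have "\<dots> = (\<integral>\<^sup>+x. ennreal (indicat_real X x * f x) \<partial>lborel)"
      by (intro nn_integral_cong) (auto simp: indicator_def)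
    also have "\<dots> = ennreal (LINT x|lborel. indicat_real X x * f x)"
      using integrable_mult_indicator[of X lborel f] f X
      by (intro nn_integral_eq_integral) auto
    finally show ?thesis .
  qed
  have P: "integrable lborel ?P" and N: "integrable lborel ?N" using int by auto
  have "density lborel (\<lambda>x. ennreal (?P x)) = density lborel (\<lambda>x. ennreal (?N x))"
  proof (rule measure_eqI_generator_eq)
    let ?E = "range (\<lambda>(a, b). box a b::'a set)"
    show "Int_stable ?E" by (auto simp: Int_stable_def box_Int_box)
    show "?E \<subseteq> Pow UNIV" "sets (density lborel (\<lambda>x. ennreal (?P x))) = sigma_sets UNIV ?E"
      "sets (density lborel (\<lambda>x. ennreal (?N x))) = sigma_sets UNIV ?E"
      by (simp_all add: borel_eq_box)
    let ?A = "\<lambda>n::nat. box (- (real n *\<^sub>R One)) (real n *\<^sub>R One) :: 'a set"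
    show "range ?A \<subseteq> ?E" "(\<Union>i. ?A i) = UNIV"
      unfolding UN_box_eq_UNIV by auto
    show "emeasure (density lborel (\<lambda>x. ennreal (?P x))) (?A i) \<noteq> \<infinity>" for i
      by (subst emb[OF P]) auto
    show "emeasure (density lborel (\<lambda>x. ennreal (?P x))) X = emeasure (density lborel (\<lambda>x. ennreal (?N x))) X"
      if "X \<in> ?E" for X
    proof -
      obtain c d where X: "X = box c d" using \<open>X \<in> ?E\<close> by auto
      have "(LINT x|lborel. indicat_real X x * ?P x) - (LINT x|lborel. indicat_real X x * ?N x)
          = (LINT x|lborel. indicat_real X x * ?P x - indicat_real X x * ?N x)"
        using integrable_mult_indicator[of X lborel ?P] integrable_mult_indicator[of X lborel ?N] P N X
        by (intro Bochner_Integration.integral_diff[symmetric]) auto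
      also have "\<dots> = (LINT x|lborel. indicat_real X x * w x)"
        by (intro Bochner_Integration.integral_cong) (auto simp: max_def)
      also have "\<dots> = 0" unfolding X by (rule zero)
      finally show ?thesis using emb[OF P, of X] emb[OF N, of X] X by simp
    qed
  qed
  then have "AE x in lborel. ennreal (?P x) = ennreal (?N x)"
    by (intro sigma_finite_measure.density_unique[OF sigma_finite_lborel]) auto
  then show ?thesis by eventually_elim (auto simp: max_def split: if_splits)
qed

text \<open>Bump functions approximate indicators of boxes whose closure lies in \<Omega>, so all
  integrals over such boxes vanish by dominated convergence. The exceptional set is then locally
  negligible, hence negligible.\<close>

lemma fundamental_lemma:
  assumes \<Omega>: "open \<Omega>" and int: "integrable (lebesgue_on \<Omega>) u"
    and zero: "\<And>\<phi>. \<phi> \<in> test_functions \<Omega> \<Longrightarrow> L2_inner \<Omega> u \<phi> = 0"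
  shows "AE x in lebesgue_on \<Omega>. u x = 0"
proof -
  define u0 where "u0 x = indicat_real \<Omega> x * u x" for x
  have u0: "integrable lebesgue u0"
    using int \<Omega> by (simp add: integrable_restrict_space u0_def[abs_def])
  obtain u' where u': "u' \<in> borel_measurable lborel" "AE x in lborel. u0 x = u' x"
    using completion_ex_borel_measurable_real[of u0 lborel] u0 by auto
  have u'_AE: "AE x in lebesgue. u' x = u0 x"
    using AE_completion[OF u'(2)] by eventually_elim simp
  have [measurable]: "u' \<in> borel_measurable borel" using u' by simp
  have u'_meas: "u' \<in> borel_measurable lebesgue" using u'(1) by (rule measurable_completion)
  have u'_int: "integrable lborel u'"
  proof -
    have "integrable lebesgue u'"
      by (rule integrable_cong_AE_imp[OF u0 u'_meas]) (use u'_AE in auto)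
    then show ?thesis by (subst (asm) integrable_completion) auto
  qed
  \<comment> \<open>The first alternative is there because these boxes arise as intersections of two
    boxes, which may be empty.\<close>
  have box0: "(LINT x|lborel. indicat_real (box e f) x * u' x) = 0" if ef: "box e f = {} \<or> cbox e f \<subseteq> \<Omega>" for e f
  proof (cases "box e f = {}")
    case False
    then have sub: "cbox e f \<subseteq> \<Omega>" using ef by blast
    have m: "(\<lambda>x. indicat_real (box e f) x * u' x) \<in> borel_measurable borel" by simp
    have "(\<lambda>n. LINT x|lebesgue. bump n e f x * u0 x) \<longlonglongrightarrow> (LINT x|lebesgue. indicat_real (box e f) x * u' x)"
    proof (rule integral_dominated_convergence[where w="\<lambda>x. \<bar>u0 x\<bar>"])
      show "(\<lambda>x. indicat_real (box e f) x * u' x) \<in> borel_measurable lebesgue"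
        by (rule measurable_completion) simp
      show "(\<lambda>x. bump n e f x * u0 x) \<in> borel_measurable lebesgue" for n
        by (intro borel_measurable_times[OF continuous_imp_borel_measurable_lebesgue[OF bump_continuous]])
           (rule borel_measurable_integrable[OF u0])
      show "integrable lebesgue (\<lambda>x. \<bar>u0 x\<bar>)" using u0 by simp
      show "AE x in lebesgue. (\<lambda>n. bump n e f x * u0 x) \<longlonglongrightarrow> indicat_real (box e f) x * u' x"
        using u'_AE by eventually_elim (auto intro!: tendsto_mult bump_tendsto)
      show "AE x in lebesgue. norm (bump n e f x * u0 x) \<le> \<bar>u0 x\<bar>" for n
        by (intro AE_I2) (simp add: abs_mult bump_nonneg bump_le_1 mult_left_le_one_le)
    qed
    moreover have "(LINT x|lebesgue. bump n e f x * u0 x) = 0" for n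
    proof -
      have \<phi>: "bump n e f \<in> test_functions \<Omega>" by (rule bump_test_function[OF sub])
      have "(LINT x|lebesgue. bump n e f x * u0 x) = (LINT x|lebesgue. u x * bump n e f x)"
        by (intro Bochner_Integration.integral_cong)
           (auto simp: u0_def indicator_def test_function_outside[OF \<phi>])
      then show ?thesis using zero[OF \<phi>] L2_inner_test[OF \<Omega> \<phi>] by simp
    qed
    ultimately have "(LINT x|lebesgue. indicat_real (box e f) x * u' x) = 0"
      by (simp add: LIMSEQ_const_iff)
    then show ?thesis using integral_completion[OF m[folded measurable_lborel2]] by simp
  qed simp
  \<comment> \<open>Cutting off at one box with closure in \<Omega> gives a function on the whole
    plane, to which the measure-theoretic lemma on all boxes applies.\<close>
  have neg: "negligible {x \<in> box a b. u0 x \<noteq> 0}" if ab: "cbox a b \<subseteq> \<Omega>" for a b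
  proof -
    have "AE x in lborel. indicat_real (box a b) x * u' x = 0"
    proof (rule AE_eq_0_if_box_integrals_0)
      show "integrable lborel (\<lambda>x. indicat_real (box a b) x * u' x)"
        using integrable_mult_indicator[of "box a b" lborel u'] u'_int by simp
      fix c d
      obtain e f where ef: "box c d \<inter> box a b = box e f" unfolding box_Int_box by blast
      have "box e f = {} \<or> cbox e f \<subseteq> \<Omega>"
      proof (cases "box e f = {}")
        case False
        have "closure (box e f) \<subseteq> cbox a b"
          unfolding ef[symmetric] by (intro closure_minimal closed_cbox) (use box_subset_cbox[of a b] in auto)
        then show ?thesis using False ab by (simp add: closure_box)
      qed simp
      then have "(LINT x|lborel. indicat_real (box e f) x * u' x) = 0" by (rule box0)
      moreover have "(\<lambda>x. indicat_real (box c d) x * (indicat_real (box a b) x * u' x))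
          = (\<lambda>x. indicat_real (box e f) x * u' x)"
        unfolding ef[symmetric] by (simp add: indicator_inter_arith mult.assoc)
      ultimately show "(LINT x|lborel. indicat_real (box c d) x * (indicat_real (box a b) x * u' x)) = 0"
        by simp
    qed
    then have "AE x in lborel. x \<in> box a b \<longrightarrow> u0 x = 0"
      using u'(2) by eventually_elim (auto simp: indicator_def split: if_splits)
    then have "AE x in lebesgue. x \<in> box a b \<longrightarrow> u0 x = 0" by (rule AE_completion)
    then obtain N where N: "negligible N" "{x. \<not> (x \<in> box a b \<longrightarrow> u0 x = 0)} \<subseteq> N"
      unfolding eventually_ae_filter_negligible by blast
    have eq: "{x \<in> box a b. u0 x \<noteq> 0} = {x. \<not> (x \<in> box a b \<longrightarrow> u0 x = 0)}" by blast
    show ?thesis unfolding eq by (rule negligible_subset[OF N])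
  qed
  have "negligible {x \<in> \<Omega>. u x \<noteq> 0}"
  proof (rule locally_negligible_alt[THEN iffD2], rule ballI)
    fix x assume x: "x \<in> {x \<in> \<Omega>. u x \<noteq> 0}"
    then obtain a b where ab: "cbox a b \<subseteq> \<Omega>" "x \<in> box a b"
      using open_contains_cbox[OF \<Omega>, of x] by (metis (no_types, lifting) mem_Collect_eq)
    have "openin (top_of_set {x \<in> \<Omega>. u x \<noteq> 0}) ({x \<in> \<Omega>. u x \<noteq> 0} \<inter> box a b)"
      by (intro openin_open_Int open_box)
    moreover have "negligible ({x \<in> \<Omega>. u x \<noteq> 0} \<inter> box a b)"
      by (rule negligible_subset[OF neg[OF ab(1)]]) (auto simp: u0_def)
    ultimately show "\<exists>U. openin (top_of_set {x \<in> \<Omega>. u x \<noteq> 0}) U \<and> x \<in> U \<and> negligible U"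
      using x ab(2) by blast
  qed
  then have "AE x in lebesgue. x \<in> \<Omega> \<longrightarrow> u x = 0"
    unfolding eventually_ae_filter_negligible by (intro exI conjI) auto
  then show ?thesis using \<Omega> by (subst AE_restrict_space_iff) auto
qed

text \<open>First-order condition at a maximum: the variation along a line is linear up to a
  quadratic term, so its linear coefficient vanishes.\<close>

lemma linear_le_quadratic_imp_0:
  fixes c A :: real
  assumes "\<And>t. 2 * t * c \<le> t\<^sup>2 * A" "0 \<le> A"
  shows "c = 0"
proof -
  have "c\<^sup>2 \<le> A * 0"
    by (rule quadratic_nonneg_discriminant) (use assms in \<open>auto simp: algebra_simps\<close>)
  then show ?thesis by simp
qed

lemma L2_inner_self_diff:
  assumes "u \<in> L2 \<Omega>" "w \<in> L2 \<Omega>"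
  shows "L2_inner \<Omega> (\<lambda>x. u x - w x) (\<lambda>x. u x - w x)
    = L2_inner \<Omega> u u - 2 * L2_inner \<Omega> u w + L2_inner \<Omega> w w"
  using assms by (simp add: L2_inner_simps L2_intros L2_inner_commute[of \<Omega> w u])

lemma L2_inner_self_add:
  assumes "u \<in> L2 \<Omega>" "w \<in> L2 \<Omega>"
  shows "L2_inner \<Omega> (\<lambda>x. u x + w x) (\<lambda>x. u x + w x)
    = L2_inner \<Omega> u u + 2 * L2_inner \<Omega> u w + L2_inner \<Omega> w w"
  using assms by (simp add: L2_inner_simps L2_intros L2_inner_commute[of \<Omega> w u])

text \<open>Up to the constant \<open>L2_inner \<Omega> h h\<close>, the functional \<open>J\<close>
  is minus the squared distance from \<open>h\<close>. A maximising sequence converges to some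
  \<open>p\<close> with \<open>h - p\<close> orthogonal to all test functions, and the fundamental
  lemma gives \<open>p = h\<close> almost everywhere.\<close>

lemma test_functions_dense:
  assumes \<Omega>: "open \<Omega>" "bounded \<Omega>" and h: "h \<in> L2 \<Omega>"
  obtains \<phi> where "\<forall>n. \<phi> n \<in> test_functions \<Omega>" "(\<lambda>n. L2_norm \<Omega> (\<lambda>x. \<phi> n x - h x)) \<longlonglongrightarrow> 0"
proof -
  let ?I = "L2_inner \<Omega>"
  note tL2 = test_function_L2[OF \<Omega>]
  define J where "J \<phi> = 2 * ?I h \<phi> - ?I \<phi> \<phi>" for \<phi>
  define d where "d \<phi> \<psi> = (L2_norm \<Omega> (\<lambda>x. \<phi> x - \<psi> x))\<^sup>2" for \<phi> \<psi> :: "real^2 \<Rightarrow> real"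
  have bdd: "J \<phi> \<le> ?I h h" if "\<phi> \<in> test_functions \<Omega>" for \<phi>
    using L2_inner_self_nonneg[of \<Omega> "\<lambda>x. h x - \<phi> x"] L2_inner_self_diff[OF h tL2[OF that]]
    by (simp add: J_def)
  have mid: "\<exists>z\<in>test_functions \<Omega>. J z = (J \<phi> + J \<psi>) / 2 + d \<phi> \<psi> / 4"
    if "\<phi> \<in> test_functions \<Omega>" "\<psi> \<in> test_functions \<Omega>" for \<phi> \<psi>
  proof (rule bexI)
    show "(\<lambda>x. 1/2 * (\<phi> x + \<psi> x)) \<in> test_functions \<Omega>"
      by (rule test_function_scale[OF test_function_add[OF that]])
    show "J (\<lambda>x. 1/2 * (\<phi> x + \<psi> x)) = (J \<phi> + J \<psi>) / 2 + d \<phi> \<psi> / 4"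
      unfolding J_def d_def L2_norm_square L2_inner_scale_left L2_inner_scale_right
        L2_inner_self_diff[OF tL2[OF that(1)] tL2[OF that(2)]]
        L2_inner_self_add[OF tL2[OF that(1)] tL2[OF that(2)]]
        L2_inner_add_right[OF tL2[OF that(1)] tL2[OF that(2)] h]
      by (simp add: field_simps)
  qed
  obtain v m where v: "\<And>n. v n \<in> test_functions \<Omega>" and m: "\<And>w. w \<in> test_functions \<Omega> \<Longrightarrow> J w \<le> m"
    and near: "\<And>n. m - 1 / real (Suc n) \<le> J (v n)"
    and cau: "\<And>e. 0 < e \<Longrightarrow> \<exists>N. \<forall>i\<ge>N. \<forall>j\<ge>N. d (v i) (v j) < e"
    by (rule maximising_sequence[of "\<lambda>x. 0" "test_functions \<Omega>" J "?I h h" d,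
          OF test_function_zero bdd mid]) auto
  have vL2: "v n \<in> L2 \<Omega>" for n by (rule tL2[OF v])
  have "\<exists>N. \<forall>i\<ge>N. \<forall>j\<ge>N. L2_norm \<Omega> (\<lambda>x. v i x - v j x) < e" if "0 < e" for e
    using cau[of "e\<^sup>2"] that unfolding d_def by (meson less_imp_le power_less_imp_less_base zero_less_power)
  then obtain p where p: "p \<in> L2 \<Omega>" "(\<lambda>n. L2_norm \<Omega> (\<lambda>x. v n x - p x)) \<longlonglongrightarrow> 0"
    by (rule L2_complete[OF \<Omega> vL2])
  have orth: "?I (\<lambda>x. h x - p x) \<phi> = 0" if \<phi>: "\<phi> \<in> test_functions \<Omega>" for \<phi>
  proof (rule linear_le_quadratic_imp_0)
    show "0 \<le> ?I \<phi> \<phi>" by (rule L2_inner_self_nonneg)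
    fix t :: real
    have le: "2 * t * (?I h \<phi> - ?I (v n) \<phi>) - t\<^sup>2 * ?I \<phi> \<phi> \<le> 1 / real (Suc n)" for n
    proof -
      have t\<phi>: "(\<lambda>x. t * \<phi> x) \<in> test_functions \<Omega>" by (rule test_function_scale[OF \<phi>])
      have "J (\<lambda>x. v n x + t * \<phi> x) = J (v n) + 2 * t * (?I h \<phi> - ?I (v n) \<phi>) - t\<^sup>2 * ?I \<phi> \<phi>"
        unfolding J_def L2_inner_self_add[OF vL2 tL2[OF t\<phi>]] L2_inner_add_right[OF vL2 tL2[OF t\<phi>] h]
          L2_inner_scale_left L2_inner_scale_right
        by (simp add: algebra_simps power2_eq_square)
      moreover have "J (\<lambda>x. v n x + t * \<phi> x) \<le> m" by (rule m[OF test_function_add[OF v t\<phi>]])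
      ultimately show ?thesis using near[of n] by linarith
    qed
    have "(\<lambda>n. 2 * t * (?I h \<phi> - ?I (v n) \<phi>) - t\<^sup>2 * ?I \<phi> \<phi>)
        \<longlonglongrightarrow> 2 * t * (?I h \<phi> - ?I p \<phi>) - t\<^sup>2 * ?I \<phi> \<phi>"
      by (intro tendsto_intros L2_inner_tendsto_left[OF vL2 p(1) tL2[OF \<phi>] p(2)])
    moreover have "(\<lambda>n. 1 / real (Suc n)) \<longlonglongrightarrow> 0" by (rule LIMSEQ_Suc[OF lim_1_over_n])
    ultimately have "2 * t * (?I h \<phi> - ?I p \<phi>) - t\<^sup>2 * ?I \<phi> \<phi> \<le> 0"
      by (rule LIMSEQ_le) (use le in auto)
    then show "2 * t * ?I (\<lambda>x. h x - p x) \<phi> \<le> t\<^sup>2 * ?I \<phi> \<phi>"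
      using h p(1) tL2[OF \<phi>] by (simp add: L2_inner_simps)
  qed
  have "AE x in lebesgue_on \<Omega>. h x - p x = 0"
    by (rule fundamental_lemma[OF \<Omega>(1) L2_integrable[OF \<Omega> L2_diff[OF h p(1)]] orth])
  then have AE: "AE x in lebesgue_on \<Omega>. v n x - p x = v n x - h x" for n
    by eventually_elim simp
  have "L2_norm \<Omega> (\<lambda>x. v n x - p x) = L2_norm \<Omega> (\<lambda>x. v n x - h x)" for n
    by (rule L2_norm_cong_AE[OF L2_diff[OF vL2 p(1)] L2_diff[OF vL2 h] AE])
  with p(2) v show ?thesis by (intro that[of v]) auto
qed

section \<open>Weak derivatives\<close>

lemma has_weak_pderiv_unique:
  assumes \<Omega>: "open \<Omega>" "bounded \<Omega>" and g: "g \<in> L2 \<Omega>" "g' \<in> L2 \<Omega>"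
    and "has_weak_pderiv \<Omega> j u g" "has_weak_pderiv \<Omega> j u g'"
  shows "AE x in lebesgue_on \<Omega>. g x = g' x"
proof -
  have "L2_inner \<Omega> (\<lambda>x. g x - g' x) \<phi> = 0" if "\<phi> \<in> test_functions \<Omega>" for \<phi>
    using assms(5,6) that g test_function_L2[OF \<Omega> that]
    by (simp add: has_weak_pderiv_def L2_inner_simps)
  from fundamental_lemma[OF \<Omega>(1) L2_integrable[OF \<Omega> L2_diff[OF g]] this]
  show ?thesis by simp
qed

lemma has_weak_pderiv_test:
  assumes "open \<Omega>" "\<phi> \<in> test_functions \<Omega>"
  shows "has_weak_pderiv \<Omega> j \<phi> (pderiv_at j \<phi>)"
  unfolding has_weak_pderiv_def
proof
  fix \<psi> assume \<psi>: "\<psi> \<in> test_functions \<Omega>"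
  show "L2_inner \<Omega> \<phi> (pderiv_at j \<psi>) = - L2_inner \<Omega> (pderiv_at j \<phi>) \<psi>"
    unfolding L2_inner_test[OF assms(1) \<psi>] L2_inner_test[OF assms(1) test_function_pderiv[OF \<psi>]]
    by (rule integral_by_parts[OF test_function_Ck[OF assms(2)] test_function_Ck[OF \<psi>] test_function_compact[OF \<psi>]])
qed

lemma has_weak_pderiv_diff:
  assumes \<Omega>: "open \<Omega>" "bounded \<Omega>" and L: "u \<in> L2 \<Omega>" "u' \<in> L2 \<Omega>" "g \<in> L2 \<Omega>" "g' \<in> L2 \<Omega>"
    and "has_weak_pderiv \<Omega> j u g" "has_weak_pderiv \<Omega> j u' g'"
  shows "has_weak_pderiv \<Omega> j (\<lambda>x. u x - u' x) (\<lambda>x. g x - g' x)"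
  unfolding has_weak_pderiv_def
proof
  fix \<psi> assume \<psi>: "\<psi> \<in> test_functions \<Omega>"
  have "\<psi> \<in> L2 \<Omega>" "pderiv_at j \<psi> \<in> L2 \<Omega>"
    using test_function_L2[OF \<Omega>] \<psi> test_function_pderiv[OF \<psi>] by blast+
  then show "L2_inner \<Omega> (\<lambda>x. u x - u' x) (pderiv_at j \<psi>) = - L2_inner \<Omega> (\<lambda>x. g x - g' x) \<psi>"
    using assms(7,8) \<psi> L by (simp add: has_weak_pderiv_def L2_inner_simps)
qed

lemma weak_pderiv_works:
  assumes "u \<in> H1 \<Omega>"
  shows "weak_pderiv \<Omega> j u \<in> L2 \<Omega>" "has_weak_pderiv \<Omega> j u (weak_pderiv \<Omega> j u)"
proof -
  have "\<exists>g. g \<in> L2 \<Omega> \<and> has_weak_pderiv \<Omega> j u g" using assms unfolding H1_def by blast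
  from someI_ex[OF this] show "weak_pderiv \<Omega> j u \<in> L2 \<Omega>" "has_weak_pderiv \<Omega> j u (weak_pderiv \<Omega> j u)"
    unfolding weak_pderiv_def by blast+
qed

lemma H1_L2: "u \<in> H1 \<Omega> \<Longrightarrow> u \<in> L2 \<Omega>"
  by (simp add: H1_def)

lemma weak_pderiv_AE:
  assumes "open \<Omega>" "bounded \<Omega>" "u \<in> H1 \<Omega>" "g \<in> L2 \<Omega>" "has_weak_pderiv \<Omega> j u g"
  shows "AE x in lebesgue_on \<Omega>. weak_pderiv \<Omega> j u x = g x"
  by (rule has_weak_pderiv_unique[OF assms(1,2) weak_pderiv_works(1)[OF assms(3)] assms(4)
        weak_pderiv_works(2)[OF assms(3)] assms(5)])

lemma test_function_H1:
  assumes "open \<Omega>" "bounded \<Omega>" "\<phi> \<in> test_functions \<Omega>"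
  shows "\<phi> \<in> H1 \<Omega>"
  unfolding H1_def
  using test_function_L2[OF assms] test_function_L2[OF assms(1,2) test_function_pderiv[OF assms(3)]]
    has_weak_pderiv_test[OF assms(1,3)] by blast

lemma H1_diff:
  assumes "open \<Omega>" "bounded \<Omega>" "u \<in> H1 \<Omega>" "w \<in> H1 \<Omega>"
  shows "(\<lambda>x. u x - w x) \<in> H1 \<Omega>"
    "AE x in lebesgue_on \<Omega>. weak_pderiv \<Omega> j (\<lambda>x. u x - w x) x = weak_pderiv \<Omega> j u x - weak_pderiv \<Omega> j w x"
proof -
  note u = weak_pderiv_works[OF assms(3)] and w = weak_pderiv_works[OF assms(4)]
  have weak: "has_weak_pderiv \<Omega> j (\<lambda>x. u x - w x) (\<lambda>x. weak_pderiv \<Omega> j u x - weak_pderiv \<Omega> j w x)" for j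
    by (rule has_weak_pderiv_diff[OF assms(1,2) H1_L2[OF assms(3)] H1_L2[OF assms(4)] u(1) w(1) u(2) w(2)])
  have L: "(\<lambda>x. weak_pderiv \<Omega> j u x - weak_pderiv \<Omega> j w x) \<in> L2 \<Omega>" for j
    by (rule L2_diff[OF u(1) w(1)])
  show H1: "(\<lambda>x. u x - w x) \<in> H1 \<Omega>"
    unfolding H1_def using L2_diff[OF H1_L2[OF assms(3)] H1_L2[OF assms(4)]] weak L by blast
  show "AE x in lebesgue_on \<Omega>. weak_pderiv \<Omega> j (\<lambda>x. u x - w x) x = weak_pderiv \<Omega> j u x - weak_pderiv \<Omega> j w x"
    by (rule weak_pderiv_AE[OF assms(1,2) H1 L weak])
qed

lemma weak_pderiv_test:
  assumes "open \<Omega>" "bounded \<Omega>" "\<phi> \<in> test_functions \<Omega>"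
  shows "AE x in lebesgue_on \<Omega>. weak_pderiv \<Omega> j \<phi> x = pderiv_at j \<phi> x"
  by (rule weak_pderiv_AE[OF assms(1,2) test_function_H1[OF assms]
        test_function_L2[OF assms(1,2) test_function_pderiv[OF assms(3)]] has_weak_pderiv_test[OF assms(1,3)]])

lemma test_function_H10:
  assumes "open \<Omega>" "bounded \<Omega>" "\<phi> \<in> test_functions \<Omega>"
  shows "\<phi> \<in> H10 \<Omega>"
proof -
  have z: "(\<lambda>x. 0) \<in> test_functions \<Omega>" by (rule test_function_zero)
  \<comment> \<open>Since \<open>weak_pderiv\<close> is a choice, even for the zero function it is
    known to vanish only almost everywhere.\<close>
  have "L2_norm \<Omega> (weak_pderiv \<Omega> j (\<lambda>x. 0)) = 0" for j
  proof -
    have "AE x in lebesgue_on \<Omega>. weak_pderiv \<Omega> j (\<lambda>x. 0) x = 0"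
      using weak_pderiv_test[OF assms(1,2) z, of j] pderiv_at_eqI[OF has_derivative_const, of j 0] by simp
    then show ?thesis
      using L2_norm_eq_0_iff[OF weak_pderiv_works(1)[OF test_function_H1[OF assms(1,2) z]]] by simp
  qed
  moreover have "L2_norm \<Omega> (\<lambda>x. 0) = 0" by (simp add: L2_norm_def L2_inner_def)
  ultimately have "H1_norm \<Omega> (\<lambda>x. \<phi> x - \<phi> x) = 0" by (simp add: H1_norm_def)
  then have "\<forall>\<epsilon>>0. \<exists>\<psi>\<in>test_functions \<Omega>. H1_norm \<Omega> (\<lambda>x. \<phi> x - \<psi> x) < \<epsilon>"
    using assms(3) by metis
  then show ?thesis unfolding H10_def using test_function_H1[OF assms] by blast
qed

lemma L2_norm_weak_pderiv_le_H1_norm: "L2_norm \<Omega> (weak_pderiv \<Omega> j u) \<le> H1_norm \<Omega> u"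
proof -
  have "(L2_norm \<Omega> (weak_pderiv \<Omega> j u))\<^sup>2 \<le> (\<Sum>j\<in>UNIV. (L2_norm \<Omega> (weak_pderiv \<Omega> j u))\<^sup>2)"
    by (rule member_le_sum) auto
  then have "(L2_norm \<Omega> (weak_pderiv \<Omega> j u))\<^sup>2
      \<le> (L2_norm \<Omega> u)\<^sup>2 + (\<Sum>j\<in>UNIV. (L2_norm \<Omega> (weak_pderiv \<Omega> j u))\<^sup>2)"
    using zero_le_power2[of "L2_norm \<Omega> u"] by linarith
  then show ?thesis unfolding H1_norm_def by (rule real_le_rsqrt)
qed

text \<open>Convergence of gradients suffices to carry identities between first derivatives from
  test functions to all of \<open>H10\<close>.\<close>

lemma H10_approximation:
  assumes \<Omega>: "open \<Omega>" "bounded \<Omega>" and u: "u \<in> H10 \<Omega>"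
  obtains \<phi> where "\<forall>n. \<phi> n \<in> test_functions \<Omega>"
    "\<forall>j. (\<lambda>n. L2_norm \<Omega> (\<lambda>x. pderiv_at j (\<phi> n) x - weak_pderiv \<Omega> j u x)) \<longlonglongrightarrow> 0"
proof -
  have H1: "u \<in> H1 \<Omega>" using u by (simp add: H10_def)
  have "\<exists>\<phi>\<in>test_functions \<Omega>. H1_norm \<Omega> (\<lambda>x. u x - \<phi> x) < 1 / real (Suc n)" for n
    using u by (simp add: H10_def)
  then obtain \<phi> where \<phi>: "\<And>n. \<phi> n \<in> test_functions \<Omega>"
    "\<And>n. H1_norm \<Omega> (\<lambda>x. u x - \<phi> n x) < 1 / real (Suc n)" by metis
  have le: "L2_norm \<Omega> (\<lambda>x. pderiv_at j (\<phi> n) x - weak_pderiv \<Omega> j u x) \<le> 1 / real (Suc n)" for j n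
  proof -
    have H1\<phi>: "\<phi> n \<in> H1 \<Omega>" by (rule test_function_H1[OF \<Omega> \<phi>(1)])
    have AE: "AE x in lebesgue_on \<Omega>. weak_pderiv \<Omega> j u x - pderiv_at j (\<phi> n) x
        = weak_pderiv \<Omega> j (\<lambda>x. u x - \<phi> n x) x"
      using H1_diff(2)[OF \<Omega> H1 H1\<phi>, of j] weak_pderiv_test[OF \<Omega> \<phi>(1)[of n], of j]
      by eventually_elim simp
    have "L2_norm \<Omega> (\<lambda>x. pderiv_at j (\<phi> n) x - weak_pderiv \<Omega> j u x)
        = L2_norm \<Omega> (\<lambda>x. weak_pderiv \<Omega> j u x - pderiv_at j (\<phi> n) x)"
      by (rule L2_norm_minus_commute)
    also have "\<dots> = L2_norm \<Omega> (weak_pderiv \<Omega> j (\<lambda>x. u x - \<phi> n x))"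
      by (rule L2_norm_cong_AE[OF L2_diff[OF weak_pderiv_works(1)[OF H1]
              test_function_L2[OF \<Omega> test_function_pderiv[OF \<phi>(1)]]]
            weak_pderiv_works(1)[OF H1_diff(1)[OF \<Omega> H1 H1\<phi>]] AE])
    also have "\<dots> \<le> 1 / real (Suc n)"
      using L2_norm_weak_pderiv_le_H1_norm \<phi>(2)[of n] by (rule order_trans[OF _ less_imp_le])
    finally show ?thesis .
  qed
  have "(\<lambda>n. L2_norm \<Omega> (\<lambda>x. pderiv_at j (\<phi> n) x - weak_pderiv \<Omega> j u x)) \<longlonglongrightarrow> 0" for j
    by (rule Lim_null_comparison[OF _ LIMSEQ_Suc[OF lim_1_over_n]])
       (use le L2_norm_nonneg in auto)
  with \<phi>(1) show ?thesis by (intro that[of \<phi>]) auto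
qed

section \<open>Bounds for the inf-sup constant\<close>

text \<open>The functions \<open>x\<close> and \<open>-y\<close> are harmonic conjugates, so
  \<open>\<langle>div v, x\<rangle> = - \<langle>rot v, y\<rangle>\<close>, while
  \<open>|v|\<^sup>2 = \<parallel>div v\<parallel>\<^sup>2 + \<parallel>rot v\<parallel>\<^sup>2\<close>.\<close>

lemma infsup_const_le:
  assumes \<Omega>: "open \<Omega>" "bounded \<Omega>"
    and mean: "(LINT x|lebesgue_on \<Omega>. x$1) = 0"
    and pos: "0 < (LINT x|lebesgue_on \<Omega>. (x$1)\<^sup>2)"
  shows "infsup_const \<Omega> \<le> ereal (sqrt ((LINT x|lebesgue_on \<Omega>. (x$2)\<^sup>2) /
    ((LINT x|lebesgue_on \<Omega>. (x$1)\<^sup>2) + (LINT x|lebesgue_on \<Omega>. (x$2)\<^sup>2))))"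
proof -
  let ?I = "L2_inner \<Omega>"
  define x1 where "x1 = (\<lambda>x::real^2. x$1)"
  define x2 where "x2 = (\<lambda>x::real^2. x$2)"
  define X where "X = ?I x1 x1"
  define Y where "Y = ?I x2 x2"
  have XY: "X = (LINT x|lebesgue_on \<Omega>. (x$1)\<^sup>2)" "Y = (LINT x|lebesgue_on \<Omega>. (x$2)\<^sup>2)"
    by (simp_all add: X_def Y_def x1_def x2_def L2_inner_def power2_eq_square)
  have X: "0 < X" and Y: "0 \<le> Y" using pos by (auto simp: XY)
  define \<kappa> where "\<kappa> = sqrt (Y / (X + Y))"
  obtain B where B: "\<forall>x\<in>\<Omega>. norm x \<le> B" using \<Omega>(2) unfolding bounded_iff by blast
  have coord_L2: "(\<lambda>x. x$i) \<in> L2 \<Omega>" for i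
  proof (rule L2_bounded[OF \<Omega>])
    show "(\<lambda>x. x$i) \<in> borel_measurable (lebesgue_on \<Omega>)"
      by (intro measurable_restrict_space1 continuous_imp_borel_measurable_lebesgue continuous_intros)
    show "\<bar>x$i\<bar> \<le> B" if "x \<in> \<Omega>" for x
      using B that component_le_norm_cart[of x i] by force
  qed
  have x1L: "x1 \<in> L2 \<Omega>" and x2L: "x2 \<in> L2 \<Omega>" by (auto simp: x1_def x2_def coord_L2)
  have x1_not0: "\<not> (AE x in lebesgue_on \<Omega>. x1 x = 0)"
  proof
    assume "AE x in lebesgue_on \<Omega>. x1 x = 0"
    then have "L2_norm \<Omega> x1 = 0" using L2_norm_eq_0_iff[OF x1L] by simp
    then show False using X L2_norm_square[of \<Omega> x1] by (simp add: X_def)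
  qed
  \<comment> \<open>A coordinate has constant gradient, so integration by parts leaves only the
    integral of \<phi>, the same value for both coordinates.\<close>
  have test_coord: "?I (pderiv_at j \<phi>) (\<lambda>x. x$i) = (if i = j then - (LINT x|lebesgue. \<phi> x) else 0)"
    if "\<phi> \<in> test_functions \<Omega>" for \<phi> i j
  proof -
    have "?I (pderiv_at j \<phi>) (\<lambda>x. x$i) = ?I (\<lambda>x. x$i) (pderiv_at j \<phi>)" by (rule L2_inner_commute)
    also have "\<dots> = (LINT x|lebesgue. x$i * pderiv_at j \<phi> x)"
      by (rule L2_inner_test[OF \<Omega>(1) test_function_pderiv[OF that]])
    also have "\<dots> = - (LINT x|lebesgue. pderiv_at j (\<lambda>x. x$i) x * \<phi> x)"
      by (rule integral_by_parts[OF Ck_component test_function_Ck[OF that] test_function_compact[OF that]])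
    finally show ?thesis by (simp add: pderiv_at_component)
  qed
  have bound: "?I (weak_div \<Omega> v) x1 / (H1_seminorm \<Omega> v * L2_norm \<Omega> x1) \<le> \<kappa>" if v: "v \<in> H10_vec \<Omega>" for v
  proof -
    define p where "p k j = weak_pderiv \<Omega> j (\<lambda>x. v x $ k)" for k j
    have H10: "(\<lambda>x. v x $ k) \<in> H10 \<Omega>" for k using v by (simp add: H10_vec_def)
    have pL: "p k j \<in> L2 \<Omega>" for k j
      unfolding p_def using H10[of k] by (intro weak_pderiv_works) (simp add: H10_def)
    have "\<forall>k. \<exists>\<phi>. (\<forall>n. \<phi> n \<in> test_functions \<Omega>) \<and>
        (\<forall>j. (\<lambda>n. L2_norm \<Omega> (\<lambda>x. pderiv_at j (\<phi> n) x - p k j x)) \<longlonglongrightarrow> 0)"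
      unfolding p_def by (rule allI, rule H10_approximation[OF \<Omega> H10], rule exI, rule conjI)
    from choice[OF this] obtain \<phi> where \<phi>: "\<And>k n. \<phi> k n \<in> test_functions \<Omega>"
      "\<And>k j. (\<lambda>n. L2_norm \<Omega> (\<lambda>x. pderiv_at j (\<phi> k n) x - p k j x)) \<longlonglongrightarrow> 0" by blast
    have \<phi>L: "pderiv_at j (\<phi> k n) \<in> L2 \<Omega>" for j k n
      by (rule test_function_L2[OF \<Omega> test_function_pderiv[OF \<phi>(1)]])
    have coord0: "?I (p k j) (\<lambda>x. x$i) = 0" if "i \<noteq> j" for i j k
    proof -
      have "(\<lambda>n. ?I (pderiv_at j (\<phi> k n)) (\<lambda>x. x$i)) \<longlonglongrightarrow> ?I (p k j) (\<lambda>x. x$i)"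
        by (rule L2_inner_tendsto_left[OF \<phi>L pL coord_L2 \<phi>(2)])
      then show ?thesis using that by (simp add: test_coord[OF \<phi>(1)] LIMSEQ_const_iff)
    qed
    have coord1: "?I (p 1 1) x1 = ?I (p 1 2) x2"
    proof -
      have "(\<lambda>n. ?I (pderiv_at 1 (\<phi> 1 n)) x1) \<longlonglongrightarrow> ?I (p 1 1) x1"
        by (rule L2_inner_tendsto_left[OF \<phi>L pL x1L \<phi>(2)])
      moreover have "(\<lambda>n. ?I (pderiv_at 2 (\<phi> 1 n)) x2) \<longlonglongrightarrow> ?I (p 1 2) x2"
        by (rule L2_inner_tendsto_left[OF \<phi>L pL x2L \<phi>(2)])
      ultimately show ?thesis
        unfolding x1_def x2_def by (simp add: test_coord[OF \<phi>(1)] LIMSEQ_unique)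
    qed
    \<comment> \<open>The Jacobian determinant of a field vanishing on the boundary has integral
      zero. This is what reduces the four squared derivatives to divergence and rotation.\<close>
    have null: "?I (p 1 1) (p 2 2) = ?I (p 1 2) (p 2 1)"
    proof -
      have "(\<lambda>n. ?I (pderiv_at 1 (\<phi> 1 n)) (pderiv_at 2 (\<phi> 2 n))) \<longlonglongrightarrow> ?I (p 1 1) (p 2 2)"
        by (rule L2_inner_tendsto[OF \<phi>L pL \<phi>L pL \<phi>(2) \<phi>(2)])
      moreover have "(\<lambda>n. ?I (pderiv_at 2 (\<phi> 1 n)) (pderiv_at 1 (\<phi> 2 n))) \<longlonglongrightarrow> ?I (p 1 2) (p 2 1)"
        by (rule L2_inner_tendsto[OF \<phi>L pL \<phi>L pL \<phi>(2) \<phi>(2)])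
      moreover have "?I (pderiv_at 1 (\<phi> 1 n)) (pderiv_at 2 (\<phi> 2 n)) = ?I (pderiv_at 2 (\<phi> 1 n)) (pderiv_at 1 (\<phi> 2 n))" for n
        unfolding L2_inner_test[OF \<Omega>(1) test_function_pderiv[OF \<phi>(1)]]
        by (rule integral_pderiv_swap[OF \<phi>(1) \<phi>(1)])
      ultimately show ?thesis by (simp add: LIMSEQ_unique)
    qed
    define D where "D = (\<lambda>x. p 1 1 x + p 2 2 x)"
    define R where "R = (\<lambda>x. p 2 1 x - p 1 2 x)"
    have DL: "D \<in> L2 \<Omega>" and RL: "R \<in> L2 \<Omega>" unfolding D_def R_def by (intro L2_add L2_diff pL)+
    have div: "weak_div \<Omega> v = D"
      by (rule ext) (simp add: weak_div_def sum_2 D_def p_def)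
    have semi: "(H1_seminorm \<Omega> v)\<^sup>2 = (L2_norm \<Omega> D)\<^sup>2 + (L2_norm \<Omega> R)\<^sup>2"
    proof -
      have "(H1_seminorm \<Omega> v)\<^sup>2 = (\<Sum>k\<in>UNIV. \<Sum>j\<in>UNIV. ?I (p k j) (p k j))"
        unfolding H1_seminorm_def p_def
        by (subst real_sqrt_pow2) (auto simp: L2_norm_square L2_inner_self_nonneg intro!: sum_nonneg)
      also have "\<dots> = (L2_norm \<Omega> D)\<^sup>2 + (L2_norm \<Omega> R)\<^sup>2"
        unfolding L2_norm_square D_def R_def L2_inner_self_add[OF pL pL] L2_inner_self_diff[OF pL pL]
        using null L2_inner_commute[of \<Omega> "p 2 1" "p 1 2"] by (simp add: sum_2)
      finally show ?thesis .
    qed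
    define l where "l = ?I D x1"
    have l2: "l = - ?I R x2"
      unfolding l_def D_def R_def L2_inner_add_left[OF pL pL x1L] L2_inner_diff_left[OF pL pL x2L]
      using coord0[of 1 2 2] coord0[of 2 1 2] coord1 by (simp add: x1_def x2_def)
    \<comment> \<open>The number \<open>l\<close> is bounded once through the divergence and
      \<open>x1\<close>, once through the rotation and \<open>x2\<close>. Weighting the two squared
      bounds with \<open>Y\<close> and \<open>X\<close> and adding them restores the full
      seminorm.\<close>
    have "\<bar>l\<bar> \<le> L2_norm \<Omega> D * L2_norm \<Omega> x1" unfolding l_def by (rule L2_Cauchy_Schwarz[OF DL x1L])
    then have lD: "l\<^sup>2 \<le> (L2_norm \<Omega> D)\<^sup>2 * X"
      using power_mono[of "\<bar>l\<bar>" _ 2] by (fastforce simp: power_mult_distrib X_def L2_norm_square)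
    have "\<bar>l\<bar> \<le> L2_norm \<Omega> R * L2_norm \<Omega> x2" unfolding l2 using L2_Cauchy_Schwarz[OF RL x2L] by simp
    then have lR: "l\<^sup>2 \<le> (L2_norm \<Omega> R)\<^sup>2 * Y"
      using power_mono[of "\<bar>l\<bar>" _ 2] by (fastforce simp: power_mult_distrib Y_def L2_norm_square)
    have "l\<^sup>2 * (X + Y) \<le> X * Y * (H1_seminorm \<Omega> v)\<^sup>2"
      using mult_right_mono[OF lD Y] mult_right_mono[OF lR less_imp_le[OF X]]
      unfolding semi by (simp add: algebra_simps)
    then have "l\<^sup>2 \<le> (Y / (X + Y)) * (X * (H1_seminorm \<Omega> v)\<^sup>2)"
      using X Y by (simp add: field_simps)
    also have "\<dots> = (\<kappa> * (H1_seminorm \<Omega> v * L2_norm \<Omega> x1))\<^sup>2"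
      using X Y by (simp add: \<kappa>_def power_mult_distrib L2_norm_square X_def[symmetric])
    finally have "l \<le> \<kappa> * (H1_seminorm \<Omega> v * L2_norm \<Omega> x1)"
    proof (rule power2_le_imp_le)
      show "0 \<le> \<kappa> * (H1_seminorm \<Omega> v * L2_norm \<Omega> x1)"
        using X Y unfolding \<kappa>_def H1_seminorm_def
        by (intro mult_nonneg_nonneg L2_norm_nonneg real_sqrt_ge_zero sum_nonneg) auto
    qed
    moreover have "0 \<le> H1_seminorm \<Omega> v * L2_norm \<Omega> x1"
      unfolding H1_seminorm_def by (intro mult_nonneg_nonneg L2_norm_nonneg real_sqrt_ge_zero sum_nonneg) auto
    moreover have "0 \<le> \<kappa>" using X Y by (simp add: \<kappa>_def)
    \<comment> \<open>For a vanishing denominator the quotient is 0 by convention, and \<kappa> is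
      nonnegative.\<close>
    ultimately show ?thesis unfolding div l_def[symmetric]
      by (cases "H1_seminorm \<Omega> v * L2_norm \<Omega> x1 = 0") (auto simp: divide_le_eq)
  qed
  have "x1 \<in> L2_mean_zero \<Omega>" using x1L mean by (simp add: L2_mean_zero_def x1_def)
  then have "infsup_const \<Omega> \<le> (SUP v \<in> {v \<in> H10_vec \<Omega>. \<not> (AE x in lebesgue_on \<Omega>. v x = 0)}.
          ereal (?I (weak_div \<Omega> v) x1 / (H1_seminorm \<Omega> v * L2_norm \<Omega> x1)))"
    unfolding infsup_const_def using x1_not0 by (intro INF_lower) auto
  also have "\<dots> \<le> ereal \<kappa>"
    by (rule SUP_least) (use bound in auto)
  finally show ?thesis unfolding \<kappa>_def XY .
qed

text \<open>Distributional Cauchy-Riemann equations of the function h + i g: after integration by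
  parts they read \<partial>1 h = \<partial>2 g and \<partial>2 h = - \<partial>1 g.\<close>

definition weak_Cauchy_Riemann :: "(real^2) set \<Rightarrow> (real^2 \<Rightarrow> real) \<Rightarrow> (real^2 \<Rightarrow> real) \<Rightarrow> bool" where
  "weak_Cauchy_Riemann \<Omega> h g \<longleftrightarrow> (\<forall>\<phi>\<in>test_functions \<Omega>.
     L2_inner \<Omega> h (pderiv_at 1 \<phi>) = L2_inner \<Omega> g (pderiv_at 2 \<phi>) \<and>
     L2_inner \<Omega> h (pderiv_at 2 \<phi>) = - L2_inner \<Omega> g (pderiv_at 1 \<phi>))"

lemma member_le_double_sum:
  fixes f :: "'a::finite \<Rightarrow> 'b::finite \<Rightarrow> real"
  assumes "\<And>k j. 0 \<le> f k j"
  shows "f k j \<le> (\<Sum>k\<in>UNIV. \<Sum>j\<in>UNIV. f k j)"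
proof -
  have "f k j \<le> (\<Sum>j\<in>UNIV. f k j)" by (rule member_le_sum) (auto simp: assms)
  also have "\<dots> \<le> (\<Sum>k\<in>UNIV. \<Sum>j\<in>UNIV. f k j)"
    by (rule member_le_sum[of k UNIV "\<lambda>k. \<Sum>j\<in>UNIV. f k j"]) (auto intro: sum_nonneg assms)
  finally show ?thesis .
qed

text \<open>For \<open>q\<close> let \<open>u\<close> solve \<open>\<Delta> u = \<nabla> q\<close> with \<open>u = 0\<close> on the boundary. Then \<open>q - div u\<close> and
  \<open>- rot u\<close> are harmonic conjugates, and Friedrichs' inequality bounds \<open>\<parallel>q\<parallel>\<close> by \<open>|u|\<close>.
  Only the gradient \<open>p\<close> of \<open>u\<close>, a limit of gradients of test functions, is needed.\<close>

lemma infsup_const_ge: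
  assumes \<Omega>: "open \<Omega>" "bounded \<Omega>" and \<Gamma>: "0 \<le> \<Gamma>"
    and Friedrichs: "\<And>h g. h \<in> L2_mean_zero \<Omega> \<Longrightarrow> g \<in> L2 \<Omega> \<Longrightarrow> weak_Cauchy_Riemann \<Omega> h g \<Longrightarrow>
      (L2_norm \<Omega> h)\<^sup>2 \<le> \<Gamma> * (L2_norm \<Omega> g)\<^sup>2"
  shows "ereal (1 / sqrt (1 + \<Gamma>)) \<le> infsup_const \<Omega>"
  unfolding infsup_const_def
proof (rule INF_greatest, rule ccontr)
  let ?I = "L2_inner \<Omega>"
  define S where "S = {v :: 2 \<Rightarrow> real^2 \<Rightarrow> real. \<forall>k. v k \<in> test_functions \<Omega>}"
  define A where "A v w = (\<Sum>k\<in>UNIV. \<Sum>j\<in>UNIV. ?I (pderiv_at j (v k)) (pderiv_at j (w k)))"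
    for v w :: "2 \<Rightarrow> real^2 \<Rightarrow> real"
  fix q assume "q \<in> {q \<in> L2_mean_zero \<Omega>. \<not> (AE x in lebesgue_on \<Omega>. q x = 0)}"
  then have qL: "q \<in> L2 \<Omega>" and q_mean: "(LINT x|lebesgue_on \<Omega>. q x) = 0"
    and q0: "\<not> (AE x in lebesgue_on \<Omega>. q x = 0)" by (auto simp: L2_mean_zero_def)
  let ?s = "SUP v \<in> {v \<in> H10_vec \<Omega>. \<not> (AE x in lebesgue_on \<Omega>. v x = 0)}.
          ereal (?I (weak_div \<Omega> v) q / (H1_seminorm \<Omega> v * L2_norm \<Omega> q))"
  assume "\<not> ereal (1 / sqrt (1 + \<Gamma>)) \<le> ?s"
  then obtain k0 where k0: "?s < ereal k0" "ereal k0 < ereal (1 / sqrt (1 + \<Gamma>))"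
    using ereal_dense2[of ?s "ereal (1 / sqrt (1 + \<Gamma>))"] by (auto simp: not_le)
  \<comment> \<open>The bound is made nonnegative because it is squared later.\<close>
  define k where "k = max k0 0"
  have k: "0 \<le> k" "k < 1 / sqrt (1 + \<Gamma>)" using k0(2) \<Gamma> by (auto simp: k_def add_nonneg_pos)
  define Q where "Q = L2_norm \<Omega> q"
  have Q: "0 < Q"
    using L2_norm_nonneg[of \<Omega> q] L2_norm_eq_0_iff[OF qL] q0 by (auto simp: Q_def less_le)
  define l where "l v = (\<Sum>k\<in>UNIV. ?I (pderiv_at k (v k)) q)" for v :: "2 \<Rightarrow> real^2 \<Rightarrow> real"
  have dL: "pderiv_at j \<phi> \<in> L2 \<Omega>" if "\<phi> \<in> test_functions \<Omega>" for j \<phi>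
    by (rule test_function_L2[OF \<Omega> test_function_pderiv[OF that]])
  have A_nonneg: "0 \<le> A v v" for v unfolding A_def by (intro sum_nonneg L2_inner_self_nonneg)
  have A_norm: "A v v = (\<Sum>k\<in>UNIV. \<Sum>j\<in>UNIV. (L2_norm \<Omega> (pderiv_at j (v k)))\<^sup>2)" for v
    by (simp add: A_def L2_norm_square)
  have comb_S: "(\<lambda>k x. v k x + t * w k x) \<in> S" if "v \<in> S" "w \<in> S" for v w t
    using that unfolding S_def by (auto intro!: test_function_add test_function_scale)
  have comb_d: "pderiv_at j (\<lambda>x. v k x + t * w k x) = (\<lambda>x. pderiv_at j (v k) x + t * pderiv_at j (w k) x)"
    if "v \<in> S" "w \<in> S" for v w t j k
  proof -
    have vk: "v k \<in> test_functions \<Omega>" and wk: "w k \<in> test_functions \<Omega>" using that by (auto simp: S_def)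
    show ?thesis
      unfolding pderiv_at_add_test[OF vk test_function_scale[OF wk]] pderiv_at_scale_test[OF wk] ..
  qed
  have l_comb: "l (\<lambda>k x. v k x + t * w k x) = l v + t * l w" if "v \<in> S" "w \<in> S" for v w t
  proof -
    have "?I (\<lambda>x. pderiv_at k (v k) x + t * pderiv_at k (w k) x) q
        = ?I (pderiv_at k (v k)) q + t * ?I (pderiv_at k (w k)) q" for k
      using that dL qL unfolding S_def by (simp add: L2_inner_add_left L2_scale L2_inner_scale_left)
    then show ?thesis by (simp add: l_def comb_d[OF that] sum.distrib sum_distrib_left)
  qed
  have A_comb: "A (\<lambda>k x. v k x + t * w k x) (\<lambda>k x. v k x + t * w k x) = A v v + 2 * t * A v w + t\<^sup>2 * A w w"
    if "v \<in> S" "w \<in> S" for v w t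
  proof -
    have "?I (\<lambda>x. pderiv_at j (v k) x + t * pderiv_at j (w k) x) (\<lambda>x. pderiv_at j (v k) x + t * pderiv_at j (w k) x)
      = ?I (pderiv_at j (v k)) (pderiv_at j (v k)) + 2 * t * ?I (pderiv_at j (v k)) (pderiv_at j (w k))
        + t\<^sup>2 * ?I (pderiv_at j (w k)) (pderiv_at j (w k))" for j k
      using that dL unfolding S_def
      by (simp add: L2_inner_self_add L2_scale L2_inner_scale_left L2_inner_scale_right power2_eq_square)
    then show ?thesis by (simp add: A_def comb_d[OF that] sum.distrib sum_distrib_left)
  qed
  have zero_S: "(\<lambda>k x. 0) \<in> S" by (simp add: S_def test_function_zero)
  have div_AE: "AE x in lebesgue_on \<Omega>. weak_div \<Omega> (\<lambda>x. vector [v 1 x, v 2 x]) x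
      = pderiv_at 1 (v 1) x + pderiv_at 2 (v 2) x" if "v \<in> S" for v
  proof -
    have "v 1 \<in> test_functions \<Omega>" "v 2 \<in> test_functions \<Omega>" using that by (auto simp: S_def)
    from weak_pderiv_test[OF \<Omega> this(1), of 1] weak_pderiv_test[OF \<Omega> this(2), of 2]
    show ?thesis by eventually_elim (simp add: weak_div_def sum_2)
  qed
  have bound: "l v \<le> k * Q * sqrt (A v v)" if v: "v \<in> S" for v
  proof (cases "A v v = 0")
    case True
    have "(L2_norm \<Omega> (pderiv_at j (v i)))\<^sup>2 \<le> A v v" for i j
      unfolding A_norm
      by (rule member_le_double_sum[of "\<lambda>i j. (L2_norm \<Omega> (pderiv_at j (v i)))\<^sup>2"]) simp
    then have "L2_norm \<Omega> (pderiv_at j (v i)) = 0" for i j using True by simp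
    moreover have "\<bar>?I (pderiv_at i (v i)) q\<bar> \<le> L2_norm \<Omega> (pderiv_at i (v i)) * L2_norm \<Omega> q" for i
      using v dL qL by (intro L2_Cauchy_Schwarz) (auto simp: S_def)
    ultimately show ?thesis using True by (simp add: l_def)
  next
    case False
    then have Apos: "0 < A v v" using A_nonneg[of v] by simp
    have tv: "v k \<in> test_functions \<Omega>" for k using v by (simp add: S_def)
    define V where "V = (\<lambda>x. vector [v 1 x, v 2 x] :: real^2)"
    have Vk: "(\<lambda>x. V x $ k) = v k" for k using exhaust_2[of k] by (auto simp: V_def)
    have VH: "V \<in> H10_vec \<Omega>" by (simp add: H10_vec_def Vk test_function_H10[OF \<Omega> tv])
    have wn: "L2_norm \<Omega> (weak_pderiv \<Omega> j (v k)) = L2_norm \<Omega> (pderiv_at j (v k))" for j k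
      by (rule L2_norm_cong_AE[OF weak_pderiv_works(1)[OF test_function_H1[OF \<Omega> tv]] dL[OF tv] weak_pderiv_test[OF \<Omega> tv]])
    have semi: "H1_seminorm \<Omega> V = sqrt (A v v)"
      by (simp add: H1_seminorm_def Vk wn A_norm)
    \<comment> \<open>The supremum ranges over fields that are not almost everywhere zero. If
      \<open>V\<close> were, uniqueness of weak derivatives would force
      \<open>A v v = 0\<close>.\<close>
    have "\<not> (AE x in lebesgue_on \<Omega>. V x = 0)"
    proof
      assume "AE x in lebesgue_on \<Omega>. V x = 0"
      then have AE0: "AE x in lebesgue_on \<Omega>. v k x = 0" for k
        unfolding Vk[of k, symmetric] by eventually_elim simp
      have "has_weak_pderiv \<Omega> j (v k) (\<lambda>x. 0)" for j k
        unfolding has_weak_pderiv_def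
      proof
        fix \<psi> assume \<psi>: "\<psi> \<in> test_functions \<Omega>"
        have "?I (v k) (pderiv_at j \<psi>) = ?I (\<lambda>x. 0) (pderiv_at j \<psi>)"
          by (rule L2_inner_cong_AE[OF test_function_L2[OF \<Omega> tv] L2_zero dL[OF \<psi>] dL[OF \<psi>] AE0]) simp
        then show "?I (v k) (pderiv_at j \<psi>) = - ?I (\<lambda>x. 0) \<psi>" by (simp add: L2_inner_def)
      qed
      then have "AE x in lebesgue_on \<Omega>. pderiv_at j (v k) x = 0" for j k
        by (rule has_weak_pderiv_unique[OF \<Omega> dL[OF tv] L2_zero has_weak_pderiv_test[OF \<Omega>(1) tv]])
      then have "L2_norm \<Omega> (pderiv_at j (v k)) = 0" for j k
        using L2_norm_eq_0_iff[OF dL[OF tv]] by blast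
      then show False using Apos by (simp add: A_norm)
    qed
    then have "ereal (?I (weak_div \<Omega> V) q / (H1_seminorm \<Omega> V * L2_norm \<Omega> q)) \<le> ?s"
      using VH by (intro SUP_upper) auto
    then have "ereal (?I (weak_div \<Omega> V) q / (H1_seminorm \<Omega> V * L2_norm \<Omega> q)) < ereal k0"
      using k0(1) by (rule le_less_trans)
    moreover have "?I (weak_div \<Omega> V) q = l v"
    proof -
      have "?I (weak_div \<Omega> V) q = ?I (\<lambda>x. pderiv_at 1 (v 1) x + pderiv_at 2 (v 2) x) q"
      proof (rule L2_inner_cong_AE[OF _ L2_add[OF dL[OF tv] dL[OF tv]] qL qL])
        show "AE x in lebesgue_on \<Omega>. weak_div \<Omega> V x = pderiv_at 1 (v 1) x + pderiv_at 2 (v 2) x"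
          unfolding V_def by (rule div_AE[OF v])
        have "(\<lambda>x. \<Sum>k\<in>UNIV. weak_pderiv \<Omega> k (v k) x) \<in> L2 \<Omega>"
          by (intro L2_sum weak_pderiv_works test_function_H1[OF \<Omega> tv])
        then show "weak_div \<Omega> V \<in> L2 \<Omega>" by (simp add: weak_div_def[abs_def] Vk)
      qed simp
      also have "\<dots> = l v" by (simp add: L2_inner_add_left[OF dL[OF tv] dL[OF tv] qL] l_def sum_2)
      finally show ?thesis .
    qed
    ultimately have "l v / (sqrt (A v v) * Q) < k0" unfolding semi Q_def by simp
    then have "l v / (sqrt (A v v) * Q) \<le> k" by (simp add: k_def)
    then show ?thesis using Apos Q by (simp add: divide_le_eq mult_ac)
  qed
  \<comment> \<open>Riesz representation of \<open>l\<close> in the Dirichlet inner product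
    \<open>A\<close>: the Euler equation of \<open>J\<close> is the weak form of \<Delta> u =
    \<nabla> q. The quantity \<open>d v w\<close> is the Dirichlet energy of the difference of
    \<open>v\<close> and \<open>w\<close>.\<close>
  define J where "J v = 2 * l v - A v v" for v
  define d where "d v w = A v v - 2 * A v w + A w w" for v w
  have J_bound: "J v \<le> (k * Q)\<^sup>2" if "v \<in> S" for v
  proof -
    have "J v \<le> 2 * (k * Q) * sqrt (A v v) - (sqrt (A v v))\<^sup>2"
      using bound[OF that] A_nonneg[of v] by (simp add: J_def)
    also have "\<dots> \<le> (k * Q)\<^sup>2"
      using zero_le_power2[of "k * Q - sqrt (A v v)"] unfolding power2_diff by linarith
    finally show ?thesis .
  qed
  have mid: "\<exists>z\<in>S. J z = (J v + J w) / 2 + d v w / 4" if vw: "v \<in> S" "w \<in> S" for v w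
  proof (rule bexI)
    \<comment> \<open>The midpoint is written as 0 + 1/2 (v + 1 w), so that it arises from two
      instances of the combination rules for \<open>l\<close> and \<open>A\<close>.\<close>
    let ?z1 = "\<lambda>k x. v k x + 1 * w k x" and ?z0 = "\<lambda>(k::2) (x::real^2). 0 :: real"
    note z1 = comb_S[OF vw, of 1]
    show "(\<lambda>k x. ?z0 k x + 1/2 * ?z1 k x) \<in> S" by (rule comb_S[OF zero_S z1])
    have z0: "l ?z0 = 0" "A ?z0 w = 0" for w
      using pderiv_at_eqI[OF has_derivative_const, of _ "0::real"]
      by (simp_all add: l_def A_def L2_inner_def)
    show "J (\<lambda>k x. ?z0 k x + 1/2 * ?z1 k x) = (J v + J w) / 2 + d v w / 4"
      unfolding J_def d_def l_comb[OF zero_S z1] A_comb[OF zero_S z1] l_comb[OF vw] A_comb[OF vw] z0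
      by (simp add: field_simps power2_eq_square)
  qed
  obtain v m where v: "\<And>n. v n \<in> S" and m: "\<And>w. w \<in> S \<Longrightarrow> J w \<le> m"
    and near: "\<And>n. m - 1 / real (Suc n) \<le> J (v n)"
    and cau: "\<And>e. 0 < e \<Longrightarrow> \<exists>N. \<forall>i\<ge>N. \<forall>j\<ge>N. d (v i) (v j) < e"
    by (rule maximising_sequence[of "\<lambda>k x. 0" S J "(k * Q)\<^sup>2" d, OF zero_S J_bound mid]) auto
  have tv: "v n k \<in> test_functions \<Omega>" for n k using v[of n] by (simp add: S_def)
  have "\<forall>k j. \<exists>p. p \<in> L2 \<Omega> \<and> (\<lambda>n. L2_norm \<Omega> (\<lambda>x. pderiv_at j (v n k) x - p x)) \<longlonglongrightarrow> 0"
  proof (intro allI)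
    fix k j
    have le: "(L2_norm \<Omega> (\<lambda>x. pderiv_at j (v n k) x - pderiv_at j (v n' k) x))\<^sup>2 \<le> d (v n) (v n')" for n n'
    proof -
      have "d (v n) (v n') = (\<Sum>k\<in>UNIV. \<Sum>j\<in>UNIV. (L2_norm \<Omega> (\<lambda>x. pderiv_at j (v n k) x - pderiv_at j (v n' k) x))\<^sup>2)"
        unfolding d_def A_def L2_norm_square L2_inner_self_diff[OF dL[OF tv] dL[OF tv]]
        by (simp add: sum.distrib sum_subtractf sum_distrib_left)
      also have "(L2_norm \<Omega> (\<lambda>x. pderiv_at j (v n k) x - pderiv_at j (v n' k) x))\<^sup>2 \<le> \<dots>"
        by (rule member_le_double_sum[of "\<lambda>k j. (L2_norm \<Omega> (\<lambda>x. pderiv_at j (v n k) x - pderiv_at j (v n' k) x))\<^sup>2"]) simp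
      finally show ?thesis .
    qed
    have Cauchy: "\<exists>N. \<forall>i\<ge>N. \<forall>i'\<ge>N. L2_norm \<Omega> (\<lambda>x. pderiv_at j (v i k) x - pderiv_at j (v i' k) x) < e" if "0 < e" for e
    proof -
      obtain N where N: "\<forall>i\<ge>N. \<forall>j\<ge>N. d (v i) (v j) < e\<^sup>2" using cau[of "e\<^sup>2"] \<open>0 < e\<close> by auto
      have "L2_norm \<Omega> (\<lambda>x. pderiv_at j (v i k) x - pderiv_at j (v i' k) x) < e" if "i \<ge> N" "i' \<ge> N" for i i'
      proof (rule power2_less_imp_less)
        show "(L2_norm \<Omega> (\<lambda>x. pderiv_at j (v i k) x - pderiv_at j (v i' k) x))\<^sup>2 < e\<^sup>2"
          using le[of i i'] N that by (meson le_less_trans)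
      qed (use \<open>0 < e\<close> in simp)
      then show ?thesis by blast
    qed
    show "\<exists>p. p \<in> L2 \<Omega> \<and> (\<lambda>n. L2_norm \<Omega> (\<lambda>x. pderiv_at j (v n k) x - p x)) \<longlonglongrightarrow> 0"
    proof (rule L2_complete[where f="\<lambda>n. pderiv_at j (v n k)", OF \<Omega>])
      show "pderiv_at j (v n k) \<in> L2 \<Omega>" for n by (rule dL[OF tv])
      show "\<exists>N. \<forall>i\<ge>N. \<forall>i'\<ge>N. L2_norm \<Omega> (\<lambda>x. pderiv_at j (v i k) x - pderiv_at j (v i' k) x) < e"
        if "0 < e" for e using that by (rule Cauchy)
    qed blast
  qed
  then have "\<forall>k. \<exists>p. \<forall>j. p j \<in> L2 \<Omega> \<and> (\<lambda>n. L2_norm \<Omega> (\<lambda>x. pderiv_at j (v n k) x - p j x)) \<longlonglongrightarrow> 0"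
    by (intro allI choice) simp
  from choice[OF this] obtain p where pL: "\<And>k j. p k j \<in> L2 \<Omega>"
    and p: "\<And>k j. (\<lambda>n. L2_norm \<Omega> (\<lambda>x. pderiv_at j (v n k) x - p k j x)) \<longlonglongrightarrow> 0" by blast
  define P where "P = (\<Sum>k\<in>UNIV. \<Sum>j\<in>UNIV. ?I (p k j) (p k j))"
  have Euler: "l w = (\<Sum>k\<in>UNIV. \<Sum>j\<in>UNIV. ?I (p k j) (pderiv_at j (w k)))" if w: "w \<in> S" for w
  proof -
    have "l w - (\<Sum>k\<in>UNIV. \<Sum>j\<in>UNIV. ?I (p k j) (pderiv_at j (w k))) = 0"
    proof (rule linear_le_quadratic_imp_0[OF _ A_nonneg[of w]])
      fix t :: real
      have tw: "w k \<in> test_functions \<Omega>" for k using w by (simp add: S_def)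
      have le: "2 * t * (l w - A (v n) w) - t\<^sup>2 * A w w \<le> 1 / real (Suc n)" for n
        using m[OF comb_S[OF v w, of n t]] near[of n]
        unfolding J_def l_comb[OF v w] A_comb[OF v w] by (simp add: algebra_simps)
      have "(\<lambda>n. 2 * t * (l w - A (v n) w) - t\<^sup>2 * A w w)
          \<longlonglongrightarrow> 2 * t * (l w - (\<Sum>k\<in>UNIV. \<Sum>j\<in>UNIV. ?I (p k j) (pderiv_at j (w k)))) - t\<^sup>2 * A w w"
        unfolding A_def
        by (intro tendsto_intros L2_inner_tendsto_left[OF dL[OF tv] pL dL[OF tw] p])
      moreover have "(\<lambda>n. 1 / real (Suc n)) \<longlonglongrightarrow> 0" by (rule LIMSEQ_Suc[OF lim_1_over_n])
      ultimately have "2 * t * (l w - (\<Sum>k\<in>UNIV. \<Sum>j\<in>UNIV. ?I (p k j) (pderiv_at j (w k)))) - t\<^sup>2 * A w w \<le> 0"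
        by (rule LIMSEQ_le) (use le in auto)
      then show "2 * t * (l w - (\<Sum>k\<in>UNIV. \<Sum>j\<in>UNIV. ?I (p k j) (pderiv_at j (w k)))) \<le> t\<^sup>2 * A w w" by simp
    qed
    then show ?thesis by simp
  qed
  have lim_lP: "(\<lambda>n. l (v n)) \<longlonglongrightarrow> P"
  proof -
    have "(\<lambda>n. \<Sum>k\<in>UNIV. \<Sum>j\<in>UNIV. ?I (pderiv_at j (v n k)) (p k j)) \<longlonglongrightarrow> P"
      unfolding P_def by (intro tendsto_sum L2_inner_tendsto_left[OF dL[OF tv] pL pL p])
    then show ?thesis unfolding Euler[OF v] by (subst L2_inner_commute)
  qed
  have "(\<lambda>n. l (v n)) \<longlonglongrightarrow> (\<Sum>k\<in>UNIV. ?I (p k k) q)"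
    unfolding l_def by (intro tendsto_sum L2_inner_tendsto_left[OF dL[OF tv] pL qL p])
  with lim_lP have Pq: "P = ?I (p 1 1) q + ?I (p 2 2) q" by (simp add: LIMSEQ_unique sum_2)
  have P0: "0 \<le> P" unfolding P_def by (intro sum_nonneg L2_inner_self_nonneg)
  \<comment> \<open>In the limit both the functional \<open>l\<close> and the Dirichlet energy of
    the sequence equal \<open>P\<close>, so the assumed bound becomes sqrt P \<le> k Q.\<close>
  have "(\<lambda>n. k * Q * sqrt (A (v n) (v n))) \<longlonglongrightarrow> k * Q * sqrt P"
    unfolding A_def P_def
    by (intro tendsto_intros L2_inner_tendsto[OF dL[OF tv] pL dL[OF tv] pL p p])
  with lim_lP have "P \<le> k * Q * sqrt P" by (rule LIMSEQ_le) (use bound[OF v] in auto)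
  then have sqrtP: "sqrt P * sqrt P \<le> k * Q * sqrt P" using P0 by simp
  have "sqrt P \<le> k * Q"
  proof (cases "P = 0")
    case False
    then show ?thesis using P0 by (intro mult_right_le_imp_le[OF sqrtP]) simp
  qed (use k(1) Q in simp)
  then have PkQ: "P \<le> k\<^sup>2 * Q\<^sup>2"
    using power_mono[of "sqrt P" "k * Q" 2] P0 by (simp add: power_mult_distrib)
  have swap: "?I (p i a) (pderiv_at b \<phi>) = ?I (p i b) (pderiv_at a \<phi>)" if \<phi>: "\<phi> \<in> test_functions \<Omega>" for i a b \<phi>
  proof -
    have "?I (pderiv_at a (v n i)) (pderiv_at b \<phi>) = ?I (pderiv_at b (v n i)) (pderiv_at a \<phi>)" for n
      unfolding L2_inner_test[OF \<Omega>(1) test_function_pderiv[OF \<phi>]] by (rule integral_pderiv_swap[OF tv \<phi>])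
    moreover have "(\<lambda>n. ?I (pderiv_at a (v n i)) (pderiv_at b \<phi>)) \<longlonglongrightarrow> ?I (p i a) (pderiv_at b \<phi>)"
      by (rule L2_inner_tendsto_left[OF dL[OF tv] pL dL[OF \<phi>] p])
    moreover have "(\<lambda>n. ?I (pderiv_at b (v n i)) (pderiv_at a \<phi>)) \<longlonglongrightarrow> ?I (p i b) (pderiv_at a \<phi>)"
      by (rule L2_inner_tendsto_left[OF dL[OF tv] pL dL[OF \<phi>] p])
    ultimately show ?thesis by (simp add: LIMSEQ_unique)
  qed
  have null: "?I (p 1 1) (p 2 2) = ?I (p 1 2) (p 2 1)"
  proof -
    have "(\<lambda>n. ?I (pderiv_at 2 (v n 2)) (p 1 1)) \<longlonglongrightarrow> ?I (p 2 2) (p 1 1)"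
      by (rule L2_inner_tendsto_left[OF dL[OF tv] pL pL p])
    moreover have "(\<lambda>n. ?I (pderiv_at 1 (v n 2)) (p 1 2)) \<longlonglongrightarrow> ?I (p 2 1) (p 1 2)"
      by (rule L2_inner_tendsto_left[OF dL[OF tv] pL pL p])
    moreover have "?I (pderiv_at 2 (v n 2)) (p 1 1) = ?I (pderiv_at 1 (v n 2)) (p 1 2)" for n
      using swap[OF tv, of 1 1 2] by (simp add: L2_inner_commute)
    ultimately have "?I (p 2 2) (p 1 1) = ?I (p 2 1) (p 1 2)" by (simp add: LIMSEQ_unique)
    then show ?thesis by (metis L2_inner_commute)
  qed
  have p_mean: "(LINT x|lebesgue_on \<Omega>. p i j x) = 0" for i j
  proof -
    have one: "(\<lambda>x. 1) \<in> L2 \<Omega>" by (rule L2_const[OF \<Omega>])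
    have "(\<lambda>n. ?I (pderiv_at j (v n i)) (\<lambda>x. 1)) \<longlonglongrightarrow> ?I (p i j) (\<lambda>x. 1)"
      by (rule L2_inner_tendsto_left[OF dL[OF tv] pL one p])
    moreover have "?I (pderiv_at j (v n i)) (\<lambda>x. 1) = 0" for n
    proof -
      have "?I (pderiv_at j (v n i)) (\<lambda>x. 1) = (LINT x|lebesgue. pderiv_at j (v n i) x)"
        unfolding L2_inner_def mult_1_right
        by (rule integral_lebesgue_on_eq[OF \<Omega>(1)]) (rule test_function_outside[OF test_function_pderiv[OF tv]])
      then show ?thesis
        using integral_pderiv_eq_0(2)[OF test_function_Ck[OF tv] test_function_compact[OF tv]] by simp
    qed
    ultimately show ?thesis by (simp add: LIMSEQ_const_iff L2_inner_def)
  qed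
  define D where "D = (\<lambda>x. p 1 1 x + p 2 2 x)"
  define g where "g = (\<lambda>x. p 1 2 x - p 2 1 x)"
  define h where "h = (\<lambda>x. q x - D x)"
  have DL: "D \<in> L2 \<Omega>" and gL: "g \<in> L2 \<Omega>" unfolding D_def g_def by (intro L2_add L2_diff pL)+
  have hL: "h \<in> L2 \<Omega>" unfolding h_def by (intro L2_diff qL DL)
  have h_mean: "h \<in> L2_mean_zero \<Omega>"
    using hL L2_integrable[OF \<Omega> qL] L2_integrable[OF \<Omega> pL] q_mean p_mean
    by (simp add: L2_mean_zero_def h_def D_def)
  have CR: "weak_Cauchy_Riemann \<Omega> h g"
    unfolding weak_Cauchy_Riemann_def
  proof
    fix \<phi> assume \<phi>: "\<phi> \<in> test_functions \<Omega>"
    have pd0: "pderiv_at j (\<lambda>x. 0) = (\<lambda>x. 0)" for j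
      using pderiv_at_eqI[OF has_derivative_const, of j "0::real"] by auto
    have I0: "?I u (\<lambda>x. 0) = 0" "?I (\<lambda>x. 0) u = 0" for u by (simp_all add: L2_inner_def)
    \<comment> \<open>Testing the Euler equation with the fields (\<phi>, 0) and (0, \<phi>) and
      exchanging weak derivatives through \<open>swap\<close> gives the two Cauchy-Riemann
      equations.\<close>
    have "(\<lambda>k. if k = 1 then \<phi> else (\<lambda>x. 0)) \<in> S" "(\<lambda>k. if k = 2 then \<phi> else (\<lambda>x. 0)) \<in> S"
      using \<phi> by (auto simp: S_def test_function_zero)
    from Euler[OF this(1)] Euler[OF this(2)]
    have E1: "?I (pderiv_at 1 \<phi>) q = ?I (p 1 1) (pderiv_at 1 \<phi>) + ?I (p 1 2) (pderiv_at 2 \<phi>)"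
      and E2: "?I (pderiv_at 2 \<phi>) q = ?I (p 2 1) (pderiv_at 1 \<phi>) + ?I (p 2 2) (pderiv_at 2 \<phi>)"
      by (simp_all add: l_def sum_2 pd0 I0)
    have h_exp: "?I h (pderiv_at j \<phi>) = ?I (pderiv_at j \<phi>) q - (?I (p 1 1) (pderiv_at j \<phi>) + ?I (p 2 2) (pderiv_at j \<phi>))" for j
      unfolding h_def D_def L2_inner_diff_left[OF qL L2_add[OF pL pL] dL[OF \<phi>]] L2_inner_add_left[OF pL pL dL[OF \<phi>]]
      by (simp add: L2_inner_commute)
    have g_exp: "?I g (pderiv_at j \<phi>) = ?I (p 1 2) (pderiv_at j \<phi>) - ?I (p 2 1) (pderiv_at j \<phi>)" for j
      unfolding g_def by (rule L2_inner_diff_left[OF pL pL dL[OF \<phi>]])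
    show "?I h (pderiv_at 1 \<phi>) = ?I g (pderiv_at 2 \<phi>) \<and> ?I h (pderiv_at 2 \<phi>) = - ?I g (pderiv_at 1 \<phi>)"
      unfolding h_exp g_exp E1 E2
      using swap[OF \<phi>, of 2 2 1] swap[OF \<phi>, of 1 1 2] by simp
  qed
  define H where "H = ?I h h"
  define G where "G = ?I g g"
  define E where "E = ?I D D"
  have HG: "H \<le> \<Gamma> * G" using Friedrichs[OF h_mean gL CR] by (simp add: H_def G_def L2_norm_square)
  have nonneg: "0 \<le> H" "0 \<le> G" "0 \<le> E" unfolding H_def G_def E_def by (rule L2_inner_self_nonneg)+
  have PEG: "P = E + G"
    unfolding P_def E_def G_def D_def g_def L2_inner_self_add[OF pL pL] L2_inner_self_diff[OF pL pL]
    using null by (simp add: sum_2)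
  \<comment> \<open>The Euler equation tested with the solution itself gives \<langle>q, D\<rangle>
    = P, and P = E + G; subtracting E leaves G.\<close>
  have hD: "?I h D = G"
  proof -
    have "?I h D = ?I q D - E" unfolding h_def E_def by (rule L2_inner_diff_left[OF qL DL DL])
    also have "?I q D = P"
      unfolding D_def Pq L2_inner_add_right[OF pL pL qL] by (simp add: L2_inner_commute)
    finally show ?thesis using PEG by simp
  qed
  have Q2: "Q\<^sup>2 = H + 2 * G + E"
  proof -
    have "Q\<^sup>2 = ?I (\<lambda>x. h x + D x) (\<lambda>x. h x + D x)" by (simp add: Q_def L2_norm_square h_def)
    then show ?thesis unfolding L2_inner_self_add[OF hL DL] hD H_def E_def by simp
  qed
  \<comment> \<open>Friedrichs' inequality is used twice: Cauchy-Schwarz for \<langle>h, D\<rangle>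
    = G together with H \<le> \<Gamma> G yields G \<le> \<Gamma> E. Then H + 2 G + E \<le> (1 +
    \<Gamma>) (E + G).\<close>
  have "G \<le> \<Gamma> * E"
  proof (cases "G = 0")
    case False
    have "\<bar>G\<bar> \<le> L2_norm \<Omega> h * L2_norm \<Omega> D" using L2_Cauchy_Schwarz[OF hL DL] hD by simp
    then have "G\<^sup>2 \<le> H * E"
      using power_mono[of "\<bar>G\<bar>" "L2_norm \<Omega> h * L2_norm \<Omega> D" 2]
      by (simp add: power_mult_distrib L2_norm_square H_def E_def)
    also have "\<dots> \<le> \<Gamma> * G * E" by (rule mult_right_mono[OF HG nonneg(3)])
    finally have "G * G \<le> (\<Gamma> * E) * G" by (simp add: power2_eq_square mult_ac)
    then show ?thesis using False nonneg(2) by simp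
  qed (use nonneg \<Gamma> in simp)
  then have QP: "Q\<^sup>2 \<le> (1 + \<Gamma>) * P" unfolding Q2 PEG using HG by (simp add: algebra_simps)
  have k2: "k\<^sup>2 * (1 + \<Gamma>) < 1"
  proof -
    have "k\<^sup>2 < (1 / sqrt (1 + \<Gamma>))\<^sup>2" using k by (intro power_strict_mono) auto
    then show ?thesis using \<Gamma> by (simp add: power_divide field_simps)
  qed
  have "Q\<^sup>2 \<le> (1 + \<Gamma>) * (k\<^sup>2 * Q\<^sup>2)" using QP PkQ \<Gamma> by (meson add_nonneg_nonneg mult_left_mono order_trans zero_le_one)
  also have "\<dots> = (k\<^sup>2 * (1 + \<Gamma>)) * Q\<^sup>2" by simp
  also have "\<dots> < 1 * Q\<^sup>2" using k2 Q by (intro mult_strict_right_mono) auto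
  finally show False by simp
qed

section \<open>The Horgan--Payne estimate on convex polygons\<close>

text \<open>A segment from \<open>D\<close> to its complement meets the frontier, where
  \<open>f\<close> is 0, at a point no farther away than the outer end.\<close>

lemma Lipschitz_extend_zero:
  fixes f :: "real^2 \<Rightarrow> real"
  assumes D: "closed D" and L: "0 \<le> L" "\<And>x y. x \<in> D \<Longrightarrow> y \<in> D \<Longrightarrow> \<bar>f x - f y\<bar> \<le> L * norm (x - y)"
    and front: "\<And>x. x \<in> frontier D \<Longrightarrow> f x = 0" and out: "\<And>x. x \<notin> D \<Longrightarrow> f x = 0"
  shows "\<bar>f x - f y\<bar> \<le> L * norm (x - y)"
proof -
  have mixed: "\<bar>f x - f y\<bar> \<le> L * norm (x - y)" if x: "x \<in> D" and y: "y \<notin> D" for x y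
  proof -
    have "closed_segment x y \<inter> frontier D \<noteq> {}"
      by (rule connected_Int_frontier) (use x y in auto)
    then obtain z where z: "z \<in> closed_segment x y" "z \<in> frontier D" by blast
    have zD: "z \<in> D" using z(2) D frontier_subset_closed by blast
    have "\<bar>f x - f y\<bar> = \<bar>f x - f z\<bar>" using front[OF z(2)] out[OF y] by simp
    also have "\<dots> \<le> L * norm (x - z)" by (rule L(2)[OF x zD])
    also have "\<dots> \<le> L * norm (x - y)"
      using segment_bound1[OF z(1)] by (intro mult_left_mono L(1)) (simp add: norm_minus_commute)
    finally show ?thesis .
  qed
  show ?thesis
  proof (cases "x \<in> D"; cases "y \<in> D")
    assume "x \<notin> D" "y \<in> D"
    then show ?thesis using mixed[of y x] by (simp add: norm_minus_commute abs_minus_commute)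
  next
    assume "x \<notin> D" "y \<notin> D"
    then show ?thesis using out L(1) by simp
  qed (use L(2) mixed in auto)
qed

text \<open>A directional derivative that exists almost everywhere agrees there with a limit of
  continuous difference quotients; completeness of Lebesgue measure does the rest.\<close>

lemma quotient_limit_measurable:
  fixes f :: "real^2 \<Rightarrow> real"
  assumes f: "continuous_on UNIV f"
    and lim: "AE x in lebesgue. ((\<lambda>t. (f (x + t *\<^sub>R e) - f x) / t) \<longlongrightarrow> d x) (at_right 0)"
  shows "d \<in> borel_measurable lebesgue"
proof -
  define s where "s n x = (f (x + (1 / real (Suc n)) *\<^sub>R e) - f x) / (1 / real (Suc n))" for n x
  have [measurable]: "f \<in> borel_measurable borel" by (rule borel_measurable_continuous_onI[OF f])
  have "s n \<in> borel_measurable borel" for n unfolding s_def by measurable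
  then have s [measurable]: "s n \<in> borel_measurable lebesgue" for n
    by (intro measurable_completion) simp
  have "filterlim (\<lambda>n. 1 / real (Suc n)) (at_right 0) sequentially"
    by (intro filterlim_at_withinI LIMSEQ_Suc[OF lim_1_over_n]) auto
  note t_right = this
  have AE: "AE x in lebesgue. lim (\<lambda>n. s n x) = d x"
    using lim
  proof eventually_elim
    case (elim x)
    show ?case unfolding s_def by (rule limI[OF filterlim_compose[OF elim t_right]])
  qed
  have "(\<lambda>x. lim (\<lambda>n. s n x)) \<in> borel_measurable lebesgue" by measurable
  then show ?thesis by (rule borel_measurable_AE[OF _ AE])
qed

lemma quadratic_form_nonneg:
  fixes a b w x y :: real
  assumes "0 \<le> a" "0 \<le> b" "w\<^sup>2 \<le> a * b"
  shows "0 \<le> a * x\<^sup>2 + 2 * w * x * y + b * y\<^sup>2"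
proof -
  have "\<bar>w\<bar> \<le> sqrt a * sqrt b"
    using assms by (simp add: real_sqrt_mult[symmetric] real_le_rsqrt)
  then have "\<bar>w\<bar> * (\<bar>x\<bar> * \<bar>y\<bar>) \<le> sqrt a * sqrt b * (\<bar>x\<bar> * \<bar>y\<bar>)"
    by (rule mult_right_mono) simp
  moreover have "- (w * x * y) \<le> \<bar>w\<bar> * (\<bar>x\<bar> * \<bar>y\<bar>)"
    by (metis abs_ge_minus_self abs_mult mult.assoc)
  moreover have "0 \<le> (sqrt a * \<bar>x\<bar> - sqrt b * \<bar>y\<bar>)\<^sup>2" by simp
  ultimately show ?thesis using assms by (simp add: power2_diff power_mult_distrib algebra_simps)
qed

text \<open>With \<open>u = n\<^sup>2 / r2\<close> the discriminant condition is linear in \<open>u\<close> and becomes an equality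
  at \<open>u = 1 / R\<^sup>2\<close>; here \<open>(1 - C) / \<delta>\<^sup>2 = 1 / (R\<^sup>2 (1 + C))\<close>.\<close>

lemma horgan_payne_pointwise:
  fixes h g g0 n k r2 :: real
  assumes \<delta>: "0 < \<delta>" and R: "0 < R" and C: "0 \<le> C" "C < 1" "C\<^sup>2 = 1 - \<delta>\<^sup>2 / R\<^sup>2"
    and r2: "0 < r2" and n: "r2 \<le> n\<^sup>2 * R\<^sup>2" and k: "n\<^sup>2 + k\<^sup>2 \<le> r2 / \<delta>\<^sup>2"
  shows "(1 - C) / \<delta>\<^sup>2 * h\<^sup>2 - (1 + C) / \<delta>\<^sup>2 * g\<^sup>2
    \<le> (n\<^sup>2 * (h\<^sup>2 - g\<^sup>2 + g0\<^sup>2) + n * k * (2 * h * g)) / r2"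
proof -
  define u where "u = n\<^sup>2 / r2"
  define w where "w = n * k / r2"
  define \<alpha> where "\<alpha> = (1 - C) / \<delta>\<^sup>2"
  define \<beta> where "\<beta> = (1 + C) / \<delta>\<^sup>2"
  have \<delta>R: "1 / R\<^sup>2 = (1 - C\<^sup>2) / \<delta>\<^sup>2" using C(3) \<delta> R by (simp add: field_simps)
  \<comment> \<open>Sum and product characterise \<alpha> and \<beta> as the roots of t^2 - (2 /
    \<delta>^2) t + 1 / (R \<delta>)^2, so (u - \<alpha>) (\<beta> - u) is minus this polynomial at
    u.\<close>
  have \<alpha>\<beta>: "\<alpha> * \<beta> = 1 / R\<^sup>2 * (1 / \<delta>\<^sup>2)" "\<alpha> + \<beta> = 2 / \<delta>\<^sup>2"
    unfolding \<alpha>_def \<beta>_def \<delta>R using \<delta> by (simp_all add: field_simps power2_eq_square)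
  have u1: "1 / R\<^sup>2 \<le> u" using n r2 R by (simp add: u_def field_simps)
  have "n\<^sup>2 \<le> r2 / \<delta>\<^sup>2" using k zero_le_power2[of k] by linarith
  then have u2: "u \<le> 1 / \<delta>\<^sup>2" using r2 \<delta> by (simp add: u_def field_simps)
  have "\<alpha> \<le> 1 / R\<^sup>2"
  proof -
    have "(1 - C) * 1 \<le> (1 - C) * (1 + C)" using C by (intro mult_left_mono) auto
    then have "1 - C \<le> 1 - C\<^sup>2" by (simp add: algebra_simps power2_eq_square)
    then show ?thesis unfolding \<alpha>_def \<delta>R by (rule divide_right_mono) simp
  qed
  then have \<alpha>u: "\<alpha> \<le> u" using u1 by linarith
  have "1 / \<delta>\<^sup>2 \<le> \<beta>" unfolding \<beta>_def using C by (intro divide_right_mono) auto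
  then have u\<beta>: "u \<le> \<beta>" using u2 by linarith
  have u0: "0 \<le> u" using r2 by (simp add: u_def)
  have "w\<^sup>2 = u * (k\<^sup>2 / r2)" by (simp add: w_def u_def power2_eq_square)
  also have "k\<^sup>2 / r2 \<le> 1 / \<delta>\<^sup>2 - u"
    using k r2 by (simp add: u_def field_simps)
  then have "u * (k\<^sup>2 / r2) \<le> u * (1 / \<delta>\<^sup>2 - u)" by (rule mult_left_mono[OF _ u0])
  \<comment> \<open>The right side exceeds the left by (u - 1 / R^2) / \<delta>^2, which is where
    the farthest distance R enters.\<close>
  also have "\<dots> \<le> (u - \<alpha>) * (\<beta> - u)"
  proof -
    have "(u - \<alpha>) * (\<beta> - u) = u * (\<alpha> + \<beta>) - \<alpha> * \<beta> - u\<^sup>2" by (simp add: algebra_simps power2_eq_square)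
    also have "\<dots> = u * (1 / \<delta>\<^sup>2 - u) + (u - 1 / R\<^sup>2) * (1 / \<delta>\<^sup>2)"
      unfolding \<alpha>\<beta> by (simp add: algebra_simps power2_eq_square)
    finally show ?thesis using mult_nonneg_nonneg[of "u - 1 / R\<^sup>2" "1 / \<delta>\<^sup>2"] u1 by simp
  qed
  finally have "0 \<le> (u - \<alpha>) * h\<^sup>2 + 2 * w * h * g + (\<beta> - u) * g\<^sup>2"
    using \<alpha>u u\<beta> by (intro quadratic_form_nonneg) auto
  \<comment> \<open>The value of the second function at the centre enters with a favourable sign, so
    only the first one has to be normalised there.\<close>
  moreover have "0 \<le> u * g0\<^sup>2" using u0 by simp
  moreover have "(n\<^sup>2 * (h\<^sup>2 - g\<^sup>2 + g0\<^sup>2) + n * k * (2 * h * g)) / r2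
      = u * h\<^sup>2 - u * g\<^sup>2 + u * g0\<^sup>2 + 2 * w * h * g"
    using r2 by (simp add: u_def w_def field_simps)
  ultimately show ?thesis unfolding \<alpha>_def[symmetric] \<beta>_def[symmetric] by (simp add: algebra_simps)
qed

section \<open>The gauge of a convex polygon\<close>

locale polygon =
  fixes A :: "(real^2) set" and c :: "real^2"
  assumes fin: "finite A" and bdd: "bounded {x. \<forall>m\<in>A. m \<bullet> (x - c) \<le> 1}"
begin

text \<open>Each side is encoded by its polar vector \<open>m\<close>: the line where the form is 1
  has distance \<open>1 / norm m\<close> from \<open>c\<close>, and the gauge becomes a maximum of
  linear forms. Bounds on \<open>norm m\<close> are thus bounds on the distance of the
  sides.\<close>

definition D :: "(real^2) set" where "D = {x. \<forall>m\<in>A. m \<bullet> (x - c) \<le> 1}"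

definition N :: "real^2 \<Rightarrow> real" where "N x = Max ((\<lambda>m. m \<bullet> (x - c)) ` A)"

definition normal :: "real^2 \<Rightarrow> real^2" where "normal x = (SOME m. m \<in> A \<and> N x = m \<bullet> (x - c))"

lemma A_ne: "A \<noteq> {}"
  using bdd not_bounded_UNIV by force

lemma N_ge: "m \<in> A \<Longrightarrow> m \<bullet> (x - c) \<le> N x"
  unfolding N_def using fin by (intro Max_ge) auto

lemma normal: "normal x \<in> A" "N x = normal x \<bullet> (x - c)"
proof -
  have "N x \<in> (\<lambda>m. m \<bullet> (x - c)) ` A"
    unfolding N_def using fin A_ne by (intro Max_in) auto
  then have "\<exists>m. m \<in> A \<and> N x = m \<bullet> (x - c)" by blast
  from someI_ex[OF this] show "normal x \<in> A" "N x = normal x \<bullet> (x - c)"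
    unfolding normal_def by blast+
qed

lemma N_le_iff: "N x \<le> t \<longleftrightarrow> (\<forall>m\<in>A. m \<bullet> (x - c) \<le> t)"
  using N_ge normal by (metis order_trans)

lemma D_iff: "x \<in> D \<longleftrightarrow> N x \<le> 1"
  by (simp add: D_def N_le_iff)

lemma N_scale: "0 \<le> s \<Longrightarrow> N (c + s *\<^sub>R (x - c)) = s * N x"
proof (rule antisym)
  assume s: "0 \<le> s"
  show "N (c + s *\<^sub>R (x - c)) \<le> s * N x"
    unfolding N_le_iff using N_ge[of _ x] s by (auto intro: mult_left_mono)
  show "s * N x \<le> N (c + s *\<^sub>R (x - c))"
    using N_ge[OF normal(1)[of x], of "c + s *\<^sub>R (x - c)"] normal(2)[of x] by simp
qed

lemma N_pos:
  assumes "x \<noteq> c"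
  shows "0 < N x"
proof (rule ccontr)
  assume neg: "\<not> 0 < N x"
  obtain B where B: "\<And>x. x \<in> D \<Longrightarrow> norm x \<le> B"
    using bdd unfolding bounded_iff D_def by blast
  \<comment> \<open>If \<open>N x \<le> 0\<close>, the whole ray from \<open>c\<close> through
    \<open>x\<close> lies in \<open>D\<close>; this \<open>s\<close> moves along it to distance
    \<bar>B\<bar> + norm c + 1, beyond the bound.\<close>
  define s where "s = (\<bar>B\<bar> + norm c + 1) / norm (x - c)"
  have s: "0 \<le> s" by (simp add: s_def)
  have "N (c + s *\<^sub>R (x - c)) \<le> 1" using N_scale[OF s, of x] neg s by (smt (verit) mult_nonneg_nonpos)
  then have "norm (c + s *\<^sub>R (x - c)) \<le> B" using B D_iff by blast
  moreover have "norm (s *\<^sub>R (x - c)) = \<bar>B\<bar> + norm c + 1" using assms s by (simp add: s_def)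
  moreover have "norm (s *\<^sub>R (x - c)) \<le> norm (c + s *\<^sub>R (x - c)) + norm c"
    using norm_triangle_ineq4[of "c + s *\<^sub>R (x - c)" c] by simp
  ultimately show False by linarith
qed

lemma N_c: "N c = 0"
  using normal(2)[of c] by simp

lemma N_nonneg: "0 \<le> N x"
  using N_pos[of x] N_c by (cases "x = c") auto

lemma N_Lipschitz:
  assumes "\<And>m. m \<in> A \<Longrightarrow> norm m \<le> M"
  shows "\<bar>N x - N y\<bar> \<le> M * norm (x - y)"
proof -
  have "N x - N y \<le> M * norm (x - y)" for x y
  proof -
    have "N x - N y \<le> normal x \<bullet> (x - c) - normal x \<bullet> (y - c)"
      using normal[of x] N_ge[OF normal(1)[of x], of y] by simp
    also have "\<dots> = normal x \<bullet> (x - y)" by (simp add: inner_diff_right)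
    also have "\<dots> \<le> norm (normal x) * norm (x - y)" by (rule norm_cauchy_schwarz)
    also have "\<dots> \<le> M * norm (x - y)" by (intro mult_right_mono assms normal) simp
    finally show ?thesis .
  qed
  from this[of x y] this[of y x] show ?thesis by (simp add: norm_minus_commute abs_le_iff)
qed

lemma N_continuous: "continuous_on UNIV N"
proof -
  have "0 \<le> (\<Sum>m\<in>A. norm m)" by (intro sum_nonneg) simp
  moreover have "norm m \<le> (\<Sum>m\<in>A. norm m)" if "m \<in> A" for m
    using that fin by (intro member_le_sum) auto
  ultimately have "(\<Sum>m\<in>A. norm m)-lipschitz_on UNIV N"
    using N_Lipschitz by (intro lipschitz_onI) (auto simp: dist_norm)
  then show ?thesis by (rule lipschitz_on_continuous_on)
qed

lemma closed_D: "closed D"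
proof -
  have "D = {x. N x \<le> 1}" using D_iff by blast
  then show ?thesis using closed_Collect_le[OF N_continuous, of "\<lambda>x. 1"] by simp
qed

lemma compact_D: "compact D"
  using closed_D bdd unfolding D_def by (simp add: compact_eq_bounded_closed)

lemma convex_D: "convex D"
proof -
  have "D = (\<Inter>m\<in>A. {x. m \<bullet> x \<le> 1 + m \<bullet> c})"
    by (auto simp: D_def inner_diff_right algebra_simps)
  then show ?thesis by (simp add: convex_INT convex_halfspace_le)
qed

lemma open_N_less: "open {x. N x < t}"
  by (rule open_Collect_less[OF N_continuous]) simp

lemma frontier_D: "x \<in> frontier D \<Longrightarrow> N x = 1"
proof -
  assume x: "x \<in> frontier D"
  have "N x \<le> 1" using x closed_D D_iff frontier_subset_closed by blast
  moreover have "\<not> N x < 1"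
  proof
    assume "N x < 1"
    moreover have "{x. N x < 1} \<subseteq> interior D"
      by (rule interior_maximal[OF _ open_N_less]) (auto simp: D_iff)
    ultimately show False using x by (auto simp: frontier_def)
  qed
  ultimately show ?thesis by simp
qed

text \<open>Off a null set the gauge \<open>N\<close> is locally \<open>m \<bullet> (x - c)\<close> for a single \<open>m\<close>. The field
  \<open>(1 - N\<^sup>2) V\<close> is Lipschitz and vanishes on the boundary, so its divergence, which is
  \<open>-2 N m \<bullet> V\<close>, has integral zero.\<close>

lemma integral_gauge_field:
  fixes V :: "2 \<Rightarrow> real^2 \<Rightarrow> real"
  assumes lip: "0 \<le> L" "\<And>j x y. x \<in> D \<Longrightarrow> y \<in> D \<Longrightarrow> \<bar>V j x - V j y\<bar> \<le> L * norm (x - y)"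
    and bd: "\<And>j x. x \<in> D \<Longrightarrow> \<bar>V j x\<bar> \<le> K"
    and deriv: "\<And>j x. N x < 1 \<Longrightarrow> (V j has_derivative V' j x) (at x)"
    and div: "\<And>x. N x < 1 \<Longrightarrow> V' 1 x (axis 1 1) + V' 2 x (axis 2 1) = 0"
  defines "E \<equiv> (\<lambda>x. if x \<in> D then N x * (normal x $ 1 * V 1 x + normal x $ 2 * V 2 x) else 0)"
  shows "integrable lebesgue E" "(LINT x|lebesgue. E x) = 0"
proof -
  define \<Phi> where "\<Phi> j x = (if x \<in> D then (1 - (N x)\<^sup>2) * V j x else 0)" for j x
  define M where "M = (\<Sum>m\<in>A. norm m)"
  have M: "0 \<le> M" "norm m \<le> M" if "m \<in> A" for m
    using that fin by (auto simp: M_def intro!: sum_nonneg member_le_sum)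
  have M0: "0 \<le> M" by (auto simp: M_def intro!: sum_nonneg)
  have c_D: "c \<in> D" by (simp add: D_iff N_c)
  have K: "0 \<le> K" using bd[OF c_D, of 1] by linarith
  \<comment> \<open>On \<open>D\<close> the gauge is at most 1, so its square has Lipschitz constant
    2 M there; the rest is the product rule for Lipschitz bounds.\<close>
  define \<Lambda> where "\<Lambda> = L + K * (2 * M)"
  have \<Lambda>: "0 \<le> \<Lambda>" using lip(1) K M0 by (simp add: \<Lambda>_def)
  have \<Phi>_lip_D: "\<bar>\<Phi> j x - \<Phi> j y\<bar> \<le> \<Lambda> * norm (x - y)" if x: "x \<in> D" and y: "y \<in> D" for j x y
  proof -
    have Nb: "0 \<le> N x" "N x \<le> 1" "0 \<le> N y" "N y \<le> 1" using x y N_nonneg D_iff by auto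
    have sq: "(N x)\<^sup>2 \<le> 1" using Nb by (simp add: power_le_one)
    have "\<bar>1 - (N x)\<^sup>2\<bar> \<le> 1" using sq by simp
    then have 1: "\<bar>(1 - (N x)\<^sup>2) * (V j x - V j y)\<bar> \<le> 1 * (L * norm (x - y))"
      unfolding abs_mult by (rule mult_mono[OF _ lip(2)[OF x y]]) auto
    have "\<bar>(N y)\<^sup>2 - (N x)\<^sup>2\<bar> = \<bar>N x - N y\<bar> * (N x + N y)"
      using Nb by (simp add: power2_eq_square square_diff_square_factored abs_mult abs_minus_commute add.commute)
    also have "\<dots> \<le> (M * norm (x - y)) * 2"
      using Nb by (intro mult_mono N_Lipschitz M) (auto intro!: mult_nonneg_nonneg M0)
    finally have 2: "\<bar>V j y * ((N y)\<^sup>2 - (N x)\<^sup>2)\<bar> \<le> K * ((M * norm (x - y)) * 2)"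
      unfolding abs_mult by (intro mult_mono bd[OF y]) (use K in auto)
    have "\<Phi> j x - \<Phi> j y = (1 - (N x)\<^sup>2) * (V j x - V j y) + V j y * ((N y)\<^sup>2 - (N x)\<^sup>2)"
      using x y by (simp add: \<Phi>_def algebra_simps)
    then have "\<bar>\<Phi> j x - \<Phi> j y\<bar> \<le> 1 * (L * norm (x - y)) + K * ((M * norm (x - y)) * 2)"
      using 1 2 by linarith
    also have "\<dots> = \<Lambda> * norm (x - y)" by (simp add: \<Lambda>_def algebra_simps)
    finally show ?thesis .
  qed
  have \<Phi>_lip: "\<bar>\<Phi> j x - \<Phi> j y\<bar> \<le> \<Lambda> * norm (x - y)" for j x y
  proof (rule Lipschitz_extend_zero[OF closed_D \<Lambda> \<Phi>_lip_D])
    show "\<Phi> j x = 0" if "x \<in> frontier D" for x using frontier_D[OF that] by (simp add: \<Phi>_def)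
  qed (auto simp: \<Phi>_def)
  define d where "d j x = (if x \<in> D then - 2 * N x * (normal x $ j) * V j x
      + (1 - (N x)\<^sup>2) * V' j x (axis j 1) else 0)" for j x
  \<comment> \<open>The null set consists of the side lines and of the lines on which two of the
    forms agree. Off it a point is either outside \<open>D\<close>, or near it exactly one form is
    active and the gauge is linear.\<close>
  define Z where "Z = (\<Union>m\<in>A. {x. m \<bullet> x = 1 + m \<bullet> c})
      \<union> (\<Union>p\<in>{p \<in> A \<times> A. fst p \<noteq> snd p}. {x. (fst p - snd p) \<bullet> x = (fst p - snd p) \<bullet> c})"
  have "negligible Z"
  proof -
    have 1: "negligible {x. m \<bullet> x = 1 + m \<bullet> c}" for m :: "real^2"
      by (rule negligible_hyperplane) auto
    have 2: "negligible {x. (fst p - snd p) \<bullet> x = (fst p - snd p) \<bullet> c}" if "fst p \<noteq> snd p"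
      for p :: "(real^2) \<times> (real^2)"
      by (rule negligible_hyperplane) (use that in auto)
    have "finite {p \<in> A \<times> A. fst p \<noteq> snd p}" using fin by auto
    then show ?thesis unfolding Z_def using fin 1 2 by (intro negligible_Un negligible_Union) auto
  qed
  then have AE_Z: "AE x in lebesgue. x \<notin> Z"
    unfolding eventually_ae_filter_negligible by (intro exI[of _ Z]) auto
  have \<Phi>_deriv: "\<exists>\<Phi>'. (\<Phi> j has_derivative \<Phi>') (at x) \<and> \<Phi>' (axis j 1) = d j x" if x: "x \<notin> Z" for j x
  proof (cases "x \<in> D")
    case False
    have "((\<lambda>x. 0 :: real) has_derivative (\<lambda>v. 0)) (at x)" by simp
    then have "(\<Phi> j has_derivative (\<lambda>v. 0)) (at x)"
      by (rule has_derivative_transform_within_open[where s="- D"])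
         (use False closed_D in \<open>auto simp: \<Phi>_def\<close>)
    then show ?thesis using False by (auto simp: d_def)
  next
    case True
    let ?m = "normal x"
    have mA: "?m \<in> A" by (rule normal)
    have "m \<bullet> (x - c) \<noteq> 1" if "m \<in> A" for m
      using x that by (auto simp: Z_def inner_diff_right)
    then have "N x < 1" using True normal[of x] D_iff[of x] by fastforce
    have uniq: "m \<bullet> (x - c) < ?m \<bullet> (x - c)" if "m \<in> A" "m \<noteq> ?m" for m
    proof -
      have "(m - ?m) \<bullet> x \<noteq> (m - ?m) \<bullet> c"
        using x that mA unfolding Z_def by force
      then have "m \<bullet> (x - c) \<noteq> ?m \<bullet> (x - c)" by (simp add: inner_diff_left inner_diff_right algebra_simps)
      moreover have "m \<bullet> (x - c) \<le> ?m \<bullet> (x - c)" using N_ge[OF that(1), of x] normal(2)[of x] by simp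
      ultimately show ?thesis by simp
    qed
    define W where "W = {y. N y < 1} \<inter> (\<Inter>m\<in>A - {?m}. {y. m \<bullet> (y - c) < ?m \<bullet> (y - c)})"
    have W: "open W" "x \<in> W"
    proof -
      have "open (\<Inter>m\<in>A - {?m}. {y. m \<bullet> (y - c) < ?m \<bullet> (y - c)})"
        using fin by (intro open_INT ballI open_Collect_less continuous_intros) auto
      then show "open W" unfolding W_def by (intro open_Int open_N_less)
      show "x \<in> W" using \<open>N x < 1\<close> uniq by (auto simp: W_def)
    qed
    have N_W: "N y = ?m \<bullet> (y - c)" if "y \<in> W" for y
    proof (rule antisym)
      show "N y \<le> ?m \<bullet> (y - c)"
        unfolding N_le_iff
      proof
        fix m assume "m \<in> A"
        then show "m \<bullet> (y - c) \<le> ?m \<bullet> (y - c)"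
          using that by (cases "m = ?m") (auto simp: W_def less_imp_le)
      qed
    qed (rule N_ge[OF mA])
    have "((\<lambda>y. (1 - (?m \<bullet> (y - c))\<^sup>2) * V j y) has_derivative
        (\<lambda>v. (1 - (?m \<bullet> (x - c))\<^sup>2) * V' j x v + (- (2 * (?m \<bullet> v) * (?m \<bullet> (x - c)))) * V j x)) (at x)"
      by (auto intro!: derivative_eq_intros deriv[OF \<open>N x < 1\<close>] simp: algebra_simps)
    then have "(\<Phi> j has_derivative
        (\<lambda>v. (1 - (?m \<bullet> (x - c))\<^sup>2) * V' j x v + (- (2 * (?m \<bullet> v) * (?m \<bullet> (x - c)))) * V j x)) (at x)"
    proof (rule has_derivative_transform_within_open[OF _ W])
      fix y assume y: "y \<in> W"
      then have "y \<in> D" by (simp add: W_def D_iff)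
      then show "(1 - (?m \<bullet> (y - c))\<^sup>2) * V j y = \<Phi> j y" using N_W[OF y] by (simp add: \<Phi>_def)
    qed
    moreover have "(1 - (?m \<bullet> (x - c))\<^sup>2) * V' j x (axis j 1) + (- (2 * (?m \<bullet> axis j 1) * (?m \<bullet> (x - c)))) * V j x = d j x"
      using True normal(2)[of x] by (simp add: d_def inner_axis)
    ultimately show ?thesis by blast
  qed
  obtain B where B: "\<And>x. x \<in> D \<Longrightarrow> norm x \<le> B"
    using compact_imp_bounded[OF compact_D] unfolding bounded_iff by blast
  have supp: "\<Phi> j x = 0" if "B < norm x" for j x
    using B[of x] that by (auto simp: \<Phi>_def)
  have quot: "AE x in lebesgue. ((\<lambda>t. (\<Phi> j (x + t *\<^sub>R axis j 1) - \<Phi> j x) / t) \<longlongrightarrow> d j x) (at_right 0)" for j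
    using AE_Z
  proof eventually_elim
    case (elim x)
    obtain \<Phi>' where \<Phi>': "(\<Phi> j has_derivative \<Phi>') (at x)" "\<Phi>' (axis j 1) = d j x"
      using \<Phi>_deriv[OF elim] by blast
    show ?case
      using has_derivative_imp_quotient_tendsto[OF \<Phi>'(1), of "axis j 1"] unfolding \<Phi>'(2)
      by (rule filterlim_mono[OF _ order_refl at_le]) auto
  qed
  have "\<Lambda>-lipschitz_on UNIV (\<Phi> j)" for j
    using \<Phi>_lip \<Lambda> by (intro lipschitz_onI) (auto simp: dist_norm)
  then have \<Phi>_cont: "continuous_on UNIV (\<Phi> j)" for j by (rule lipschitz_on_continuous_on)
  have int: "integrable lebesgue (d j)" "(LINT x|lebesgue. d j x) = 0" for j
    using integral_directional_derivative_eq_0[OF \<Phi>_lip supp quotient_limit_measurable[OF \<Phi>_cont quot] quot]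
    by blast+
  \<comment> \<open>The terms with the factor 1 - N^2 add up to that factor times the divergence of
    \<open>V\<close> and cancel.\<close>
  have sum: "AE x in lebesgue. d 1 x + d 2 x = - 2 * E x"
    using AE_Z
  proof eventually_elim
    case (elim x)
    show ?case
    proof (cases "x \<in> D")
      case True
      have "N x \<noteq> 1"
        using elim normal[of x] by (auto simp: Z_def inner_diff_right)
      then have "N x < 1" using True D_iff[of x] by simp
      then have "(1 - (N x)\<^sup>2) * V' 1 x (axis 1 1) + (1 - (N x)\<^sup>2) * V' 2 x (axis 2 1) = 0"
        using div[of x] by (simp add: distrib_left[symmetric])
      then show ?thesis using True by (simp add: d_def E_def algebra_simps)
    qed (simp add: d_def E_def)
  qed
  then have E_AE: "AE x in lebesgue. - (1/2) * (d 1 x + d 2 x) = E x" by eventually_elim simp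
  have intS: "integrable lebesgue (\<lambda>x. - (1/2) * (d 1 x + d 2 x))" using int(1) by simp
  \<comment> \<open>The function \<open>normal\<close> is a mere choice, so measurability of
    \<open>E\<close> is taken over from the derivatives with which it agrees almost
    everywhere.\<close>
  have E_meas: "E \<in> borel_measurable lebesgue"
    by (rule borel_measurable_AE[OF borel_measurable_integrable[OF intS] E_AE])
  show "integrable lebesgue E" by (rule integrable_cong_AE_imp[OF intS E_meas]) (use E_AE in auto)
  have "(LINT x|lebesgue. E x) = (LINT x|lebesgue. - (1/2) * (d 1 x + d 2 x))"
    by (rule integral_cong_AE[OF E_meas borel_measurable_integrable[OF intS]]) (use E_AE in auto)
  also have "\<dots> = 0" using int by simp
  finally show "(LINT x|lebesgue. E x) = 0" .
qed

text \<open>For the holomorphic function \<open>F = h - h c + i g\<close> the field is \<open>(Re H, - Im H)\<close> with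
  \<open>H z = (F z\<^sup>2 - F 0\<^sup>2) / z\<close>.\<close>

lemma horgan_payne_smooth:
  assumes U: "open U" "D \<subseteq> U"
    and \<delta>: "0 < \<delta>" "\<And>m. m \<in> A \<Longrightarrow> norm m \<le> 1 / \<delta>"
    and R: "0 < R" "\<And>x. x \<in> D \<Longrightarrow> norm (x - c) \<le> R"
    and C: "0 \<le> C" "C < 1" "C\<^sup>2 = 1 - \<delta>\<^sup>2 / R\<^sup>2"
    and CR: "\<And>x. x \<in> U \<Longrightarrow> (h has_derivative (\<lambda>v. p x * v$1 + q x * v$2)) (at x)"
      "\<And>x. x \<in> U \<Longrightarrow> (g has_derivative (\<lambda>v. - q x * v$1 + p x * v$2)) (at x)"
  shows "(1 - C) * (LINT x|lebesgue_on D. (h x - h c)\<^sup>2) \<le> (1 + C) * (LINT x|lebesgue_on D. (g x)\<^sup>2)"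
proof -
  define P where "P v = Complex (v$1) (v$2)" for v :: "real^2"
  have P_lin: "bounded_linear P"
    unfolding linear_conv_bounded_linear[symmetric] by (rule linearI) (auto simp: P_def complex_eq_iff)
  have P_norm: "norm (P v) = norm v" for v by (simp add: P_def cmod_def norm_vec2)
  define pr where "pr x = P (x - c)" for x
  define S where "S z = Re z *\<^sub>R axis 1 1 + Im z *\<^sub>R (axis 2 1 :: real^2)" for z
  have S_lin: "bounded_linear S"
    unfolding linear_conv_bounded_linear[symmetric] S_def[abs_def]
    by (rule linearI) (auto simp: algebra_simps)
  have S_comp: "S z $ 1 = Re z" "S z $ 2 = Im z" for z by (auto simp: S_def axis_def)
  define emb where "emb z = c + S z" for z
  have emb_pr: "emb (pr x) = x" for x
    by (simp add: emb_def pr_def vec_eq_iff forall_2 S_comp P_def)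
  have emb_0: "emb 0 = c" by (simp add: emb_def S_def)
  have emb_der: "(emb has_derivative S) (at z)" for z
    unfolding emb_def[abs_def] using bounded_linear_imp_has_derivative[OF S_lin]
    by (auto intro!: derivative_eq_intros)
  have pr_der: "(pr has_derivative P) (at x)" for x
    unfolding pr_def[abs_def]
    by (rule bounded_linear.has_derivative[OF P_lin]) (auto intro!: derivative_eq_intros)
  define W where "W = emb -` U"
  have W: "open W"
    unfolding W_def by (rule open_vimage[OF U(1)])
      (use has_derivative_continuous[OF emb_der] in \<open>auto intro!: continuous_at_imp_continuous_on\<close>)
  have pr_W: "pr x \<in> W" if "x \<in> U" for x using that by (simp add: W_def emb_pr)
  define F where "F z = complex_of_real (h (emb z) - h c) + \<i> * complex_of_real (g (emb z))" for z
  have F_der: "(F has_field_derivative Complex (p (emb z)) (- q (emb z))) (at z)" if "z \<in> W" for z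
  proof -
    have z: "emb z \<in> U" using that by (simp add: W_def)
    have h': "((\<lambda>z. h (emb z)) has_derivative (\<lambda>w. p (emb z) * Re w + q (emb z) * Im w)) (at z)"
      using diff_chain_at[OF emb_der CR(1)[OF z]] by (simp add: o_def S_comp)
    have g': "((\<lambda>z. g (emb z)) has_derivative (\<lambda>w. - q (emb z) * Re w + p (emb z) * Im w)) (at z)"
      using diff_chain_at[OF emb_der CR(2)[OF z]] by (simp add: o_def S_comp)
    have "(F has_derivative (\<lambda>w. complex_of_real (p (emb z) * Re w + q (emb z) * Im w - 0)
        + \<i> * complex_of_real (- q (emb z) * Re w + p (emb z) * Im w))) (at z)"
      unfolding F_def[abs_def]
      by (intro has_derivative_add has_derivative_of_real has_derivative_diff has_derivative_const
          has_derivative_mult_right h' g')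
    moreover have "(\<lambda>w. complex_of_real (p (emb z) * Re w + q (emb z) * Im w - 0)
        + \<i> * complex_of_real (- q (emb z) * Re w + p (emb z) * Im w))
        = (*) (Complex (p (emb z)) (- q (emb z)))"
      by (rule ext) (simp add: complex_eq_iff)
    ultimately show ?thesis by (simp add: has_field_derivative_def)
  qed
  then have F_hol: "F holomorphic_on W" using holomorphic_on_open[OF W] by blast
  \<comment> \<open>Since F 0 = i g c, adding the square of \<open>g c\<close> subtracts F 0
    squared. This makes \<open>G\<close> vanish at 0.\<close>
  define G where "G z = (F z)\<^sup>2 + (complex_of_real (g c))\<^sup>2" for z
  have G_hol: "G holomorphic_on W" unfolding G_def[abs_def] by (intro holomorphic_intros F_hol)
  have G0: "G 0 = 0" by (simp add: G_def F_def emb_0 power_mult_distrib)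
  \<comment> \<open>The singularity of G z / z at the centre is removable; the value there is the
    derivative.\<close>
  define H where "H z = (if z = 0 then deriv G 0 else (G z - G 0) / (z - 0))" for z
  have H_hol: "H holomorphic_on W" unfolding H_def[abs_def] by (rule pole_lemma_open[OF G_hol W])
  have H_der: "(H has_field_derivative deriv H z) (at z)" if "z \<in> W" for z
    by (rule holomorphic_derivI[OF H_hol W that])
  have Hpr_der: "((\<lambda>x. H (pr x)) has_derivative (\<lambda>v. deriv H (pr x) * P v)) (at x)" if "x \<in> U" for x
    using diff_chain_at[OF pr_der H_der[OF pr_W[OF that], unfolded has_field_derivative_def]]
    by (simp add: o_def)
  \<comment> \<open>By the Cauchy-Riemann equations the complex conjugate of a holomorphic function,
    read as a plane field, has divergence zero.\<close>
  define V :: "2 \<Rightarrow> real^2 \<Rightarrow> real" where "V j x = (if j = 1 then Re (H (pr x)) else - Im (H (pr x)))" for j x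
  define V' :: "2 \<Rightarrow> real^2 \<Rightarrow> real^2 \<Rightarrow> real" where
    "V' j x v = (if j = 1 then Re (deriv H (pr x) * P v) else - Im (deriv H (pr x) * P v))" for j x v
  have V_der: "(V j has_derivative V' j x) (at x)" if "x \<in> U" for j x
  proof (cases "j = 1")
    case True
    then show ?thesis
      unfolding V_def[abs_def] V'_def[abs_def]
      using bounded_linear.has_derivative[OF bounded_linear_Re Hpr_der[OF that]] by simp
  next
    case False
    then show ?thesis
      unfolding V_def[abs_def] V'_def[abs_def]
      using has_derivative_minus[OF bounded_linear.has_derivative[OF bounded_linear_Im Hpr_der[OF that]]] by simp
  qed
  have prD: "compact (pr ` D)" "pr ` D \<subseteq> W"
  proof -
    show "compact (pr ` D)"
      by (rule compact_continuous_image[OF _ compact_D])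
         (use has_derivative_continuous[OF pr_der] in \<open>auto intro!: continuous_at_imp_continuous_on\<close>)
    show "pr ` D \<subseteq> W" using U(2) pr_W by blast
  qed
  have bounded_on: "\<exists>B\<ge>0. \<forall>x\<in>D. norm (f (pr x)) \<le> B" if "f holomorphic_on W" for f
  proof -
    have "continuous_on (pr ` D) f"
      by (rule continuous_on_subset[OF holomorphic_on_imp_continuous_on[OF that] prD(2)])
    from compact_imp_bounded[OF compact_continuous_image[OF this prD(1)]]
    obtain B where B: "\<forall>y\<in>f ` pr ` D. norm y \<le> B" unfolding bounded_iff by blast
    have "norm (f (pr x)) \<le> \<bar>B\<bar>" if "x \<in> D" for x
      using bspec[OF B imageI[OF imageI[OF that]]] by linarith
    then show ?thesis by (intro exI[of _ "\<bar>B\<bar>"]) simp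
  qed
  obtain K where K: "0 \<le> K" "\<forall>x\<in>D. norm (H (pr x)) \<le> K" using bounded_on[OF H_hol] by blast
  obtain L where L: "0 \<le> L" "\<forall>x\<in>D. norm (deriv H (pr x)) \<le> L"
    using bounded_on[OF holomorphic_deriv[OF H_hol W]] by blast
  have V_bd: "\<bar>V j x\<bar> \<le> K" if "x \<in> D" for j x
    using K(2) that abs_Re_le_cmod[of "H (pr x)"] abs_Im_le_cmod[of "H (pr x)"]
    by (auto simp: V_def intro: order_trans)
  have V_lip: "\<bar>V j x - V j y\<bar> \<le> L * norm (x - y)" if "x \<in> D" "y \<in> D" for j x y
  proof -
    have "norm (V j x - V j y) \<le> L * norm (x - y)"
    proof (rule differentiable_bound[OF convex_D _ _ that, where f'="V' j"])
      show "(V j has_derivative V' j x) (at x within D)" if "x \<in> D" for x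
        using V_der U(2) that by (blast intro: has_derivative_at_withinI)
      show "onorm (V' j x) \<le> L" if "x \<in> D" for x
      proof (rule onorm_bound[OF L(1)])
        fix v
        have "\<bar>V' j x v\<bar> \<le> norm (deriv H (pr x) * P v)"
          by (cases "j = 1") (simp_all only: V'_def if_True if_False abs_minus_cancel simp_thms
              abs_Re_le_cmod abs_Im_le_cmod)
        also have "\<dots> \<le> L * norm v"
          unfolding norm_mult P_norm using L(2) that by (intro mult_right_mono) auto
        finally show "norm (V' j x v) \<le> L * norm v" by simp
      qed
    qed
    then show ?thesis by simp
  qed
  have less_U: "x \<in> U" if "N x < 1" for x using that D_iff[of x] U(2) by auto
  have div: "V' 1 x (axis 1 1) + V' 2 x (axis 2 1) = 0" for x
    by (simp add: V'_def P_def axis_def)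
  define E where "E = (\<lambda>x. if x \<in> D then N x * (normal x $ 1 * V 1 x + normal x $ 2 * V 2 x) else 0)"
  have E_int: "integrable lebesgue E" "(LINT x|lebesgue. E x) = 0"
    unfolding E_def
    by (rule integral_gauge_field[OF L(1) V_lip V_bd V_der[OF less_U] div]; assumption)+
  define f where "f x = (1 - C) / \<delta>\<^sup>2 * (h x - h c)\<^sup>2 - (1 + C) / \<delta>\<^sup>2 * (g x)\<^sup>2" for x
  have fE: "f x \<le> E x" if xD: "x \<in> D" and xc: "x \<noteq> c" for x
  proof -
    define X Y where "X = x$1 - c$1" and "Y = x$2 - c$2"
    define m where "m = normal x"
    define n where "n = N x"
    \<comment> \<open>With \<open>n\<close> the inner product and \<open>k\<close> the cross product
      of \<open>m\<close> and \<open>x - c\<close>, n^2 + k^2 is the product of the squared lengths;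
      the distance of the side enters through \<open>norm m\<close>.\<close>
    define k where "k = m$1 * Y - m$2 * X"
    define r2 where "r2 = X\<^sup>2 + Y\<^sup>2"
    have r2: "r2 = (norm (x - c))\<^sup>2" by (simp add: r2_def X_def Y_def norm_vec2)
    have r2_pos: "0 < r2" using xc by (simp add: r2)
    have n_pos: "0 < n" using N_pos[OF xc] by (simp add: n_def)
    have n_eq: "n = m$1 * X + m$2 * Y"
      using normal(2)[of x] by (simp add: n_def m_def inner_vec2 X_def Y_def)
    \<comment> \<open>The point of \<open>D\<close> on the ray through \<open>x\<close> where the
      gauge is 1 has distance at most \<open>R\<close>, so \<open>x\<close> itself has distance at
      most \<open>n * R\<close>.\<close>
    have "N (c + (1/n) *\<^sub>R (x - c)) = 1" using N_scale[of "1/n" x] n_pos by (simp add: n_def)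
    then have "1 / n * norm (x - c) \<le> R"
      using R(2)[of "c + (1/n) *\<^sub>R (x - c)"] D_iff n_pos
      by (simp del: scaleR_right_diff_distrib)
    then have "norm (x - c) \<le> n * R" using n_pos by (simp add: field_simps)
    then have nR: "r2 \<le> n\<^sup>2 * R\<^sup>2" unfolding r2 power_mult_distrib[symmetric] by (rule power_mono) simp
    have "n\<^sup>2 + k\<^sup>2 = (norm m)\<^sup>2 * r2"
      unfolding n_eq k_def r2_def norm_vec2 by (simp add: power2_eq_square algebra_simps)
    also have "(norm m)\<^sup>2 \<le> (1 / \<delta>)\<^sup>2" using \<delta>(2)[OF normal(1)] by (intro power_mono) (auto simp: m_def)
    then have "(norm m)\<^sup>2 * r2 \<le> (1 / \<delta>)\<^sup>2 * r2" using r2_pos by (intro mult_right_mono) auto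
    finally have nk: "n\<^sup>2 + k\<^sup>2 \<le> r2 / \<delta>\<^sup>2" by (simp add: power_divide)
    have pr0: "pr x = Complex X Y" by (simp add: pr_def P_def X_def Y_def)
    have "pr x \<noteq> 0" using r2_pos by (auto simp: pr0 r2_def complex_eq_iff)
    then have Hx: "H (pr x) = G (pr x) / pr x" by (simp add: H_def G0)
    have Gr: "Re (G (pr x)) = (h x - h c)\<^sup>2 - (g x)\<^sup>2 + (g c)\<^sup>2" "Im (G (pr x)) = n * 0 + 2 * (h x - h c) * g x"
      by (simp_all add: G_def F_def emb_pr power2_eq_square)
    have "E x = n * (m$1 * Re (H (pr x)) - m$2 * Im (H (pr x)))"
      using xD by (simp add: E_def V_def n_def m_def)
    also have "\<dots> = (n * (Re (G (pr x)) * (m$1 * X + m$2 * Y) + Im (G (pr x)) * k)) / r2"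
    proof -
      have H_parts: "Re (H (pr x)) = (Re (G (pr x)) * X + Im (G (pr x)) * Y) / r2"
        "Im (H (pr x)) = (Im (G (pr x)) * X - Re (G (pr x)) * Y) / r2"
        unfolding Hx by (simp_all add: Re_divide Im_divide r2_def) (simp_all add: pr0)
      show ?thesis unfolding H_parts k_def
        by (simp add: add_divide_distrib diff_divide_distrib algebra_simps)
    qed
    also have "\<dots> = (n\<^sup>2 * ((h x - h c)\<^sup>2 - (g x)\<^sup>2 + (g c)\<^sup>2) + n * k * (2 * (h x - h c) * g x)) / r2"
      unfolding n_eq[symmetric] Gr by (simp add: power2_eq_square algebra_simps)
    finally show ?thesis
      unfolding f_def using horgan_payne_pointwise[OF \<delta>(1) R(1) C r2_pos nR nk] by metis
  qed
  have cont: "continuous_on D h" "continuous_on D g"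
    using CR U(2) by (blast intro!: continuous_at_imp_continuous_on has_derivative_continuous)+
  have int_D: "integrable (lebesgue_on D) u" if "continuous_on D u" for u :: "real^2 \<Rightarrow> real"
  proof -
    have "integrable lborel (\<lambda>x. indicat_real D x *\<^sub>R u x)"
      using borel_integrable_compact[OF compact_D that] by (simp add: set_integrable_def)
    moreover from this have "(\<lambda>x. indicat_real D x *\<^sub>R u x) \<in> borel_measurable borel" by auto
    ultimately have "integrable lebesgue (\<lambda>x. indicat_real D x *\<^sub>R u x)"
      by (subst integrable_completion) auto
    then show ?thesis using closed_D by (subst integrable_restrict_space) auto
  qed
  have int1: "integrable (lebesgue_on D) (\<lambda>x. (h x - h c)\<^sup>2)" and int2: "integrable (lebesgue_on D) (\<lambda>x. (g x)\<^sup>2)"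
    by (intro int_D continuous_intros cont)+
  have f_int: "integrable lebesgue (\<lambda>x. indicat_real D x *\<^sub>R f x)"
  proof -
    have "integrable (lebesgue_on D) f" unfolding f_def[abs_def] using int1 int2 by simp
    then show ?thesis using closed_D by (subst (asm) integrable_restrict_space) auto
  qed
  have "(LINT x|lebesgue_on D. f x) = (LINT x|lebesgue. indicat_real D x *\<^sub>R f x)"
    by (rule integral_restrict_space) (use closed_D in auto)
  also have "\<dots> \<le> (LINT x|lebesgue. E x)"
  proof (rule integral_mono_AE[OF f_int E_int(1)])
    have "AE x in lebesgue. x \<noteq> c"
      unfolding eventually_ae_filter_negligible by (intro exI[of _ "{c}"]) auto
    then show "AE x in lebesgue. indicat_real D x *\<^sub>R f x \<le> E x"
      by eventually_elim (use fE in \<open>auto simp: indicator_def E_def\<close>)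
  qed
  finally have "(LINT x|lebesgue_on D. f x) \<le> 0" using E_int(2) by simp
  moreover have "(LINT x|lebesgue_on D. f x)
      = ((1 - C) * (LINT x|lebesgue_on D. (h x - h c)\<^sup>2) - (1 + C) * (LINT x|lebesgue_on D. (g x)\<^sup>2)) / \<delta>\<^sup>2"
    unfolding f_def using int1 int2 by (simp add: diff_divide_distrib left_diff_distrib)
  ultimately show ?thesis using \<delta>(1) by (simp add: divide_le_0_iff)
qed

end

section \<open>Mollification\<close>

lemma integrable_mult_bounded:
  fixes f u :: "real^2 \<Rightarrow> real"
  assumes "integrable lborel f" "continuous_on UNIV u" "\<And>x. \<bar>u x\<bar> \<le> B"
  shows "integrable lborel (\<lambda>x. f x * u x)"
proof (rule Bochner_Integration.integrable_bound)
  show "integrable lborel (\<lambda>x. B * f x)" using assms(1) by simp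
  have "u \<in> borel_measurable borel" by (rule borel_measurable_continuous_onI[OF assms(2)])
  then show "(\<lambda>x. f x * u x) \<in> borel_measurable lborel"
    using borel_measurable_integrable[OF assms(1)] by simp
  have "\<bar>u x\<bar> * \<bar>f x\<bar> \<le> \<bar>B\<bar> * \<bar>f x\<bar>" for x
    using assms(3)[of x] by (intro mult_right_mono) auto
  then show "AE x in lborel. norm (f x * u x) \<le> norm (B * f x)"
    by (simp add: abs_mult mult.commute)
qed

text \<open>Members of \<open>L2\<close> are only Lebesgue measurable and arbitrary outside
  \<Omega>. Convolution and Fubini are carried out on the whole plane for Borel functions, hence
  this replacement, which keeps the norm and all pairings with continuous functions.\<close>

lemma L2_borel_representative:
  assumes \<Omega>: "open \<Omega>" "bounded \<Omega>" and h: "h \<in> L2 \<Omega>"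
  obtains f where "f \<in> borel_measurable borel" "integrable lborel f" "integrable lborel (\<lambda>x. (f x)\<^sup>2)"
    "\<forall>x. x \<notin> \<Omega> \<longrightarrow> f x = 0" "(L2_norm \<Omega> h)\<^sup>2 = (LINT x|lborel. (f x)\<^sup>2)"
    "\<forall>u. continuous_on UNIV u \<longrightarrow> L2_inner \<Omega> h u = (LINT x|lborel. f x * u x)"
proof -
  define h0 where "h0 x = indicat_real \<Omega> x * h x" for x
  have h0_meas: "h0 \<in> borel_measurable lebesgue"
    using L2_measurable[OF h] \<Omega>(1) by (simp add: borel_measurable_restrict_space_iff h0_def[abs_def])
  obtain f0 where f0: "f0 \<in> borel_measurable lborel" "AE x in lborel. h0 x = f0 x"
    using completion_ex_borel_measurable_real[OF h0_meas] by blast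
  define f where "f x = indicat_real \<Omega> x * f0 x" for x
  have [measurable]: "\<Omega> \<in> sets borel" using \<Omega>(1) by simp
  have [measurable]: "f0 \<in> borel_measurable borel" using f0(1) by simp
  have f [measurable]: "f \<in> borel_measurable borel" unfolding f_def[abs_def] by measurable
  have "AE x in lborel. h0 x = f x"
    using f0(2) by eventually_elim (auto simp: f_def h0_def indicator_def)
  then have AE: "AE x in lebesgue. h0 x = f x" by (rule AE_completion)
  have transfer: "(integrable (lebesgue_on \<Omega>) (\<lambda>x. k (h x) x) \<longleftrightarrow> integrable lborel (\<lambda>x. k (f x) x)) \<and>
      (LINT x|lebesgue_on \<Omega>. k (h x) x) = (LINT x|lborel. k (f x) x)"
    if k: "(\<lambda>x. k (f x) x) \<in> borel_measurable borel" and k0: "\<And>x. k 0 x = 0"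
      and kh: "(\<lambda>x. k (h0 x) x) \<in> borel_measurable lebesgue" for k :: "real \<Rightarrow> real^2 \<Rightarrow> real"
  proof -
    have eq: "(\<lambda>x. indicat_real \<Omega> x *\<^sub>R k (h x) x) = (\<lambda>x. k (h0 x) x)"
      by (auto simp: fun_eq_iff h0_def indicator_def k0)
    have AE': "AE x in lebesgue. k (h0 x) x = k (f x) x" using AE by eventually_elim simp
    have kf: "(\<lambda>x. k (f x) x) \<in> borel_measurable lebesgue"
      by (rule measurable_completion) (use k in simp)
    have "integrable (lebesgue_on \<Omega>) (\<lambda>x. k (h x) x) \<longleftrightarrow> integrable lebesgue (\<lambda>x. k (h0 x) x)"
      by (subst integrable_restrict_space) (use \<Omega>(1) in simp, simp only: eq)
    also have "\<dots> \<longleftrightarrow> integrable lebesgue (\<lambda>x. k (f x) x)"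
      by (rule integrable_cong_AE[OF kh kf AE'])
    also have "\<dots> \<longleftrightarrow> integrable lborel (\<lambda>x. k (f x) x)"
      by (rule integrable_completion) (use k in simp)
    finally have 1: "integrable (lebesgue_on \<Omega>) (\<lambda>x. k (h x) x) \<longleftrightarrow> integrable lborel (\<lambda>x. k (f x) x)" .
    have "(LINT x|lebesgue_on \<Omega>. k (h x) x) = (LINT x|lebesgue. k (h0 x) x)"
      by (subst integral_restrict_space) (use \<Omega>(1) in simp, simp only: eq)
    also have "\<dots> = (LINT x|lebesgue. k (f x) x)" by (rule integral_cong_AE[OF kh kf AE'])
    also have "\<dots> = (LINT x|lborel. k (f x) x)" by (rule integral_completion) (use k in simp)
    finally show ?thesis using 1 by blast
  qed
  have id: "(integrable (lebesgue_on \<Omega>) h \<longleftrightarrow> integrable lborel f)"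
    using transfer[of "\<lambda>y x. y"] h0_meas by simp
  have sq: "(integrable (lebesgue_on \<Omega>) (\<lambda>x. (h x)\<^sup>2) \<longleftrightarrow> integrable lborel (\<lambda>x. (f x)\<^sup>2))"
      "(LINT x|lebesgue_on \<Omega>. (h x)\<^sup>2) = (LINT x|lborel. (f x)\<^sup>2)"
    using transfer[of "\<lambda>y x. y\<^sup>2"] h0_meas by simp_all
  show ?thesis
  proof (rule that[OF f])
    show "integrable lborel f" using id L2_integrable[OF \<Omega> h] by simp
    show "integrable lborel (\<lambda>x. (f x)\<^sup>2)" using sq(1) L2_square_integrable[OF h] by simp
    show "\<forall>x. x \<notin> \<Omega> \<longrightarrow> f x = 0" by (simp add: f_def)
    show "(L2_norm \<Omega> h)\<^sup>2 = (LINT x|lborel. (f x)\<^sup>2)" by (simp add: L2_norm_eq_integral sq(2))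
    show "\<forall>u. continuous_on UNIV u \<longrightarrow> L2_inner \<Omega> h u = (LINT x|lborel. f x * u x)"
    proof (intro allI impI)
      fix u :: "real^2 \<Rightarrow> real" assume u: "continuous_on UNIV u"
      have "u \<in> borel_measurable borel" "u \<in> borel_measurable lebesgue"
        using borel_measurable_continuous_onI[OF u] continuous_imp_borel_measurable_lebesgue[OF u] by auto
      then show "L2_inner \<Omega> h u = (LINT x|lborel. f x * u x)"
        unfolding L2_inner_def using transfer[of "\<lambda>y x. y * u x"] h0_meas by simp
    qed
  qed
qed

lemma has_derivative_quadratic_error:
  fixes f :: "real^2 \<Rightarrow> real"
  assumes "bounded_linear L" "\<And>v. \<bar>f (x + v) - f x - L v\<bar> \<le> K * (norm v)\<^sup>2"
  shows "(f has_derivative L) (at x)"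
  unfolding has_derivative_at
proof (intro conjI assms(1))
  have lim: "((\<lambda>v. K * norm v) \<longlongrightarrow> 0) (at (0::real^2))"
    by (rule tendsto_eq_intros refl)+ simp
  show "((\<lambda>v. norm (f (x + v) - f x - L v) / norm v) \<longlongrightarrow> 0) (at 0)"
  proof (rule Lim_null_comparison[OF _ lim])
    have "norm (norm (f (x + v) - f x - L v) / norm v) \<le> K * norm v" if "v \<noteq> 0" for v
      using assms(2)[of v] that by (simp add: field_simps power2_eq_square)
    then show "\<forall>\<^sub>F v in at 0. norm (norm (f (x + v) - f x - L v) / norm v) \<le> K * norm v"
      by (simp add: eventually_at_filter)
  qed
qed

text \<open>The Taylor remainder of \<rho> is quadratic uniformly in the base point, so integrating
  it against the integrable \<open>f\<close> leaves a quadratic remainder for the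
  convolution.\<close>

lemma mollify_has_derivative:
  assumes f: "integrable lborel f" and \<rho>: "\<rho> \<in> test_functions UNIV"
  shows "((\<lambda>x. LINT y|lborel. f y * \<rho> (x - y)) has_derivative
    (\<lambda>v. (LINT y|lborel. f y * pderiv_at 1 \<rho> (x - y)) * v$1
       + (LINT y|lborel. f y * pderiv_at 2 \<rho> (x - y)) * v$2)) (at x)"
proof -
  obtain K where K: "0 \<le> K" "\<forall>x v. \<bar>\<rho> (x + v) - \<rho> x - (v$1 * pderiv_at 1 \<rho> x + v$2 * pderiv_at 2 \<rho> x)\<bar>
     \<le> K * (norm v)\<^sup>2"
    by (rule test_function_second_order[OF \<rho>])
  have int: "integrable lborel (\<lambda>y. f y * \<phi> (z - y))" if \<phi>: "\<phi> \<in> test_functions UNIV" for \<phi> z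
  proof -
    obtain B where "0 \<le> B" "\<forall>x. \<bar>\<phi> x\<bar> \<le> B" by (rule test_function_bounded[OF \<phi>])
    then show ?thesis
      by (intro integrable_mult_bounded[OF f] continuous_on_compose2[OF test_function_continuous[OF \<phi>]]
          continuous_intros) auto
  qed
  note i0 = int[OF \<rho>] and i1 = int[OF test_function_pderiv[OF \<rho>, of 1]]
    and i2 = int[OF test_function_pderiv[OF \<rho>, of 2]]
  show ?thesis
  proof (rule has_derivative_quadratic_error)
    show "bounded_linear (\<lambda>v::real^2. (LINT y|lborel. f y * pderiv_at 1 \<rho> (x - y)) * v$1
       + (LINT y|lborel. f y * pderiv_at 2 \<rho> (x - y)) * v$2)"
      by (intro bounded_linear_add bounded_linear_const_mult bounded_linear_vec_nth)
    fix v :: "real^2"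
    have "(LINT y|lborel. f y * \<rho> (x + v - y)) - (LINT y|lborel. f y * \<rho> (x - y))
        - ((LINT y|lborel. f y * pderiv_at 1 \<rho> (x - y)) * v$1
          + (LINT y|lborel. f y * pderiv_at 2 \<rho> (x - y)) * v$2)
        = (LINT y|lborel. f y * \<rho> (x + v - y) - f y * \<rho> (x - y)
          - (f y * pderiv_at 1 \<rho> (x - y) * v$1 + f y * pderiv_at 2 \<rho> (x - y) * v$2))"
      using i0 i1 i2 by simp
    also have "\<bar>\<dots>\<bar> \<le> (LINT y|lborel. \<bar>f y\<bar> * (K * (norm v)\<^sup>2))"
    proof (rule order_trans[OF integral_abs_bound integral_mono])
      show "integrable lborel (\<lambda>y. \<bar>f y * \<rho> (x + v - y) - f y * \<rho> (x - y)
          - (f y * pderiv_at 1 \<rho> (x - y) * v$1 + f y * pderiv_at 2 \<rho> (x - y) * v$2)\<bar>)"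
        using i0 i1 i2 by simp
      show "integrable lborel (\<lambda>y. \<bar>f y\<bar> * (K * (norm v)\<^sup>2))" using f by simp
      fix y
      have "f y * \<rho> (x + v - y) - f y * \<rho> (x - y)
          - (f y * pderiv_at 1 \<rho> (x - y) * v$1 + f y * pderiv_at 2 \<rho> (x - y) * v$2)
          = f y * (\<rho> ((x - y) + v) - \<rho> (x - y) - (v$1 * pderiv_at 1 \<rho> (x - y) + v$2 * pderiv_at 2 \<rho> (x - y)))"
        by (simp add: algebra_simps)
      then show "\<bar>f y * \<rho> (x + v - y) - f y * \<rho> (x - y)
          - (f y * pderiv_at 1 \<rho> (x - y) * v$1 + f y * pderiv_at 2 \<rho> (x - y) * v$2)\<bar>
          \<le> \<bar>f y\<bar> * (K * (norm v)\<^sup>2)"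
        using K(2) by (simp add: abs_mult mult_left_mono)
    qed
    also have "\<dots> = (LINT y|lborel. \<bar>f y\<bar>) * K * (norm v)\<^sup>2" by (simp add: mult.assoc)
    finally show "\<bar>(LINT y|lborel. f y * \<rho> (x + v - y)) - (LINT y|lborel. f y * \<rho> (x - y))
        - ((LINT y|lborel. f y * pderiv_at 1 \<rho> (x - y)) * v$1
          + (LINT y|lborel. f y * pderiv_at 2 \<rho> (x - y)) * v$2)\<bar> \<le> (LINT y|lborel. \<bar>f y\<bar>) * K * (norm v)\<^sup>2" .
  qed
qed

lemma mollifier_exists:
  assumes "0 < \<epsilon>"
  obtains \<rho> where "\<rho> \<in> test_functions UNIV" "\<forall>x. 0 \<le> \<rho> x" "\<forall>x. \<epsilon> < norm x \<longrightarrow> \<rho> x = 0"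
    "(LINT x|lborel. \<rho> x) = 1"
proof -
  \<comment> \<open>Half side \<epsilon>/2 keeps the square inside the ball of radius \<epsilon>,
    because the norm is at most the sum of the absolute coordinates.\<close>
  define a :: "real^2" where "a = (\<chi> i. \<epsilon> / 2)"
  define \<beta> where "\<beta> = bump 0 (- a) a"
  have test: "\<beta> \<in> test_functions UNIV" unfolding \<beta>_def by (rule bump_test_function) simp
  have int: "integrable lborel \<beta>"
    by (rule continuous_compact_support_integrable(2)[OF test_function_continuous[OF test] test_function_compact[OF test]])
  have nonneg: "0 \<le> \<beta> x" for x by (simp add: \<beta>_def bump_nonneg)
  have "(LINT x|lborel. \<beta> x) \<noteq> 0"
  proof
    assume "(LINT x|lborel. \<beta> x) = 0"
    then have "AE x in lborel. \<beta> x = 0"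
      using integral_nonneg_eq_0_iff_AE[OF int] nonneg by simp
    then have "AE x in lebesgue. \<beta> x = 0" by (rule AE_completion)
    then obtain S where "negligible S" "{x. \<not> \<beta> x = 0} \<subseteq> S"
      unfolding eventually_ae_filter_negligible by blast
    then have "negligible (box (- a) a)"
      using bump_support[of 0 "- a" a] by (auto simp: \<beta>_def intro: negligible_subset)
    moreover have "0 \<in> box (- a) a" using assms by (simp add: mem_box_cart a_def)
    ultimately show False by (metis empty_iff negligible_interval(2))
  qed
  moreover have "0 \<le> (LINT x|lborel. \<beta> x)" by (rule Bochner_Integration.integral_nonneg) (simp add: nonneg)
  ultimately have pos: "0 < (LINT x|lborel. \<beta> x)" by simp
  define s where "s = 1 / (LINT x|lborel. \<beta> x)"
  show ?thesis
  proof (rule that[of "\<lambda>x. s * \<beta> x"])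
    show "(\<lambda>x. s * \<beta> x) \<in> test_functions UNIV" by (rule test_function_scale[OF test])
    show "\<forall>x. 0 \<le> s * \<beta> x" using pos nonneg by (simp add: s_def)
    show "(LINT x|lborel. s * \<beta> x) = 1" using pos by (simp add: s_def)
    show "\<forall>x. \<epsilon> < norm x \<longrightarrow> s * \<beta> x = 0"
    proof (intro allI impI)
      fix x :: "real^2" assume x: "\<epsilon> < norm x"
      have "x \<notin> box (- a) a"
      proof
        assume "x \<in> box (- a) a"
        then have "- (\<epsilon>/2) < x$i \<and> x$i < \<epsilon>/2" for i by (simp add: mem_box_cart a_def)
        from this[of 1] this[of 2] have "\<bar>x$1\<bar> \<le> \<epsilon>/2" "\<bar>x$2\<bar> \<le> \<epsilon>/2" by auto
        then have "norm x \<le> \<epsilon>/2 + \<epsilon>/2"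
          using norm_le_l1_cart[of x] by (simp add: sum_2)
        then show False using x by simp
      qed
      then show "s * \<beta> x = 0" using bump_support[of 0 "- a" a] by (auto simp: \<beta>_def)
    qed
  qed
qed

lemma test_function_reflect:
  assumes \<rho>: "\<rho> \<in> test_functions UNIV" and out: "\<forall>x. \<epsilon> < norm x \<longrightarrow> \<rho> x = 0"
    and sub: "cball x \<epsilon> \<subseteq> \<Omega>"
  shows "(\<lambda>y. \<rho> (x - y)) \<in> test_functions \<Omega>"
proof -
  have "{y. \<rho> (x - y) \<noteq> 0} \<subseteq> cball x \<epsilon>" using out by (force simp: dist_norm)
  then have cl: "closure {y. \<rho> (x - y) \<noteq> 0} \<subseteq> cball x \<epsilon>" by (rule closure_minimal) simp
  then have "compact (closure {y. \<rho> (x - y) \<noteq> 0})"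
    by (meson bounded_cball bounded_subset closed_closure compact_eq_bounded_closed)
  then show ?thesis
    using cl sub Ck_reflect[OF test_function_Ck[OF \<rho>], of _ x] unfolding test_functions_def by blast
qed

lemma pderiv_at_reflect_test:
  assumes "\<rho> \<in> test_functions UNIV"
  shows "pderiv_at j (\<lambda>y. \<rho> (x - y)) = (\<lambda>y. - pderiv_at j \<rho> (x - y))"
  by (rule ext, rule pderiv_at_reflect[OF test_function_differentiable[OF assms]])

lemma lborel_integral_reflect:
  fixes f :: "real^2 \<Rightarrow> real"
  assumes f [measurable]: "f \<in> borel_measurable borel"
  shows "(\<integral>\<^sup>+y. ennreal (f (x - y)) \<partial>lborel) = (\<integral>\<^sup>+y. ennreal (f y) \<partial>lborel)"
proof -
  have "lborel = distr lborel borel (\<lambda>y. x - y)"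
    using lborel_affine[of "-1" x] by (simp add: density_1)
  then have "(\<integral>\<^sup>+y. ennreal (f y) \<partial>lborel) = (\<integral>\<^sup>+y. ennreal (f y) \<partial>distr lborel borel (\<lambda>y. x - y))"
    by simp
  also have "\<dots> = (\<integral>\<^sup>+y. ennreal (f (x - y)) \<partial>lborel)" by (rule nn_integral_distr) auto
  finally show ?thesis by simp
qed

lemma nn_integral_translate:
  fixes f :: "real^2 \<Rightarrow> real"
  assumes f [measurable]: "f \<in> borel_measurable borel"
  shows "(\<integral>\<^sup>+x. ennreal (f (x - y)) \<partial>lborel) = (\<integral>\<^sup>+x. ennreal (f x) \<partial>lborel)"
proof -
  have "(\<integral>\<^sup>+x. ennreal (f x) \<partial>lborel) = (\<integral>\<^sup>+x. ennreal (f x) \<partial>distr lborel borel ((+) (- y)))"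
    by (simp add: lborel_distr_plus)
  also have "\<dots> = (\<integral>\<^sup>+x. ennreal (f (- y + x)) \<partial>lborel)" by (rule nn_integral_distr) auto
  finally show ?thesis by (simp add: add.commute)
qed

section \<open>Convolution with a fixed mollifier\<close>

context
  fixes \<rho> :: "real^2 \<Rightarrow> real" and \<epsilon> :: real
  assumes \<rho>: "\<rho> \<in> test_functions UNIV" "\<forall>x. 0 \<le> \<rho> x" "\<forall>x. \<epsilon> < norm x \<longrightarrow> \<rho> x = 0"
    "(LINT x|lborel. \<rho> x) = 1"
begin

lemma \<rho>_borel: "\<rho> \<in> borel_measurable borel"
  by (rule borel_measurable_continuous_onI[OF test_function_continuous[OF \<rho>(1)]])

lemma \<rho>_int: "integrable lborel \<rho>"
  by (rule continuous_compact_support_integrable(2)[OF test_function_continuous[OF \<rho>(1)] test_function_compact[OF \<rho>(1)]])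

lemma nn_integral_\<rho>: "(\<integral>\<^sup>+x. ennreal (\<rho> x) \<partial>lborel) = 1"
  using nn_integral_eq_integral[OF \<rho>_int] \<rho>(2,4) by simp

lemma \<rho>_reflect: "integrable lborel (\<lambda>y. \<rho> (x - y))" "(LINT y|lborel. \<rho> (x - y)) = 1"
proof -
  have m: "(\<lambda>y. \<rho> (x - y)) \<in> borel_measurable lborel" using \<rho>_borel by simp
  have 1: "(\<integral>\<^sup>+y. ennreal (\<rho> (x - y)) \<partial>lborel) = 1"
    using lborel_integral_reflect[OF \<rho>_borel] nn_integral_\<rho> by simp
  show i: "integrable lborel (\<lambda>y. \<rho> (x - y))"
    by (rule integrableI_nonneg[OF m]) (use 1 \<rho>(2) in auto)
  show "(LINT y|lborel. \<rho> (x - y)) = 1"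
    using nn_integral_eq_integral[OF i] 1 \<rho>(2) by simp
qed

text \<open>For fixed \<open>x\<close> the kernel is a probability density, and nonnegativity of the
  variance bounds the squared mean by the mean square. Exchanging the integrals then uses that the
  kernel has mass 1 in \<open>x\<close> as well.\<close>

lemma mollify_L2:
  assumes g: "integrable lborel g" "integrable lborel (\<lambda>x. (g x)\<^sup>2)"
  shows "(\<integral>\<^sup>+x. ennreal ((LINT y|lborel. g y * \<rho> (x - y))\<^sup>2) \<partial>lborel) \<le> ennreal (LINT x|lborel. (g x)\<^sup>2)"
proof -
  have [measurable]: "\<rho> \<in> borel_measurable borel" by (rule \<rho>_borel)
  have [measurable]: "g \<in> borel_measurable borel" using borel_measurable_integrable[OF g(1)] by simp
  obtain B where B: "0 \<le> B" "\<forall>x. \<bar>\<rho> x\<bar> \<le> B" by (rule test_function_bounded[OF \<rho>(1)])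
  have cont: "continuous_on UNIV (\<lambda>y. \<rho> (x - y))" for x
    by (intro continuous_on_compose2[OF test_function_continuous[OF \<rho>(1)]] continuous_intros) auto
  have int1: "integrable lborel (\<lambda>y. g y * \<rho> (x - y))" for x
    by (rule integrable_mult_bounded[OF g(1) cont]) (use B in auto)
  have int2: "integrable lborel (\<lambda>y. (g y)\<^sup>2 * \<rho> (x - y))" for x
    by (rule integrable_mult_bounded[OF g(2) cont]) (use B in auto)
  have le: "(LINT y|lborel. g y * \<rho> (x - y))\<^sup>2 \<le> (LINT y|lborel. (g y)\<^sup>2 * \<rho> (x - y))" for x
  proof -
    let ?s = "LINT y|lborel. g y * \<rho> (x - y)"
    have "0 \<le> (LINT y|lborel. (g y - ?s)\<^sup>2 * \<rho> (x - y))"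
      by (rule Bochner_Integration.integral_nonneg) (use \<rho>(2) in auto)
    also have "\<dots> = (LINT y|lborel. (g y)\<^sup>2 * \<rho> (x - y) - 2 * ?s * (g y * \<rho> (x - y)) + ?s\<^sup>2 * \<rho> (x - y))"
      by (intro Bochner_Integration.integral_cong) (auto simp: power2_diff algebra_simps)
    also have "\<dots> = (LINT y|lborel. (g y)\<^sup>2 * \<rho> (x - y)) - 2 * ?s * ?s + ?s\<^sup>2"
      using int1[of x] int2[of x] \<rho>_reflect[of x] by simp
    finally show ?thesis by (simp add: power2_eq_square)
  qed
  have "(\<integral>\<^sup>+x. ennreal ((LINT y|lborel. g y * \<rho> (x - y))\<^sup>2) \<partial>lborel)
      \<le> (\<integral>\<^sup>+x. \<integral>\<^sup>+y. ennreal ((g y)\<^sup>2 * \<rho> (x - y)) \<partial>lborel \<partial>lborel)"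
  proof (rule nn_integral_mono)
    fix x :: "real^2"
    have "(\<integral>\<^sup>+y. ennreal ((g y)\<^sup>2 * \<rho> (x - y)) \<partial>lborel) = ennreal (LINT y|lborel. (g y)\<^sup>2 * \<rho> (x - y))"
      by (rule nn_integral_eq_integral[OF int2]) (use \<rho>(2) in auto)
    then show "ennreal ((LINT y|lborel. g y * \<rho> (x - y))\<^sup>2) \<le> (\<integral>\<^sup>+y. ennreal ((g y)\<^sup>2 * \<rho> (x - y)) \<partial>lborel)"
      using le[of x] by (simp add: ennreal_leI)
  qed
  also have "\<dots> = (\<integral>\<^sup>+y. \<integral>\<^sup>+x. ennreal ((g y)\<^sup>2 * \<rho> (x - y)) \<partial>lborel \<partial>lborel)"
    by (rule lborel_pair.Fubini'[symmetric]) measurable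
  also have "\<dots> = (\<integral>\<^sup>+y. ennreal ((g y)\<^sup>2) \<partial>lborel)"
  proof (rule nn_integral_cong)
    fix y :: "real^2"
    have "(\<integral>\<^sup>+x. ennreal ((g y)\<^sup>2 * \<rho> (x - y)) \<partial>lborel) = (\<integral>\<^sup>+x. ennreal ((g y)\<^sup>2) * ennreal (\<rho> (x - y)) \<partial>lborel)"
      using \<rho>(2) by (intro nn_integral_cong) (simp add: ennreal_mult)
    also have "\<dots> = ennreal ((g y)\<^sup>2) * (\<integral>\<^sup>+x. ennreal (\<rho> (x - y)) \<partial>lborel)"
      by (rule nn_integral_cmult) simp
    also have "\<dots> = ennreal ((g y)\<^sup>2)"
      using nn_integral_translate[OF \<rho>_borel] nn_integral_\<rho> by simp
    finally show "(\<integral>\<^sup>+x. ennreal ((g y)\<^sup>2 * \<rho> (x - y)) \<partial>lborel) = ennreal ((g y)\<^sup>2)" .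
  qed
  also have "\<dots> = ennreal (LINT x|lborel. (g x)\<^sup>2)"
    by (rule nn_integral_eq_integral[OF g(2)]) simp
  finally show ?thesis .
qed

text \<open>Fubini moves the kernel from \<open>f\<close> to \<eta>. Averaging \<eta> over distances
  at most \<epsilon> changes it by at most L \<epsilon>, so the pairing converges with a rate,
  without pointwise convergence of the mollified \<open>f\<close>.\<close>

lemma mollify_inner:
  assumes f: "integrable lborel f" and \<eta>: "\<eta> \<in> test_functions \<Omega>"
    and L: "\<forall>x y. \<bar>\<eta> x - \<eta> y\<bar> \<le> L * norm (x - y)" "0 \<le> L"
  shows "\<bar>(LINT x|lborel. (LINT y|lborel. f y * \<rho> (x - y)) * \<eta> x) - (LINT y|lborel. f y * \<eta> y)\<bar>
    \<le> L * \<epsilon> * (LINT y|lborel. \<bar>f y\<bar>)"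
proof -
  have [measurable]: "\<rho> \<in> borel_measurable borel" by (rule \<rho>_borel)
  have [measurable]: "f \<in> borel_measurable borel" using borel_measurable_integrable[OF f] by simp
  have [measurable]: "\<eta> \<in> borel_measurable borel"
    by (rule borel_measurable_continuous_onI[OF test_function_continuous[OF \<eta>]])
  obtain B where B: "0 \<le> B" "\<forall>x. \<bar>\<rho> x\<bar> \<le> B" by (rule test_function_bounded[OF \<rho>(1)])
  obtain B' where B': "0 \<le> B'" "\<forall>x. \<bar>\<eta> x\<bar> \<le> B'" by (rule test_function_bounded[OF \<eta>])
  have \<eta>_int: "integrable lborel \<eta>"
    by (rule continuous_compact_support_integrable(2)[OF test_function_continuous[OF \<eta>] test_function_compact[OF \<eta>]])
  have cont1: "continuous_on UNIV (\<lambda>y. \<rho> (x - y))" for x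
    by (intro continuous_on_compose2[OF test_function_continuous[OF \<rho>(1)]] continuous_intros) auto
  have cont2: "continuous_on UNIV (\<lambda>x. \<rho> (x - y))" for y
    by (intro continuous_on_compose2[OF test_function_continuous[OF \<rho>(1)]] continuous_intros) auto
  have int_f: "integrable lborel (\<lambda>y. f y * \<rho> (x - y))" for x
    by (rule integrable_mult_bounded[OF f cont1]) (use B in auto)
  have \<rho>_shift: "integrable lborel (\<lambda>x. \<rho> (x - y))" "(LINT x|lborel. \<rho> (x - y)) = 1" for y
    using lborel_integrable_translation[OF \<rho>_int, of "- y"] lborel_integral_translation[OF \<rho>_borel, of "- y"] \<rho>(4)
    by simp_all
  have int_\<eta>: "integrable lborel (\<lambda>x. \<eta> x * \<rho> (x - y))" for y
    by (rule integrable_mult_bounded[OF \<eta>_int cont2]) (use B in auto)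
  have prod: "integrable (lborel \<Otimes>\<^sub>M lborel) (\<lambda>(y, x). f y * (\<eta> x * \<rho> (x - y)))"
  proof (rule lborel_pair.Fubini_integrable)
    show "(\<lambda>(y, x). f y * (\<eta> x * \<rho> (x - y))) \<in> borel_measurable (lborel \<Otimes>\<^sub>M lborel)" by measurable
    have bound: "(LINT x|lborel. norm (f y * (\<eta> x * \<rho> (x - y)))) \<le> \<bar>f y\<bar> * B'" for y
    proof -
      have "(LINT x|lborel. norm (f y * (\<eta> x * \<rho> (x - y)))) \<le> (LINT x|lborel. \<bar>f y\<bar> * (B' * \<rho> (x - y)))"
      proof (rule integral_mono)
        show "integrable lborel (\<lambda>x. norm (f y * (\<eta> x * \<rho> (x - y))))" using int_\<eta>[of y] by simp
        show "integrable lborel (\<lambda>x. \<bar>f y\<bar> * (B' * \<rho> (x - y)))" using \<rho>_shift(1)[of y] by simp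
        show "norm (f y * (\<eta> x * \<rho> (x - y))) \<le> \<bar>f y\<bar> * (B' * \<rho> (x - y))" for x
          using B' \<rho>(2) by (simp add: abs_mult mult_left_mono mult_right_mono)
      qed
      then show ?thesis using \<rho>_shift[of y] by simp
    qed
    show "integrable lborel (\<lambda>y. LINT x|lborel. norm (case (y, x) of (y, x) \<Rightarrow> f y * (\<eta> x * \<rho> (x - y))))"
    proof (rule Bochner_Integration.integrable_bound[where f="\<lambda>y. \<bar>f y\<bar> * B'"])
      show "integrable lborel (\<lambda>y. \<bar>f y\<bar> * B')" using f by simp
      show "AE y in lborel. norm (LINT x|lborel. norm (case (y, x) of (y, x) \<Rightarrow> f y * (\<eta> x * \<rho> (x - y)))) \<le> norm (\<bar>f y\<bar> * B')"
        using bound B'(1) by (intro AE_I2) (simp add: abs_of_nonneg[OF Bochner_Integration.integral_nonneg] abs_mult)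
    qed measurable
    show "AE y in lborel. integrable lborel (\<lambda>x. case (y, x) of (y, x) \<Rightarrow> f y * (\<eta> x * \<rho> (x - y)))"
      using int_\<eta> by simp
  qed
  have "(LINT x|lborel. (LINT y|lborel. f y * \<rho> (x - y)) * \<eta> x)
      = (LINT x|lborel. LINT y|lborel. f y * (\<eta> x * \<rho> (x - y)))"
    by (intro Bochner_Integration.integral_cong refl)
       (simp add: integral_mult_left_zero[symmetric] mult_ac del: integral_mult_left_zero)
  also have "\<dots> = (LINT y|lborel. LINT x|lborel. f y * (\<eta> x * \<rho> (x - y)))"
    by (rule lborel_pair.Fubini_integral[OF prod])
  also have "\<dots> = (LINT y|lborel. f y * (LINT x|lborel. \<eta> x * \<rho> (x - y)))" by simp
  finally have eq: "(LINT x|lborel. (LINT y|lborel. f y * \<rho> (x - y)) * \<eta> x)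
      = (LINT y|lborel. f y * (LINT x|lborel. \<eta> x * \<rho> (x - y)))" .
  define \<eta>\<epsilon> where "\<eta>\<epsilon> y = (LINT x|lborel. \<eta> x * \<rho> (x - y))" for y
  have close: "\<bar>\<eta>\<epsilon> y - \<eta> y\<bar> \<le> L * \<epsilon>" for y
  proof -
    have "\<eta>\<epsilon> y - \<eta> y = (LINT x|lborel. \<eta> x * \<rho> (x - y) - \<eta> y * \<rho> (x - y))"
      using int_\<eta>[of y] \<rho>_shift[of y] by (simp add: \<eta>\<epsilon>_def)
    also have "\<bar>\<dots>\<bar> \<le> (LINT x|lborel. L * \<epsilon> * \<rho> (x - y))"
    proof (rule order_trans[OF integral_abs_bound integral_mono])
      show "integrable lborel (\<lambda>x. \<bar>\<eta> x * \<rho> (x - y) - \<eta> y * \<rho> (x - y)\<bar>)"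
        using int_\<eta>[of y] \<rho>_shift(1)[of y] by simp
      show "integrable lborel (\<lambda>x. L * \<epsilon> * \<rho> (x - y))" using \<rho>_shift(1)[of y] by simp
      fix x
      show "\<bar>\<eta> x * \<rho> (x - y) - \<eta> y * \<rho> (x - y)\<bar> \<le> L * \<epsilon> * \<rho> (x - y)"
      proof (cases "\<epsilon> < norm (x - y)")
        case True
        then show ?thesis using \<rho>(3) by simp
      next
        case False
        have "\<bar>\<eta> x - \<eta> y\<bar> \<le> L * norm (x - y)" using L(1) by blast
        also have "\<dots> \<le> L * \<epsilon>" using False L(2) by (intro mult_left_mono) auto
        finally have "\<bar>\<eta> x - \<eta> y\<bar> * \<rho> (x - y) \<le> L * \<epsilon> * \<rho> (x - y)" using \<rho>(2) by (intro mult_right_mono) auto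
        then show ?thesis using \<rho>(2) by (simp add: left_diff_distrib[symmetric] abs_mult)
      qed
    qed
    also have "\<dots> = L * \<epsilon>" using \<rho>_shift[of y] by simp
    finally show ?thesis .
  qed
  have \<eta>\<epsilon>_meas [measurable]: "\<eta>\<epsilon> \<in> borel_measurable borel" unfolding \<eta>\<epsilon>_def[abs_def] by measurable
  have int_f\<eta>: "integrable lborel (\<lambda>y. f y * \<eta> y)"
    by (rule integrable_mult_bounded[OF f test_function_continuous[OF \<eta>]]) (use B' in auto)
  have int_d: "integrable lborel (\<lambda>y. f y * (\<eta>\<epsilon> y - \<eta> y))"
  proof (rule Bochner_Integration.integrable_bound[where f="\<lambda>y. L * \<epsilon> * f y"])
    show "AE y in lborel. norm (f y * (\<eta>\<epsilon> y - \<eta> y)) \<le> norm (L * \<epsilon> * f y)"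
    proof (intro AE_I2)
      fix y
      have "\<bar>f y\<bar> * \<bar>\<eta>\<epsilon> y - \<eta> y\<bar> \<le> \<bar>f y\<bar> * \<bar>L * \<epsilon>\<bar>" using close[of y] by (intro mult_left_mono) auto
      then show "norm (f y * (\<eta>\<epsilon> y - \<eta> y)) \<le> norm (L * \<epsilon> * f y)" by (simp add: abs_mult mult_ac)
    qed
  qed (use f in auto)
  have int_f\<eta>\<epsilon>: "integrable lborel (\<lambda>y. f y * \<eta>\<epsilon> y)"
  proof -
    have "integrable lborel (\<lambda>y. f y * (\<eta>\<epsilon> y - \<eta> y) + f y * \<eta> y)" by (rule Bochner_Integration.integrable_add[OF int_d int_f\<eta>])
    then show ?thesis by (simp add: algebra_simps)
  qed
  have "(LINT x|lborel. (LINT y|lborel. f y * \<rho> (x - y)) * \<eta> x) - (LINT y|lborel. f y * \<eta> y)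
      = (LINT y|lborel. f y * (\<eta>\<epsilon> y - \<eta> y))"
    unfolding eq \<eta>\<epsilon>_def[symmetric] using int_f\<eta> int_f\<eta>\<epsilon> by (simp add: right_diff_distrib)
  also have "\<bar>\<dots>\<bar> \<le> (LINT y|lborel. L * \<epsilon> * \<bar>f y\<bar>)"
  proof (rule order_trans[OF integral_abs_bound integral_mono])
    show "integrable lborel (\<lambda>y. \<bar>f y * (\<eta>\<epsilon> y - \<eta> y)\<bar>)" using int_d by simp
    show "integrable lborel (\<lambda>y. L * \<epsilon> * \<bar>f y\<bar>)" using f by simp
    show "\<bar>f y * (\<eta>\<epsilon> y - \<eta> y)\<bar> \<le> L * \<epsilon> * \<bar>f y\<bar>" for y
      unfolding abs_mult using mult_left_mono[OF close[of y], of "\<bar>f y\<bar>"] by (simp add: mult.commute)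
  qed
  finally show ?thesis by simp
qed

end

section \<open>Friedrichs' inequality on convex polygons\<close>

lemma integral_lebesgue_on_eq':
  fixes f :: "real^2 \<Rightarrow> real"
  assumes "S \<in> sets lebesgue" "\<And>x. x \<notin> S \<Longrightarrow> f x = 0"
  shows "(LINT x|lebesgue_on S. f x) = (LINT x|lebesgue. f x)"
proof -
  have "(LINT x|lebesgue_on S. f x) = (LINT x|lebesgue. indicat_real S x *\<^sub>R f x)"
    by (rule integral_restrict_space) (use assms(1) in simp)
  also have "\<dots> = (LINT x|lebesgue. f x)"
    by (rule Bochner_Integration.integral_cong) (use assms(2) in \<open>auto simp: indicator_def\<close>)
  finally show ?thesis .
qed

lemma continuous_on_compact_L2:
  assumes S: "compact S" and f: "continuous_on UNIV f"
  shows "f \<in> L2 S"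
proof -
  have "integrable lborel (\<lambda>x. indicat_real S x *\<^sub>R (f x)\<^sup>2)"
    using borel_integrable_compact[OF S, of "\<lambda>x. (f x)\<^sup>2"] continuous_on_subset[OF f]
    by (simp add: set_integrable_def continuous_on_power)
  moreover from this have "(\<lambda>x. indicat_real S x *\<^sub>R (f x)\<^sup>2) \<in> borel_measurable borel" by auto
  ultimately have "integrable lebesgue (\<lambda>x. indicat_real S x *\<^sub>R (f x)\<^sup>2)"
    by (subst integrable_completion) auto
  moreover have "S \<in> sets lebesgue" using compact_imp_closed[OF S] by auto
  ultimately have "integrable (lebesgue_on S) (\<lambda>x. (f x)\<^sup>2)"
    by (subst integrable_restrict_space) auto
  then show ?thesis
    by (simp add: L2_def measurable_restrict_space1 continuous_imp_borel_measurable_lebesgue[OF f])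
qed

text \<open>Approximating test functions have integrals tending to 0 because \<open>h\<close> has
  mean zero, so they can be corrected to integral zero at vanishing cost. Testing with integral zero
  only is what makes additive constants in \<open>h\<close> invisible.\<close>

lemma L2_norm_le_by_duality:
  assumes \<Omega>: "open \<Omega>" "bounded \<Omega>" "\<Omega> \<noteq> {}" and h: "h \<in> L2_mean_zero \<Omega>" and B: "0 \<le> B"
    and dual: "\<And>\<eta>. \<eta> \<in> test_functions \<Omega> \<Longrightarrow> (LINT x|lebesgue. \<eta> x) = 0 \<Longrightarrow> L2_inner \<Omega> h \<eta> \<le> B * L2_norm \<Omega> \<eta>"
  shows "L2_norm \<Omega> h \<le> B"
proof -
  have hL: "h \<in> L2 \<Omega>" and mean: "(LINT x|lebesgue_on \<Omega>. h x) = 0" using h by (auto simp: L2_mean_zero_def)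
  have one: "(\<lambda>x. 1) \<in> L2 \<Omega>" by (rule L2_const[OF \<Omega>(1,2)])
  obtain \<phi> where \<phi>: "\<forall>n. \<phi> n \<in> test_functions \<Omega>" "(\<lambda>n. L2_norm \<Omega> (\<lambda>x. \<phi> n x - h x)) \<longlonglongrightarrow> 0"
    by (rule test_functions_dense[OF \<Omega>(1,2) hL])
  obtain z where "z \<in> \<Omega>" using \<Omega>(3) by blast
  then obtain e where e: "0 < e" "cball z e \<subseteq> \<Omega>" using \<Omega>(1) open_contains_cball by blast
  obtain \<rho> where \<rho>: "\<rho> \<in> test_functions UNIV" "\<forall>x. 0 \<le> \<rho> x" "\<forall>x. e < norm x \<longrightarrow> \<rho> x = 0" "(LINT x|lborel. \<rho> x) = 1"
    by (rule mollifier_exists[OF e(1)])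
  \<comment> \<open>A fixed test function of integral 1; subtracting multiples of it corrects the
    integrals.\<close>
  define \<omega> where "\<omega> y = \<rho> (z - y)" for y
  have \<omega>: "\<omega> \<in> test_functions \<Omega>" unfolding \<omega>_def[abs_def] by (rule test_function_reflect[OF \<rho>(1,3) e(2)])
  have \<omega>1: "(LINT x|lebesgue. \<omega> x) = 1"
  proof -
    have "\<omega> \<in> borel_measurable lborel"
      using borel_measurable_continuous_onI[OF test_function_continuous[OF \<omega>]] by simp
    then have "(LINT x|lebesgue. \<omega> x) = (LINT x|lborel. \<omega> x)" by (rule integral_completion)
    then show ?thesis using \<rho>_reflect(2)[OF \<rho>] by (simp add: \<omega>_def)
  qed
  have test_int: "integrable lebesgue \<psi>" if "\<psi> \<in> test_functions \<Omega>" for \<psi>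
    by (rule continuous_compact_support_integrable(1)[OF test_function_continuous[OF that] test_function_compact[OF that]])
  have test_1: "L2_inner \<Omega> \<psi> (\<lambda>x. 1) = (LINT x|lebesgue. \<psi> x)" if "\<psi> \<in> test_functions \<Omega>" for \<psi>
    unfolding L2_inner_def mult_1_right
    by (rule integral_lebesgue_on_eq[OF \<Omega>(1)]) (rule test_function_outside[OF that])
  define \<mu> where "\<mu> n = (LINT x|lebesgue. \<phi> n x)" for n
  have \<phi>L: "\<phi> n \<in> L2 \<Omega>" for n using \<phi>(1) test_function_L2[OF \<Omega>(1,2)] by blast
  have \<omega>L: "\<omega> \<in> L2 \<Omega>" by (rule test_function_L2[OF \<Omega>(1,2) \<omega>])
  have "(\<lambda>n. L2_inner \<Omega> (\<phi> n) (\<lambda>x. 1)) \<longlonglongrightarrow> L2_inner \<Omega> h (\<lambda>x. 1)"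
    by (rule L2_inner_tendsto_left[OF \<phi>L hL one \<phi>(2)])
  then have \<mu>0: "\<mu> \<longlonglongrightarrow> 0" using mean \<phi>(1) by (simp add: test_1 \<mu>_def[abs_def] L2_inner_def[of \<Omega> h])
  define \<eta> where "\<eta> n x = \<phi> n x - \<mu> n * \<omega> x" for n x
  have \<eta>: "\<eta> n \<in> test_functions \<Omega>" for n
    unfolding \<eta>_def[abs_def] using \<phi>(1) \<omega> by (intro test_function_diff test_function_scale) auto
  have \<eta>0: "(LINT x|lebesgue. \<eta> n x) = 0" for n
    unfolding \<eta>_def using test_int[OF \<omega>] test_int[of "\<phi> n"] \<phi>(1) \<omega>1 by (simp add: \<mu>_def)
  have \<eta>L: "\<eta> n \<in> L2 \<Omega>" for n by (rule test_function_L2[OF \<Omega>(1,2) \<eta>])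
  have lim: "(\<lambda>n. L2_norm \<Omega> (\<lambda>x. \<eta> n x - h x)) \<longlonglongrightarrow> 0"
  proof (rule Lim_null_comparison)
    have "(\<lambda>n. L2_norm \<Omega> (\<lambda>x. \<phi> n x - h x) + \<bar>\<mu> n\<bar> * L2_norm \<Omega> \<omega>) \<longlonglongrightarrow> 0 + \<bar>0\<bar> * L2_norm \<Omega> \<omega>"
      by (intro tendsto_intros \<phi>(2) \<mu>0)
    then show "(\<lambda>n. L2_norm \<Omega> (\<lambda>x. \<phi> n x - h x) + \<bar>\<mu> n\<bar> * L2_norm \<Omega> \<omega>) \<longlonglongrightarrow> 0" by simp
    have "norm (L2_norm \<Omega> (\<lambda>x. \<eta> n x - h x)) \<le> L2_norm \<Omega> (\<lambda>x. \<phi> n x - h x) + \<bar>\<mu> n\<bar> * L2_norm \<Omega> \<omega>" for n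
    proof -
      have eq: "(\<lambda>x. \<eta> n x - h x) = (\<lambda>x. (\<phi> n x - h x) + (- \<mu> n) * \<omega> x)" by (auto simp: \<eta>_def)
      have "L2_norm \<Omega> (\<lambda>x. (- \<mu> n) * \<omega> x) = \<bar>\<mu> n\<bar> * L2_norm \<Omega> \<omega>"
        unfolding L2_norm_def L2_inner_scale_left L2_inner_scale_right
        by (simp add: real_sqrt_mult mult.assoc[symmetric] power2_eq_square[symmetric])
      then show ?thesis
        using L2_norm_triangle[OF L2_diff[OF \<phi>L[of n] hL] L2_scale[OF \<omega>L, of "- \<mu> n"]] unfolding eq
        by (simp add: L2_norm_nonneg)
    qed
    then show "\<forall>\<^sub>F n in sequentially. norm (L2_norm \<Omega> (\<lambda>x. \<eta> n x - h x)) \<le> L2_norm \<Omega> (\<lambda>x. \<phi> n x - h x) + \<bar>\<mu> n\<bar> * L2_norm \<Omega> \<omega>"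
      by simp
  qed
  have "(\<lambda>n. L2_inner \<Omega> (\<eta> n) h) \<longlonglongrightarrow> L2_inner \<Omega> h h"
    by (rule L2_inner_tendsto_left[OF \<eta>L hL hL lim])
  moreover have "(\<lambda>n. B * L2_norm \<Omega> (\<eta> n)) \<longlonglongrightarrow> B * L2_norm \<Omega> h"
    by (intro tendsto_intros L2_norm_tendsto[OF \<eta>L hL lim])
  moreover have "L2_inner \<Omega> (\<eta> n) h \<le> B * L2_norm \<Omega> (\<eta> n)" for n
    using dual[OF \<eta> \<eta>0] by (simp add: L2_inner_commute)
  ultimately have "L2_inner \<Omega> h h \<le> B * L2_norm \<Omega> h" by (intro LIMSEQ_le) auto
  then have sq: "L2_norm \<Omega> h * L2_norm \<Omega> h \<le> B * L2_norm \<Omega> h"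
    unfolding L2_norm_square[symmetric] power2_eq_square .
  show ?thesis
  proof (cases "L2_norm \<Omega> h = 0")
    case False
    then show ?thesis using L2_norm_nonneg[of \<Omega> h] by (intro mult_right_le_imp_le[OF sq]) simp
  qed (use B in simp)
qed

context polygon
begin

text \<open>Dividing the polar vectors by \<open>t\<close> shrinks the polygon towards
  \<open>c\<close>. Inner and outer distances both scale by \<open>t\<close>, so the constant
  \<open>C\<close> is unchanged.\<close>

lemma scaled_polygon:
  assumes t: "0 < t" "t \<le> 1"
  shows "polygon ((\<lambda>m. (1 / t) *\<^sub>R m) ` A) c" "polygon.D ((\<lambda>m. (1 / t) *\<^sub>R m) ` A) c = {x. N x \<le> t}"
proof -
  have eq: "{x. \<forall>m\<in>(\<lambda>m. (1 / t) *\<^sub>R m) ` A. m \<bullet> (x - c) \<le> 1} = {x. N x \<le> t}"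
    using t by (auto simp: N_le_iff divide_le_eq)
  have sub: "{x. N x \<le> t} \<subseteq> D" using t by (auto simp: D_iff)
  have "bounded {x. N x \<le> t}" by (rule bounded_subset[OF compact_imp_bounded[OF compact_D] sub])
  then show p: "polygon ((\<lambda>m. (1 / t) *\<^sub>R m) ` A) c"
    unfolding polygon_def eq using fin by simp
  show "polygon.D ((\<lambda>m. (1 / t) *\<^sub>R m) ` A) c = {x. N x \<le> t}"
    unfolding polygon.D_def[OF p] by (rule eq)
qed

text \<open>The derivative of the mollified function at \<open>x\<close> is the pairing with the
  derivative of a kernel that is a test function of \<Omega> once the \<epsilon>-ball fits.
  Reflection costs one sign on each side of the equations.\<close>

lemma mollified_Cauchy_Riemann:
  assumes \<Omega>: "open \<Omega>" and CR: "weak_Cauchy_Riemann \<Omega> h g"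
    and fh: "integrable lborel fh" "\<forall>u. continuous_on UNIV u \<longrightarrow> L2_inner \<Omega> h u = (LINT x|lborel. fh x * u x)"
    and fg: "integrable lborel fg" "\<forall>u. continuous_on UNIV u \<longrightarrow> L2_inner \<Omega> g u = (LINT x|lborel. fg x * u x)"
    and \<rho>: "\<rho> \<in> test_functions UNIV" "\<forall>x. \<epsilon> < norm x \<longrightarrow> \<rho> x = 0" and sub: "cball x \<epsilon> \<subseteq> \<Omega>"
  shows "(LINT y|lborel. fh y * pderiv_at 1 \<rho> (x - y)) = (LINT y|lborel. fg y * pderiv_at 2 \<rho> (x - y))"
    "(LINT y|lborel. fh y * pderiv_at 2 \<rho> (x - y)) = - (LINT y|lborel. fg y * pderiv_at 1 \<rho> (x - y))"
proof -
  let ?\<phi> = "\<lambda>y. \<rho> (x - y)"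
  have \<phi>: "?\<phi> \<in> test_functions \<Omega>" by (rule test_function_reflect[OF \<rho> sub])
  have cont: "continuous_on UNIV (pderiv_at j ?\<phi>)" for j
    by (rule test_function_continuous[OF test_function_pderiv[OF \<phi>]])
  have fh': "L2_inner \<Omega> h (pderiv_at j ?\<phi>) = - (LINT y|lborel. fh y * pderiv_at j \<rho> (x - y))" for j
    using fh(2) cont[of j] unfolding pderiv_at_reflect_test[OF \<rho>(1)] by simp
  have fg': "L2_inner \<Omega> g (pderiv_at j ?\<phi>) = - (LINT y|lborel. fg y * pderiv_at j \<rho> (x - y))" for j
    using fg(2) cont[of j] unfolding pderiv_at_reflect_test[OF \<rho>(1)] by simp
  have "L2_inner \<Omega> h (pderiv_at 1 ?\<phi>) = L2_inner \<Omega> g (pderiv_at 2 ?\<phi>)"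
    "L2_inner \<Omega> h (pderiv_at 2 ?\<phi>) = - L2_inner \<Omega> g (pderiv_at 1 ?\<phi>)"
    using CR \<phi> unfolding weak_Cauchy_Riemann_def by blast+
  then show "(LINT y|lborel. fh y * pderiv_at 1 \<rho> (x - y)) = (LINT y|lborel. fg y * pderiv_at 2 \<rho> (x - y))"
    "(LINT y|lborel. fh y * pderiv_at 2 \<rho> (x - y)) = - (LINT y|lborel. fg y * pderiv_at 1 \<rho> (x - y))"
    unfolding fh' fg' by simp_all
qed

text \<open>The test function in the dual pairing has compact support and so fits into a smaller
  copy of the polygon, around which the mollified pair is smooth and conjugate. The smooth estimate
  applies there with the same \<open>C\<close>, independently of the copy, and \<epsilon> tends to 0
  at the end.\<close>

lemma Friedrichs_inequality:
  assumes \<delta>: "0 < \<delta>" "\<And>m. m \<in> A \<Longrightarrow> norm m \<le> 1 / \<delta>"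
    and R: "0 < R" "\<And>x. x \<in> D \<Longrightarrow> norm (x - c) \<le> R"
    and C: "0 \<le> C" "C < 1" "C\<^sup>2 = 1 - \<delta>\<^sup>2 / R\<^sup>2"
    and h: "h \<in> L2_mean_zero {x. N x < 1}" and g: "g \<in> L2 {x. N x < 1}"
    and CR: "weak_Cauchy_Riemann {x. N x < 1} h g"
  shows "(1 - C) * (L2_norm {x. N x < 1} h)\<^sup>2 \<le> (1 + C) * (L2_norm {x. N x < 1} g)\<^sup>2"
proof -
  define \<Omega> where "\<Omega> = {x. N x < 1}"
  note h = h[folded \<Omega>_def] and g = g[folded \<Omega>_def] and CR = CR[folded \<Omega>_def]
  have \<Omega>: "open \<Omega>" "bounded \<Omega>" "\<Omega> \<noteq> {}"
  proof -
    show "open \<Omega>" unfolding \<Omega>_def by (rule open_N_less)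
    have sub: "\<Omega> \<subseteq> D" by (auto simp: \<Omega>_def D_iff)
    show "bounded \<Omega>" by (rule bounded_subset[OF compact_imp_bounded[OF compact_D] sub])
    have "c \<in> \<Omega>" by (simp add: \<Omega>_def N_c)
    then show "\<Omega> \<noteq> {}" by blast
  qed
  have hL: "h \<in> L2 \<Omega>" using h by (simp add: L2_mean_zero_def)
  obtain fh where fh: "fh \<in> borel_measurable borel" "integrable lborel fh" "integrable lborel (\<lambda>x. (fh x)\<^sup>2)"
    "\<forall>x. x \<notin> \<Omega> \<longrightarrow> fh x = 0" "(L2_norm \<Omega> h)\<^sup>2 = (LINT x|lborel. (fh x)\<^sup>2)"
    "\<forall>u. continuous_on UNIV u \<longrightarrow> L2_inner \<Omega> h u = (LINT x|lborel. fh x * u x)"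
    by (rule L2_borel_representative[OF \<Omega>(1,2) hL])
  obtain fg where fg: "fg \<in> borel_measurable borel" "integrable lborel fg" "integrable lborel (\<lambda>x. (fg x)\<^sup>2)"
    "\<forall>x. x \<notin> \<Omega> \<longrightarrow> fg x = 0" "(L2_norm \<Omega> g)\<^sup>2 = (LINT x|lborel. (fg x)\<^sup>2)"
    "\<forall>u. continuous_on UNIV u \<longrightarrow> L2_inner \<Omega> g u = (LINT x|lborel. fg x * u x)"
    by (rule L2_borel_representative[OF \<Omega>(1,2) g])
  define \<kappa> where "\<kappa> = sqrt ((1 + C) / (1 - C))"
  have \<kappa>: "0 \<le> \<kappa>" "\<kappa>\<^sup>2 = (1 + C) / (1 - C)" using C by (auto simp: \<kappa>_def)
  have dual: "L2_inner \<Omega> h \<eta> \<le> \<kappa> * L2_norm \<Omega> g * L2_norm \<Omega> \<eta>"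
    if \<eta>: "\<eta> \<in> test_functions \<Omega>" and \<eta>0: "(LINT x|lebesgue. \<eta> x) = 0" for \<eta>
  proof -
    note \<eta>c = test_function_continuous[OF \<eta>]
    obtain L where L: "0 \<le> L" "\<forall>x y. \<bar>\<eta> x - \<eta> y\<bar> \<le> L * norm (x - y)" by (rule test_function_Lipschitz[OF \<eta>])
    \<comment> \<open>The maximum of the gauge over the support is below 1 by compactness; taking
      the maximum with 1/2 keeps \<open>t\<close> positive.\<close>
    obtain t where t: "0 < t" "t < 1" "\<And>x. \<eta> x \<noteq> 0 \<Longrightarrow> N x \<le> t"
    proof (cases "closure {x. \<eta> x \<noteq> 0} = {}")
      case True
      then have "\<eta> x = 0" for x using closure_subset[of "{x. \<eta> x \<noteq> 0}"] by auto
      then show ?thesis using that[of "1/2"] by simp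
    next
      case False
      obtain z where z: "z \<in> closure {x. \<eta> x \<noteq> 0}" "\<forall>y\<in>closure {x. \<eta> x \<noteq> 0}. N y \<le> N z"
        using continuous_attains_sup[OF test_function_compact[OF \<eta>] False continuous_on_subset[OF N_continuous]] by blast
      have "N z < 1" using z(1) test_function_support[OF \<eta>] by (auto simp: \<Omega>_def)
      have "N x \<le> N z" if "\<eta> x \<noteq> 0" for x
      proof -
        have "x \<in> closure {x. \<eta> x \<noteq> 0}" by (rule subsetD[OF closure_subset]) (use that in simp)
        then show ?thesis using z(2) by blast
      qed
      then show ?thesis using that[of "max (N z) (1/2)"] \<open>N z < 1\<close> by (force simp: le_max_iff_disj)
    qed
    have t1: "t \<le> 1" using t by simp
    interpret P: polygon "(\<lambda>m. (1 / t) *\<^sub>R m) ` A" c by (rule scaled_polygon(1)[OF t(1) t1])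
    have PD: "P.D = {x. N x \<le> t}" by (rule scaled_polygon(2)[OF t(1) t1])
    have PDs: "P.D \<in> sets lebesgue" using P.closed_D by auto
    have \<eta>out: "\<eta> x = 0" if "x \<notin> P.D" for x using that t(3) by (auto simp: PD)
    have \<eta>PD: "L2_norm P.D \<eta> = L2_norm \<Omega> \<eta>"
      unfolding L2_norm_def L2_inner_def
      by (subst integral_lebesgue_on_eq[OF \<Omega>(1)], simp add: test_function_outside[OF \<eta>],
          subst integral_lebesgue_on_eq'[OF PDs], simp add: \<eta>out, rule refl)
    \<comment> \<open>Three levels: the estimate is made on gauge at most \<open>t\<close>, the
      smooth pair lives on gauge below \<open>t'\<close>, and the gap from \<open>t'\<close> to 1
      leaves room for the kernel.\<close>
    define t' where "t' = (1 + t) / 2"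
    have t': "t < t'" "t' < 1" using t by (auto simp: t'_def)
    \<comment> \<open>The gauge has Lipschitz constant 1 / \<delta>, so a shift by less than
      \<delta> (1 - t') raises it by less than 1 - t'.\<close>
    define \<epsilon>0 where "\<epsilon>0 = \<delta> * (1 - t')"
    have \<epsilon>0: "0 < \<epsilon>0" using \<delta>(1) t' by (simp add: \<epsilon>0_def)
    have main: "L2_inner \<Omega> h \<eta> \<le> \<kappa> * L2_norm \<Omega> g * L2_norm \<Omega> \<eta> + L * \<epsilon> * (LINT y|lborel. \<bar>fh y\<bar>)"
      if \<epsilon>: "0 < \<epsilon>" "\<epsilon> < \<epsilon>0" for \<epsilon>
    proof -
      obtain \<rho> where \<rho>: "\<rho> \<in> test_functions UNIV" "\<forall>x. 0 \<le> \<rho> x" "\<forall>x. \<epsilon> < norm x \<longrightarrow> \<rho> x = 0" "(LINT x|lborel. \<rho> x) = 1"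
        by (rule mollifier_exists[OF \<epsilon>(1)])
      define U where "U = {x. N x < t'}"
      have sub: "cball x \<epsilon> \<subseteq> \<Omega>" if "x \<in> U" for x
      proof
        fix y assume "y \<in> cball x \<epsilon>"
        then have "norm (y - x) \<le> \<epsilon>" by (simp add: dist_norm norm_minus_commute)
        moreover have "\<bar>N y - N x\<bar> \<le> 1 / \<delta> * norm (y - x)" by (rule N_Lipschitz[OF \<delta>(2)])
        ultimately have "N y - N x \<le> 1 / \<delta> * \<epsilon>"
          using \<delta>(1) by (meson abs_le_D1 divide_nonneg_pos mult_left_mono order_trans zero_le_one)
        also have "\<dots> < 1 - t'" using \<epsilon>(2) \<delta>(1) by (simp add: \<epsilon>0_def field_simps)
        finally show "y \<in> \<Omega>" using that by (simp add: U_def \<Omega>_def)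
      qed
      define h\<epsilon> where "h\<epsilon> x = (LINT y|lborel. fh y * \<rho> (x - y))" for x
      define g\<epsilon> where "g\<epsilon> x = (LINT y|lborel. fg y * \<rho> (x - y))" for x
      define p where "p x = (LINT y|lborel. fh y * pderiv_at 1 \<rho> (x - y))" for x
      define q where "q x = (LINT y|lborel. fh y * pderiv_at 2 \<rho> (x - y))" for x
      note h_der = mollify_has_derivative[OF fh(2) \<rho>(1), folded h\<epsilon>_def p_def q_def]
      note g_der = mollify_has_derivative[OF fg(2) \<rho>(1), folded g\<epsilon>_def]
      have h\<epsilon>c: "continuous_on UNIV h\<epsilon>" and g\<epsilon>c: "continuous_on UNIV g\<epsilon>"
        using has_derivative_continuous[OF h_der] has_derivative_continuous[OF g_der]
        by (auto intro!: continuous_at_imp_continuous_on)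
      have g_der': "(g\<epsilon> has_derivative (\<lambda>v. - q x * v$1 + p x * v$2)) (at x)" if "x \<in> U" for x
        using g_der[of x]
          mollified_Cauchy_Riemann[OF \<Omega>(1) CR fh(2) fh(6) fg(2) fg(6) \<rho>(1,3) sub[OF that], folded p_def q_def]
        by simp
      have est: "(1 - C) * (LINT x|lebesgue_on P.D. (h\<epsilon> x - h\<epsilon> c)\<^sup>2) \<le> (1 + C) * (LINT x|lebesgue_on P.D. (g\<epsilon> x)\<^sup>2)"
      proof (rule P.horgan_payne_smooth[where U=U and \<delta>="t * \<delta>" and R="t * R" and p=p and q=q])
        show "open U" unfolding U_def by (rule open_N_less)
        show "P.D \<subseteq> U" using t' by (auto simp: PD U_def)
        show "0 < t * \<delta>" "0 < t * R" using t \<delta> R by auto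
        show "norm m \<le> 1 / (t * \<delta>)" if m: "m \<in> (\<lambda>m. (1 / t) *\<^sub>R m) ` A" for m
          using m \<delta>(2) t(1) \<delta>(1) by (auto simp: field_simps)
        show "norm (x - c) \<le> t * R" if x: "x \<in> P.D" for x
        proof -
          have "N (c + (1/t) *\<^sub>R (x - c)) = (1/t) * N x" using N_scale[of "1/t" x] t(1) by simp
          also have "\<dots> \<le> 1" using x t(1) by (simp add: PD field_simps)
          finally have "norm ((c + (1/t) *\<^sub>R (x - c)) - c) \<le> R" by (intro R(2)) (simp add: D_iff)
          then have "1 / t * norm (x - c) \<le> R" using t(1) by (simp del: scaleR_right_diff_distrib)
          then show ?thesis using t(1) by (simp add: field_simps)
        qed
        show "0 \<le> C" "C < 1" by (fact C)+
        show "C\<^sup>2 = 1 - (t * \<delta>)\<^sup>2 / (t * R)\<^sup>2" using C(3) t(1) by (simp add: power_mult_distrib)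
        show "(h\<epsilon> has_derivative (\<lambda>v. p x * v$1 + q x * v$2)) (at x)" for x by (rule h_der)
      qed (rule g_der')
      have g\<epsilon>L: "g\<epsilon> \<in> L2 P.D" and h\<epsilon>L: "(\<lambda>x. h\<epsilon> x - h\<epsilon> c) \<in> L2 P.D" and \<eta>L: "\<eta> \<in> L2 P.D"
        by (intro continuous_on_compact_L2[OF P.compact_D] continuous_intros h\<epsilon>c g\<epsilon>c \<eta>c)+
      have g_le: "(LINT x|lebesgue_on P.D. (g\<epsilon> x)\<^sup>2) \<le> (L2_norm \<Omega> g)\<^sup>2"
      proof -
        have "ennreal (LINT x|lebesgue_on P.D. (g\<epsilon> x)\<^sup>2) = (\<integral>\<^sup>+x. ennreal ((g\<epsilon> x)\<^sup>2) \<partial>lebesgue_on P.D)"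
          by (rule nn_integral_eq_integral[symmetric]) (use L2_square_integrable[OF g\<epsilon>L] in auto)
        also have "\<dots> = (\<integral>\<^sup>+x. ennreal ((g\<epsilon> x)\<^sup>2) * indicator P.D x \<partial>lebesgue)"
          by (rule nn_integral_restrict_space) (use PDs in simp)
        also have "\<dots> \<le> (\<integral>\<^sup>+x. ennreal ((g\<epsilon> x)\<^sup>2) \<partial>lebesgue)"
          by (rule nn_integral_mono) (auto simp: indicator_def)
        also have "\<dots> = (\<integral>\<^sup>+x. ennreal ((g\<epsilon> x)\<^sup>2) \<partial>lborel)" by (rule nn_integral_completion)
        also have "\<dots> \<le> ennreal ((L2_norm \<Omega> g)\<^sup>2)"
          unfolding g\<epsilon>_def fg(5) by (rule mollify_L2[OF \<rho> fg(2,3)])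
        finally show ?thesis by simp
      qed
      have "(L2_norm P.D (\<lambda>x. h\<epsilon> x - h\<epsilon> c))\<^sup>2 \<le> \<kappa>\<^sup>2 * (L2_norm \<Omega> g)\<^sup>2"
      proof -
        have "(1 - C) * (LINT x|lebesgue_on P.D. (h\<epsilon> x - h\<epsilon> c)\<^sup>2) \<le> (1 + C) * (L2_norm \<Omega> g)\<^sup>2"
          by (rule order_trans[OF est mult_left_mono[OF g_le]]) (use C in simp)
        then show ?thesis using C unfolding \<kappa>(2) L2_norm_eq_integral by (simp add: field_simps)
      qed
      then have h_le: "L2_norm P.D (\<lambda>x. h\<epsilon> x - h\<epsilon> c) \<le> \<kappa> * L2_norm \<Omega> g"
        unfolding power_mult_distrib[symmetric]
        by (rule power2_le_imp_le) (use \<kappa> L2_norm_nonneg in auto)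
      \<comment> \<open>Because \<eta> has integral zero, subtracting the value at the centre does
        not change the pairing.\<close>
      have "(LINT x|lborel. h\<epsilon> x * \<eta> x) = L2_inner P.D (\<lambda>x. h\<epsilon> x - h\<epsilon> c) \<eta>"
      proof -
        have cs: "compact (closure {x. h\<epsilon> x * \<eta> x \<noteq> 0})"
          using closure_support_mult[of h\<epsilon> \<eta>] test_function_compact[OF \<eta>]
          by (meson bounded_subset closed_closure compact_eq_bounded_closed)
        have i1: "integrable lebesgue (\<lambda>x. h\<epsilon> x * \<eta> x)"
          by (intro continuous_compact_support_integrable continuous_intros h\<epsilon>c \<eta>c cs)
        have i2: "integrable lebesgue \<eta>"
          by (rule continuous_compact_support_integrable(1)[OF \<eta>c test_function_compact[OF \<eta>]])
        have "L2_inner P.D (\<lambda>x. h\<epsilon> x - h\<epsilon> c) \<eta> = (LINT x|lebesgue. (h\<epsilon> x - h\<epsilon> c) * \<eta> x)"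
          unfolding L2_inner_def by (rule integral_lebesgue_on_eq'[OF PDs]) (simp add: \<eta>out)
        also have "\<dots> = (LINT x|lebesgue. h\<epsilon> x * \<eta> x) - h\<epsilon> c * (LINT x|lebesgue. \<eta> x)"
          unfolding left_diff_distrib using i1 i2 by simp
        also have "\<dots> = (LINT x|lebesgue. h\<epsilon> x * \<eta> x)" using \<eta>0 by simp
        also have "\<dots> = (LINT x|lborel. h\<epsilon> x * \<eta> x)"
        proof (rule integral_completion)
          have "(\<lambda>x. h\<epsilon> x * \<eta> x) \<in> borel_measurable borel"
            by (intro borel_measurable_continuous_onI continuous_intros h\<epsilon>c \<eta>c)
          then show "(\<lambda>x. h\<epsilon> x * \<eta> x) \<in> borel_measurable lborel" by simp
        qed
        finally show ?thesis by simp
      qed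
      also have "\<dots> \<le> L2_norm P.D (\<lambda>x. h\<epsilon> x - h\<epsilon> c) * L2_norm P.D \<eta>"
        using L2_Cauchy_Schwarz[OF h\<epsilon>L \<eta>L] by simp
      also have "\<dots> \<le> \<kappa> * L2_norm \<Omega> g * L2_norm \<Omega> \<eta>"
        unfolding \<eta>PD by (rule mult_right_mono[OF h_le L2_norm_nonneg])
      finally have "(LINT x|lborel. h\<epsilon> x * \<eta> x) \<le> \<kappa> * L2_norm \<Omega> g * L2_norm \<Omega> \<eta>" .
      moreover have "\<bar>(LINT x|lborel. h\<epsilon> x * \<eta> x) - (LINT y|lborel. fh y * \<eta> y)\<bar> \<le> L * \<epsilon> * (LINT y|lborel. \<bar>fh y\<bar>)"
        unfolding h\<epsilon>_def by (rule mollify_inner[OF \<rho> fh(2) \<eta> L(2,1)])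
      moreover have "L2_inner \<Omega> h \<eta> = (LINT y|lborel. fh y * \<eta> y)" using fh(6) \<eta>c by blast
      ultimately show ?thesis by linarith
    qed
    have lim: "((\<lambda>\<epsilon>. \<kappa> * L2_norm \<Omega> g * L2_norm \<Omega> \<eta> + L * \<epsilon> * (LINT y|lborel. \<bar>fh y\<bar>))
        \<longlongrightarrow> \<kappa> * L2_norm \<Omega> g * L2_norm \<Omega> \<eta> + L * 0 * (LINT y|lborel. \<bar>fh y\<bar>)) (at_right 0)"
      by (intro tendsto_intros)
    have "\<forall>\<^sub>F \<epsilon> in at_right 0. L2_inner \<Omega> h \<eta> \<le> \<kappa> * L2_norm \<Omega> g * L2_norm \<Omega> \<eta> + L * \<epsilon> * (LINT y|lborel. \<bar>fh y\<bar>)"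
      unfolding eventually_at_right_field using main \<epsilon>0 by blast
    from tendsto_lowerbound[OF lim this] show ?thesis by simp
  qed
  have "L2_norm \<Omega> h \<le> \<kappa> * L2_norm \<Omega> g"
    by (rule L2_norm_le_by_duality[OF \<Omega> h _ dual]) (use \<kappa> L2_norm_nonneg in auto)
  then have "(L2_norm \<Omega> h)\<^sup>2 \<le> (\<kappa> * L2_norm \<Omega> g)\<^sup>2" by (rule power_mono) (rule L2_norm_nonneg)
  then show ?thesis using C unfolding \<Omega>_def[symmetric] power_mult_distrib \<kappa>(2) by (simp add: field_simps)
qed

text \<open>For \<Gamma> = (1 + C) / (1 - C) one has 1 / (1 + \<Gamma>) = (1 - C) / 2, which for C =
  cos \<omega> is the square of sin (\<omega> / 2).\<close>

lemma infsup_const_polygon: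
  assumes \<delta>: "0 < \<delta>" "\<And>m. m \<in> A \<Longrightarrow> norm m \<le> 1 / \<delta>"
    and R: "0 < R" "\<And>x. x \<in> D \<Longrightarrow> norm (x - c) \<le> R"
    and C: "0 \<le> C" "C < 1" "C\<^sup>2 = 1 - \<delta>\<^sup>2 / R\<^sup>2"
  shows "ereal (sqrt ((1 - C) / 2)) \<le> infsup_const {x. N x < 1}"
proof -
  have sub: "{x. N x < 1} \<subseteq> D" by (auto simp: D_iff)
  have bd: "bounded {x. N x < 1}" by (rule bounded_subset[OF compact_imp_bounded[OF compact_D] sub])
  have "ereal (1 / sqrt (1 + (1 + C) / (1 - C))) \<le> infsup_const {x. N x < 1}"
  proof (rule infsup_const_ge[OF open_N_less bd])
    show "0 \<le> (1 + C) / (1 - C)" using C by simp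
    show "(L2_norm {x. N x < 1} h)\<^sup>2 \<le> (1 + C) / (1 - C) * (L2_norm {x. N x < 1} g)\<^sup>2"
      if "h \<in> L2_mean_zero {x. N x < 1}" "g \<in> L2 {x. N x < 1}" "weak_Cauchy_Riemann {x. N x < 1} h g" for h g
      using Friedrichs_inequality[OF \<delta> R C that] C by (simp add: field_simps)
  qed
  moreover have "1 + (1 + C) / (1 - C) = 1 / ((1 - C) / 2)" using C by (simp add: field_simps)
  then have "1 / sqrt (1 + (1 + C) / (1 - C)) = sqrt ((1 - C) / 2)" by (simp add: real_sqrt_divide)
  ultimately show ?thesis by simp
qed

end

section \<open>The Horgan--Payne angle of a polygon\<close>

lemma continuous_integrable_lebesgue_on:
  fixes u :: "real^2 \<Rightarrow> 'b::euclidean_space"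
  assumes \<Omega>: "open \<Omega>" "bounded \<Omega>" and u: "continuous_on UNIV u"
  shows "integrable (lebesgue_on \<Omega>) u"
proof -
  interpret finite_measure "lebesgue_on \<Omega>" by (rule finite_measure_lebesgue_on[OF \<Omega>])
  have "compact (u ` closure \<Omega>)"
    by (rule compact_continuous_image[OF continuous_on_subset[OF u subset_UNIV]])
       (simp add: compact_closure \<Omega>(2))
  from compact_imp_bounded[OF this] obtain B where B: "\<forall>y\<in>u ` closure \<Omega>. norm y \<le> B"
    unfolding bounded_iff by blast
  have "norm (u x) \<le> B" if "x \<in> \<Omega>" for x
    using bspec[OF B imageI[OF subsetD[OF closure_subset that]]] .
  then have "AE x in lebesgue_on \<Omega>. norm (u x) \<le> B" by (intro AE_I2) simp
  then show ?thesis
    by (rule integrable_const_bound)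
       (intro measurable_restrict_space1 continuous_imp_borel_measurable_lebesgue u)
qed

text \<open>It yields barycenters and moment identities from symmetry alone, without evaluating an
  integral.\<close>

lemma integral_affine_symmetry:
  fixes f :: "real^2 \<Rightarrow> real^2"
  assumes \<Omega>: "open \<Omega>" "bounded \<Omega>" "\<Omega> \<noteq> {}" and L: "linear L" "inj L"
    and T: "(\<lambda>x. c + L (x - c)) ` \<Omega> = \<Omega>" and f: "continuous_on UNIV f"
  shows "(LINT x|lebesgue_on \<Omega>. f (c + L (x - c))) = (LINT x|lebesgue_on \<Omega>. f x)"
proof -
  let ?T = "\<lambda>x. c + L (x - c)" and ?d = "\<bar>det (matrix L)\<bar>"
  have \<Omega>s: "\<Omega> \<in> sets lebesgue" using \<Omega>(1) by simp
  have der: "(?T has_derivative L) (at x within \<Omega>)" for x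
  proof -
    have lin: "bounded_linear L" using L(1) by (simp add: linear_conv_bounded_linear)
    have sub: "((\<lambda>x. x - c) has_derivative (\<lambda>v. v)) (at x within \<Omega>)" by (auto intro!: derivative_eq_intros)
    from has_derivative_add[OF has_derivative_const bounded_linear.has_derivative[OF lin sub], of c]
    show ?thesis by simp
  qed
  have inj: "inj_on ?T \<Omega>"
    by (rule inj_onI) (use injD[OF L(2)] in fastforce)
  have int: "integrable (lebesgue_on \<Omega>) u" if "continuous_on UNIV u" for u :: "real^2 \<Rightarrow> real^2"
    by (rule continuous_integrable_lebesgue_on[OF \<Omega>(1,2) that])
  have abs_int: "u absolutely_integrable_on \<Omega>" "(LINT x|lebesgue_on \<Omega>. u x) = integral \<Omega> u"
    if "continuous_on UNIV u" for u :: "real^2 \<Rightarrow> real^2"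
    using int[OF that] \<Omega>s lebesgue_integral_eq_integral[OF int[OF that] \<Omega>s]
    by (simp_all add: set_integrable_def integrable_restrict_space)
  have change: "?d *\<^sub>R (LINT x|lebesgue_on \<Omega>. u (?T x)) = (LINT x|lebesgue_on \<Omega>. u x)"
    if u: "continuous_on UNIV u" for u :: "real^2 \<Rightarrow> real^2"
  proof -
    have Lc: "continuous_on UNIV L" by (rule linear_continuous_on) (use L(1) in \<open>simp add: linear_conv_bounded_linear\<close>)
    have Tc: "continuous_on UNIV (\<lambda>x. ?T x)"
      by (intro continuous_intros continuous_on_compose2[OF Lc]) auto
    have uT: "continuous_on UNIV (\<lambda>x. u (?T x))" by (rule continuous_on_compose2[OF u Tc]) auto
    have "integral \<Omega> (\<lambda>x. ?d *\<^sub>R u (?T x)) = integral \<Omega> u"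
      using has_absolute_integral_change_of_variables[OF \<Omega>s der inj, of u "integral \<Omega> u"] abs_int[OF u]
      unfolding T by blast
    then have "?d *\<^sub>R integral \<Omega> (\<lambda>x. u (?T x)) = integral \<Omega> u" by simp
    then show ?thesis using abs_int(2)[OF u] abs_int(2)[OF uT] by simp
  qed
  \<comment> \<open>A map of a set of positive finite measure onto itself preserves measure: the
    change of variables for a constant function forces the determinant to be 1 in absolute
    value.\<close>
  have "?d = 1"
  proof -
    have pos: "measure lebesgue \<Omega> \<noteq> 0"
    proof
      assume "measure lebesgue \<Omega> = 0"
      then have "negligible \<Omega>"
        using bounded_set_imp_lmeasurable[OF \<Omega>(2) \<Omega>s] negligible_iff_measure by blast
      then show False using open_not_negligible[OF \<Omega>(1,3)] by blast
    qed
    have "measure (lebesgue_on \<Omega>) \<Omega> = measure lebesgue \<Omega>"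
      using \<Omega>s by (simp add: measure_restrict_space)
    then have "(LINT x|lebesgue_on \<Omega>. (axis 1 1 :: real^2)) = measure lebesgue \<Omega> *\<^sub>R axis 1 1" by simp
    then have "?d *\<^sub>R (measure lebesgue \<Omega> *\<^sub>R (axis 1 1 :: real^2)) = measure lebesgue \<Omega> *\<^sub>R axis 1 1"
      using change[of "\<lambda>x. axis 1 1"] by simp
    then show ?thesis using pos by simp
  qed
  then show ?thesis using change[OF f] by simp
qed

lemma integral_affine_symmetry_real:
  fixes f :: "real^2 \<Rightarrow> real"
  assumes \<Omega>: "open \<Omega>" "bounded \<Omega>" "\<Omega> \<noteq> {}" and L: "linear L" "inj L"
    and T: "(\<lambda>x. c + L (x - c)) ` \<Omega> = \<Omega>" and f: "continuous_on UNIV f"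
  shows "(LINT x|lebesgue_on \<Omega>. f (c + L (x - c))) = (LINT x|lebesgue_on \<Omega>. f x)"
proof -
  have fv: "continuous_on UNIV (\<lambda>x. f x *\<^sub>R (axis 1 1 :: real^2))" by (intro continuous_intros f)
  have Lc: "continuous_on UNIV L" by (rule linear_continuous_on) (use L(1) in \<open>simp add: linear_conv_bounded_linear\<close>)
  have fT: "continuous_on UNIV (\<lambda>x. f (c + L (x - c)))"
    by (rule continuous_on_compose2[OF f]) (auto intro!: continuous_intros continuous_on_compose2[OF Lc])
  have "(LINT x|lebesgue_on \<Omega>. f (c + L (x - c))) *\<^sub>R (axis 1 1 :: real^2)
      = (LINT x|lebesgue_on \<Omega>. f x) *\<^sub>R axis 1 1"
    using integral_affine_symmetry[OF assms(1-6) fv] continuous_integrable_lebesgue_on[OF \<Omega>(1,2) f]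
      continuous_integrable_lebesgue_on[OF \<Omega>(1,2) fT] by simp
  then show ?thesis by simp
qed

section \<open>Elementary bounds for the angle\<close>

lemma ray_line_angle_nonneg: "0 \<le> ray_line_angle e \<tau>"
proof -
  have "\<bar>e \<bullet> \<tau>\<bar> / (norm e * norm \<tau>) \<le> 1"
    using Cauchy_Schwarz_ineq2[of e \<tau>] by (cases "e = 0 \<or> \<tau> = 0") (auto simp: divide_le_eq_1)
  then show ?thesis unfolding ray_line_angle_def by (intro arccos_lbound) (auto intro: order_trans[of _ 0])
qed

lemma horgan_payne_angle_le:
  assumes "tangent_direction (frontier \<Omega>) x \<tau>"
  shows "horgan_payne_angle \<Omega> x0 \<le> ray_line_angle (x - x0) \<tau>"
  unfolding horgan_payne_angle_def
  by (rule cInf_lower) (use assms ray_line_angle_nonneg in \<open>auto intro!: bdd_belowI[of _ 0]\<close>)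

lemma horgan_payne_angle_nonneg:
  assumes "tangent_direction (frontier \<Omega>) x \<tau>"
  shows "0 \<le> horgan_payne_angle \<Omega> x0"
  unfolding horgan_payne_angle_def
  by (rule cInf_greatest) (use assms ray_line_angle_nonneg in auto)

lemma sin_half_arccos:
  assumes "-1 \<le> C" "C \<le> 1"
  shows "sin (arccos C / 2) = sqrt ((1 - C) / 2)"
proof -
  have "C = 1 - 2 * (sin (arccos C / 2))\<^sup>2"
    using cos_double_sin[of "arccos C / 2"] assms by simp
  then have "(sin (arccos C / 2))\<^sup>2 = (1 - C) / 2" by simp
  moreover have "0 \<le> sin (arccos C / 2)"
    using arccos_lbound[OF assms] arccos_ubound[OF assms] by (intro sin_ge_zero) auto
  ultimately show ?thesis by (rule real_sqrt_unique[symmetric])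
qed

lemma orthogonal_parallel:
  fixes a b v :: "real^2"
  assumes "a \<bullet> v = 0" "b \<bullet> v = 0" "v \<noteq> 0" "b \<noteq> 0"
  obtains t where "a = t *\<^sub>R b"
proof -
  have cross: "a$1 * b$2 = a$2 * b$1"
  proof -
    have "v$1 * (a$1 * b$2 - a$2 * b$1) = (a \<bullet> v) * b$2 - (b \<bullet> v) * a$2"
      "v$2 * (a$1 * b$2 - a$2 * b$1) = (b \<bullet> v) * a$1 - (a \<bullet> v) * b$1"
      by (simp_all add: inner_vec2 algebra_simps)
    then have "v$1 * (a$1 * b$2 - a$2 * b$1) = 0" "v$2 * (a$1 * b$2 - a$2 * b$1) = 0"
      using assms(1,2) by simp_all
    moreover have "v$1 \<noteq> 0 \<or> v$2 \<noteq> 0" using assms(3) by (auto simp: vec_eq_iff forall_2)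
    ultimately show ?thesis by auto
  qed
  consider "b$1 \<noteq> 0" | "b$2 \<noteq> 0" using assms(4) by (auto simp: vec_eq_iff forall_2)
  then show ?thesis
  proof cases
    case 1
    then show ?thesis using cross that[of "a$1 / b$1"] by (simp add: vec_eq_iff forall_2 field_simps)
  next
    case 2
    then show ?thesis using cross that[of "a$2 / b$2"] by (simp add: vec_eq_iff forall_2 field_simps)
  qed
qed

context polygon
begin

lemma interior_D: "interior D = {x. N x < 1}"
proof
  show "{x. N x < 1} \<subseteq> interior D"
    by (rule interior_maximal[OF _ open_N_less]) (auto simp: D_iff)
  show "interior D \<subseteq> {x. N x < 1}"
  proof
    fix x assume x: "x \<in> interior D"
    then have xD: "x \<in> D" using interior_subset by blast
    obtain e where e: "0 < e" "ball x e \<subseteq> D" using x by (auto simp: mem_interior)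
    show "x \<in> {x. N x < 1}"
    proof (rule ccontr)
      assume "x \<notin> {x. N x < 1}"
      then have N1: "N x = 1" using xD D_iff[of x] by simp
      let ?m = "normal x"
      have m0: "?m \<noteq> 0" using normal(2)[of x] N1 by auto
      define s where "s = e / (2 * norm ?m)"
      have s: "0 < s" using e m0 by (simp add: s_def)
      have "x + s *\<^sub>R ?m \<in> ball x e" using e m0 by (simp add: s_def dist_norm)
      then have "N (x + s *\<^sub>R ?m) \<le> 1" using e D_iff by blast
      moreover have "?m \<bullet> (x + s *\<^sub>R ?m - c) \<le> N (x + s *\<^sub>R ?m)" by (rule N_ge[OF normal(1)])
      moreover have "?m \<bullet> (x + s *\<^sub>R ?m - c) = 1 + s * (?m \<bullet> ?m)"
        using normal(2)[of x] N1 by (simp add: inner_simps)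
      moreover have "0 < s * (?m \<bullet> ?m)" using s m0 by simp
      ultimately show False by linarith
    qed
  qed
qed

lemma frontier_interior: "frontier {x. N x < 1} = {x. N x = 1}"
proof
  have "closure {x. N x < 1} \<subseteq> D"
    by (rule closure_minimal[OF _ closed_D]) (auto simp: D_iff)
  moreover have "interior {x. N x < 1} = {x. N x < 1}" by (rule interior_open[OF open_N_less])
  ultimately show "frontier {x. N x < 1} \<subseteq> {x. N x = 1}" by (force simp: frontier_def D_iff)
  show "{x. N x = 1} \<subseteq> frontier {x. N x < 1}"
  proof
    fix x assume "x \<in> {x. N x = 1}"
    then have x: "N x = 1" by simp
    have lim: "(\<lambda>n. c + (1 - 1 / real (Suc n)) *\<^sub>R (x - c)) \<longlonglongrightarrow> c + (1 - 0) *\<^sub>R (x - c)"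
      by (intro tendsto_intros LIMSEQ_Suc[OF lim_1_over_n])
    have "N (c + (1 - 1 / real (Suc n)) *\<^sub>R (x - c)) < 1" for n
      using N_scale[of "1 - 1 / real (Suc n)" x] x by simp
    then have "x \<in> closure {x. N x < 1}"
      using lim unfolding closure_sequential by (intro exI conjI allI) auto
    then show "x \<in> frontier {x. N x < 1}"
      using x interior_open[OF open_N_less] by (simp add: frontier_def)
  qed
qed

text \<open>A vertex need not have a tangent, so the angle there is reached as a limit along the
  open side from \<open>p\<close> to \<open>p'\<close>, whose points all have the side as tangent.
  The last equation says that the sine of this limit angle is the distance of the side divided by
  the distance of \<open>p\<close>.\<close>

lemma horgan_payne_angle_edge:
  assumes m0: "m0 \<in> A" and p: "p \<in> D" "m0 \<bullet> (p - c) = 1" and p': "p' \<in> D" "m0 \<bullet> (p' - c) = 1"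
    and ne: "p \<noteq> p'"
  shows "0 \<le> horgan_payne_angle {x. N x < 1} c"
    "horgan_payne_angle {x. N x < 1} c \<le> arccos (\<bar>(p - c) \<bullet> (p' - p)\<bar> / (norm (p - c) * norm (p' - p)))"
    "\<bar>(p - c) \<bullet> (p' - p)\<bar> / (norm (p - c) * norm (p' - p)) < 1"
    "(\<bar>(p - c) \<bullet> (p' - p)\<bar> / (norm (p - c) * norm (p' - p)))\<^sup>2 = 1 - (1 / norm m0)\<^sup>2 / (norm (p - c))\<^sup>2"
proof -
  define \<tau> where "\<tau> = p' - p"
  have \<tau>: "\<tau> \<noteq> 0" using ne by (simp add: \<tau>_def)
  have m\<tau>: "m0 \<bullet> \<tau> = 0" using p(2) p'(2) by (simp add: \<tau>_def inner_diff_right)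
  have m00: "m0 \<noteq> 0" using p(2) by auto
  have pc: "p \<noteq> c" using p(2) by auto
  define P where "P s = p + s *\<^sub>R \<tau>" for s
  have mP: "m0 \<bullet> (P s - c) = 1" for s
    using p(2) m\<tau> by (simp add: P_def inner_simps)
  have PN: "N (P s) = 1" if s: "0 \<le> s" "s \<le> 1" for s
  proof (rule antisym)
    have "P s = (1 - s) *\<^sub>R p + s *\<^sub>R p'" by (simp add: P_def \<tau>_def algebra_simps)
    then have "P s \<in> D" using convexD_alt[OF convex_D p(1) p'(1) s] by simp
    then show "N (P s) \<le> 1" by (simp add: D_iff)
    show "1 \<le> N (P s)" using N_ge[OF m0, of "P s"] mP by simp
  qed
  \<comment> \<open>An inner point of the side lies on no other side line: another form is at most 1
    at both ends, so reaching 1 in between makes it 1 at both ends, and two points on the line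
    determine the polar vector.\<close>
  have strict: "m \<bullet> (P s - c) < 1" if s: "0 < s" "s < 1" and m: "m \<in> A" "m \<noteq> m0" for s m
  proof (rule ccontr)
    assume "\<not> m \<bullet> (P s - c) < 1"
    then have eq: "1 \<le> m \<bullet> (P s - c)" by simp
    have 1: "m \<bullet> (p - c) \<le> 1" "m \<bullet> (p' - c) \<le> 1" using p(1) p'(1) m(1) by (auto simp: D_def)
    define a b where "a = m \<bullet> (p - c)" and "b = m \<bullet> (p' - c)"
    have "m \<bullet> (P s - c) = (1 - s) * a + s * b"
      by (simp add: P_def \<tau>_def a_def b_def inner_simps algebra_simps)
    then have "(1 - s) * (1 - a) + s * (1 - b) \<le> 0" using eq by (simp add: algebra_simps)
    moreover have nn: "0 \<le> (1 - s) * (1 - a)" "0 \<le> s * (1 - b)"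
      using 1 s by (auto simp: a_def b_def)
    ultimately have "(1 - s) * (1 - a) + s * (1 - b) = 0" by (intro antisym add_nonneg_nonneg)
    then have "(1 - s) * (1 - a) = 0 \<and> s * (1 - b) = 0"
      using add_nonneg_eq_0_iff[OF nn] by blast
    then have mp: "m \<bullet> (p - c) = 1" "m \<bullet> (p' - c) = 1" using s by (auto simp: a_def b_def)
    have "(m - m0) \<bullet> \<tau> = 0" using mp m\<tau> by (simp add: \<tau>_def inner_simps)
    then obtain t where t: "m - m0 = t *\<^sub>R m0" by (rule orthogonal_parallel[OF _ m\<tau> \<tau> m00])
    have "(m - m0) \<bullet> (p - c) = 0" using mp p(2) by (simp add: inner_diff_left)
    then have "t = 0" unfolding t using p(2) by simp
    then show False using t m(2) by simp
  qed
  have tangent: "tangent_direction (frontier {x. N x < 1}) (P s) \<tau>" if s: "0 < s" "s < 1" for s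
    unfolding tangent_direction_def frontier_interior
  proof (intro conjI \<tau>)
    show "P s \<in> {x. N x = 1}" using PN s by simp
    show "P s islimpt {x. N x = 1}"
      unfolding islimpt_approachable
    proof (intro allI impI)
      fix e :: real assume e: "0 < e"
      define r where "r = min ((1 - s) / 2) (e / (2 * norm \<tau>))"
      have r: "0 < r" "r < 1 - s" "r * norm \<tau> < e"
      proof -
        show "0 < r" "r < 1 - s" using s e \<tau> by (auto simp: r_def min_def field_simps)
        have "r * norm \<tau> \<le> e / (2 * norm \<tau>) * norm \<tau>" by (intro mult_right_mono) (auto simp: r_def)
        then show "r * norm \<tau> < e" using \<tau> e by simp
      qed
      show "\<exists>x'\<in>{x. N x = 1}. x' \<noteq> P s \<and> dist x' (P s) < e"
      proof (intro bexI conjI)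
        show "P (s + r) \<in> {x. N x = 1}" using PN[of "s + r"] s r by simp
        show "P (s + r) \<noteq> P s" using r \<tau> by (simp add: P_def)
        show "dist (P (s + r)) (P s) < e" using r by (simp add: P_def dist_norm algebra_simps)
      qed
    qed
    \<comment> \<open>Near an inner point of the side only the form \<open>m0\<close> can attain 1,
      so the boundary lies on the line itself and the distance to it is exactly 0.\<close>
    define W where "W = (\<Inter>m\<in>A - {m0}. {y. m \<bullet> (y - c) < 1})"
    have W: "open W" "P s \<in> W"
      using fin strict[OF s] unfolding W_def by (auto intro!: open_INT open_Collect_less continuous_intros)
    have zero: "infdist y {P s + t *\<^sub>R \<tau> |t. True} = 0" if y: "y \<in> W" "N y = 1" for y
    proof -
      have "normal y = m0"
      proof (rule ccontr)
        assume "normal y \<noteq> m0"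
        then have "normal y \<bullet> (y - c) < 1" using y(1) normal(1)[of y] unfolding W_def by blast
        then show False using normal(2)[of y] y(2) by simp
      qed
      then have "m0 \<bullet> (y - c) = 1" using normal(2)[of y] y(2) by simp
      then have "m0 \<bullet> (y - P s) = 0" using mP[of s] by (simp add: inner_diff_right)
      then obtain t where "y - P s = t *\<^sub>R \<tau>"
        using orthogonal_parallel[of "y - P s" m0 \<tau>] m\<tau> m00 \<tau> by (metis inner_commute)
      then have "y = P s + t *\<^sub>R \<tau>" by (simp add: algebra_simps)
      then show ?thesis by (intro infdist_zero) blast
    qed
    have "\<forall>\<^sub>F y in at (P s) within {x. N x = 1}. 0 = infdist y {P s + t *\<^sub>R \<tau> |t. True} / dist y (P s)"
      unfolding eventually_at_topological using W zero by auto
    then show "((\<lambda>y. infdist y {P s + t *\<^sub>R \<tau> |t. True} / dist y (P s)) \<longlongrightarrow> 0) (at (P s) within {x. N x = 1})"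
      by (rule Lim_transform_eventually[OF tendsto_const])
  qed
  define C where "C s = \<bar>(P s - c) \<bullet> \<tau>\<bar> / (norm (P s - c) * norm \<tau>)" for s
  have C0: "C 0 = \<bar>(p - c) \<bullet> (p' - p)\<bar> / (norm (p - c) * norm (p' - p))"
    by (simp add: C_def P_def \<tau>_def)
  \<comment> \<open>Lagrange's identity in the plane: \<tau> is a multiple of \<open>m0\<close>
    turned by a right angle, so its product with \<open>p - c\<close> is a multiple of the cross
    product of \<open>m0\<close> and \<open>p - c\<close>.\<close>
  have id: "((p - c) \<bullet> \<tau>)\<^sup>2 * (norm m0)\<^sup>2 = ((norm (p - c))\<^sup>2 * (norm m0)\<^sup>2 - 1) * (norm \<tau>)\<^sup>2"
  proof -
    let ?u = "p - c"
    have sq: "(m0 \<bullet> ?u)\<^sup>2 = 1" using p(2) by simp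
    have "m0$1 * \<tau>$1 + m0$2 * \<tau>$2 = 0" using m\<tau> by (simp add: inner_vec2)
    then obtain t where t: "\<tau>$1 = - t * m0$2" "\<tau>$2 = t * m0$1"
    proof -
      have "\<tau> \<bullet> m0 = 0" using m\<tau> by (simp add: inner_commute)
      moreover have "vector [- (m0$2), m0$1] \<bullet> m0 = (0::real)" by (simp add: inner_vec2)
      moreover have "vector [- (m0$2), m0$1] \<noteq> (0::real^2)" using m00 by (auto simp: vec_eq_iff forall_2)
      ultimately obtain t where "\<tau> = t *\<^sub>R vector [- (m0$2), m0$1]"
        using orthogonal_parallel[of \<tau> m0 "vector [- (m0$2), m0$1]"] m00 by metis
      then show ?thesis using that[of t] by simp
    qed
    have "(u \<bullet> \<tau>)\<^sup>2 * (norm m0)\<^sup>2 = ((norm u)\<^sup>2 * (norm m0)\<^sup>2 - (m0 \<bullet> u)\<^sup>2) * (norm \<tau>)\<^sup>2" for u :: "real^2"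
      unfolding power2_norm_eq_inner inner_vec2 t by (simp add: power2_eq_square algebra_simps)
    from this[of ?u] show ?thesis unfolding sq .
  qed
  have C0sq: "(C 0)\<^sup>2 = 1 - (1 / norm m0)\<^sup>2 / (norm (p - c))\<^sup>2"
  proof -
    have "(C 0)\<^sup>2 = ((p - c) \<bullet> \<tau>)\<^sup>2 / ((norm (p - c))\<^sup>2 * (norm \<tau>)\<^sup>2)"
      by (simp add: C_def P_def power_divide power_mult_distrib)
    also have "((p - c) \<bullet> \<tau>)\<^sup>2 = ((norm (p - c))\<^sup>2 * (norm m0)\<^sup>2 - 1) * (norm \<tau>)\<^sup>2 / (norm m0)\<^sup>2"
      using id m00 by (simp add: field_simps)
    finally show ?thesis using \<tau> m00 pc by (simp add: divide_simps)
  qed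
  have C0_nonneg: "0 \<le> C 0" by (simp add: C_def)
  have "(C 0)\<^sup>2 < 1" unfolding C0sq using m00 pc by simp
  then have C0_less: "C 0 < 1" using C0_nonneg by (simp add: power_less_one_iff abs_square_less_1)
  \<comment> \<open>Continuity of \<open>arccos\<close> is needed only inside the open interval; the
    cosine at the vertex is below 1 because the line of the side misses \<open>c\<close>.\<close>
  have lim: "((\<lambda>s. arccos (C s)) \<longlongrightarrow> arccos (C 0)) (at_right 0)"
  proof (rule isCont_tendsto_compose[OF isCont_arccos])
    show "(C \<longlongrightarrow> C 0) (at_right 0)"
      unfolding C_def P_def using pc \<tau> by (intro tendsto_eq_intros) auto
  qed (use C0_nonneg C0_less in auto)
  have ev: "\<forall>\<^sub>F s in at_right 0. horgan_payne_angle {x. N x < 1} c \<le> arccos (C s)"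
    unfolding eventually_at_right_field
  proof (intro exI[of _ 1] conjI allI impI)
    fix s :: real assume "0 < s" "s < 1"
    then show "horgan_payne_angle {x. N x < 1} c \<le> arccos (C s)"
      using horgan_payne_angle_le[OF tangent, of s c] by (simp add: ray_line_angle_def C_def)
  qed simp
  show "horgan_payne_angle {x. N x < 1} c \<le> arccos (\<bar>(p - c) \<bullet> (p' - p)\<bar> / (norm (p - c) * norm (p' - p)))"
    unfolding C0[symmetric] by (rule tendsto_lowerbound[OF lim ev]) simp
  show "0 \<le> horgan_payne_angle {x. N x < 1} c"
    by (rule horgan_payne_angle_nonneg[OF tangent[of "1/2"]]) auto
  show "\<bar>(p - c) \<bullet> (p' - p)\<bar> / (norm (p - c) * norm (p' - p)) < 1" unfolding C0[symmetric] by (rule C0_less)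
  show "(\<bar>(p - c) \<bullet> (p' - p)\<bar> / (norm (p - c) * norm (p' - p)))\<^sup>2 = 1 - (1 / norm m0)\<^sup>2 / (norm (p - c))\<^sup>2"
    unfolding C0[symmetric] by (rule C0sq)
qed

text \<open>If a nearest side contains a farthest vertex, the angle is attained there.\<close>

lemma horgan_payne_inequality:
  assumes m0: "m0 \<in> A" "\<And>m. m \<in> A \<Longrightarrow> norm m \<le> norm m0"
    and p: "p \<in> D" "m0 \<bullet> (p - c) = 1" and p': "p' \<in> D" "m0 \<bullet> (p' - c) = 1" and ne: "p \<noteq> p'"
    and far: "\<And>x. x \<in> D \<Longrightarrow> norm (x - c) \<le> norm (p - c)"
  shows "ereal (sin (horgan_payne_angle {x. N x < 1} c / 2)) \<le> infsup_const {x. N x < 1}"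
proof -
  define C where "C = \<bar>(p - c) \<bullet> (p' - p)\<bar> / (norm (p - c) * norm (p' - p))"
  note edge = horgan_payne_angle_edge[OF m0(1) p p' ne, folded C_def]
  have C0: "0 \<le> C" by (simp add: C_def)
  have m00: "0 < norm m0" and pc: "0 < norm (p - c)" using p(2) by auto
  have "horgan_payne_angle {x. N x < 1} c / 2 \<le> arccos C / 2" using edge(2) by simp
  moreover have "arccos C \<le> pi / 2" by (rule arccos_le_pi2[OF C0 less_imp_le[OF edge(3)]])
  ultimately have "sin (horgan_payne_angle {x. N x < 1} c / 2) \<le> sin (arccos C / 2)"
    using edge(1) by (intro sin_monotone_2pi_le) auto
  also have "\<dots> = sqrt ((1 - C) / 2)" using C0 edge(3) by (intro sin_half_arccos) auto
  finally have le: "ereal (sin (horgan_payne_angle {x. N x < 1} c / 2)) \<le> ereal (sqrt ((1 - C) / 2))" by simp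
  also have "\<dots> \<le> infsup_const {x. N x < 1}"
    by (rule infsup_const_polygon[where \<delta>="1 / norm m0" and R="norm (p - c)"])
       (use m00 m0(2) pc far C0 edge(3,4) in auto)
  finally show ?thesis .
qed

end

section \<open>Affine images of regular polygons\<close>

text \<open>A vertex and the middle of a side differ in angle by an odd multiple of pi / n, between
  pi / n and 2 pi - pi / n in absolute value. Hence every vertex satisfies the inequality of every
  side.\<close>

lemma cos_odd_multiple_le:
  assumes "i < n" "j < n"
  shows "cos ((2 * real i - (2 * real j + 1)) * pi / real n) \<le> cos (pi / real n)"
proof -
  define y where "y = \<bar>2 * real i - (2 * real j + 1)\<bar>"
  have n: "0 < real n" using assms by simp
  have y: "1 \<le> y" "y \<le> 2 * real n - 1"
  proof -
    have "real i \<le> real j \<or> real j + 1 \<le> real i"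
      by (cases "i \<le> j") (auto simp: nat_less_real_le)
    then show "1 \<le> y" by (auto simp: y_def)
    have "real i + 1 \<le> real n" "real j + 1 \<le> real n" using assms by linarith+
    then show "y \<le> 2 * real n - 1" by (simp add: y_def abs_le_iff)
  qed
  define x where "x = y * pi / real n"
  have "\<bar>(2 * real i - (2 * real j + 1)) * pi / real n\<bar> = x"
    using n by (simp add: x_def y_def abs_mult)
  then have cos_x: "cos ((2 * real i - (2 * real j + 1)) * pi / real n) = cos x"
    by (metis cos_abs_real)
  have x1: "pi / real n \<le> x"
    using mult_right_mono[OF y(1), of pi] n by (simp add: x_def divide_right_mono)
  have "y * pi \<le> (2 * real n - 1) * pi" by (rule mult_right_mono[OF y(2)]) simp
  then have "x \<le> (2 * real n - 1) * pi / real n" unfolding x_def by (rule divide_right_mono) (use n in simp)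
  also have "\<dots> = 2 * pi - pi / real n" using n by (simp add: field_simps)
  finally have x2: "x \<le> 2 * pi - pi / real n" .
  have pn: "0 \<le> pi / real n" using n by simp
  show ?thesis unfolding cos_x
  proof (cases "x \<le> pi")
    case True
    then show "cos x \<le> cos (pi / real n)" using x1 pn by (intro cos_monotone_0_pi_le) auto
  next
    case False
    have "cos x = cos (2 * pi - x)" by simp
    also have "\<dots> \<le> cos (pi / real n)" using False x2 pn by (intro cos_monotone_0_pi_le) auto
    finally show "cos x \<le> cos (pi / real n)" .
  qed
qed

text \<open>All the shapes are affine images of regular polygons, triangles with n = 3 and
  parallelograms with n = 4. The vectors \<open>e\<close> and \<open>f\<close> are the images of an
  orthonormal frame, so sides, gauge and barycenter are computed only once.\<close>

locale affine_regular_polygon =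
  fixes n :: nat and c e f :: "real^2"
  assumes n: "3 \<le> n" and det: "e$1 * f$2 - e$2 * f$1 \<noteq> 0"
begin

definition k :: real where "k = e$1 * f$2 - e$2 * f$1"

text \<open>The pair \<open>es\<close>, \<open>fs\<close> is the basis dual to \<open>e\<close>,
  \<open>f\<close>; it reads off coordinates in the affine frame.\<close>

definition es :: "real^2" where "es = vector [f$2 / k, - f$1 / k]"

definition fs :: "real^2" where "fs = vector [- e$2 / k, e$1 / k]"

definition w :: real where "w = 2 * pi / real n"

definition Q :: "real \<Rightarrow> real^2" where "Q t = c + cos t *\<^sub>R e + sin t *\<^sub>R f"

definition P :: "nat \<Rightarrow> real^2" where "P j = Q (real j * w)"

text \<open>The parameter angle of the middle of the side from \<open>P j\<close> to
  \<open>P (Suc j)\<close>.\<close>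

definition \<psi> :: "nat \<Rightarrow> real" where "\<psi> j = (2 * real j + 1) * pi / real n"

text \<open>The polar vector of this side: in the parameter plane the sides have distance cos (pi /
  n) from the centre of the unit circle.\<close>

definition M :: "nat \<Rightarrow> real^2" where
  "M j = (1 / cos (pi / real n)) *\<^sub>R (cos (\<psi> j) *\<^sub>R es + sin (\<psi> j) *\<^sub>R fs)"

definition H :: "(real^2) set" where "H = convex hull (P ` {..<n})"

lemma k: "k \<noteq> 0" using det by (simp add: k_def)

lemma dual: "es \<bullet> e = 1" "es \<bullet> f = 0" "fs \<bullet> e = 0" "fs \<bullet> f = 1"
proof -
  have "es \<bullet> e = (e$1 * f$2 - e$2 * f$1) / k" "fs \<bullet> f = (e$1 * f$2 - e$2 * f$1) / k"
    by (simp_all add: es_def fs_def inner_vec2 diff_divide_distrib mult.commute)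
  then show "es \<bullet> e = 1" "fs \<bullet> f = 1" using k by (simp_all add: k_def[symmetric])
  show "es \<bullet> f = 0" "fs \<bullet> e = 0" by (simp_all add: es_def fs_def inner_vec2)
qed

lemma expand: "v = (es \<bullet> v) *\<^sub>R e + (fs \<bullet> v) *\<^sub>R f"
proof -
  define a b where "a = f$2 * v$1 - f$1 * v$2" and "b = e$1 * v$2 - e$2 * v$1"
  have "a * e$1 + b * f$1 = k * v$1" "a * e$2 + b * f$2 = k * v$2"
    by (simp_all add: a_def b_def k_def algebra_simps)
  then have "(a * e$1 + b * f$1) / k = v$1" "(a * e$2 + b * f$2) / k = v$2" using k by simp_all
  moreover have "es \<bullet> v = a / k" "fs \<bullet> v = b / k"
    by (simp_all add: a_def b_def es_def fs_def inner_vec2 diff_divide_distrib)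
  ultimately show ?thesis by (simp add: vec_eq_iff forall_2 add_divide_distrib)
qed

lemma angle: "0 < pi / real n" "pi / real n < pi / 2" "0 < cos (pi / real n)" "0 < sin (pi / real n)"
  "0 < w" "w < pi" "0 < sin w"
proof -
  have "2 < real n" using n by simp
  then show 1: "0 < pi / real n" "pi / real n < pi / 2" by (auto simp: field_simps)
  then have 2: "pi / real n < pi" using pi_gt_zero by linarith
  show "0 < cos (pi / real n)" "0 < sin (pi / real n)"
    using cos_gt_zero[OF 1] sin_gt_zero[OF 1(1) 2] .
  have "w = 2 * (pi / real n)" by (simp add: w_def)
  then show "0 < w" "w < pi" using 1 by linarith+
  then show "0 < sin w" by (intro sin_gt_zero)
qed

lemma w_eq: "real j * w = \<psi> j - pi / real n" "real (Suc j) * w = \<psi> j + pi / real n"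
  using n by (simp_all add: w_def \<psi>_def field_simps)

lemma n_w: "real n * w = 2 * pi"
  using n by (simp add: w_def)

lemma P_n: "P n = P 0"
  by (simp add: P_def Q_def n_w)

lemma P_Suc_mem: "j < n \<Longrightarrow> P (Suc j) \<in> P ` {..<n}"
  using P_n n by (cases "Suc j = n") (auto intro: image_eqI[of _ _ 0])

lemma M_Q: "M j \<bullet> (Q t - c) = cos (t - \<psi> j) / cos (pi / real n)"
proof -
  have "M j \<bullet> (Q t - c) = (1 / cos (pi / real n)) * (cos (\<psi> j) * cos t + sin (\<psi> j) * sin t)"
    by (simp add: M_def Q_def inner_simps dual add_divide_distrib mult.commute)
  also have "\<dots> = cos (t - \<psi> j) / cos (pi / real n)" by (simp add: cos_diff mult.commute)
  finally show ?thesis .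
qed

lemma M_P_le: "i < n \<Longrightarrow> j < n \<Longrightarrow> M j \<bullet> (P i - c) \<le> 1"
proof -
  assume ij: "i < n" "j < n"
  have "real i * w - \<psi> j = (2 * real i - (2 * real j + 1)) * pi / real n"
    using n by (simp add: w_def \<psi>_def field_simps)
  then have "cos (real i * w - \<psi> j) \<le> cos (pi / real n)" using cos_odd_multiple_le[OF ij] by simp
  then show ?thesis unfolding P_def M_Q using angle(3) by simp
qed

lemma M_P_edge: "M j \<bullet> (P j - c) = 1" "M j \<bullet> (P (Suc j) - c) = 1"
proof -
  have "cos (real j * w - \<psi> j) = cos (pi / real n)" "cos (real (Suc j) * w - \<psi> j) = cos (pi / real n)"
    unfolding w_eq(1)[of j] w_eq(2)[of j] by simp_all
  then show "M j \<bullet> (P j - c) = 1" "M j \<bullet> (P (Suc j) - c) = 1"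
    unfolding P_def M_Q using angle(3) by simp_all
qed

text \<open>The roots of unity sum to zero, so \<open>c\<close> is the average of the
  vertices.\<close>

lemma center_mem: "c \<in> H"
proof -
  have ne1: "cis w \<noteq> 1"
    using angle(7) by (auto simp: complex_eq_iff)
  have "(\<Sum>j<n. cis w ^ j) = (cis w ^ n - 1) / (cis w - 1)" by (rule geometric_sum[OF ne1])
  also have "\<dots> = 0" by (simp add: Complex.DeMoivre n_w)
  finally have "(\<Sum>j<n. cis (real j * w)) = 0" by (simp add: Complex.DeMoivre)
  then have "Re (\<Sum>j<n. cis (real j * w)) = 0" "Im (\<Sum>j<n. cis (real j * w)) = 0" by simp_all
  then have sums: "(\<Sum>j<n. cos (real j * w)) = 0" "(\<Sum>j<n. sin (real j * w)) = 0" by simp_all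
  have "(\<Sum>j<n. (1 / real n) *\<^sub>R P j) \<in> H"
    unfolding H_def using n by (intro convex_sum convex_convex_hull) (auto intro: hull_inc)
  moreover have "(\<Sum>j<n. (1 / real n) *\<^sub>R P j) = c"
  proof -
    have "(\<Sum>j<n. (1 / real n) *\<^sub>R P j) = (1 / real n) *\<^sub>R (real n *\<^sub>R c
        + (\<Sum>j<n. cos (real j * w)) *\<^sub>R e + (\<Sum>j<n. sin (real j * w)) *\<^sub>R f)"
      by (simp add: P_def Q_def scaleR_right.sum[symmetric] sum.distrib scaleR_left.sum sum_constant_scaleR del: sum_constant)
    then show ?thesis using n by (simp add: sums)
  qed
  ultimately show ?thesis by simp
qed

text \<open>In polar coordinates of the affine frame \<open>x\<close> lies in the sector between two
  consecutive vertices. Its coordinates along them are nonnegative, and their sum is the form of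
  that side at \<open>x\<close>, hence at most 1; so \<open>x\<close> is in the triangle with
  \<open>c\<close>.\<close>

lemma sector_mem:
  assumes x: "\<forall>j<n. M j \<bullet> (x - c) \<le> 1"
  shows "x \<in> H"
proof -
  define a b where "a = es \<bullet> (x - c)" and "b = fs \<bullet> (x - c)"
  have xab: "x - c = a *\<^sub>R e + b *\<^sub>R f" unfolding a_def b_def by (rule expand)
  define r where "r = sqrt (a\<^sup>2 + b\<^sup>2)"
  show ?thesis
  proof (cases "r = 0")
    case True
    then have "a = 0" "b = 0" by (auto simp: r_def)
    then have "x = c" using xab by simp
    then show ?thesis using center_mem by simp
  next
    case False
    moreover have "0 \<le> r" by (simp add: r_def)
    ultimately have r: "0 < r" by simp
    have "r\<^sup>2 = a\<^sup>2 + b\<^sup>2" by (simp add: r_def)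
    have "(a / r)\<^sup>2 + (b / r)\<^sup>2 = 1"
      using r by (simp add: power_divide add_divide_distrib[symmetric] flip: \<open>r\<^sup>2 = a\<^sup>2 + b\<^sup>2\<close>)
    then obtain \<phi> where \<phi>: "0 \<le> \<phi>" "\<phi> < 2 * pi" "a / r = cos \<phi>" "b / r = sin \<phi>"
      by (rule sincos_total_2pi)
    have ab: "a = r * cos \<phi>" "b = r * sin \<phi>" using \<phi>(3,4) r by (simp_all add: field_simps)
    \<comment> \<open>The number of the sector; the bound \<phi> < 2 pi keeps it below
      \<open>n\<close>.\<close>
    define j where "j = nat \<lfloor>\<phi> / w\<rfloor>"
    have "0 \<le> \<lfloor>\<phi> / w\<rfloor>" using \<phi>(1) angle(5) by simp
    then have j_real: "real j = of_int \<lfloor>\<phi> / w\<rfloor>" by (simp add: j_def)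
    have "real j \<le> \<phi> / w" "\<phi> / w < real j + 1" unfolding j_real by linarith+
    then have j1: "real j * w \<le> \<phi>" and j2: "\<phi> \<le> real j * w + w"
      using angle(5) by (simp_all add: field_simps)
    have "real j * w < real n * w" using j1 \<phi>(2) n_w by simp
    then have jn: "j < n" using angle(5) by simp
    define u where "u = real j * w"
    have uS: "real (Suc j) * w = u + w" by (simp add: u_def algebra_simps)
    \<comment> \<open>Cramer's rule: decomposition of the direction \<phi> along the directions u
      and u + w.\<close>
    define \<alpha> where "\<alpha> = r * sin (u + w - \<phi>) / sin w"
    define \<beta> where "\<beta> = r * sin (\<phi> - u) / sin w"
    have \<alpha>\<beta>: "0 \<le> \<alpha>" "0 \<le> \<beta>"
      using r angle j1 j2 unfolding \<alpha>_def \<beta>_def u_def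
      by (auto intro!: divide_nonneg_pos mult_nonneg_nonneg sin_ge_zero)
    have "\<alpha> * cos u + \<beta> * cos (u + w) = r * (sin (u + w - \<phi>) * cos u + sin (\<phi> - u) * cos (u + w)) / sin w"
      by (simp add: \<alpha>_def \<beta>_def field_simps add_divide_distrib)
    also have "sin (u + w - \<phi>) * cos u + sin (\<phi> - u) * cos (u + w) = cos \<phi> * sin ((u + w) - u)"
      unfolding sin_diff[of "u + w" \<phi>] sin_diff[of \<phi> u] sin_diff[of "u + w" u] by (simp add: algebra_simps)
    finally have ca: "\<alpha> * cos u + \<beta> * cos (u + w) = a" using angle(7) ab by simp
    have "\<alpha> * sin u + \<beta> * sin (u + w) = r * (sin (u + w - \<phi>) * sin u + sin (\<phi> - u) * sin (u + w)) / sin w"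
      by (simp add: \<alpha>_def \<beta>_def field_simps add_divide_distrib)
    also have "sin (u + w - \<phi>) * sin u + sin (\<phi> - u) * sin (u + w) = sin \<phi> * sin ((u + w) - u)"
      unfolding sin_diff[of "u + w" \<phi>] sin_diff[of \<phi> u] sin_diff[of "u + w" u] by (simp add: algebra_simps)
    finally have cb: "\<alpha> * sin u + \<beta> * sin (u + w) = b" using angle(7) ab by simp
    have x_eq: "x - c = \<alpha> *\<^sub>R (P j - c) + \<beta> *\<^sub>R (P (Suc j) - c)"
    proof -
      have "\<alpha> *\<^sub>R (P j - c) + \<beta> *\<^sub>R (P (Suc j) - c)
          = (\<alpha> * cos u + \<beta> * cos (u + w)) *\<^sub>R e + (\<alpha> * sin u + \<beta> * sin (u + w)) *\<^sub>R f"
        unfolding P_def uS u_def[symmetric] Q_def by (simp add: algebra_simps)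
      then show ?thesis unfolding ca cb xab by simp
    qed
    have "M j \<bullet> (x - c) = \<alpha> + \<beta>"
      unfolding x_eq inner_add_right inner_scaleR_right M_P_edge by simp
    then have le: "\<alpha> + \<beta> \<le> 1" using x jn by auto
    have "x = (1 - \<alpha> - \<beta>) *\<^sub>R c + \<alpha> *\<^sub>R P j + \<beta> *\<^sub>R P (Suc j)"
      using x_eq by (simp add: algebra_simps)
    then have "x \<in> convex hull {c, P j, P (Suc j)}"
      unfolding convex_hull_3
      by (intro CollectI exI[of _ "1 - \<alpha> - \<beta>"] exI[of _ \<alpha>] exI[of _ \<beta>] conjI) (use le \<alpha>\<beta> in auto)
    moreover have "convex hull {c, P j, P (Suc j)} \<subseteq> H"
    proof (rule hull_minimal)
      show "{c, P j, P (Suc j)} \<subseteq> H"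
        using center_mem jn P_Suc_mem[OF jn] by (auto simp: H_def intro: hull_inc)
      show "convex H" by (simp add: H_def)
    qed
    ultimately show ?thesis by blast
  qed
qed

lemma H_eq: "H = {x. \<forall>m\<in>M ` {..<n}. m \<bullet> (x - c) \<le> 1}"
proof
  show "H \<subseteq> {x. \<forall>m\<in>M ` {..<n}. m \<bullet> (x - c) \<le> 1}"
    unfolding H_def
  proof (rule hull_minimal)
    have "{x. \<forall>m\<in>M ` {..<n}. m \<bullet> (x - c) \<le> 1} = (\<Inter>m\<in>M ` {..<n}. {x. m \<bullet> x \<le> 1 + m \<bullet> c})"
      by (auto simp: inner_diff_right algebra_simps)
    then show "convex {x. \<forall>m\<in>M ` {..<n}. m \<bullet> (x - c) \<le> 1}"
      by (simp add: convex_INT convex_halfspace_le)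
  qed (auto intro: M_P_le)
  show "{x. \<forall>m\<in>M ` {..<n}. m \<bullet> (x - c) \<le> 1} \<subseteq> H" by (auto intro: sector_mem)
qed

sublocale polygon "M ` {..<n}" c
proof
  show "bounded {x. \<forall>m\<in>M ` {..<n}. m \<bullet> (x - c) \<le> 1}"
    unfolding H_eq[symmetric] H_def by (intro bounded_convex_hull finite_imp_bounded) simp
qed simp

lemma D_eq: "D = H"
  unfolding D_def H_eq ..

text \<open>The linear part of the rotation by one step, transported to the affine frame; with
  centre \<open>c\<close> it carries each vertex to the next.\<close>

definition L :: "real^2 \<Rightarrow> real^2" where
  "L v = (es \<bullet> v) *\<^sub>R (cos w *\<^sub>R e + sin w *\<^sub>R f) + (fs \<bullet> v) *\<^sub>R (cos w *\<^sub>R f - sin w *\<^sub>R e)"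

lemma L_linear: "linear L"
  by (rule linearI) (simp_all add: L_def inner_simps algebra_simps)

lemma dual_L: "es \<bullet> L v = cos w * (es \<bullet> v) - sin w * (fs \<bullet> v)"
  "fs \<bullet> L v = sin w * (es \<bullet> v) + cos w * (fs \<bullet> v)"
  by (simp_all add: L_def inner_simps dual algebra_simps)

text \<open>A rotation by an angle strictly between 0 and pi fixes only 0: the determinant of L - 1
  is (1 - cos w)^2 + (sin w)^2, which is positive. Multiplying the fixed-point equations by the
  adjugate shows this.\<close>

lemma L_fixed:
  assumes "L v = v"
  shows "v = 0"
proof -
  define a b where "a = es \<bullet> v" and "b = fs \<bullet> v"
  have 1: "cos w * a - sin w * b = a" "sin w * a + cos w * b = b"
    using dual_L[of v] assms by (simp_all add: a_def b_def)
  have "((1 - C)\<^sup>2 + S\<^sup>2) * a = (1 - C) * (a - (C * a - S * b)) - S * (b - (S * a + C * b))"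
    "((1 - C)\<^sup>2 + S\<^sup>2) * b = (1 - C) * (b - (S * a + C * b)) + S * (a - (C * a - S * b))" for C S :: real
    by (simp_all add: algebra_simps power2_eq_square)
  from this[where C="cos w" and S="sin w"]
  have "((1 - cos w)\<^sup>2 + (sin w)\<^sup>2) * a = 0" "((1 - cos w)\<^sup>2 + (sin w)\<^sup>2) * b = 0"
    unfolding 1 by simp_all
  moreover have "(1 - cos w)\<^sup>2 + (sin w)\<^sup>2 \<noteq> 0" using angle(7) by (auto simp: sum_power2_eq_zero_iff)
  ultimately have "a = 0" "b = 0" by auto
  then show ?thesis using expand[of v] by (simp add: a_def b_def)
qed

lemma L_inj: "inj L"
  unfolding linear_injective_0[OF L_linear]
proof (intro allI impI)
  fix v assume "L v = 0"
  then have 1: "cos w * (es \<bullet> v) - sin w * (fs \<bullet> v) = 0" "sin w * (es \<bullet> v) + cos w * (fs \<bullet> v) = 0"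
    using dual_L[of v] by simp_all
  have sc: "(cos w)\<^sup>2 + (sin w)\<^sup>2 = 1" by simp
  have "(C\<^sup>2 + S\<^sup>2) * (es \<bullet> v) = C * (C * (es \<bullet> v) - S * (fs \<bullet> v)) + S * (S * (es \<bullet> v) + C * (fs \<bullet> v))"
    "(C\<^sup>2 + S\<^sup>2) * (fs \<bullet> v) = C * (S * (es \<bullet> v) + C * (fs \<bullet> v)) - S * (C * (es \<bullet> v) - S * (fs \<bullet> v))"
    for C S :: real
    by (simp_all add: algebra_simps power2_eq_square)
  from this[where C="cos w" and S="sin w"]
  have "es \<bullet> v = 0" "fs \<bullet> v = 0" unfolding 1 sc by simp_all
  then show "v = 0" using expand[of v] by simp
qed

lemma L_P: "c + L (P j - c) = P (Suc j)"
proof -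
  have "es \<bullet> (P j - c) = cos (real j * w)" "fs \<bullet> (P j - c) = sin (real j * w)"
    by (simp_all add: P_def Q_def inner_simps dual)
  moreover have "real (Suc j) * w = real j * w + w" by (simp add: algebra_simps)
  ultimately show ?thesis
    unfolding L_def P_def[of "Suc j"] Q_def by (simp add: cos_add sin_add algebra_simps)
qed

text \<open>The map permutes the vertices cyclically and, being an affine bijection, commutes with
  convex hull and interior.\<close>

lemma rotation_invariant: "(\<lambda>x. c + L (x - c)) ` interior H = interior H"
proof -
  have T: "(\<lambda>x. c + L (x - c)) ` S = (+) (c - L c) ` L ` S" for S
    by (simp add: image_image linear_diff[OF L_linear] algebra_simps)
  have "(\<lambda>x. c + L (x - c)) ` P ` {..<n} = (\<lambda>j. P (Suc j)) ` {..<n}"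
    by (simp add: image_image L_P)
  also have "\<dots> = P ` {..<n}"
  proof
    show "(\<lambda>j. P (Suc j)) ` {..<n} \<subseteq> P ` {..<n}" using P_Suc_mem by auto
    show "P ` {..<n} \<subseteq> (\<lambda>j. P (Suc j)) ` {..<n}"
    proof
      fix x assume "x \<in> P ` {..<n}"
      then obtain j where j: "j < n" "x = P j" by auto
      show "x \<in> (\<lambda>j. P (Suc j)) ` {..<n}"
      proof (cases j)
        case 0
        then have "x = P (Suc (n - 1))" using j P_n n by simp
        moreover have "n - 1 < n" using n by simp
        ultimately show ?thesis by blast
      next
        case (Suc i)
        then show ?thesis using j by auto
      qed
    qed
  qed
  finally have V: "(+) (c - L c) ` L ` P ` {..<n} = P ` {..<n}" unfolding T .
  have "(+) (c - L c) ` L ` interior H = interior ((+) (c - L c) ` L ` H)"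
    by (simp add: interior_translation interior_injective_linear_image[OF L_linear L_inj])
  also have "(+) (c - L c) ` L ` H = convex hull ((+) (c - L c) ` L ` P ` {..<n})"
    by (simp add: H_def convex_hull_translation convex_hull_linear_image[OF L_linear])
  finally show ?thesis unfolding T V H_def .
qed

lemma interior_H: "interior H = {x. N x < 1}"
  using interior_D D_eq by simp

text \<open>By symmetry the integral of \<open>x - c\<close> is a fixed vector of \<open>L\<close>,
  and 0 is the only one.\<close>

lemma barycenter_eq: "barycenter (interior H) = c"
proof -
  let ?\<Omega> = "interior H"
  have \<Omega>: "open ?\<Omega>" "bounded ?\<Omega>" "?\<Omega> \<noteq> {}"
  proof -
    show "bounded ?\<Omega>"
      using bounded_subset[OF compact_imp_bounded[OF compact_D] interior_subset] by (simp add: D_eq)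
    have "c \<in> ?\<Omega>" unfolding interior_H by (simp add: N_c)
    then show "?\<Omega> \<noteq> {}" by blast
  qed simp
  have \<Omega>s: "?\<Omega> \<in> sets lebesgue" by simp
  have f: "continuous_on UNIV (\<lambda>x::real^2. x - c)" by (intro continuous_intros)
  note fi = continuous_integrable_lebesgue_on[OF \<Omega>(1,2) f]
  define I where "I = (LINT x|lebesgue_on ?\<Omega>. x - c)"
  have "I = (LINT x|lebesgue_on ?\<Omega>. L (x - c))"
    using integral_affine_symmetry[OF \<Omega> L_linear L_inj rotation_invariant f] by (simp add: I_def)
  also have "\<dots> = L I"
    unfolding I_def by (rule integral_bounded_linear[OF _ fi]) (use L_linear in \<open>simp add: linear_conv_bounded_linear\<close>)
  finally have "I = 0" using L_fixed by simp
  have "measure lebesgue ?\<Omega> \<noteq> 0"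
  proof
    assume "measure lebesgue ?\<Omega> = 0"
    then have "negligible ?\<Omega>"
      using bounded_set_imp_lmeasurable[OF \<Omega>(2) \<Omega>s] negligible_iff_measure by blast
    then show False using open_not_negligible[OF \<Omega>(1,3)] by blast
  qed
  moreover have "(LINT x|lebesgue_on ?\<Omega>. x) = measure lebesgue ?\<Omega> *\<^sub>R c"
  proof -
    have "continuous_on UNIV (\<lambda>x::real^2. c)" by (intro continuous_intros)
    note ci = continuous_integrable_lebesgue_on[OF \<Omega>(1,2) this]
    have "(LINT x|lebesgue_on ?\<Omega>. x) = (LINT x|lebesgue_on ?\<Omega>. (x - c) + c)" by simp
    also have "\<dots> = I + (LINT x|lebesgue_on ?\<Omega>. c)"
      unfolding I_def by (rule Bochner_Integration.integral_add[OF fi ci])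
    also have "\<dots> = measure lebesgue ?\<Omega> *\<^sub>R c" using \<open>I = 0\<close> by (simp add: measure_restrict_space)
    finally show ?thesis .
  qed
  ultimately show ?thesis by (simp add: barycenter_def)
qed

text \<open>The triangles spanned by \<open>c\<close> and the sides all have the same area, an
  affine invariant of the regular polygon. So the distance of a side from \<open>c\<close>, the
  reciprocal of \<open>norm (M j)\<close>, is inversely proportional to its length, and a longest
  side is a nearest one.\<close>

lemma norm_M: "norm (M j) = norm (P (Suc j) - P j) / (\<bar>k\<bar> * (2 * sin (pi / real n) * cos (pi / real n)))"
proof -
  let ?s = "sin (pi / real n)" and ?C = "cos (pi / real n)"
  define z where "z = cos (\<psi> j) *\<^sub>R f - sin (\<psi> j) *\<^sub>R e"
  have "P (Suc j) - P j = (2 * ?s) *\<^sub>R z"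
    unfolding P_def Q_def w_eq(1)[of j] w_eq(2)[of j] z_def cos_add cos_diff sin_add sin_diff
    by (simp add: vec_eq_iff algebra_simps)
  then have 1: "norm (P (Suc j) - P j) = 2 * ?s * norm z" using angle(4) by simp
  have "M j = (1 / ?C) *\<^sub>R vector [z$2 / k, - z$1 / k]"
    by (simp add: M_def vec_eq_iff forall_2 es_def fs_def z_def diff_divide_distrib add_divide_distrib algebra_simps)
  moreover have "norm (vector [z$2 / k, - z$1 / k] :: real^2) = norm z / \<bar>k\<bar>"
    by (simp add: norm_vec2 power_divide add_divide_distrib[symmetric] real_sqrt_divide add.commute)
  ultimately have "norm (M j) = norm z / (\<bar>k\<bar> * ?C)" using angle(3) by simp
  then show ?thesis unfolding 1 using angle(3,4) k by (simp add: field_simps)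
qed

text \<open>By \<open>norm_M\<close> the longest side has the largest polar vector. What remains of
  the general criterion is that one of its ends, \<open>p\<close>, is a farthest vertex.\<close>

lemma inequality:
  assumes i: "i < n" and side: "\<And>j. j < n \<Longrightarrow> norm (P (Suc j) - P j) \<le> norm (P (Suc i) - P i)"
    and p: "p = P i \<or> p = P (Suc i)" and far: "\<And>j. j < n \<Longrightarrow> norm (P j - c) \<le> norm (p - c)"
  shows "ereal (sin (horgan_payne_angle (interior H) (barycenter (interior H)) / 2)) \<le> infsup_const (interior H)"
proof -
  have D: "P i \<in> D" "P (Suc i) \<in> D"
    using i P_Suc_mem[OF i] by (auto simp: D_eq H_def intro: hull_inc)
  have ne: "P i \<noteq> P (Suc i)"
  proof
    assume "P i = P (Suc i)"
    then have "norm (M i) = 0" using norm_M[of i] by simp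
    then show False using M_P_edge(1)[of i] by simp
  qed
  obtain p' where p': "p' \<in> D" "M i \<bullet> (p' - c) = 1" "p \<noteq> p'" and pD: "p \<in> D" "M i \<bullet> (p - c) = 1"
    using p D ne M_P_edge[of i] by metis
  have farD: "norm (x - c) \<le> norm (p - c)" if "x \<in> D" for x
  proof -
    have "H \<subseteq> cball c (norm (p - c))"
      unfolding H_def by (rule hull_minimal) (use far in \<open>auto simp: dist_norm norm_minus_commute\<close>)
    then show ?thesis using that by (auto simp: D_eq dist_norm norm_minus_commute)
  qed
  have "norm m \<le> norm (M i)" if "m \<in> M ` {..<n}" for m
  proof -
    obtain j where j: "j < n" "m = M j" using \<open>m \<in> M ` {..<n}\<close> by auto
    show ?thesis unfolding j(2) norm_M
      using side[OF j(1)] angle(3,4) by (intro divide_right_mono) auto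
  qed
  from horgan_payne_inequality[OF _ this pD p'(1,2,3) farD]
  show ?thesis unfolding barycenter_eq unfolding interior_H using i by simp
qed

end

section \<open>Triangles, parallelograms and regular polygons\<close>

lemma collinear_det:
  assumes "(u::real^2)$1 * v$2 = u$2 * v$1"
  shows "collinear {0, u, v}"
proof (cases "u = 0")
  case False
  let ?w = "vector [- (u$2), u$1] :: real^2"
  have "u \<bullet> ?w = 0" "v \<bullet> ?w = 0"
    using assms by (simp_all add: inner_vec2 mult.commute)
  moreover have "?w \<noteq> 0" using False by (auto simp: vec_eq_iff forall_2)
  ultimately obtain t where "v = t *\<^sub>R u" using orthogonal_parallel[of v ?w u] False by metis
  then show ?thesis by (auto simp: collinear_lemma)
qed simp

text \<open>All sides and all radii agree here, so any side serves.\<close>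

lemma horgan_payne_inequality_regular_polygon:
  assumes n: "3 \<le> n" and R: "0 < R"
    and \<Omega>: "\<Omega> = interior (convex hull
      ((\<lambda>k. c + R *\<^sub>R vector [cos (\<theta> + 2 * pi * real k / real n), sin (\<theta> + 2 * pi * real k / real n)]) ` {..<n}))"
  shows "ereal (sin (horgan_payne_angle \<Omega> (barycenter \<Omega>) / 2)) \<le> infsup_const \<Omega>"
proof -
  interpret affine_regular_polygon n c "R *\<^sub>R vector [cos \<theta>, sin \<theta>]" "R *\<^sub>R vector [- sin \<theta>, cos \<theta>]"
  proof
    have "(R *\<^sub>R vector [cos \<theta>, sin \<theta>] :: real^2)$1 * (R *\<^sub>R vector [- sin \<theta>, cos \<theta>] :: real^2)$2
        - (R *\<^sub>R vector [cos \<theta>, sin \<theta>] :: real^2)$2 * (R *\<^sub>R vector [- sin \<theta>, cos \<theta>] :: real^2)$1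
        = R\<^sup>2 * ((cos \<theta>)\<^sup>2 + (sin \<theta>)\<^sup>2)"
      unfolding distrib_left by (simp add: power2_eq_square)
    then show "(R *\<^sub>R vector [cos \<theta>, sin \<theta>] :: real^2)$1 * (R *\<^sub>R vector [- sin \<theta>, cos \<theta>] :: real^2)$2
        - (R *\<^sub>R vector [cos \<theta>, sin \<theta>] :: real^2)$2 * (R *\<^sub>R vector [- sin \<theta>, cos \<theta>] :: real^2)$1 \<noteq> 0"
      using R by simp
  qed (rule n)
  have Pj: "P j = c + R *\<^sub>R vector [cos (\<theta> + real j * w), sin (\<theta> + real j * w)]" for j
    by (simp add: P_def Q_def vec_eq_iff forall_2 cos_add sin_add algebra_simps)
  have H: "interior H = \<Omega>"
    unfolding \<Omega> H_def Pj by (simp add: w_def mult.commute)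
  have radius: "norm (P j - c) = R" for j
    using R by (simp add: Pj norm_vec2 power_mult_distrib flip: distrib_left)
  have side: "(norm (P (Suc j) - P j))\<^sup>2 = R\<^sup>2 * (2 - 2 * cos w)" for j
  proof -
    have dist: "(norm ((c + R *\<^sub>R vector [p, q]) - (c + R *\<^sub>R vector [p', q'] :: real^2)))\<^sup>2
        = R\<^sup>2 * ((p - p')\<^sup>2 + (q - q')\<^sup>2)" for p q p' q'
      unfolding power2_norm_eq_inner inner_vec2 by (simp add: power2_eq_square algebra_simps)
    define x where "x = \<theta> + real j * w"
    have Suc: "\<theta> + real (Suc j) * w = x + w" by (simp add: x_def algebra_simps)
    have "(norm (P (Suc j) - P j))\<^sup>2 = R\<^sup>2 * ((cos (x + w) - cos x)\<^sup>2 + (sin (x + w) - sin x)\<^sup>2)"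
      unfolding Pj Suc x_def[symmetric] by (rule dist)
    also have "(cos (x + w) - cos x)\<^sup>2 + (sin (x + w) - sin x)\<^sup>2
        = ((cos (x + w))\<^sup>2 + (sin (x + w))\<^sup>2) + ((cos x)\<^sup>2 + (sin x)\<^sup>2) - 2 * cos ((x + w) - x)"
      unfolding cos_diff[of "x + w" x] power2_diff by (simp add: algebra_simps)
    finally show ?thesis unfolding sin_cos_squared_add2 by simp
  qed
  have "norm (P (Suc j) - P j) = norm (P (Suc 0) - P 0)" for j
    using side[of j] side[of 0] by (metis norm_ge_zero power2_eq_imp_eq)
  then have "norm (P (Suc j) - P j) \<le> norm (P (Suc 0) - P 0)" for j by (rule eq_refl)
  from inequality[OF _ this, of "P 0", unfolded H radius] show ?thesis using n by simp
qed

text \<open>Opposite vertices are equally far from the centre and every side contains one end of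
  each diagonal, hence always a farthest vertex. The only choice is that of a longer side.\<close>

lemma horgan_payne_inequality_parallelogram:
  assumes uv: "\<not> collinear {0, u, v}"
    and \<Omega>: "\<Omega> = interior (convex hull {a, a + u, a + u + v, a + v})"
  shows "ereal (sin (horgan_payne_angle \<Omega> (barycenter \<Omega>) / 2)) \<le> infsup_const \<Omega>"
proof -
  define c where "c = a + (1/2) *\<^sub>R (u + v)"
  \<comment> \<open>The half diagonals, from the centre to the first and to the second
    vertex.\<close>
  define e f where "e = - (1/2) *\<^sub>R (u + v)" and "f = (1/2) *\<^sub>R (u - v)"
  interpret affine_regular_polygon 4 c e f
  proof
    have *: "e$1 * f$2 - e$2 * f$1
        = (u$1 * v$2 - u$2 * v$1) / 2"
      by (simp add: e_def f_def field_simps)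
    show "e$1 * f$2 - e$2 * f$1 \<noteq> 0"
      unfolding * using collinear_det[of u v] uv by auto
  qed simp
  have w: "w = pi / 2" by (simp add: w_def)
  have w3: "3 * (pi / 2) = 3 / 2 * pi" by simp
  have P: "P 0 = a" "P (Suc 0) = a + u" "P 2 = a + u + v" "P 3 = a + v"
    unfolding P_def Q_def w of_nat_0 of_nat_Suc of_nat_numeral w3 cos_3over2_pi sin_3over2_pi
    by (simp_all add: c_def e_def f_def vec_eq_iff field_simps)
  have P4: "P (Suc 3) = a" using P_n P(1) by simp
  have four: "{..<4::nat} = {0, Suc 0, 2, 3}" by auto
  have H: "interior H = \<Omega>"
    unfolding \<Omega> H_def four image_insert image_empty P ..
  have side: "norm (P (Suc j) - P j) \<in> {norm u, norm v}" if "j < 4" for j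
  proof -
    have "j \<in> {0, Suc 0, 2, 3}" using that by auto
    moreover have "norm (P (Suc 2) - P 2) = norm u"
      using P by (simp add: norm_minus_commute numeral_3_eq_3[symmetric])
    ultimately show ?thesis using P P4 by (auto simp: numeral_2_eq_2)
  qed
  have radius: "norm (P j - c) \<in> {norm (P 0 - c), norm (P (Suc 0) - c)}" if "j < 4" for j
  proof -
    have "j \<in> {0, Suc 0, 2, 3}" using that by auto
    moreover have "P 2 - c = - (P 0 - c)" "P 3 - c = - (P (Suc 0) - c)"
      unfolding P by (simp_all add: c_def vec_eq_iff field_simps)
    ultimately show ?thesis by (metis insertE insertI1 insertI2 norm_minus_cancel singletonD)
  qed
  obtain i where i: "i \<in> {0, Suc 0}" "norm (P (Suc i) - P i) = max (norm u) (norm v)"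
  proof (cases "norm v \<le> norm u")
    case True
    then show ?thesis using that[of 0] P by simp
  next
    case False
    then show ?thesis using that[of "Suc 0"] P by (simp add: numeral_2_eq_2)
  qed
  have ends: "{norm (P i - c), norm (P (Suc i) - c)} = {norm (P 0 - c), norm (P (Suc 0) - c)}"
  proof -
    have "P 2 - c = - (P 0 - c)" unfolding P by (simp add: c_def vec_eq_iff field_simps)
    then have "norm (P 2 - c) = norm (P 0 - c)" by (metis norm_minus_cancel)
    then show ?thesis using i(1) by (auto simp: numeral_2_eq_2)
  qed
  obtain p where p: "p = P i \<or> p = P (Suc i)"
    "norm (p - c) = max (norm (P i - c)) (norm (P (Suc i) - c))"
    by (metis max_def)
  show ?thesis
  proof (rule inequality[of i p, unfolded H])
    show "i < 4" using i(1) by auto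
    show "norm (P (Suc j) - P j) \<le> norm (P (Suc i) - P i)" if "j < 4" for j
      using side[OF that] i(2) by auto
    show "norm (P j - c) \<le> norm (p - c)" if "j < 4" for j
      using radius[OF that] unfolding p(2) ends[symmetric] by auto
  qed (rule p(1))
qed

text \<open>If the three vectors sum to zero, |X - Y|^2 - |Y - Z|^2 = 3 (|X|^2 - |Z|^2). For the
  vectors from the barycenter of a triangle to its vertices this says that the vertex opposite to a
  longest side is nearest.\<close>

lemma norm_le_of_sum_zero:
  fixes X Y Z :: "'a::real_inner"
  assumes "X + Y + Z = 0" "norm (Y - Z) \<le> norm (X - Y)"
  shows "norm Z \<le> norm X"
proof -
  have Z: "Z = - X - Y" using assms(1) by (simp add: eq_neg_iff_add_eq_0 algebra_simps)
  have "(Y - Z) \<bullet> (Y - Z) \<le> (X - Y) \<bullet> (X - Y)" using assms(2) by (simp add: norm_le)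
  then have "Z \<bullet> Z \<le> X \<bullet> X"
    unfolding Z by (simp add: inner_simps inner_commute)
  then show ?thesis by (simp add: norm_le)
qed

text \<open>The vertex opposite to a longest side is nearest to the barycenter, so the farther end
  of that side is a farthest vertex. The three cases differ only in which side is longest.\<close>

lemma horgan_payne_inequality_triangle:
  assumes abd: "\<not> collinear {a, b, d}" and \<Omega>: "\<Omega> = interior (convex hull {a, b, d})"
  shows "ereal (sin (horgan_payne_angle \<Omega> (barycenter \<Omega>) / 2)) \<le> infsup_const \<Omega>"
proof -
  define c where "c = (1/3) *\<^sub>R (a + b + d)"
  define s where "s = sqrt 3"
  have s: "s * s = 3" "s > 0" by (simp_all add: s_def)
  \<comment> \<open>The vertex after the first is c - e / 2 + (sqrt 3 / 2) f and the last one has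
    the opposite sign of f, so their difference is sqrt 3 times f.\<close>
  interpret affine_regular_polygon 3 c "a - c" "(1/s) *\<^sub>R (b - d)"
  proof
    have "(a - c)$1 * ((1/s) *\<^sub>R (b - d))$2 - (a - c)$2 * ((1/s) *\<^sub>R (b - d))$1
        = (2 / (3 * s)) * ((a - b)$2 * (d - b)$1 - (a - b)$1 * (d - b)$2)"
      using s(2) by (simp add: c_def field_simps)
    moreover have "(a - b)$1 * (d - b)$2 \<noteq> (a - b)$2 * (d - b)$1"
    proof
      assume "(a - b)$1 * (d - b)$2 = (a - b)$2 * (d - b)$1"
      from collinear_det[OF this] have "collinear {a, b, d}" by (subst collinear_3) auto
      then show False using abd by simp
    qed
    ultimately show "(a - c)$1 * ((1/s) *\<^sub>R (b - d))$2 - (a - c)$2 * ((1/s) *\<^sub>R (b - d))$1 \<noteq> 0"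
      using s(2) by simp
  qed simp
  have w: "w = 2 * pi / 3" by (simp add: w_def)
  have trig: "cos w = - 1 / 2" "sin w = s / 2" unfolding w s_def by (simp_all add: cos_120 sin_120)
  have trig2: "cos (2 * w) = - 1 / 2" "sin (2 * w) = - s / 2"
    unfolding cos_double_cos sin_double trig by (simp_all add: power2_eq_square)
  have P: "P 0 = a" "P (Suc 0) = b" "P 2 = d"
    using s(2) unfolding P_def Q_def of_nat_0 of_nat_Suc of_nat_numeral trig trig2
    by (simp_all add: trig c_def vec_eq_iff field_simps)
  have P3: "P (Suc 2) = a" using P_n P(1) by (simp add: numeral_3_eq_3 numeral_2_eq_2)
  have P2: "P (Suc (Suc 0)) = d" using P(3) by (simp add: numeral_2_eq_2)
  have three: "{..<3::nat} = {0, Suc 0, 2}" by auto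
  have H: "interior H = \<Omega>" unfolding \<Omega> H_def three image_insert image_empty P ..
  have sum: "(a - c) + (b - c) + (d - c) = 0"
    by (simp add: c_def vec_eq_iff field_simps)
  have farthest: "norm (z - c) \<le> norm (x - c) \<and> norm (z - c) \<le> norm (y - c)"
    if "(x - c) + (y - c) + (z - c) = 0" "norm (y - z) \<le> norm (x - y)" "norm (z - x) \<le> norm (x - y)" for x y z
    using norm_le_of_sum_zero[of "x - c" "y - c" "z - c"] norm_le_of_sum_zero[of "y - c" "x - c" "z - c"] that
    by (simp add: algebra_simps norm_minus_commute)
  have conclude: ?thesis
    if i: "i < 3" "P i = x" "P (Suc i) = y" and perm: "{x, y, z} = {a, b, d}"
      and xyz: "(x - c) + (y - c) + (z - c) = 0"
      and longest: "norm (y - z) \<le> norm (x - y)" "norm (z - x) \<le> norm (x - y)"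
      and sides: "{norm (b - a), norm (d - b), norm (a - d)} = {norm (y - x), norm (z - y), norm (x - z)}"
    for i x y z
  proof -
    obtain p where p: "p = P i \<or> p = P (Suc i)"
      "norm (p - c) = max (norm (P i - c)) (norm (P (Suc i) - c))"
      by (metis max_def)
    show ?thesis
    proof (rule inequality[of i p, unfolded H])
      show "norm (P (Suc j) - P j) \<le> norm (P (Suc i) - P i)" if "j < 3" for j
      proof -
        have "j \<in> {0, Suc 0, 2}" using that by auto
        then have "norm (P (Suc j) - P j) \<in> {norm (y - x), norm (z - y), norm (x - z)}"
          using P P2 P3 unfolding sides[symmetric] by auto
        then show ?thesis using longest by (auto simp: i norm_minus_commute)
      qed
      show "norm (P j - c) \<le> norm (p - c)" if "j < 3" for j
      proof -
        have "j \<in> {0, Suc 0, 2}" using that by auto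
        then have "P j \<in> {x, y, z}" using P unfolding perm by auto
        then show ?thesis using farthest[OF xyz longest] unfolding p(2) i by auto
      qed
    qed (use i p(1) in auto)
  qed
  consider "norm (d - b) \<le> norm (b - a)" "norm (a - d) \<le> norm (b - a)"
    | "norm (b - a) \<le> norm (d - b)" "norm (a - d) \<le> norm (d - b)"
    | "norm (b - a) \<le> norm (a - d)" "norm (d - b) \<le> norm (a - d)"
    by linarith
  then show ?thesis
  proof cases
    case 1
    show ?thesis
      by (rule conclude[of 0 a b d]) (use 1 P sum in \<open>auto simp: norm_minus_commute\<close>)
  next
    case 2
    show ?thesis
      by (rule conclude[of "Suc 0" b d a]) (use 2 P P2 sum in \<open>auto simp: norm_minus_commute add_ac\<close>)
  next
    case 3
    show ?thesis
      by (rule conclude[of 2 d a b]) (use 3 P P3 sum in \<open>auto simp: norm_minus_commute add_ac\<close>)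
  qed
qed

lemma horgan_payne_inequality_shapes:
  assumes "open_triangle \<Omega> \<or> open_rectangle \<Omega> \<or> open_rhombus \<Omega> \<or> open_regular_polygon \<Omega>"
  shows "ereal (sin (horgan_payne_angle \<Omega> (barycenter \<Omega>) / 2)) \<le> infsup_const \<Omega>"
  using assms
proof (elim disjE)
  assume "open_triangle \<Omega>"
  then obtain a b d where "\<not> collinear {a, b, d}" "\<Omega> = interior (convex hull {a, b, d})"
    unfolding open_triangle_def by auto
  then show ?thesis by (rule horgan_payne_inequality_triangle)
next
  assume "open_rectangle \<Omega>"
  then obtain a u v where uv: "u \<noteq> 0" "v \<noteq> 0" "u \<bullet> v = 0"
    and \<Omega>: "\<Omega> = interior (convex hull {a, a + u, a + u + v, a + v})"
    unfolding open_rectangle_def by auto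
  have "\<not> collinear {0, u, v}"
    using uv by (auto simp: collinear_lemma)
  then show ?thesis using \<Omega> by (rule horgan_payne_inequality_parallelogram)
next
  assume "open_rhombus \<Omega>"
  then obtain a u v where "\<not> collinear {0, u, v}"
    "\<Omega> = interior (convex hull {a, a + u, a + u + v, a + v})"
    unfolding open_rhombus_def by auto
  then show ?thesis by (rule horgan_payne_inequality_parallelogram)
next
  assume "open_regular_polygon \<Omega>"
  then obtain n c R \<theta> where "3 \<le> n" "0 < R" "\<Omega> = interior (convex hull
      ((\<lambda>k. c + R *\<^sub>R vector [cos (\<theta> + 2 * pi * real k / real n), sin (\<theta> + 2 * pi * real k / real n)]) ` {..<n}))"
    unfolding open_regular_polygon_def by auto
  then show ?thesis by (rule horgan_payne_inequality_regular_polygon)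
qed

section \<open>A truncated ellipse\<close>

text \<open>Along the curve the distance from the tangent line, divided by the distance from
  \<open>x\<close>, tends to the sine of the angle between \<open>v\<close> and \<tau>, so this sine
  is 0. Membership in \<open>S\<close> is required for positive parameters only, so curves starting
  at an end of a boundary piece are covered.\<close>

lemma tangent_parallel_curve:
  fixes \<gamma> :: "real \<Rightarrow> real^2"
  assumes tan: "tangent_direction S x \<tau>" and x: "\<gamma> 0 = x"
    and d: "(\<gamma> has_vector_derivative v) (at 0)" and v: "v \<noteq> 0"
    and mem: "\<forall>\<^sub>F s in at_right 0. \<gamma> s \<in> S"
  obtains t where "\<tau> = t *\<^sub>R v"
proof -
  let ?w = "vector [- (\<tau>$2), \<tau>$1] :: real^2"
  have \<tau>: "\<tau> \<noteq> 0" and lim: "((\<lambda>y. infdist y {x + t *\<^sub>R \<tau> | t. True} / dist y x) \<longlongrightarrow> 0) (at x within S)"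
    using tan by (simp_all add: tangent_direction_def)
  have w\<tau>: "\<tau> \<bullet> ?w = 0" and w: "norm ?w = norm \<tau>" "?w \<noteq> 0"
    using \<tau> by (auto simp: inner_vec2 norm_vec2 vec_eq_iff forall_2 add.commute)
  \<comment> \<open>Difference quotients replace the points of the curve, because they have the
    nonzero limit \<open>v\<close> and the quotient with \<tau> is invariant under scaling.\<close>
  define q where "q s = (1 / s) *\<^sub>R (\<gamma> s - x)" for s
  have q: "(q \<longlongrightarrow> v) (at_right 0)"
  proof -
    have "(\<gamma> has_derivative (\<lambda>s. s *\<^sub>R v)) (at_right 0)"
      using has_vector_derivative_at_within[OF d] by (simp add: has_vector_derivative_def)
    then have "((\<lambda>s. (1 / norm (s - 0)) *\<^sub>R (\<gamma> s - (\<gamma> 0 + (s - 0) *\<^sub>R v))) \<longlongrightarrow> 0) (at_right 0)"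
      unfolding has_derivative_within by blast
    then have "((\<lambda>s. q s - v) \<longlongrightarrow> 0) (at_right 0)"
    proof (rule Lim_transform_eventually)
      show "\<forall>\<^sub>F s in at_right 0. (1 / norm (s - 0)) *\<^sub>R (\<gamma> s - (\<gamma> 0 + (s - 0) *\<^sub>R v)) = q s - v"
        using eventually_at_right_less[of "0::real"]
        by eventually_elim (simp add: q_def x algebra_simps)
    qed
    then show ?thesis by (rule Lim_null[THEN iffD2])
  qed
  have q0: "\<forall>\<^sub>F s in at_right 0. q s \<noteq> 0" by (rule tendsto_imp_eventually_ne[OF q v])
  have pos: "\<forall>\<^sub>F s in at_right (0::real). 0 < s" by (simp add: eventually_at_right_less)
  have filt: "filterlim \<gamma> (at x within S) (at_right 0)"
    unfolding filterlim_at
  proof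
    show "\<forall>\<^sub>F s in at_right 0. \<gamma> s \<in> S \<and> \<gamma> s \<noteq> x"
      using mem q0 by eventually_elim (auto simp: q_def)
    have "isCont \<gamma> 0" using has_vector_derivative_continuous[OF d] .
    then show "(\<gamma> \<longlongrightarrow> x) (at_right 0)"
      unfolding isCont_def x by (auto intro: tendsto_mono[OF at_le])
  qed
  have lim_q: "((\<lambda>s. \<bar>q s \<bullet> ?w\<bar> / (norm (q s) * norm \<tau>)) \<longlongrightarrow> \<bar>v \<bullet> ?w\<bar> / (norm v * norm \<tau>)) (at_right 0)"
    using v \<tau> by (intro tendsto_intros q) auto
  have lim_0: "((\<lambda>s. infdist (\<gamma> s) {x + t *\<^sub>R \<tau> | t. True} / dist (\<gamma> s) x) \<longlongrightarrow> 0) (at_right 0)"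
    by (rule filterlim_compose[OF lim filt])
  have "\<forall>\<^sub>F s in at_right 0. \<bar>q s \<bullet> ?w\<bar> / (norm (q s) * norm \<tau>)
      \<le> infdist (\<gamma> s) {x + t *\<^sub>R \<tau> | t. True} / dist (\<gamma> s) x"
    using pos q0
  proof eventually_elim
    case (elim s)
    have "\<gamma> s - x = s *\<^sub>R q s" using elim by (simp add: q_def)
    then have eq: "\<bar>q s \<bullet> ?w\<bar> / norm (q s) = \<bar>(\<gamma> s - x) \<bullet> ?w\<bar> / dist (\<gamma> s) x"
      using elim by (simp add: dist_norm abs_mult)
    have "\<bar>(\<gamma> s - x) \<bullet> ?w\<bar> / norm \<tau> \<le> infdist (\<gamma> s) {x + t *\<^sub>R \<tau> | t. True}"
    proof (subst infdist_notempty)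
      show "\<bar>(\<gamma> s - x) \<bullet> ?w\<bar> / norm \<tau> \<le> (INF a\<in>{x + t *\<^sub>R \<tau> | t. True}. dist (\<gamma> s) a)"
      proof (rule cINF_greatest)
        fix a assume "a \<in> {x + t *\<^sub>R \<tau> | t. True}"
        then obtain t where a: "a = x + t *\<^sub>R \<tau>" by auto
        have "(\<gamma> s - x) \<bullet> ?w = (\<gamma> s - a) \<bullet> ?w"
          using w\<tau> by (simp add: a inner_diff_left inner_add_left)
        also have "\<bar>\<dots>\<bar> \<le> norm (\<gamma> s - a) * norm \<tau>"
          using Cauchy_Schwarz_ineq2[of "\<gamma> s - a" ?w] w by simp
        finally show "\<bar>(\<gamma> s - x) \<bullet> ?w\<bar> / norm \<tau> \<le> dist (\<gamma> s) a"
          using \<tau> by (simp add: dist_norm divide_le_eq)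
      qed auto
    qed auto
    then have "\<bar>(\<gamma> s - x) \<bullet> ?w\<bar> / norm \<tau> / dist (\<gamma> s) x
        \<le> infdist (\<gamma> s) {x + t *\<^sub>R \<tau> | t. True} / dist (\<gamma> s) x"
      by (rule divide_right_mono) simp
    also have "\<bar>(\<gamma> s - x) \<bullet> ?w\<bar> / norm \<tau> / dist (\<gamma> s) x = \<bar>(\<gamma> s - x) \<bullet> ?w\<bar> / dist (\<gamma> s) x / norm \<tau>"
      unfolding divide_divide_eq_left by (simp only: mult.commute)
    also have "\<dots> = \<bar>q s \<bullet> ?w\<bar> / (norm (q s) * norm \<tau>)"
      unfolding eq[symmetric] divide_divide_eq_left ..
    finally show ?case .
  qed
  from tendsto_le[OF _ lim_0 lim_q this] have "\<bar>v \<bullet> ?w\<bar> / (norm v * norm \<tau>) \<le> 0" by simp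
  then have "v \<bullet> ?w = 0" using v \<tau> by (auto simp: divide_le_0_iff mult_le_0_iff)
  then show ?thesis by (rule orthogonal_parallel[OF w\<tau> _ w(2) v that])
qed

definition ellipse :: "(real^2) set" where
  "ellipse = {x. (x$1)\<^sup>2 + 4 * (x$2)\<^sup>2 < 4}"

text \<open>For the full ellipse the moment bound is exactly \<open>sqrt (1/5)\<close>, the sine of half its
  Horgan--Payne angle. Cutting off the caps lowers the former. It keeps the latter as long as
  the arcs contain the points \<open>(2 cos u, sin u)\<close> with \<open>\<bar>cos u\<bar> = \<bar>sin u\<bar>\<close> and the new flat sides
  are seen at a larger angle.\<close>

definition truncated_ellipse :: "(real^2) set" where
  "truncated_ellipse = {x. (x$1)\<^sup>2 + 4 * (x$2)\<^sup>2 < 4 \<and> \<bar>x$2\<bar> < 19/20}"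

section \<open>Shape and boundary of the region\<close>

lemma open_ellipse: "open ellipse" "open truncated_ellipse"
  unfolding ellipse_def truncated_ellipse_def
  by (intro open_Collect_conj open_Collect_less continuous_intros)+

lemma truncated_ellipse_subset: "truncated_ellipse \<subseteq> ellipse"
  by (auto simp: ellipse_def truncated_ellipse_def)

lemma bounded_ellipse: "bounded ellipse" "bounded truncated_ellipse"
proof -
  have "norm x \<le> 2" if "x \<in> ellipse" for x
  proof -
    have "(norm x)\<^sup>2 = (x$1)\<^sup>2 + (x$2)\<^sup>2" unfolding power2_norm_eq_inner inner_vec2 by (simp add: power2_eq_square)
    then have "(norm x)\<^sup>2 \<le> 4" using that zero_le_power2[of "x$2"] unfolding ellipse_def mem_Collect_eq by linarith
    then have "(norm x)\<^sup>2 \<le> 2\<^sup>2" by simp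
    then show ?thesis by (rule power2_le_imp_le) simp
  qed
  then show 1: "bounded ellipse" unfolding bounded_iff by blast
  show "bounded truncated_ellipse" by (rule bounded_subset[OF 1 truncated_ellipse_subset])
qed

lemma zero_mem_truncated_ellipse: "0 \<in> truncated_ellipse"
  by (simp add: truncated_ellipse_def)

lemma convex_truncated_ellipse: "convex truncated_ellipse"
proof -
  let ?A = "\<lambda>x::real^2. vector [x$1 / 2, x$2] :: real^2"
  have lin: "linear ?A" by (rule linearI) (simp_all add: vec_eq_iff forall_2 add_divide_distrib)
  have norm: "norm (?A x) < 1 \<longleftrightarrow> (x$1)\<^sup>2 + 4 * (x$2)\<^sup>2 < 4" for x
    unfolding norm_vec2 real_sqrt_lt_1_iff by (simp add: power_divide) linarith
  have "truncated_ellipse = {x. norm (?A x) < 1} \<inter> {x. axis 2 1 \<bullet> x < 19/20} \<inter> {x. axis 2 1 \<bullet> x > - (19/20)}"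
    unfolding norm by (auto simp: truncated_ellipse_def inner_axis' abs_less_iff)
  moreover have "{x. norm (?A x) < 1} = ?A -` ball 0 1" by auto
  ultimately have eq: "truncated_ellipse = ?A -` ball 0 1 \<inter> {x. axis 2 1 \<bullet> x < 19/20} \<inter> {x. axis 2 1 \<bullet> x > - (19/20)}"
    by simp
  show ?thesis
    unfolding eq
    by (rule convex_Int[OF convex_Int[OF convex_linear_vimage[OF lin convex_ball] convex_halfspace_lt] convex_halfspace_gt])
qed

lemma star_shaped_truncated_ellipse: "star_shaped_wrt_ball truncated_ellipse 0 (1/2)"
proof -
  have "ball 0 (1/2) \<subseteq> truncated_ellipse"
  proof
    fix x :: "real^2" assume "x \<in> ball 0 (1/2)"
    then have x: "norm x < 1/2" by simp
    then have "(norm x)\<^sup>2 < (1/2)\<^sup>2" by (intro power_strict_mono) auto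
    then have "(x$1)\<^sup>2 + (x$2)\<^sup>2 < 1/4"
      unfolding power2_norm_eq_inner inner_vec2 by (simp add: power2_eq_square)
    moreover have "\<bar>x$2\<bar> < 19/20" using component_le_norm_cart[of x 2] x by linarith
    ultimately show "x \<in> truncated_ellipse"
      using zero_le_power2[of "x$1"] unfolding truncated_ellipse_def mem_Collect_eq by linarith
  qed
  moreover have "closed_segment b x \<subseteq> truncated_ellipse"
    if "b \<in> ball 0 (1/2)" "x \<in> truncated_ellipse" for b x
    by (rule closed_segment_subset[OF _ that(2) convex_truncated_ellipse]) (use calculation that(1) in blast)
  ultimately show ?thesis by (simp add: star_shaped_wrt_ball_def)
qed

lemma frontier_truncated_ellipse:
  "frontier truncated_ellipse =
    {x. (x$1)\<^sup>2 + 4 * (x$2)\<^sup>2 \<le> 4 \<and> \<bar>x$2\<bar> \<le> 19/20 \<and> ((x$1)\<^sup>2 + 4 * (x$2)\<^sup>2 = 4 \<or> \<bar>x$2\<bar> = 19/20)}"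
proof -
  have closure: "closure truncated_ellipse = {x. (x$1)\<^sup>2 + 4 * (x$2)\<^sup>2 \<le> 4 \<and> \<bar>x$2\<bar> \<le> 19/20}" (is "_ = ?C")
  proof
    have "closed ?C" by (intro closed_Collect_conj closed_Collect_le continuous_intros)
    then show "closure truncated_ellipse \<subseteq> ?C"
      by (intro closure_minimal) (auto simp: truncated_ellipse_def)
    show "?C \<subseteq> closure truncated_ellipse"
    proof
      fix x assume x: "x \<in> ?C"
      \<comment> \<open>Contraction towards the origin makes both inequalities strict.\<close>
      have mem: "s *\<^sub>R x \<in> truncated_ellipse" if s: "0 < s" "s < 1" for s
      proof -
        have "(s * x$1)\<^sup>2 + 4 * (s * x$2)\<^sup>2 = s\<^sup>2 * ((x$1)\<^sup>2 + 4 * (x$2)\<^sup>2)"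
          by (simp add: power2_eq_square algebra_simps)
        also have "\<dots> \<le> s\<^sup>2 * 4" using x by (intro mult_left_mono) auto
        also have "\<dots> < 4" using s by (simp add: power_less_one_iff)
        finally have 1: "(s * x$1)\<^sup>2 + 4 * (s * x$2)\<^sup>2 < 4" .
        have "\<bar>s * x$2\<bar> \<le> s * (19/20)" using x s by (simp add: abs_mult mult_left_mono)
        then show ?thesis using 1 s by (simp add: truncated_ellipse_def)
      qed
      have "((\<lambda>s. s *\<^sub>R x) \<longlongrightarrow> 1 *\<^sub>R x) (at_left 1)" by (intro tendsto_intros)
      moreover have "\<forall>\<^sub>F s in at_left 1. s *\<^sub>R x \<in> closure truncated_ellipse"
        unfolding eventually_at_left_field using mem closure_subset by (intro exI[of _ 0]) auto
      ultimately show "x \<in> closure truncated_ellipse"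
        using Lim_in_closed_set[of "closure truncated_ellipse" "\<lambda>s. s *\<^sub>R x" "at_left 1"] by simp
    qed
  qed
  show ?thesis
    unfolding frontier_def closure interior_open[OF open_ellipse(2)]
    by (auto simp: truncated_ellipse_def)
qed

text \<open>The number 3/5 is the cosine of the smallest angle on the full ellipse, attained where
  cos u and sin u agree in absolute value. On the flat sides the cosine stays below it because those
  sides are short.\<close>

lemma truncated_ellipse_tangent:
  assumes tan: "tangent_direction (frontier truncated_ellipse) x \<tau>"
  shows "\<bar>x \<bullet> \<tau>\<bar> / (norm x * norm \<tau>) \<le> 3/5"
proof -
  have x: "(x$1)\<^sup>2 + 4 * (x$2)\<^sup>2 \<le> 4" "\<bar>x$2\<bar> \<le> 19/20" "(x$1)\<^sup>2 + 4 * (x$2)\<^sup>2 = 4 \<or> \<bar>x$2\<bar> = 19/20"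
    using tan unfolding tangent_direction_def frontier_truncated_ellipse by auto
  have reduce: ?thesis if "\<tau> = t *\<^sub>R v" "25 * (x \<bullet> v)\<^sup>2 \<le> 9 * ((norm x)\<^sup>2 * (norm v)\<^sup>2)" for t v
  proof -
    have "t\<^sup>2 * (25 * (x \<bullet> v)\<^sup>2) \<le> t\<^sup>2 * (9 * ((norm x)\<^sup>2 * (norm v)\<^sup>2))"
      by (rule mult_left_mono[OF that(2)]) simp
    then have "(5 * \<bar>x \<bullet> \<tau>\<bar>)\<^sup>2 \<le> (3 * (norm x * norm \<tau>))\<^sup>2"
      unfolding that(1) by (simp add: power_mult_distrib algebra_simps)
    then have "5 * \<bar>x \<bullet> \<tau>\<bar> \<le> 3 * (norm x * norm \<tau>)" by (rule power2_le_imp_le) simp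
    moreover have "\<tau> \<noteq> 0" using tan by (simp add: tangent_direction_def)
    moreover have "x \<noteq> 0" using x by auto
    ultimately show ?thesis by (simp add: divide_le_eq)
  qed
  show ?thesis
  proof (cases "\<bar>x$2\<bar> = 19/20")
    case True
    then have x2: "(x$2)\<^sup>2 = (19/20)\<^sup>2" by (metis power2_abs)
    \<comment> \<open>The number 39/100 is 4 - 4 (19/20)^2, the squared half length of a flat
      side.\<close>
    have x1: "(x$1)\<^sup>2 \<le> 39/100" using x(1) unfolding x2 by (simp add: power2_eq_square)
    \<comment> \<open>The direction points to the middle of the flat side, so the curve stays on the
      side even when it starts at a corner.\<close>
    define \<sigma> :: real where "\<sigma> = (if x$1 \<le> 0 then 1 else -1)"
    define v :: "real^2" where "v = vector [\<sigma>, 0]"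
    have \<sigma>: "\<sigma>\<^sup>2 = 1" by (auto simp: \<sigma>_def)
    have v0: "v \<noteq> 0" using \<sigma> by (auto simp: v_def vec_eq_iff forall_2)
    have ev: "\<forall>\<^sub>F s in at_right 0. x + s *\<^sub>R v \<in> frontier truncated_ellipse"
      unfolding eventually_at_right_field
    proof (intro exI[of _ "1/4"] conjI allI impI)
      fix s :: real assume s: "0 < s" "s < 1/4"
      have "(x$1 + s * \<sigma>)\<^sup>2 \<le> 39/100"
      proof (cases "\<bar>x$1\<bar> \<le> s")
        case True
        then have "\<bar>x$1 + s * \<sigma>\<bar> \<le> \<bar>1/2\<bar>" using s by (auto simp: \<sigma>_def)
        then have "(x$1 + s * \<sigma>)\<^sup>2 \<le> (1/2)\<^sup>2" unfolding abs_le_square_iff .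
        then show ?thesis by (simp add: power2_eq_square)
      next
        case False
        then have "\<bar>x$1 + s * \<sigma>\<bar> \<le> \<bar>x$1\<bar>" using s by (auto simp: \<sigma>_def split: if_splits)
        then show ?thesis using x1 unfolding abs_le_square_iff by linarith
      qed
      then have "(x$1 + s * \<sigma>)\<^sup>2 + 4 * (x$2)\<^sup>2 \<le> 4" unfolding x2 by (simp add: power2_eq_square)
      then show "x + s *\<^sub>R v \<in> frontier truncated_ellipse"
        unfolding frontier_truncated_ellipse using True by (simp add: v_def)
    qed simp
    have der: "((\<lambda>s. x + s *\<^sub>R v) has_vector_derivative v) (at 0)"
      by (auto intro!: derivative_eq_intros)
    have "\<exists>t. \<tau> = t *\<^sub>R v"
      by (rule tangent_parallel_curve[OF tan _ der v0 ev]) auto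
    then obtain t where t: "\<tau> = t *\<^sub>R v" ..
    show ?thesis
    proof (rule reduce[OF t])
      have "(x \<bullet> v)\<^sup>2 = (x$1)\<^sup>2 * \<sigma>\<^sup>2" "(norm x)\<^sup>2 = (x$1)\<^sup>2 + (x$2)\<^sup>2" "(norm v)\<^sup>2 = \<sigma>\<^sup>2"
        unfolding power2_norm_eq_inner by (simp_all add: inner_vec2 v_def power2_eq_square)
      then show "25 * (x \<bullet> v)\<^sup>2 \<le> 9 * ((norm x)\<^sup>2 * (norm v)\<^sup>2)"
        using x1 unfolding \<sigma> x2 by (simp add: power2_eq_square)
    qed
  next
    case False
    then have ell: "(x$1 / 2)\<^sup>2 + (x$2)\<^sup>2 = 1" and lt: "\<bar>x$2\<bar> < 19/20"
      using x by (auto simp: power_divide)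
    obtain u where u: "x$1 / 2 = cos u" "x$2 = sin u"
      using sincos_total_2pi[OF ell] by metis
    define \<gamma> :: "real \<Rightarrow> real^2" where "\<gamma> s = vector [2 * cos (u + s), sin (u + s)]" for s
    define v :: "real^2" where "v = vector [- 2 * sin u, cos u]"
    have v0: "v \<noteq> 0"
      using sin_zero_abs_cos_one[of u] by (auto simp: v_def vec_eq_iff forall_2)
    have "((\<lambda>s. \<bar>sin (u + s)\<bar>) \<longlongrightarrow> \<bar>sin (u + 0)\<bar>) (at_right 0)" by (intro tendsto_intros)
    then have "\<forall>\<^sub>F s in at_right 0. \<bar>sin (u + s)\<bar> < 19/20"
      using lt u by (intro order_tendstoD(2)) auto
    then have ev: "\<forall>\<^sub>F s in at_right 0. \<gamma> s \<in> frontier truncated_ellipse"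
    proof eventually_elim
      case (elim s)
      have "(2 * cos (u + s))\<^sup>2 + 4 * (sin (u + s))\<^sup>2 = 4 * ((sin (u + s))\<^sup>2 + (cos (u + s))\<^sup>2)"
        by (simp add: power_mult_distrib del: sin_cos_squared_add sin_cos_squared_add2)
      then have "(2 * cos (u + s))\<^sup>2 + 4 * (sin (u + s))\<^sup>2 = 4" by simp
      then show ?case using elim unfolding frontier_truncated_ellipse \<gamma>_def by simp
    qed
    have \<gamma>0: "\<gamma> 0 = x" using u by (simp add: \<gamma>_def vec_eq_iff forall_2)
    have der: "(\<gamma> has_vector_derivative v) (at 0)"
    proof -
      have "\<gamma> = (\<lambda>s. (2 * cos (u + s)) *\<^sub>R axis 1 1 + sin (u + s) *\<^sub>R axis 2 1)"
        by (auto simp: \<gamma>_def vec_eq_iff forall_2 axis_def)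
      moreover have "v = (- 2 * sin u) *\<^sub>R axis 1 1 + cos u *\<^sub>R axis 2 1"
        by (auto simp: v_def vec_eq_iff forall_2 axis_def)
      ultimately show ?thesis by (auto intro!: derivative_eq_intros)
    qed
    have "\<exists>t. \<tau> = t *\<^sub>R v"
      by (rule tangent_parallel_curve[OF tan \<gamma>0 der v0 ev]) auto
    then obtain t where t: "\<tau> = t *\<^sub>R v" ..
    show ?thesis
    proof (rule reduce[OF t])
      have x12: "x$1 = 2 * cos u" "x$2 = sin u" using u by simp_all
      \<comment> \<open>The difference is a perfect square, which shows both the bound and the
        points of equality.\<close>
      have "9 * ((norm x)\<^sup>2 * (norm v)\<^sup>2) - 25 * (x \<bullet> v)\<^sup>2 = 36 * ((cos u)\<^sup>2 - (sin u)\<^sup>2)\<^sup>2"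
        unfolding power2_norm_eq_inner inner_vec2 x12 v_def vector_2
        by (simp add: power2_eq_square algebra_simps)
      then show "25 * (x \<bullet> v)\<^sup>2 \<le> 9 * ((norm x)\<^sup>2 * (norm v)\<^sup>2)"
        using zero_le_power2[of "(cos u)\<^sup>2 - (sin u)\<^sup>2"] by linarith
    qed
  qed
qed

text \<open>The infimum defining the angle needs a nonempty set. The middle of the upper flat side
  serves as witness and also bounds the angle from above.\<close>

lemma truncated_ellipse_tangent_exists:
  "tangent_direction (frontier truncated_ellipse) (vector [0, 19/20]) (axis 1 1)"
proof -
  let ?p = "vector [0, 19/20] :: real^2" and ?F = "frontier truncated_ellipse"
  have p: "?p + s *\<^sub>R axis 1 1 \<in> ?F" if "0 \<le> s" "s \<le> 1/2" for s :: real
  proof -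
    have "s\<^sup>2 \<le> (1/2)\<^sup>2" using that by (intro power_mono)
    then show ?thesis unfolding frontier_truncated_ellipse by (simp add: axis_def power2_eq_square)
  qed
  have lp: "?p islimpt ?F"
    unfolding islimpt_approachable
  proof (intro allI impI)
    fix e :: real assume e: "0 < e"
    define s where "s = min (1/2) (e/2)"
    have s: "0 < s" "s \<le> 1/2" "s < e" using e by (auto simp: s_def)
    show "\<exists>y\<in>?F. y \<noteq> ?p \<and> dist y ?p < e"
      by (rule bexI[OF _ p[of s]]) (use s in \<open>auto simp: dist_norm axis_eq_0_iff\<close>)
  qed
  \<comment> \<open>In this neighbourhood the boundary has no point of the arcs, since (1/2)^2 + 4
    (19/20)^2 < 4; it is therefore flat.\<close>
  define W where "W = {y::real^2. \<bar>y$1\<bar> < 1/2 \<and> 0 < y$2}"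
  have W: "open W" "?p \<in> W"
    unfolding W_def by (auto intro!: open_Collect_conj open_Collect_less continuous_intros)
  have "infdist y {?p + t *\<^sub>R axis 1 1 |t. True} = 0" if y: "y \<in> W" "y \<in> ?F" for y
  proof -
    have "\<bar>y$1\<bar>\<^sup>2 < (1/2)\<^sup>2" using y(1) unfolding W_def by (intro power_strict_mono) auto
    moreover have "(y$2)\<^sup>2 \<le> (19/20)\<^sup>2"
      using y(2) unfolding frontier_truncated_ellipse by (subst abs_le_square_iff[symmetric]) auto
    ultimately have "(y$1)\<^sup>2 + 4 * (y$2)\<^sup>2 \<noteq> 4" unfolding power2_abs by (simp add: power_divide)
    then have "y$2 = 19/20" using y unfolding frontier_truncated_ellipse W_def by auto
    then have "y = ?p + (y$1) *\<^sub>R axis 1 1" by (simp add: vec_eq_iff forall_2 axis_def)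
    then show ?thesis by (intro infdist_zero) blast
  qed
  then have "\<forall>\<^sub>F y in at ?p within ?F. 0 = infdist y {?p + t *\<^sub>R axis 1 1 |t. True} / dist y ?p"
    unfolding eventually_at_topological using W by auto
  then have "((\<lambda>y. infdist y {?p + t *\<^sub>R axis 1 1 |t. True} / dist y ?p) \<longlongrightarrow> 0) (at ?p within ?F)"
    by (rule Lim_transform_eventually[OF tendsto_const])
  moreover have "?p \<in> ?F" using p[of 0] by simp
  ultimately show ?thesis using lp by (simp add: tangent_direction_def axis_eq_0_iff)
qed

lemma sin_horgan_payne_truncated_ellipse:
  "sqrt (1/5) \<le> sin (horgan_payne_angle truncated_ellipse 0 / 2)"
proof -
  let ?h = "horgan_payne_angle truncated_ellipse 0"
  have ac: "arccos (3/5) \<le> ray_line_angle (x - 0) \<tau>" if "tangent_direction (frontier truncated_ellipse) x \<tau>" for x \<tau>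
    unfolding ray_line_angle_def
  proof (rule arccos_le_arccos)
    show "- 1 \<le> \<bar>(x - 0) \<bullet> \<tau>\<bar> / (norm (x - 0) * norm \<tau>)"
      by (rule order_trans[of _ 0]) simp_all
  qed (use truncated_ellipse_tangent[OF that] in simp_all)
  have low: "arccos (3/5) \<le> ?h"
    unfolding horgan_payne_angle_def
    by (rule cInf_greatest) (use ac truncated_ellipse_tangent_exists in auto)
  \<comment> \<open>The upper bound keeps the half angle in the range where the sine
    increases.\<close>
  have "?h \<le> pi"
  proof -
    have "?h \<le> ray_line_angle (vector [0, 19/20] - 0) (axis 1 1)"
      by (rule horgan_payne_angle_le[OF truncated_ellipse_tangent_exists])
    also have "\<dots> \<le> pi"
      unfolding ray_line_angle_def
      by (rule arccos_ubound) (simp_all add: inner_vec2 axis_def)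
    finally show ?thesis .
  qed
  moreover have "0 \<le> arccos (3/5::real)" by (rule arccos_lbound) simp_all
  ultimately have "sin (arccos (3/5) / 2) \<le> sin (?h / 2)"
    using low by (intro sin_monotone_2pi_le) auto
  then show ?thesis by (simp add: sin_half_arccos)
qed

text \<open>The moment bound is below sqrt (1/5) exactly when \<open>g\<close> has positive
  integral. On the full ellipse this integral is 0, and \<open>g\<close> is negative on the removed
  caps.\<close>

lemma infsup_const_truncated_ellipse: "infsup_const truncated_ellipse < ereal (sqrt (1/5))"
proof -
  let ?\<Omega> = truncated_ellipse
  define g :: "real^2 \<Rightarrow> real" where "g x = (x$1)\<^sup>2 - 4 * (x$2)\<^sup>2" for x
  have cont: "continuous_on UNIV g" "continuous_on UNIV (\<lambda>x::real^2. x$1)"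
    "continuous_on UNIV (\<lambda>x::real^2. (x$1)\<^sup>2)" "continuous_on UNIV (\<lambda>x::real^2. (x$2)\<^sup>2)"
    unfolding g_def by (intro continuous_intros)+
  have ne: "?\<Omega> \<noteq> {}" "ellipse \<noteq> {}"
    using zero_mem_truncated_ellipse truncated_ellipse_subset by auto
  have mean: "(LINT x|lebesgue_on ?\<Omega>. x$1) = 0"
  proof -
    have "(\<lambda>x. 0 + - (x - 0)) ` ?\<Omega> = ?\<Omega>"
    proof -
      have "- x \<in> ?\<Omega>" if "x \<in> ?\<Omega>" for x using that by (simp add: truncated_ellipse_def)
      then show ?thesis by (auto intro!: image_eqI[of _ _ "- x" for x])
    qed
    from integral_affine_symmetry_real[OF open_ellipse(2) bounded_ellipse(2) ne(1) _ _ this cont(2)]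
    have "(LINT x|lebesgue_on ?\<Omega>. - (x$1)) = (LINT x|lebesgue_on ?\<Omega>. x$1)"
      by (simp add: linear_uminus)
    then show ?thesis by simp
  qed
  have E0: "(LINT x|lebesgue_on ellipse. g x) = 0"
  proof -
    \<comment> \<open>A quarter turn of the unit disc, transported to the ellipse; it exchanges the
      two terms of \<open>g\<close> and so reverses its sign.\<close>
    define S :: "real^2 \<Rightarrow> real^2" where "S x = vector [- 2 * x$2, x$1 / 2]" for x
    have lin: "linear S" unfolding S_def
      by (rule linearI) (simp_all add: vec_eq_iff forall_2 add_divide_distrib)
    have inj: "inj S" by (rule injI) (simp add: S_def vec_eq_iff forall_2)
    have SE: "S x \<in> ellipse \<longleftrightarrow> x \<in> ellipse" for x
      by (simp add: S_def ellipse_def power_divide power_mult_distrib add.commute)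
    have SS: "S (S (S (S x))) = x" for x by (simp add: S_def vec_eq_iff forall_2)
    have "S ` ellipse = ellipse"
    proof
      show "S ` ellipse \<subseteq> ellipse" using SE by auto
      show "ellipse \<subseteq> S ` ellipse"
        using SS SE by (metis image_eqI subsetI)
    qed
    then have "(\<lambda>x. 0 + S (x - 0)) ` ellipse = ellipse" by simp
    from integral_affine_symmetry_real[OF open_ellipse(1) bounded_ellipse(1) ne(2) lin inj this cont(1)]
    have "(LINT x|lebesgue_on ellipse. g (S x)) = (LINT x|lebesgue_on ellipse. g x)" by simp
    moreover have "g (S x) = - g x" for x
      by (simp add: S_def g_def power_divide power_mult_distrib)
    ultimately show ?thesis by simp
  qed
  \<comment> \<open>Part of the upper cap alone, where \<open>g\<close> is at most -1; its area
    already bounds the gain from below by a positive number.\<close>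
  define W where "W = {x \<in> ellipse. 19/20 < x$2}"
  have W: "open W" "bounded W" "W \<noteq> {}"
  proof -
    have "W = ellipse \<inter> {x. 19/20 < x$2}" by (auto simp: W_def)
    moreover have "open {x::real^2. 19/20 < x$2}" by (intro open_Collect_less continuous_intros)
    ultimately show "open W" using open_ellipse(1) by auto
    show "bounded W" by (rule bounded_subset[OF bounded_ellipse(1)]) (auto simp: W_def)
    have "vector [0, 24/25] \<in> W" by (simp add: W_def ellipse_def power2_eq_square)
    then show "W \<noteq> {}" by blast
  qed
  have Ws: "W \<in> lmeasurable" using W by (simp add: bounded_set_imp_lmeasurable)
  have Wpos: "0 < measure lebesgue W"
  proof -
    have "measure lebesgue W \<noteq> 0"
      using Ws W(1,3) open_not_negligible negligible_iff_measure by blast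
    then show ?thesis by (simp add: less_le)
  qed
  have pos: "0 < (LINT x|lebesgue_on ?\<Omega>. g x)"
  proof -
    have s: "?\<Omega> \<in> sets lebesgue" "ellipse \<in> sets lebesgue" using open_ellipse by auto
    have i: "integrable lebesgue (\<lambda>x. indicator ?\<Omega> x *\<^sub>R g x)" "integrable lebesgue (\<lambda>x. indicator ellipse x *\<^sub>R g x)"
      using continuous_integrable_lebesgue_on[OF open_ellipse(2) bounded_ellipse(2) cont(1)]
        continuous_integrable_lebesgue_on[OF open_ellipse(1) bounded_ellipse(1) cont(1)] s
      by (simp_all add: integrable_restrict_space)
    have iW: "integrable lebesgue (indicator W :: _ \<Rightarrow> real)"
      using Ws by (intro integrable_real_indicator) (auto simp: fmeasurable_def)
    have eq: "(LINT x|lebesgue_on ?\<Omega>. g x) = (LINT x|lebesgue. indicator ?\<Omega> x *\<^sub>R g x)"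
      "(LINT x|lebesgue_on ellipse. g x) = (LINT x|lebesgue. indicator ellipse x *\<^sub>R g x)"
      using s by (simp_all add: integral_restrict_space)
    have "measure lebesgue W = (LINT x|lebesgue. indicator W x)"
      using Ws by simp
    also have "\<dots> \<le> (LINT x|lebesgue. indicator ?\<Omega> x *\<^sub>R g x - indicator ellipse x *\<^sub>R g x)"
    proof (rule integral_mono[OF iW Bochner_Integration.integrable_diff[OF i]])
      fix x :: "real^2"
      show "indicator W x \<le> indicator ?\<Omega> x *\<^sub>R g x - indicator ellipse x *\<^sub>R g x"
      proof (cases "x \<in> ellipse \<and> x \<notin> ?\<Omega>")
        case True
        then have x: "(x$1)\<^sup>2 + 4 * (x$2)\<^sup>2 < 4" "\<bar>19/20\<bar> \<le> \<bar>x$2\<bar>"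
          by (auto simp: ellipse_def truncated_ellipse_def)
        then have "(19/20)\<^sup>2 \<le> (x$2)\<^sup>2" unfolding abs_le_square_iff by simp
        \<comment> \<open>In the ellipse g < 4 - 8 y^2 with y the second coordinate, and this is
          below -1 for y^2 \<ge> (19/20)^2.\<close>
        then have "g x \<le> - 1" using x(1) by (simp add: g_def power2_eq_square)
        then show ?thesis using True by (auto simp: indicator_def)
      next
        case False
        then have "x \<notin> W" by (auto simp: W_def truncated_ellipse_def)
        then show ?thesis using False truncated_ellipse_subset by (auto simp: indicator_def)
      qed
    qed
    also have "\<dots> = (LINT x|lebesgue_on ?\<Omega>. g x) - (LINT x|lebesgue_on ellipse. g x)"
      unfolding eq by (rule Bochner_Integration.integral_diff[OF i])
    finally show ?thesis using E0 Wpos by simp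
  qed
  define Ix Iy where "Ix = (LINT x|lebesgue_on ?\<Omega>. (x$1)\<^sup>2)" and "Iy = (LINT x|lebesgue_on ?\<Omega>. (x$2)\<^sup>2)"
  note int = continuous_integrable_lebesgue_on[OF open_ellipse(2) bounded_ellipse(2)]
  have "(LINT x|lebesgue_on ?\<Omega>. g x) = Ix - 4 * Iy"
    unfolding g_def Ix_def Iy_def using int[OF cont(3)] int[OF cont(4)] by simp
  then have I: "4 * Iy < Ix" using pos by simp
  have "0 \<le> Iy" unfolding Iy_def by (rule integral_nonneg_AE) simp
  then have "0 < Ix" and ratio: "Iy / (Ix + Iy) < 1/5" using I by (simp_all add: divide_less_eq)
  have "infsup_const ?\<Omega> \<le> ereal (sqrt (Iy / (Ix + Iy)))"
    unfolding Ix_def Iy_def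
    by (rule infsup_const_le) (use mean \<open>0 < Ix\<close> open_ellipse bounded_ellipse in \<open>simp_all add: Ix_def\<close>)
  also have "\<dots> < ereal (sqrt (1/5))" using ratio by (simp only: ereal_less_eq less_ereal.simps real_sqrt_less_iff)
  finally show ?thesis .
qed

lemma is_domain_truncated_ellipse: "is_domain truncated_ellipse"
  unfolding is_domain_def
  using zero_mem_truncated_ellipse convex_connected[OF convex_truncated_ellipse] open_ellipse(2) by auto

theorem theorem2p2:
  shows "(\<forall>\<Omega> x0. (open_triangle \<Omega> \<or> open_rectangle \<Omega> \<or> open_rhombus \<Omega> \<or> open_regular_polygon \<Omega>) \<and>
              x0 = barycenter \<Omega> \<longrightarrow>
            infsup_const \<Omega> \<ge> ereal (sin (horgan_payne_angle \<Omega> x0 / 2))) \<and>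
         (\<exists>\<Omega> x0 r. is_domain \<Omega> \<and> bounded \<Omega> \<and> star_shaped_wrt_ball \<Omega> x0 r \<and>
            infsup_const \<Omega> < ereal (sin (horgan_payne_angle \<Omega> x0 / 2)))"
  proof (intro conjI allI impI)
  fix \<Omega> x0
  assume "(open_triangle \<Omega> \<or> open_rectangle \<Omega> \<or> open_rhombus \<Omega> \<or> open_regular_polygon \<Omega>) \<and> x0 = barycenter \<Omega>"
  then show "infsup_const \<Omega> \<ge> ereal (sin (horgan_payne_angle \<Omega> x0 / 2))"
    using horgan_payne_inequality_shapes by blast
next
  have "infsup_const truncated_ellipse < ereal (sin (horgan_payne_angle truncated_ellipse 0 / 2))"
    using infsup_const_truncated_ellipse sin_horgan_payne_truncated_ellipse by (auto intro: less_le_trans)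
  then show "\<exists>\<Omega> x0 r. is_domain \<Omega> \<and> bounded \<Omega> \<and> star_shaped_wrt_ball \<Omega> x0 r \<and>
      infsup_const \<Omega> < ereal (sin (horgan_payne_angle \<Omega> x0 / 2))"
    using is_domain_truncated_ellipse bounded_ellipse(2) star_shaped_truncated_ellipse by blast
qed

end
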